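(* Concurrent games form a bicategory $\mathbf{CG}$, with the following data. The objects are games. The morphisms (1-cells) from $A$ to $B$ are strategies $\sigma:S\to A^\perp\parallel B$. The 2-cells from $\sigma:S\to A^\perp\parallel B$ to $\sigma':S'\to A^\perp\parallel B$ are maps of esps $f:S\to S'$ with $\sigma'\circ f=\sigma$, composed as functions. The identity 1-cell on $A$ is the copycat strategy $\gamma_A$. The horizontal composition is $\odot$ on 1-cells, with action on 2-cells $(g,f)\mapsto g\odot f$ as described in the context. That is: the composition $\tau\odot\sigma$ of two strategies is a strategy; $\odot$ is a functor $\mathbf{CG}(B,C)\times\mathbf{CG}(A,B)\to\mathbf{CG}(A,C)$; and there are invertible 2-cells $$\alpha_{\sigma,\tau,\rho}:(\rho\odot\tau)\odot\sigma\Rightarrow\rho\odot(\tau\odot\sigma),\qquad \rho_\sigma:\sigma\odot\gamma_A\Rightarrow\sigma,\qquad \lambda_\sigma:\gamma_B\odot\sigma\Rightarrow\sigma,$$ natural in all their arguments and satisfying the pentagon and triangle coherence laws of a bicategory.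
   Context: **Event structures.** An event structure (es) is a triple $(E,\leq_E,\mathrm{Con}_E)$ where $E$ is a set of events, $\leq_E$ is a partial order on $E$ (causality) and $\mathrm{Con}_E$ is a non-empty set of finite subsets of $E$ (the consistent sets) such that: $[e]=\{e'\mid e'\leq_E e\}$ is finite for all $e\in E$; $\{e\}\in \mathrm{Con}_E$ for all $e$; $\mathrm{Con}_E$ is closed under subsets; and if $e'\leq_E e\in X\in \mathrm{Con}_E$ then $X\cup\{e'\}\in \mathrm{Con}_E$. $\mathcal{C}(E)$ is the set of (finite) configurations: finite consistent down-closed subsets of $E$, ordered by inclusion. A map of es $f:E\to F$ is a total function such that $fx\in\mathcal{C}(F)$ for all $x\in\mathcal{C}(E)$ and $f$ is injective on each configuration. **Polarities, games, pre-strategies.** An event structure with polarities (esp) is an es $A$ with a function $\mathrm{pol}_A:A\to\{-,+\}$; a game is an esp. $A^\perp$ is $A$ with polarities reversed. Maps of esps are maps of es preserving polarity. The parallel composition $E\parallel F$ has events $\{0\}\times E\cup\{1\}\times F$, causality and polarity componentwise (no causality across components), a set being consistent iff both its components are; $\parallel$ acts on maps componentwise. $1$ is the empty game. A pre-strategy on $A$ is a map of esps $\sigma:S\to A$. Pre-strategies $\sigma:S\to A$, $\tau:T\to A$ are isomorphic, $\sigma\cong\tau$, if there is an isomorphism of esps $\phi:S\cong T$ with $\tau\circ\phi=\sigma$. **Interaction and composition.** A bijection $\varphi:q\simeq q'$ between finite partial orders is secured if the reflexive transitive closure of the relation $(a,b)\vartriangleleft(a',b')$ iff $a<_q a'$ or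 $b<_{q'}b'$ on its graph is a partial order. For maps of es $\sigma:S\to A$, $\tau:T\to A$, the es $S\wedge T$ is: let $\mathcal{B}$ be the set of (graphs of) secured bijections $x\simeq\sigma x=\tau y\simeq y$ induced by $\sigma,\tau$ with $x\in\mathcal{C}(S)$, $y\in\mathcal{C}(T)$, $\sigma x=\tau y$; events are the elements of $\mathcal{B}$ having a greatest element (for the partial order on the graph given by the reflexive transitive closure of $\vartriangleleft$, with $x$ ordered by $\leq_S$ and $y$ by $\leq_T$); causality is inclusion; a finite set is consistent iff its union is in $\mathcal{B}$. The maps $\Pi_1:S\wedge T\to S$, $\Pi_2:S\wedge T\to T$ send an event with greatest element $(s,t)$ to $s$, resp. $t$, and $\sigma\wedge\tau=\sigma\circ\Pi_1=\tau\circ\Pi_2$; this is a pullback of $\sigma$ and $\tau$ in the category of es. For pre-strategies $\sigma:S\to A^\perp\parallel B$ and $\tau:T\to B^\perp\parallel C$, ignoring polarities, $\tau\circledast\sigma:T\circledast S\to A\parallel B\parallel C$ is $(\sigma\parallel \mathrm{id}_C)\wedge(\mathrm{id}_A\parallel\tau)$. $T\odot S$ is the restriction of $T\circledast S$ (causality and consistency inherited) to the visible events, i.e. those mapped to $A$ or $C$; $\tau\odot\sigma:T\odot S\to A^\perp\parallel C$ is the restriction of $\tau\circledast\sigma$, with polarities on $T\odot S$ making it polarity preserving. **Action on 2-cells.** Given $f:\sigma\Rightarrow\sigma'$ and $g:\tau\Rightarrow\tau'$ ($\sigma':S'\to A^\perp\parallel B$, $\tau':T'\to B^\perp\parallel C$),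 $g\circledast f:T\circledast S\to T'\circledast S'$ is the unique map of es with $\Pi_1\circ(g\circledast f)=(f\parallel \mathrm{id}_C)\circ\Pi_1$ and $\Pi_2\circ(g\circledast f)=(\mathrm{id}_A\parallel g)\circ\Pi_2$; it preserves and reflects visibility of events, and $g\odot f:T\odot S\to T'\odot S'$ is its restriction to visible events. **Copycat.** For a game $A$, $\Gamma_A$ has the events and polarities of $A^\perp\parallel A$, causality the transitive closure of $\leq_{A^\perp\parallel A}\cup\{((1-i,a),(i,a))\mid (i,a)\text{ positive in }A^\perp\parallel A\}$, and $X$ consistent iff its down-closure in $\Gamma_A$ is consistent in $A^\perp\parallel A$. $\gamma_A:\Gamma_A\to A^\perp\parallel A$ is the identity function. **Strategies.** A strategy on a game $A$ is a pre-strategy $\sigma:S\to A$ such that $\gamma_A\odot\sigma\cong\sigma$ (regarding $\sigma$ as a pre-strategy on $1^\perp\parallel A$). Equivalently, $\sigma$ is courteous (if $s$ is an immediate cause of $s'$ in $S$, i.e. $s<s'$ with nothing strictly in between, and $(\mathrm{pol}(s),\mathrm{pol}(s'))\neq(-,+)$, then $\sigma s$ is an immediate cause of $\sigma s'$ in $A$) and receptive (if $x\in\mathcal{C}(S)$, $a\in A\setminus\sigma x$ is negative and $\sigma x\cup\{a\}\in\mathcal{C}(A)$, there is a unique $s\in S \setminus x$ with $x\cup\{s\}\in\mathcal{C}(S)$ and $\sigma s=a$). *)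

theory Defs
  imports Main "HOL-Library.FuncSet" "HOL-Library.FSet"
begin

section \<open>Bicategories\<close>

definition is_category ::
    "'m set \<Rightarrow> ('m \<Rightarrow> 'm \<Rightarrow> 'c set) \<Rightarrow> ('m \<Rightarrow> 'c) \<Rightarrow> ('c \<Rightarrow> 'c \<Rightarrow> 'c) \<Rightarrow> bool" where
  "is_category Ob hom ident cmp \<longleftrightarrow>
     (\<forall>f\<in>Ob. ident f \<in> hom f f) \<and>
     (\<forall>f\<in>Ob. \<forall>g\<in>Ob. \<forall>h\<in>Ob. \<forall>\<phi>\<in>hom f g. \<forall>\<psi>\<in>hom g h. cmp \<psi> \<phi> \<in> hom f h) \<and>
     (\<forall>f\<in>Ob. \<forall>g\<in>Ob. \<forall>\<phi>\<in>hom f g. cmp \<phi> (ident f) = \<phi> \<and> cmp (ident g) \<phi> = \<phi>) \<and>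
     (\<forall>f\<in>Ob. \<forall>g\<in>Ob. \<forall>h\<in>Ob. \<forall>k\<in>Ob. \<forall>\<phi>\<in>hom f g. \<forall>\<psi>\<in>hom g h. \<forall>\<chi>\<in>hom h k.
        cmp \<chi> (cmp \<psi> \<phi>) = cmp (cmp \<chi> \<psi>) \<phi>)"

definition invertible ::
    "('m \<Rightarrow> 'm \<Rightarrow> 'c set) \<Rightarrow> ('m \<Rightarrow> 'c) \<Rightarrow> ('c \<Rightarrow> 'c \<Rightarrow> 'c) \<Rightarrow> 'm \<Rightarrow> 'm \<Rightarrow> 'c \<Rightarrow> bool" where
  "invertible hom ident cmp f g \<phi> \<longleftrightarrow>
     \<phi> \<in> hom f g \<and> (\<exists>\<psi>\<in>hom g f. cmp \<psi> \<phi> = ident f \<and> cmp \<phi> \<psi> = ident g)"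

text \<open>
  Compositions are written in the order of functions: for \<open>f \<in> hom A B\<close> and \<open>g \<in> hom B C\<close>,
  the composite is \<open>g \<odot> f \<in> hom A C\<close>. The arguments of the associator are listed in diagrammatic
  order, \<open>assoc f g h : (h \<odot> g) \<odot> f \<Rightarrow> h \<odot> (g \<odot> f)\<close>.
\<close>

locale bicategory =
  fixes obj :: "'o set"
    and hom :: "'o \<Rightarrow> 'o \<Rightarrow> 'm set"
    and cell :: "'m \<Rightarrow> 'm \<Rightarrow> 'c set"
    and id2 :: "'m \<Rightarrow> 'c"
    and vcomp :: "'c \<Rightarrow> 'c \<Rightarrow> 'c"  (infixr "\<cdot>" 55)
    and id1 :: "'o \<Rightarrow> 'm"
    and hcomp :: "'m \<Rightarrow> 'm \<Rightarrow> 'm"  (infixr "\<odot>" 60)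
    and hcomp2 :: "'c \<Rightarrow> 'c \<Rightarrow> 'c"  (infixr "\<star>" 60)
    and assoc :: "'m \<Rightarrow> 'm \<Rightarrow> 'm \<Rightarrow> 'c"
    and runit :: "'m \<Rightarrow> 'c"
    and lunit :: "'m \<Rightarrow> 'c"
  assumes hom_category:
      "\<lbrakk>A \<in> obj; B \<in> obj\<rbrakk> \<Longrightarrow> is_category (hom A B) cell id2 vcomp"
    and id1_hom: "A \<in> obj \<Longrightarrow> id1 A \<in> hom A A"
    and hcomp_hom:
      "\<lbrakk>A \<in> obj; B \<in> obj; C \<in> obj; f \<in> hom A B; g \<in> hom B C\<rbrakk> \<Longrightarrow> g \<odot> f \<in> hom A C"
    and hcomp2_cell:
      "\<lbrakk>A \<in> obj; B \<in> obj; C \<in> obj; f \<in> hom A B; f' \<in> hom A B; g \<in> hom B C; g' \<in> hom B C;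
        \<phi> \<in> cell f f'; \<psi> \<in> cell g g'\<rbrakk> \<Longrightarrow> \<psi> \<star> \<phi> \<in> cell (g \<odot> f) (g' \<odot> f')"
    and hcomp2_id2:
      "\<lbrakk>A \<in> obj; B \<in> obj; C \<in> obj; f \<in> hom A B; g \<in> hom B C\<rbrakk>
        \<Longrightarrow> id2 g \<star> id2 f = id2 (g \<odot> f)"
    and interchange:
      "\<lbrakk>A \<in> obj; B \<in> obj; C \<in> obj;
        f \<in> hom A B; f' \<in> hom A B; f'' \<in> hom A B; g \<in> hom B C; g' \<in> hom B C; g'' \<in> hom B C;
        \<phi> \<in> cell f f'; \<phi>' \<in> cell f' f''; \<psi> \<in> cell g g'; \<psi>' \<in> cell g' g''\<rbrakk>
        \<Longrightarrow> (\<psi>' \<cdot> \<psi>) \<star> (\<phi>' \<cdot> \<phi>) = (\<psi>' \<star> \<phi>') \<cdot> (\<psi> \<star> \<phi>)"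
    and assoc_invertible:
      "\<lbrakk>A \<in> obj; B \<in> obj; C \<in> obj; D \<in> obj; f \<in> hom A B; g \<in> hom B C; h \<in> hom C D\<rbrakk>
        \<Longrightarrow> invertible cell id2 vcomp ((h \<odot> g) \<odot> f) (h \<odot> (g \<odot> f)) (assoc f g h)"
    and runit_invertible:
      "\<lbrakk>A \<in> obj; B \<in> obj; f \<in> hom A B\<rbrakk>
        \<Longrightarrow> invertible cell id2 vcomp (f \<odot> id1 A) f (runit f)"
    and lunit_invertible:
      "\<lbrakk>A \<in> obj; B \<in> obj; f \<in> hom A B\<rbrakk>
        \<Longrightarrow> invertible cell id2 vcomp (id1 B \<odot> f) f (lunit f)"
    and assoc_natural:
      "\<lbrakk>A \<in> obj; B \<in> obj; C \<in> obj; D \<in> obj; f \<in> hom A B; f' \<in> hom A B;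
        g \<in> hom B C; g' \<in> hom B C; h \<in> hom C D; h' \<in> hom C D;
        \<phi> \<in> cell f f'; \<psi> \<in> cell g g'; \<chi> \<in> cell h h'\<rbrakk>
        \<Longrightarrow> assoc f' g' h' \<cdot> ((\<chi> \<star> \<psi>) \<star> \<phi>) = (\<chi> \<star> (\<psi> \<star> \<phi>)) \<cdot> assoc f g h"
    and runit_natural:
      "\<lbrakk>A \<in> obj; B \<in> obj; f \<in> hom A B; f' \<in> hom A B; \<phi> \<in> cell f f'\<rbrakk>
        \<Longrightarrow> runit f' \<cdot> (\<phi> \<star> id2 (id1 A)) = \<phi> \<cdot> runit f"
    and lunit_natural:
      "\<lbrakk>A \<in> obj; B \<in> obj; f \<in> hom A B; f' \<in> hom A B; \<phi> \<in> cell f f'\<rbrakk>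
        \<Longrightarrow> lunit f' \<cdot> (id2 (id1 B) \<star> \<phi>) = \<phi> \<cdot> lunit f"
    and pentagon:
      "\<lbrakk>A \<in> obj; B \<in> obj; C \<in> obj; D \<in> obj; E \<in> obj;
        f \<in> hom A B; g \<in> hom B C; h \<in> hom C D; k \<in> hom D E\<rbrakk>
        \<Longrightarrow> assoc (g \<odot> f) h k \<cdot> assoc f g (k \<odot> h)
            = (id2 k \<star> assoc f g h) \<cdot> assoc f (h \<odot> g) k \<cdot> (assoc g h k \<star> id2 f)"
    and triangle:
      "\<lbrakk>A \<in> obj; B \<in> obj; C \<in> obj; f \<in> hom A B; g \<in> hom B C\<rbrakk>
        \<Longrightarrow> (id2 g \<star> lunit f) \<cdot> assoc f (id1 B) g = runit g \<star> id2 f"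


section \<open>Event structures\<close>

record 'e es =
  Ev :: "'e set"
  Leq :: "('e \<times> 'e) set"
  Con :: "'e set set"

definition is_es :: "('e, 'x) es_scheme \<Rightarrow> bool" where
  "is_es E \<longleftrightarrow>
     partial_order_on (Ev E) (Leq E) \<and>
     Con E \<noteq> {} \<and>
     (\<forall>X\<in>Con E. finite X \<and> X \<subseteq> Ev E) \<and>
     (\<forall>e\<in>Ev E. finite {e'. (e', e) \<in> Leq E}) \<and>
     (\<forall>e\<in>Ev E. {e} \<in> Con E) \<and>
     (\<forall>X\<in>Con E. \<forall>Y. Y \<subseteq> X \<longrightarrow> Y \<in> Con E) \<and>
     (\<forall>X\<in>Con E. \<forall>e\<in>X. \<forall>e'. (e', e) \<in> Leq E \<longrightarrow> X \<union> {e'} \<in> Con E)"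

definition conf :: "('e, 'x) es_scheme \<Rightarrow> 'e set set" where
  "conf E = {x. finite x \<and> x \<subseteq> Ev E \<and> x \<in> Con E \<and> (\<forall>e\<in>x. \<forall>e'. (e', e) \<in> Leq E \<longrightarrow> e' \<in> x)}"

text \<open>
  Functions between event structures are extensional (\<open>undefined\<close> off the domain), so that
  equality of maps is equality of HOL functions.
\<close>

definition es_map :: "('e, 'x) es_scheme \<Rightarrow> ('f, 'y) es_scheme \<Rightarrow> ('e \<Rightarrow> 'f) \<Rightarrow> bool" where
  "es_map E F f \<longleftrightarrow>
     f \<in> Ev E \<rightarrow>\<^sub>E Ev F \<and> (\<forall>x\<in>conf E. f ` x \<in> conf F \<and> inj_on f x)"

definition restr_es :: "('e, 'x) es_scheme \<Rightarrow> 'e set \<Rightarrow> 'e es" where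
  "restr_es E V = \<lparr>Ev = Ev E \<inter> V, Leq = Leq E \<inter> V \<times> V, Con = {X \<in> Con E. X \<subseteq> V}\<rparr>"

datatype polarity = Neg | Pos

fun opp :: "polarity \<Rightarrow> polarity" where
  "opp Neg = Pos"
| "opp Pos = Neg"

record 'e esp = "'e es" +
  pol :: "'e \<Rightarrow> polarity"

definition is_esp :: "'e esp \<Rightarrow> bool" where
  "is_esp A \<longleftrightarrow> is_es A \<and> pol A \<in> extensional (Ev A)"

definition esp_map :: "'e esp \<Rightarrow> 'f esp \<Rightarrow> ('e \<Rightarrow> 'f) \<Rightarrow> bool" where
  "esp_map A B f \<longleftrightarrow> es_map A B f \<and> (\<forall>e\<in>Ev A. pol B (f e) = pol A e)"

definition esp_iso :: "'e esp \<Rightarrow> 'f esp \<Rightarrow> ('e \<Rightarrow> 'f) \<Rightarrow> bool" where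
  "esp_iso A B f \<longleftrightarrow>
     esp_map A B f \<and>
     (\<exists>g. esp_map B A g \<and> (\<forall>e\<in>Ev A. g (f e) = e) \<and> (\<forall>e\<in>Ev B. f (g e) = e))"

definition dual :: "'e esp \<Rightarrow> 'e esp" where
  "dual A = A\<lparr>pol := (\<lambda>e\<in>Ev A. opp (pol A e))\<rparr>"

definition empty_game :: "'e esp" where
  "empty_game = \<lparr>Ev = {}, Leq = {}, Con = {{}}, pol = (\<lambda>_. undefined)\<rparr>"


section \<open>The universe of events\<close>

text \<open>
  All event structures forming the bicategory take their events from one type. It contains an
  arbitrary type \<open>'u\<close> of atoms and is closed under the two constructions used below: \<open>In0 e\<close> and
  \<open>In1 e\<close> are the tagged events \<open>(0, e)\<close> and \<open>(1, e)\<close> of a parallel composition, and \<open>Graph q\<close> is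
  the (finite) graph of a secured bijection, regarded as an event.
\<close>

datatype 'u ev =
    Atom 'u
  | In0 "'u ev"
  | In1 "'u ev"
  | Graph "('u ev \<times> 'u ev) fset"

fun graph_of :: "'u ev \<Rightarrow> ('u ev \<times> 'u ev) set" where
  "graph_of (Graph q) = fset q"
| "graph_of _ = {}"

definition copair :: "('u ev \<Rightarrow> 'b) \<Rightarrow> ('u ev \<Rightarrow> 'b) \<Rightarrow> 'u ev \<Rightarrow> 'b" where
  "copair f g e = (case e of In0 a \<Rightarrow> f a | In1 b \<Rightarrow> g b | _ \<Rightarrow> undefined)"

type_synonym 'u game = "'u ev esp"


section \<open>Parallel composition\<close>

definition par :: "('u ev, 'x) es_scheme \<Rightarrow> ('u ev, 'y) es_scheme \<Rightarrow> 'u ev es" where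
  "par E F =
     \<lparr>Ev = In0 ` Ev E \<union> In1 ` Ev F,
      Leq = map_prod In0 In0 ` Leq E \<union> map_prod In1 In1 ` Leq F,
      Con = {In0 ` X \<union> In1 ` Y | X Y. X \<in> Con E \<and> Y \<in> Con F}\<rparr>"

definition par_game :: "'u game \<Rightarrow> 'u game \<Rightarrow> 'u game"  (infixr "\<parallel>" 70) where
  "A \<parallel> B =
     \<lparr>Ev = Ev (par A B), Leq = Leq (par A B), Con = Con (par A B),
      pol = (\<lambda>e\<in>Ev (par A B). copair (pol A) (pol B) e)\<rparr>"

definition par_map :: "('u ev, 'x) es_scheme \<Rightarrow> ('u ev, 'y) es_scheme \<Rightarrow>
    ('u ev \<Rightarrow> 'u ev) \<Rightarrow> ('u ev \<Rightarrow> 'u ev) \<Rightarrow> 'u ev \<Rightarrow> 'u ev" where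
  "par_map E F f g = (\<lambda>e\<in>Ev (par E F). copair (In0 \<circ> f) (In1 \<circ> g) e)"

text \<open>
  The ternary composition \<open>A \<parallel> B \<parallel> C\<close> is \<open>A \<parallel> (B \<parallel> C)\<close>; \<open>reassoc\<close> identifies \<open>(A \<parallel> B) \<parallel> C\<close> with it.
  \<open>hide_mid\<close> sends the \<open>A\<close> and \<open>C\<close> parts of \<open>A \<parallel> (B \<parallel> C)\<close> to \<open>A \<parallel> C\<close>.
\<close>

definition reassoc :: "'u ev \<Rightarrow> 'u ev" where
  "reassoc = copair (copair In0 (In1 \<circ> In0)) (In1 \<circ> In1)"

definition hide_mid :: "'u ev \<Rightarrow> 'u ev" where
  "hide_mid = copair In0 (copair (\<lambda>_. undefined) In1)"


section \<open>Secured bijections and the pullback\<close>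

definition strictly :: "('a \<times> 'a) set \<Rightarrow> 'a \<Rightarrow> 'a \<Rightarrow> bool" where
  "strictly r a b \<longleftrightarrow> (a, b) \<in> r \<and> a \<noteq> b"

definition graph_step ::
    "('s \<times> 's) set \<Rightarrow> ('t \<times> 't) set \<Rightarrow> ('s \<times> 't) set \<Rightarrow> (('s \<times> 't) \<times> ('s \<times> 't)) set" where
  "graph_step r r' q =
     {((a, b), (a', b')). (a, b) \<in> q \<and> (a', b') \<in> q \<and> (strictly r a a' \<or> strictly r' b b')}"

definition graph_le ::
    "('s \<times> 's) set \<Rightarrow> ('t \<times> 't) set \<Rightarrow> ('s \<times> 't) set \<Rightarrow> (('s \<times> 't) \<times> ('s \<times> 't)) set" where
  "graph_le r r' q = (graph_step r r' q)\<^sup>* \<inter> q \<times> q"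

definition secured :: "('s \<times> 's) set \<Rightarrow> ('t \<times> 't) set \<Rightarrow> ('s \<times> 't) set \<Rightarrow> bool" where
  "secured r r' q \<longleftrightarrow> partial_order_on q (graph_le r r' q)"

text \<open>
  The bijection \<open>x \<simeq> y\<close> induced by \<open>\<sigma>\<close> and \<open>\<tau>\<close> relates \<open>s\<close> and \<open>t\<close> when \<open>\<sigma> s = \<tau> t\<close>; it is a
  bijection because \<open>\<sigma>\<close> and \<open>\<tau>\<close> are injective on configurations.
\<close>

definition sec_bij :: "('s, 'x) es_scheme \<Rightarrow> ('t, 'y) es_scheme \<Rightarrow>
    ('s \<Rightarrow> 'a) \<Rightarrow> ('t \<Rightarrow> 'a) \<Rightarrow> ('s \<times> 't) set set" where
  "sec_bij S T \<sigma> \<tau> =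
     {q. \<exists>x\<in>conf S. \<exists>y\<in>conf T. \<sigma> ` x = \<tau> ` y \<and>
           q = {(s, t). s \<in> x \<and> t \<in> y \<and> \<sigma> s = \<tau> t} \<and> secured (Leq S) (Leq T) q}"

definition is_top :: "('s, 'x) es_scheme \<Rightarrow> ('t, 'y) es_scheme \<Rightarrow>
    ('s \<times> 't) set \<Rightarrow> 's \<times> 't \<Rightarrow> bool" where
  "is_top S T q p \<longleftrightarrow> p \<in> q \<and> (\<forall>p'\<in>q. (p', p) \<in> graph_le (Leq S) (Leq T) q)"

definition wedge_ev :: "('u ev, 'x) es_scheme \<Rightarrow> ('u ev, 'y) es_scheme \<Rightarrow>
    ('u ev \<Rightarrow> 'a) \<Rightarrow> ('u ev \<Rightarrow> 'a) \<Rightarrow> 'u ev set" where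
  "wedge_ev S T \<sigma> \<tau> = {Graph q | q. fset q \<in> sec_bij S T \<sigma> \<tau> \<and> (\<exists>p. is_top S T (fset q) p)}"

definition wedge :: "('u ev, 'x) es_scheme \<Rightarrow> ('u ev, 'y) es_scheme \<Rightarrow>
    ('u ev \<Rightarrow> 'a) \<Rightarrow> ('u ev \<Rightarrow> 'a) \<Rightarrow> 'u ev es" where
  "wedge S T \<sigma> \<tau> =
     \<lparr>Ev = wedge_ev S T \<sigma> \<tau>,
      Leq = {(d, e). d \<in> wedge_ev S T \<sigma> \<tau> \<and> e \<in> wedge_ev S T \<sigma> \<tau> \<and> graph_of d \<subseteq> graph_of e},
      Con = {X. finite X \<and> X \<subseteq> wedge_ev S T \<sigma> \<tau> \<and> \<Union> (graph_of ` X) \<in> sec_bij S T \<sigma> \<tau>}\<rparr>"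

definition proj1 :: "('u ev, 'x) es_scheme \<Rightarrow> ('u ev, 'y) es_scheme \<Rightarrow>
    ('u ev \<Rightarrow> 'a) \<Rightarrow> ('u ev \<Rightarrow> 'a) \<Rightarrow> 'u ev \<Rightarrow> 'u ev" where
  "proj1 S T \<sigma> \<tau> = (\<lambda>e\<in>Ev (wedge S T \<sigma> \<tau>). fst (THE p. is_top S T (graph_of e) p))"

definition proj2 :: "('u ev, 'x) es_scheme \<Rightarrow> ('u ev, 'y) es_scheme \<Rightarrow>
    ('u ev \<Rightarrow> 'a) \<Rightarrow> ('u ev \<Rightarrow> 'a) \<Rightarrow> 'u ev \<Rightarrow> 'u ev" where
  "proj2 S T \<sigma> \<tau> = (\<lambda>e\<in>Ev (wedge S T \<sigma> \<tau>). snd (THE p. is_top S T (graph_of e) p))"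


section \<open>Pre-strategies and their composition\<close>

text \<open>
  \<open>\<lparr>src = A, trg = B, st = S, lab = \<sigma>\<rparr>\<close> stands for \<open>\<sigma> : S \<rightarrow> A\<^sup>\<bottom> \<parallel> B\<close>.
\<close>

record 'u prestrat =
  src :: "'u game"
  trg :: "'u game"
  st :: "'u game"
  lab :: "'u ev \<Rightarrow> 'u ev"

definition is_prestrategy_on :: "'u game \<Rightarrow> 'u game \<Rightarrow> ('u ev \<Rightarrow> 'u ev) \<Rightarrow> bool" where
  "is_prestrategy_on A S \<sigma> \<longleftrightarrow> is_esp A \<and> is_esp S \<and> esp_map S A \<sigma>"

definition prestrat_iso :: "'u prestrat \<Rightarrow> 'u prestrat \<Rightarrow> bool"  (infix "\<cong>\<^sub>s" 50) where
  "\<sigma> \<cong>\<^sub>s \<tau> \<longleftrightarrow>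
     src \<sigma> = src \<tau> \<and> trg \<sigma> = trg \<tau> \<and>
     (\<exists>\<phi>. esp_iso (st \<sigma>) (st \<tau>) \<phi> \<and> (\<forall>s\<in>Ev (st \<sigma>). lab \<tau> (\<phi> s) = lab \<sigma> s))"

text \<open>
  For \<open>\<sigma> : S \<rightarrow> A\<^sup>\<bottom> \<parallel> B\<close> and \<open>\<tau> : T \<rightarrow> B\<^sup>\<bottom> \<parallel> C\<close>, the two maps into \<open>A \<parallel> (B \<parallel> C)\<close> whose pullback is
  \<open>\<tau> \<circledast> \<sigma>\<close>.
\<close>

definition left_es :: "'u prestrat \<Rightarrow> 'u prestrat \<Rightarrow> 'u ev es" where
  "left_es \<tau> \<sigma> = par (st \<sigma>) (trg \<tau>)"

definition left_map :: "'u prestrat \<Rightarrow> 'u prestrat \<Rightarrow> 'u ev \<Rightarrow> 'u ev" where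
  "left_map \<tau> \<sigma> =
     (\<lambda>e\<in>Ev (left_es \<tau> \<sigma>). reassoc (par_map (st \<sigma>) (trg \<tau>) (lab \<sigma>) (\<lambda>c. c) e))"

definition right_es :: "'u prestrat \<Rightarrow> 'u prestrat \<Rightarrow> 'u ev es" where
  "right_es \<tau> \<sigma> = par (src \<sigma>) (st \<tau>)"

definition right_map :: "'u prestrat \<Rightarrow> 'u prestrat \<Rightarrow> 'u ev \<Rightarrow> 'u ev" where
  "right_map \<tau> \<sigma> = par_map (src \<sigma>) (st \<tau>) (\<lambda>a. a) (lab \<tau>)"

definition inter_es :: "'u prestrat \<Rightarrow> 'u prestrat \<Rightarrow> 'u ev es" where
  "inter_es \<tau> \<sigma> = wedge (left_es \<tau> \<sigma>) (right_es \<tau> \<sigma>) (left_map \<tau> \<sigma>) (right_map \<tau> \<sigma>)"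

definition inter_proj1 :: "'u prestrat \<Rightarrow> 'u prestrat \<Rightarrow> 'u ev \<Rightarrow> 'u ev" where
  "inter_proj1 \<tau> \<sigma> = proj1 (left_es \<tau> \<sigma>) (right_es \<tau> \<sigma>) (left_map \<tau> \<sigma>) (right_map \<tau> \<sigma>)"

definition inter_proj2 :: "'u prestrat \<Rightarrow> 'u prestrat \<Rightarrow> 'u ev \<Rightarrow> 'u ev" where
  "inter_proj2 \<tau> \<sigma> = proj2 (left_es \<tau> \<sigma>) (right_es \<tau> \<sigma>) (left_map \<tau> \<sigma>) (right_map \<tau> \<sigma>)"

definition inter_map :: "'u prestrat \<Rightarrow> 'u prestrat \<Rightarrow> 'u ev \<Rightarrow> 'u ev" where
  "inter_map \<tau> \<sigma> = (\<lambda>e\<in>Ev (inter_es \<tau> \<sigma>). left_map \<tau> \<sigma> (inter_proj1 \<tau> \<sigma> e))"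

definition visible :: "'u prestrat \<Rightarrow> 'u prestrat \<Rightarrow> 'u ev set" where
  "visible \<tau> \<sigma> =
     {e \<in> Ev (inter_es \<tau> \<sigma>).
        inter_map \<tau> \<sigma> e \<in> In0 ` Ev (src \<sigma>) \<union> In1 ` In1 ` Ev (trg \<tau>)}"

definition comp_es :: "'u prestrat \<Rightarrow> 'u prestrat \<Rightarrow> 'u ev es" where
  "comp_es \<tau> \<sigma> = restr_es (inter_es \<tau> \<sigma>) (visible \<tau> \<sigma>)"

definition comp_lab :: "'u prestrat \<Rightarrow> 'u prestrat \<Rightarrow> 'u ev \<Rightarrow> 'u ev" where
  "comp_lab \<tau> \<sigma> = (\<lambda>e\<in>Ev (comp_es \<tau> \<sigma>). hide_mid (inter_map \<tau> \<sigma> e))"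

definition comp_strat :: "'u prestrat \<Rightarrow> 'u prestrat \<Rightarrow> 'u prestrat"  (infixr "\<odot>\<^sub>s" 60) where
  "\<tau> \<odot>\<^sub>s \<sigma> =
     \<lparr>src = src \<sigma>, trg = trg \<tau>,
      st = \<lparr>Ev = Ev (comp_es \<tau> \<sigma>), Leq = Leq (comp_es \<tau> \<sigma>), Con = Con (comp_es \<tau> \<sigma>),
            pol = (\<lambda>e\<in>Ev (comp_es \<tau> \<sigma>). pol (dual (src \<sigma>) \<parallel> trg \<tau>) (comp_lab \<tau> \<sigma> e))\<rparr>,
      lab = comp_lab \<tau> \<sigma>\<rparr>"


section \<open>Copycat and strategies\<close>

definition swap_side :: "'u ev \<Rightarrow> 'u ev" where
  "swap_side = copair In1 In0"

definition copycat_leq :: "'u game \<Rightarrow> ('u ev \<times> 'u ev) set" where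
  "copycat_leq A =
     (Leq (dual A \<parallel> A) \<union>
      {(swap_side e, e) | e. e \<in> Ev (dual A \<parallel> A) \<and> pol (dual A \<parallel> A) e = Pos})\<^sup>+"

definition copycat_game :: "'u game \<Rightarrow> 'u game" where
  "copycat_game A =
     \<lparr>Ev = Ev (dual A \<parallel> A),
      Leq = copycat_leq A,
      Con = {X. finite X \<and> X \<subseteq> Ev (dual A \<parallel> A) \<and>
                {e'. \<exists>e\<in>X. (e', e) \<in> copycat_leq A} \<in> Con (dual A \<parallel> A)},
      pol = pol (dual A \<parallel> A)\<rparr>"

definition copycat :: "'u game \<Rightarrow> 'u prestrat" where
  "copycat A =
     \<lparr>src = A, trg = A, st = copycat_game A, lab = (\<lambda>e\<in>Ev (copycat_game A). e)\<rparr>"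

text \<open>A pre-strategy on \<open>A\<close> regarded as a pre-strategy on \<open>1\<^sup>\<bottom> \<parallel> A\<close>.\<close>

definition from_empty :: "'u game \<Rightarrow> 'u game \<Rightarrow> ('u ev \<Rightarrow> 'u ev) \<Rightarrow> 'u prestrat" where
  "from_empty A S \<sigma> =
     \<lparr>src = empty_game, trg = A, st = S, lab = (\<lambda>s\<in>Ev S. In1 (\<sigma> s))\<rparr>"

definition is_strategy_on :: "'u game \<Rightarrow> 'u game \<Rightarrow> ('u ev \<Rightarrow> 'u ev) \<Rightarrow> bool" where
  "is_strategy_on A S \<sigma> \<longleftrightarrow>
     is_prestrategy_on A S \<sigma> \<and> copycat A \<odot>\<^sub>s from_empty A S \<sigma> \<cong>\<^sub>s from_empty A S \<sigma>"


section \<open>The data of the bicategory of concurrent games\<close>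

definition games :: "'u game set" where
  "games = {A. is_esp A}"

definition strategies :: "'u game \<Rightarrow> 'u game \<Rightarrow> 'u prestrat set" where
  "strategies A B =
     {\<sigma>. src \<sigma> = A \<and> trg \<sigma> = B \<and> is_strategy_on (dual A \<parallel> B) (st \<sigma>) (lab \<sigma>)}"

record 'u two_cell =
  cdom :: "'u prestrat"
  ccod :: "'u prestrat"
  cfun :: "'u ev \<Rightarrow> 'u ev"

definition two_cells :: "'u prestrat \<Rightarrow> 'u prestrat \<Rightarrow> 'u two_cell set" where
  "two_cells \<sigma> \<sigma>' =
     {f. cdom f = \<sigma> \<and> ccod f = \<sigma>' \<and> src \<sigma> = src \<sigma>' \<and> trg \<sigma> = trg \<sigma>' \<and>
         esp_map (st \<sigma>) (st \<sigma>') (cfun f) \<and>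
         (\<forall>s\<in>Ev (st \<sigma>). lab \<sigma>' (cfun f s) = lab \<sigma> s)}"

definition id_cell :: "'u prestrat \<Rightarrow> 'u two_cell" where
  "id_cell \<sigma> = \<lparr>cdom = \<sigma>, ccod = \<sigma>, cfun = (\<lambda>s\<in>Ev (st \<sigma>). s)\<rparr>"

definition vcomp_cell :: "'u two_cell \<Rightarrow> 'u two_cell \<Rightarrow> 'u two_cell" where
  "vcomp_cell g f =
     \<lparr>cdom = cdom f, ccod = ccod g, cfun = compose (Ev (st (cdom f))) (cfun g) (cfun f)\<rparr>"

text \<open>The map \<open>g \<circledast> f\<close> of event structures.\<close>

definition inter_cell :: "'u two_cell \<Rightarrow> 'u two_cell \<Rightarrow> 'u ev \<Rightarrow> 'u ev" where
  "inter_cell g f =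
     (let \<sigma> = cdom f; \<sigma>' = ccod f; \<tau> = cdom g; \<tau>' = ccod g in
      THE h. es_map (inter_es \<tau> \<sigma>) (inter_es \<tau>' \<sigma>') h \<and>
        (\<forall>e\<in>Ev (inter_es \<tau> \<sigma>).
           inter_proj1 \<tau>' \<sigma>' (h e)
             = par_map (st \<sigma>) (trg \<tau>) (cfun f) (\<lambda>c. c) (inter_proj1 \<tau> \<sigma> e) \<and>
           inter_proj2 \<tau>' \<sigma>' (h e)
             = par_map (src \<sigma>) (st \<tau>) (\<lambda>a. a) (cfun g) (inter_proj2 \<tau> \<sigma> e)))"

definition hcomp_cell :: "'u two_cell \<Rightarrow> 'u two_cell \<Rightarrow> 'u two_cell" where
  "hcomp_cell g f =
     \<lparr>cdom = cdom g \<odot>\<^sub>s cdom f, ccod = ccod g \<odot>\<^sub>s ccod f,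
      cfun = (\<lambda>e\<in>visible (cdom g) (cdom f). inter_cell g f e)\<rparr>"

end

theory Submission
  imports Defs
begin

text \<open>
  Labels identify the events inside a configuration, so maps between pre-strategies can be
  recovered from their action on configurations. A configuration of \<open>\<tau> \<odot>\<^sub>s \<sigma>\<close> is the visible part of a
  least pair of configurations of \<open>\<sigma>\<close> and \<open>\<tau>\<close> that match over the common game and can be scheduled
  together. For a chain of pre-strategies such synchronised states make no reference to a bracketing
  of the composites; the associator is the identity on them, whence naturality and the pentagon.
  Strategies are the courteous and receptive pre-strategies, and these are the ones along which the
  Scott order (remove positive moves, add negative moves) lifts uniquely; the unitors send a
  configuration of a composite with copycat to the lift of its component in the strategy.
\<close>

section \<open>Configurations of event structures\<close>

text \<open>The events of a composite are graphs of secured bijections, so the two bracketings of a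
  triple composite have events that are nested in different ways; comparing events would mean
  unfolding these graphs. Configurations avoid this, because each is described by configurations of
  the factors and has a least such description. Security is traded for a rank, a numerical schedule
  on the locations of moves in the games: it restricts to smaller states and is untouched by maps
  that preserve labels. The obstacle is gluing. A composite remembers only the order between its
  visible moves, so the schedules of two parts and the schedule of their composites are unrelated
  numbers. They are combined without arithmetic, by the criterion that a state has a schedule as
  soon as every smaller matching state can be enlarged by one location inside it. A strategy is
  given by an isomorphism that is only known to preserve polarities and labels; a composite inherits
  courtesy and receptivity on each outer side from the factor there, so this already passes the
  properties of copycat to the strategy, and the left unitor gives the converse.\<close>

definition dn :: "('e, 'x) es_scheme \<Rightarrow> 'e \<Rightarrow> 'e set" where
  "dn E e = {e'. (e', e) \<in> Leq E}"

lemma es_partial_order: "is_es E \<Longrightarrow> partial_order_on (Ev E) (Leq E)"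
  by (simp add: is_es_def)

lemma es_LeqD: "is_es E \<Longrightarrow> (a, b) \<in> Leq E \<Longrightarrow> a \<in> Ev E \<and> b \<in> Ev E"
  using es_partial_order[of E] by (auto simp: order_on_defs)

lemma es_refl: "is_es E \<Longrightarrow> a \<in> Ev E \<Longrightarrow> (a, a) \<in> Leq E"
  using es_partial_order[of E] by (auto simp: order_on_defs refl_on_def)

lemma es_trans: "is_es E \<Longrightarrow> (a, b) \<in> Leq E \<Longrightarrow> (b, c) \<in> Leq E \<Longrightarrow> (a, c) \<in> Leq E"
  using es_partial_order[of E] by (auto simp: order_on_defs dest: transD)

lemma es_antisym: "is_es E \<Longrightarrow> (a, b) \<in> Leq E \<Longrightarrow> (b, a) \<in> Leq E \<Longrightarrow> a = b"
  using es_partial_order[of E] by (auto simp: order_on_defs dest: antisymD)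

lemma es_finite_dn: "is_es E \<Longrightarrow> finite (dn E e)"
proof -
  assume E: "is_es E"
  show ?thesis
  proof (cases "e \<in> Ev E")
    case True then show ?thesis using E by (simp add: is_es_def dn_def)
  next
    case False then have "dn E e = {}" using es_LeqD[OF E] by (auto simp: dn_def)
    then show ?thesis by simp
  qed
qed

lemma confD:
  assumes "x \<in> conf E"
  shows "finite x" "x \<subseteq> Ev E" "x \<in> Con E"
    "\<And>e e'. e \<in> x \<Longrightarrow> (e', e) \<in> Leq E \<Longrightarrow> e' \<in> x"
  using assms by (auto simp: conf_def)

lemma Con_subset: "is_es E \<Longrightarrow> X \<in> Con E \<Longrightarrow> Y \<subseteq> X \<Longrightarrow> Y \<in> Con E"
  by (simp add: is_es_def)

lemma conf_empty: "is_es E \<Longrightarrow> {} \<in> conf E"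
  unfolding conf_def by (auto simp: is_es_def)

lemma conf_sub:
  assumes "is_es E" "x \<in> conf E" "u \<subseteq> x" "\<And>e e'. e \<in> u \<Longrightarrow> (e', e) \<in> Leq E \<Longrightarrow> e' \<in> u"
  shows "u \<in> conf E"
  using assms confD[OF assms(2)] Con_subset[OF assms(1), of x u]
  unfolding conf_def by (auto intro: finite_subset)

lemma conf_Int: "is_es E \<Longrightarrow> x \<in> conf E \<Longrightarrow> y \<in> conf E \<Longrightarrow> x \<inter> y \<in> conf E"
  by (rule conf_sub[of E x]) (auto dest: confD)

lemma conf_Un:
  "is_es E \<Longrightarrow> z \<in> conf E \<Longrightarrow> x \<in> conf E \<Longrightarrow> y \<in> conf E \<Longrightarrow> x \<subseteq> z \<Longrightarrow> y \<subseteq> z \<Longrightarrow> x \<union> y \<in> conf E"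
  by (rule conf_sub[of E z]) (auto dest: confD)

lemma Con_insert_below:
  "is_es E \<Longrightarrow> X \<in> Con E \<Longrightarrow> e \<in> X \<Longrightarrow> (e', e) \<in> Leq E \<Longrightarrow> X \<union> {e'} \<in> Con E"
  by (simp add: is_es_def)

text \<open>The closure is finite because principal down-sets are, so its elements can be added one
  at a time, each by the axiom that a cause of a member may join a consistent set.\<close>

lemma Con_down_closure:
  assumes E: "is_es E" and X: "X \<in> Con E"
  shows "{e'. \<exists>e\<in>X. (e', e) \<in> Leq E} \<in> conf E"
proof -
  let ?D = "{e'. \<exists>e\<in>X. (e', e) \<in> Leq E}"
  have X': "finite X" "X \<subseteq> Ev E" using E X by (auto simp: is_es_def)
  have D: "?D = (\<Union>e\<in>X. dn E e)" by (auto simp: dn_def)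
  have fin: "finite ?D" unfolding D using X' es_finite_dn[OF E] by blast
  have "X \<union> F \<in> Con E" if "finite F" "F \<subseteq> ?D" for F
    using that
  proof (induction F)
    case empty then show ?case using X by simp
  next
    case (insert a F)
    then obtain e where e: "e \<in> X" "(a, e) \<in> Leq E" by auto
    have "(X \<union> F) \<union> {a} \<in> Con E"
      using Con_insert_below[OF E, of "X \<union> F" e a] insert e by auto
    then show ?case by simp
  qed
  from this[OF fin] have "X \<union> ?D \<in> Con E" by simp
  then have "?D \<in> Con E" using Con_subset[OF E] by blast
  then show ?thesis using fin es_trans[OF E] es_LeqD[OF E] unfolding conf_def by auto
qed

lemma dn_conf: "is_es E \<Longrightarrow> e \<in> Ev E \<Longrightarrow> dn E e \<in> conf E"
  using Con_down_closure[of E "{e}"] by (simp add: is_es_def dn_def)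

lemma dn_self: "is_es E \<Longrightarrow> e \<in> Ev E \<Longrightarrow> e \<in> dn E e"
  by (simp add: dn_def es_refl)

lemma dn_subset_conf: "x \<in> conf E \<Longrightarrow> e \<in> x \<Longrightarrow> dn E e \<subseteq> x"
  by (auto simp: dn_def dest: confD)

lemma Ev_in_conf: "is_es E \<Longrightarrow> e \<in> Ev E \<Longrightarrow> \<exists>x\<in>conf E. e \<in> x"
  by (rule bexI[of _ "dn E e"]) (simp_all add: dn_conf dn_self)

text \<open>A numerical height, since strict causes have strictly smaller principal down-sets. It
  selects minimal and maximal events of finite sets, and the schedule of a single pre-strategy is
  made from it.\<close>

definition rk :: "('e, 'x) es_scheme \<Rightarrow> 'e \<Rightarrow> nat" where
  "rk E e = card (dn E e)"

lemma rk_less: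
  assumes "is_es E" "(a, b) \<in> Leq E" "a \<noteq> b" shows "rk E a < rk E b"
proof -
  have "dn E a \<subseteq> dn E b" using es_trans[OF assms(1)] assms(2) by (auto simp: dn_def)
  moreover have "b \<in> dn E b" "b \<notin> dn E a"
    using assms es_LeqD[OF assms(1,2)] es_antisym[OF assms(1,2)] dn_self[OF assms(1)]
    by (auto simp: dn_def)
  ultimately have "dn E a \<subset> dn E b" by blast
  then show ?thesis
    unfolding rk_def by (rule psubset_card_mono[OF es_finite_dn[OF assms(1)]])
qed

lemma conf_remove:
  assumes "is_es E" "x \<in> conf E" "\<And>e'. e' \<in> x \<Longrightarrow> (e, e') \<in> Leq E \<Longrightarrow> e' = e"
  shows "x - {e} \<in> conf E"
proof (rule conf_sub[OF assms(1,2)])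
  fix a b assume "a \<in> x - {e}" "(b, a) \<in> Leq E"
  then show "b \<in> x - {e}" using assms(3)[of a] confD(4)[OF assms(2)] by blast
qed auto

lemma conf_insert:
  assumes "is_es E" "x \<in> conf E" "y \<in> conf E" "x \<subseteq> y" "e \<in> y"
    "\<And>e'. (e', e) \<in> Leq E \<Longrightarrow> e' \<noteq> e \<Longrightarrow> e' \<in> x"
  shows "insert e x \<in> conf E"
proof (rule conf_sub[OF assms(1,3)])
  show "insert e x \<subseteq> y" using assms by blast
  fix a b assume "a \<in> insert e x" "(b, a) \<in> Leq E"
  then show "b \<in> insert e x" using assms(6)[of b] confD(4)[OF assms(2)] by blast
qed

text \<open>An event of least rank in the difference has all its strict causes in \<open>x\<close>
  already.\<close>

lemma conf_extend:
  assumes E: "is_es E" and x: "x \<in> conf E" and y: "y \<in> conf E" and "x \<subset> y"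
  shows "\<exists>e\<in>y - x. insert e x \<in> conf E"
proof -
  have "y - x \<noteq> {}" using assms by blast
  then obtain e where e: "e \<in> y - x" "\<And>e'. e' \<in> y - x \<Longrightarrow> \<not> rk E e' < rk E e"
    using ex_has_least_nat[of "\<lambda>e. e \<in> y - x" _ "rk E"] by (metis all_not_in_conv not_le)
  have "insert e x \<in> conf E"
  proof (rule conf_insert[OF E x y])
    show "x \<subseteq> y" "e \<in> y" using assms e by auto
    fix e' assume e': "(e', e) \<in> Leq E" "e' \<noteq> e"
    then have "e' \<in> y" using confD(4)[OF y] e(1) by blast
    with e(2)[of e'] rk_less[OF E e'] show "e' \<in> x" by blast
  qed
  then show ?thesis using e by blast
qed

text \<open>By \<open>conf_extend\<close> there is always a next event on the way to
  \<open>y\<close>; the induction runs on the number of events of \<open>y\<close> that are still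
  missing.\<close>

lemma conf_chain_induct [consumes 4, case_names base step]:
  assumes E: "is_es E" and x: "x \<in> conf E" and y: "y \<in> conf E" and xy: "x \<subseteq> y"
    and base: "P x"
    and step: "\<And>u s. u \<in> conf E \<Longrightarrow> x \<subseteq> u \<Longrightarrow> s \<notin> u \<Longrightarrow> insert s u \<in> conf E \<Longrightarrow> insert s u \<subseteq> y
      \<Longrightarrow> P u \<Longrightarrow> P (insert s u)"
  shows "P y"
proof -
  have fin: "finite y" using y confD by blast
  have "\<forall>u. card (y - u) = n \<longrightarrow> u \<in> conf E \<longrightarrow> x \<subseteq> u \<longrightarrow> u \<subseteq> y \<longrightarrow> P u \<longrightarrow> P y" for n
  proof (induction n)
    case 0 then show ?case using fin by (metis Diff_eq_empty_iff card_0_eq finite_Diff subset_antisym)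
  next
    case (Suc n)
    show ?case
    proof (intro allI impI)
      fix u assume u: "card (y - u) = Suc n" "u \<in> conf E" "x \<subseteq> u" "u \<subseteq> y" "P u"
      then have "u \<subset> y" by auto
      then obtain s where s: "s \<in> y - u" "insert s u \<in> conf E"
        using conf_extend[OF E u(2) y] by blast
      have "P (insert s u)" using step[OF u(2,3), of s] s u by blast
      moreover have "card (y - insert s u) = n"
        using u(1) s(1) fin by (metis Diff_insert card_Diff_singleton diff_Suc_1)
      ultimately show "P y" using Suc s u by (metis Diff_iff insert_subset subset_insertI2)
    qed
  qed
  then show ?thesis using x xy base by blast
qed

section \<open>Maps of event structures and their action on configurations\<close>

lemma es_mapD:
  assumes "es_map E F f"
  shows "\<And>e. e \<in> Ev E \<Longrightarrow> f e \<in> Ev F" "\<And>x. x \<in> conf E \<Longrightarrow> f ` x \<in> conf F"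
    "\<And>x. x \<in> conf E \<Longrightarrow> inj_on f x" "f \<in> extensional (Ev E)"
  using assms by (auto simp: es_map_def PiE_def)

text \<open>The image of \<open>dn E e'\<close> is a configuration, hence down-closed, and so
  contains \<open>f e\<close>. Injectivity on \<open>x\<close> identifies \<open>e\<close> with the
  preimage found below \<open>e'\<close>. Maps thus reflect causality locally, although they need
  not preserve it.\<close>

lemma es_map_reflect:
  assumes E: "is_es E" and f: "es_map E F f" and x: "x \<in> conf E" and e: "e \<in> x" "e' \<in> x"
    and le: "(f e, f e') \<in> Leq F"
  shows "(e, e') \<in> Leq E"
proof -
  have "e' \<in> Ev E" using x e confD(2)[OF x] by blast
  then have d: "dn E e' \<in> conf E" "e' \<in> dn E e'" using dn_conf[OF E] dn_self[OF E] by auto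
  then have "f ` dn E e' \<in> conf F" using es_mapD[OF f] by blast
  then have "f e \<in> f ` dn E e'" using le confD(4)[of "f ` dn E e'" F "f e'" "f e"] d by blast
  then obtain e'' where e'': "e'' \<in> dn E e'" "f e = f e''" by blast
  then have "e'' \<in> x" using dn_subset_conf[OF x e(2)] by blast
  then have "e = e''" using es_mapD(3)[OF f x] e'' e by (auto dest: inj_onD)
  then show ?thesis using e'' by (simp add: dn_def)
qed

text \<open>The configurations \<open>dn E e\<close> and \<open>dn E e - {e}\<close> differ by
  \<open>e\<close> alone, so their images isolate the value at \<open>e\<close>.\<close>

lemma es_map_eqI:
  assumes E: "is_es E" and f: "es_map E F f" and g: "es_map E F g"
    and eq: "\<And>x. x \<in> conf E \<Longrightarrow> f ` x = g ` x"
  shows "f = g"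
proof (rule extensionalityI[of _ "Ev E"])
  show "f \<in> extensional (Ev E)" "g \<in> extensional (Ev E)" using es_mapD(4)[OF f] es_mapD(4)[OF g] .
  fix e assume e: "e \<in> Ev E"
  let ?y = "dn E e - {e}"
  have y: "?y \<in> conf E"
    using conf_remove[OF E dn_conf[OF E e], of e] es_antisym[OF E] by (auto simp: dn_def)
  have d: "dn E e \<in> conf E" "insert e ?y = dn E e" using dn_conf[OF E e] dn_self[OF E e] by auto
  have "f e \<notin> f ` ?y" "g e \<notin> g ` ?y"
    using es_mapD(3)[OF f d(1)] es_mapD(3)[OF g d(1)] dn_self[OF E e]
    unfolding inj_on_def by blast+
  moreover have "insert (f e) (f ` ?y) = insert (g e) (g ` ?y)"
    using eq[OF d(1)] d(2) by (metis image_insert)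
  ultimately show "f e = g e" using eq[OF y] by auto
qed

text \<open>The label of \<open>e\<close> occurs in \<open>\<Phi> (dn E e)\<close>, and exactly once
  since labels are injective on configurations; this fixes the value at \<open>e\<close>.
  Monotonicity of \<open>\<Phi>\<close> places that value in \<open>\<Phi> x\<close> for every
  configuration \<open>x\<close> containing \<open>e\<close>, and comparing labels shows that
  nothing of \<open>\<Phi> x\<close> is missed.\<close>

lemma map_from_conf:
  assumes E: "is_es E" and F: "is_es F"
    and injE: "\<And>x. x \<in> conf E \<Longrightarrow> inj_on lE x" and injF: "\<And>x. x \<in> conf F \<Longrightarrow> inj_on lF x"
    and \<Phi>: "\<And>x. x \<in> conf E \<Longrightarrow> \<Phi> x \<in> conf F"
    and mono: "\<And>x y. x \<in> conf E \<Longrightarrow> y \<in> conf E \<Longrightarrow> x \<subseteq> y \<Longrightarrow> \<Phi> x \<subseteq> \<Phi> y"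
    and lab: "\<And>x. x \<in> conf E \<Longrightarrow> lF ` \<Phi> x = lE ` x"
  shows "\<exists>h. es_map E F h \<and> (\<forall>x\<in>conf E. h ` x = \<Phi> x) \<and> (\<forall>e\<in>Ev E. lF (h e) = lE e)"
proof -
  define h where "h = (\<lambda>e\<in>Ev E. SOME e'. e' \<in> \<Phi> (dn E e) \<and> lF e' = lE e)"
  have h: "h e \<in> \<Phi> (dn E e) \<and> lF (h e) = lE e" if e: "e \<in> Ev E" for e
  proof -
    have "lE e \<in> lF ` \<Phi> (dn E e)" using lab[OF dn_conf[OF E e]] dn_self[OF E e] by blast
    then have "\<exists>e'. e' \<in> \<Phi> (dn E e) \<and> lF e' = lE e" by (auto intro: sym)
    from someI_ex[OF this] e show ?thesis by (simp add: h_def)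
  qed
  have img: "h ` x = \<Phi> x" if x: "x \<in> conf E" for x
  proof -
    have sub: "h e \<in> \<Phi> x" if "e \<in> x" for e
    proof -
      have "e \<in> Ev E" using that confD(2)[OF x] by blast
      then show ?thesis using h[of e] mono[OF dn_conf[OF E, of e] x dn_subset_conf[OF x that]] by blast
    qed
    have "\<Phi> x \<subseteq> h ` x"
    proof
      fix e' assume e': "e' \<in> \<Phi> x"
      then obtain e where e: "e \<in> x" "lF e' = lE e" using lab[OF x] by (metis imageE imageI)
      then have "lF (h e) = lF e'" using h[of e] confD(2)[OF x] by auto
      then have "h e = e'" using injF[OF \<Phi>[OF x]] sub[OF e(1)] e' by (auto dest: inj_onD)
      then show "e' \<in> h ` x" using e by blast
    qed
    then show ?thesis using sub by blast
  qed
  have "es_map E F h"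
    unfolding es_map_def
  proof (intro conjI ballI)
    show "h \<in> Ev E \<rightarrow>\<^sub>E Ev F"
    proof (rule PiE_I)
      fix e assume "e \<in> Ev E"
      then show "h e \<in> Ev F" using h[of e] confD(2)[OF \<Phi>[OF dn_conf[OF E, of e]]] by blast
    qed (simp add: h_def)
    fix x assume x: "x \<in> conf E"
    show "h ` x \<in> conf F" using img \<Phi> x by simp
    show "inj_on h x"
      proof (rule inj_onI)
      fix a b assume ab: "a \<in> x" "b \<in> x" "h a = h b"
      then have "a \<in> Ev E" "b \<in> Ev E" using confD(2)[OF x] by auto
      then have "lE a = lE b" using h[of a] h[of b] ab(3) by metis
      then show "a = b" using ab injE[OF x] by (auto dest: inj_onD)
    qed
  qed
  then show ?thesis using img h by blast
qed

text \<open>The maps obtained from \<open>\<Phi>\<close> and \<open>\<Psi>\<close> compose to maps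
  that preserve labels and send \<open>dn E e\<close> onto itself; labels are injective there, so
  each composite fixes \<open>e\<close>.\<close>

lemma iso_from_conf:
  assumes E: "is_es E" and F: "is_es F"
    and injE: "\<And>x. x \<in> conf E \<Longrightarrow> inj_on lE x" and injF: "\<And>x. x \<in> conf F \<Longrightarrow> inj_on lF x"
    and \<Phi>: "\<And>x. x \<in> conf E \<Longrightarrow> \<Phi> x \<in> conf F" and \<Psi>: "\<And>y. y \<in> conf F \<Longrightarrow> \<Psi> y \<in> conf E"
    and mono\<Phi>: "\<And>x y. x \<in> conf E \<Longrightarrow> y \<in> conf E \<Longrightarrow> x \<subseteq> y \<Longrightarrow> \<Phi> x \<subseteq> \<Phi> y"
    and mono\<Psi>: "\<And>x y. x \<in> conf F \<Longrightarrow> y \<in> conf F \<Longrightarrow> x \<subseteq> y \<Longrightarrow> \<Psi> x \<subseteq> \<Psi> y"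
    and lab: "\<And>x. x \<in> conf E \<Longrightarrow> lF ` \<Phi> x = lE ` x"
    and inv1: "\<And>x. x \<in> conf E \<Longrightarrow> \<Psi> (\<Phi> x) = x" and inv2: "\<And>y. y \<in> conf F \<Longrightarrow> \<Phi> (\<Psi> y) = y"
  shows "\<exists>h k. es_map E F h \<and> es_map F E k \<and> (\<forall>x\<in>conf E. h ` x = \<Phi> x) \<and>
    (\<forall>y\<in>conf F. k ` y = \<Psi> y) \<and> (\<forall>e\<in>Ev E. lF (h e) = lE e) \<and> (\<forall>e\<in>Ev F. lE (k e) = lF e) \<and>
    (\<forall>e\<in>Ev E. k (h e) = e) \<and> (\<forall>e\<in>Ev F. h (k e) = e)"
proof -
  have lab': "lE ` \<Psi> y = lF ` y" if "y \<in> conf F" for y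
    using lab[OF \<Psi>[OF that]] inv2[OF that] by simp
  obtain h where h: "es_map E F h" "\<forall>x\<in>conf E. h ` x = \<Phi> x" "\<forall>e\<in>Ev E. lF (h e) = lE e"
    using map_from_conf[OF E F injE injF \<Phi> mono\<Phi> lab] by blast
  obtain k where k: "es_map F E k" "\<forall>x\<in>conf F. k ` x = \<Psi> x" "\<forall>e\<in>Ev F. lE (k e) = lF e"
    using map_from_conf[OF F E injF injE \<Psi> mono\<Psi> lab'] by blast
  have "k (h e) = e" if e: "e \<in> Ev E" for e
  proof -
    have d: "dn E e \<in> conf E" "e \<in> dn E e" using dn_conf[OF E e] dn_self[OF E e] by auto
    have "k ` h ` dn E e = dn E e" using h k inv1 \<Phi> d by simp
    then have "k (h e) \<in> dn E e" using d by blast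
    moreover have "lE (k (h e)) = lE e" using h k es_mapD(1) e by metis
    ultimately show ?thesis using injE d by (auto dest: inj_onD)
  qed
  moreover have "h (k e) = e" if e: "e \<in> Ev F" for e
  proof -
    have d: "dn F e \<in> conf F" "e \<in> dn F e" using dn_conf[OF F e] dn_self[OF F e] by auto
    have "h ` k ` dn F e = dn F e" using h k inv2 \<Psi> d by simp
    then have "h (k e) \<in> dn F e" using d by blast
    moreover have "lF (h (k e)) = lF e" using h k es_mapD(1) e by metis
    ultimately show ?thesis using injF d by (auto dest: inj_onD)
  qed
  ultimately show ?thesis using h k by blast
qed

text \<open>The standard way of identifying configurations of composites below: two that are
  comparable and carry the same labels.\<close>

lemma conf_eqI_lab:
  assumes "inj_on l y" "x \<subseteq> y" "l ` x = l ` y"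
  shows "x = y"
  using assms by (metis inj_on_image_eq_iff order_refl)

lemma es_map_id: "es_map E E (\<lambda>e\<in>Ev E. e)"
proof -
  have eq: "(\<lambda>e\<in>Ev E. e) e = e" if "x \<in> conf E" "e \<in> x" for x e
    using confD(2)[OF that(1)] that(2) by auto
  have "(\<lambda>e\<in>Ev E. e) ` x = x" "inj_on (\<lambda>e\<in>Ev E. e) x" if "x \<in> conf E" for x
    using eq[OF that] by (simp_all add: inj_on_def)
  then show ?thesis by (auto simp: es_map_def)
qed

lemma es_map_compose:
  assumes f: "es_map E F f" and g: "es_map F G g"
  shows "es_map E G (compose (Ev E) g f)" "\<And>x. x \<in> conf E \<Longrightarrow> compose (Ev E) g f ` x = g ` f ` x"
proof -
  show img: "compose (Ev E) g f ` x = g ` f ` x" if "x \<in> conf E" for x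
  proof -
    have "compose (Ev E) g f ` x = (\<lambda>e. g (f e)) ` x"
      using confD(2)[OF that] by (intro image_cong) (auto simp: compose_def)
    then show ?thesis by (simp add: image_image)
  qed
  show "es_map E G (compose (Ev E) g f)"
    unfolding es_map_def
  proof (intro conjI ballI)
    show "compose (Ev E) g f \<in> Ev E \<rightarrow>\<^sub>E Ev G"
      using es_mapD(1)[OF f] es_mapD(1)[OF g] by (auto simp: compose_def)
    fix x assume x: "x \<in> conf E"
    show "compose (Ev E) g f ` x \<in> conf G" using img es_mapD(2) f g x by metis
    have "inj_on (g \<circ> f) x" using es_mapD(2,3)[OF f x] es_mapD(3)[OF g] by (simp add: comp_inj_on)
    moreover have "compose (Ev E) g f e = (g \<circ> f) e" if "e \<in> x" for e
      using that confD(2)[OF x] by (auto simp: compose_def)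
    ultimately show "inj_on (compose (Ev E) g f) x" using inj_on_cong[of x "compose (Ev E) g f"] by blast
  qed
qed

section \<open>The pullback of event structures\<close>

lemma graph_step_mono: "r \<subseteq> q \<Longrightarrow> graph_step l l' r \<subseteq> graph_step l l' q"
  by (auto simp: graph_step_def)

lemma graph_le_mono: "r \<subseteq> q \<Longrightarrow> graph_le l l' r \<subseteq> graph_le l l' q"
  using rtrancl_mono[OF graph_step_mono[of r q l l']] by (auto simp: graph_le_def)

text \<open>The closure of the step relation is reflexive and transitive by construction; only a
  cycle can prevent it from being a partial order.\<close>

lemma secured_iff_antisym: "secured l l' q \<longleftrightarrow> antisym (graph_le l l' q)"
proof -
  have "trans (graph_le l l' q)" unfolding graph_le_def by (auto intro!: transI)
  then show ?thesis
    unfolding secured_def order_on_defs refl_on_def by (auto simp: graph_le_def)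
qed

lemma secured_subset: "secured l l' q \<Longrightarrow> r \<subseteq> q \<Longrightarrow> secured l l' r"
  unfolding secured_iff_antisym by (rule antisym_subset[OF graph_le_mono])

lemma secured_rankI:
  fixes \<rho> :: "'s \<times> 't \<Rightarrow> nat"
  assumes "\<And>p p'. (p, p') \<in> graph_step l l' q \<Longrightarrow> \<rho> p < \<rho> p'"
  shows "secured l l' q"
proof -
  have "p = p' \<or> \<rho> p < \<rho> p'" if "(p, p') \<in> (graph_step l l' q)\<^sup>*" for p p'
    using that by (induction rule: rtrancl_induct) (auto dest: assms)
  then show ?thesis
    unfolding secured_iff_antisym antisym_def graph_le_def by (metis IntD1 less_asym)
qed

definition gr :: "('s \<Rightarrow> 'a) \<Rightarrow> ('t \<Rightarrow> 'a) \<Rightarrow> 's set \<Rightarrow> 't set \<Rightarrow> ('s \<times> 't) set" where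
  "gr \<sigma> \<tau> x y = {(s, t). s \<in> x \<and> t \<in> y \<and> \<sigma> s = \<tau> t}"

text \<open>The prime generated by \<open>p\<close> inside \<open>q\<close>, that is, the candidate
  for an event of the pullback with greatest element \<open>p\<close>.\<close>

definition cl :: "('s, 'x) es_scheme \<Rightarrow> ('t, 'y) es_scheme \<Rightarrow> ('s \<times> 't) set \<Rightarrow> 's \<times> 't \<Rightarrow> ('s \<times> 't) set" where
  "cl S T q p = {p' \<in> q. (p', p) \<in> graph_le (Leq S) (Leq T) q}"

text \<open>For a secured bijection \<open>q\<close> this is the general form of a configuration of
  the pullback.\<close>

definition primes :: "('u ev, 'x) es_scheme \<Rightarrow> ('u ev, 'y) es_scheme \<Rightarrow>
    ('u ev \<Rightarrow> 'a) \<Rightarrow> ('u ev \<Rightarrow> 'a) \<Rightarrow> ('u ev \<times> 'u ev) set \<Rightarrow> 'u ev set" where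
  "primes S T \<sigma> \<tau> q = {e \<in> wedge_ev S T \<sigma> \<tau>. graph_of e \<subseteq> q}"

definition ptop :: "('u ev, 'x) es_scheme \<Rightarrow> ('u ev, 'y) es_scheme \<Rightarrow> 'u ev \<Rightarrow> 'u ev \<times> 'u ev" where
  "ptop S T e = (THE p. is_top S T (graph_of e) p)"

text \<open>The common target is represented by labels alone; injectivity of the labels on
  configurations is what makes the relation between matched configurations a bijection.\<close>

locale pull =
  fixes S :: "('u ev, 'x) es_scheme" and T :: "('u ev, 'y) es_scheme"
    and \<sigma> \<tau> :: "'u ev \<Rightarrow> 'a"
  assumes S: "is_es S" and T: "is_es T"
    and inj\<sigma>: "\<And>x. x \<in> conf S \<Longrightarrow> inj_on \<sigma> x" and inj\<tau>: "\<And>y. y \<in> conf T \<Longrightarrow> inj_on \<tau> y"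
begin

abbreviation "F \<equiv> sec_bij S T \<sigma> \<tau>"
abbreviation "W \<equiv> wedge S T \<sigma> \<tau>"
abbreviation "stp \<equiv> graph_step (Leq S) (Leq T)"

definition matched :: "'u ev set \<Rightarrow> 'u ev set \<Rightarrow> bool" where
  "matched x y \<longleftrightarrow> x \<in> conf S \<and> y \<in> conf T \<and> \<sigma> ` x = \<tau> ` y"

lemma gr_fst: "matched x y \<Longrightarrow> fst ` gr \<sigma> \<tau> x y = x"
  unfolding matched_def gr_def by (auto simp: image_iff) (metis imageE imageI)

lemma gr_snd: "matched x y \<Longrightarrow> snd ` gr \<sigma> \<tau> x y = y"
  unfolding matched_def gr_def by (auto simp: image_iff) (metis imageE imageI)

lemma gr_fstE: "matched x y \<Longrightarrow> s \<in> x \<Longrightarrow> \<exists>p\<in>gr \<sigma> \<tau> x y. s = fst p"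
  using gr_fst[of x y] by blast

lemma gr_sndE: "matched x y \<Longrightarrow> t \<in> y \<Longrightarrow> \<exists>p\<in>gr \<sigma> \<tau> x y. t = snd p"
  using gr_snd[of x y] by blast

lemma gr_inj:
  assumes "matched x y" "p \<in> gr \<sigma> \<tau> x y" "p' \<in> gr \<sigma> \<tau> x y"
  shows "fst p = fst p' \<Longrightarrow> p = p'" "snd p = snd p' \<Longrightarrow> p = p'" "\<sigma> (fst p) = \<sigma> (fst p') \<Longrightarrow> p = p'"
proof -
  have "inj_on \<sigma> x" "inj_on \<tau> y" using assms(1) inj\<sigma> inj\<tau> by (auto simp: matched_def)
  moreover obtain a b a' b' where "p = (a, b)" "p' = (a', b')" by (metis prod.exhaust)
  ultimately show "fst p = fst p' \<Longrightarrow> p = p'" "snd p = snd p' \<Longrightarrow> p = p'"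
    "\<sigma> (fst p) = \<sigma> (fst p') \<Longrightarrow> p = p'"
    using assms(2,3) inj_onD[of \<sigma> x a a'] inj_onD[of \<tau> y b b'] by (simp_all add: gr_def)
qed

lemma F_iff: "q \<in> F \<longleftrightarrow> (\<exists>x y. matched x y \<and> q = gr \<sigma> \<tau> x y \<and> secured (Leq S) (Leq T) q)"
  unfolding sec_bij_def matched_def gr_def by blast

lemma F_gr:
  assumes "q \<in> F"
  shows "matched (fst ` q) (snd ` q)" "q = gr \<sigma> \<tau> (fst ` q) (snd ` q)" "secured (Leq S) (Leq T) q"
  using assms gr_fst gr_snd unfolding F_iff by auto

lemma F_eqI: "q \<in> F \<Longrightarrow> q' \<in> F \<Longrightarrow> fst ` q = fst ` q' \<Longrightarrow> snd ` q = snd ` q' \<Longrightarrow> q = q'"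
  using F_gr(2) by metis

lemma F_finite: "q \<in> F \<Longrightarrow> finite q"
proof -
  assume q: "q \<in> F"
  have "finite (fst ` q \<times> snd ` q)"
    using F_gr(1)[OF q] confD(1)[of "fst ` q" S] confD(1)[of "snd ` q" T] unfolding matched_def by simp
  then show ?thesis by (rule finite_subset[rotated]) (auto intro: rev_image_eqI)
qed

lemma F_inj:
  assumes "q \<in> F" "p \<in> q" "p' \<in> q"
  shows "fst p = fst p' \<Longrightarrow> p = p'" "snd p = snd p' \<Longrightarrow> p = p'" "\<sigma> (fst p) = \<sigma> (fst p') \<Longrightarrow> p = p'"
  using gr_inj[OF F_gr(1)[OF assms(1)], of p p'] F_gr(2)[OF assms(1)] assms(2,3) by auto

lemma F_lab: "q \<in> F \<Longrightarrow> p \<in> q \<Longrightarrow> \<sigma> (fst p) = \<tau> (snd p)"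
proof -
  assume "q \<in> F" "p \<in> q"
  then have "p \<in> gr \<sigma> \<tau> (fst ` q) (snd ` q)" using F_gr(2) by metis
  then show ?thesis by (auto simp: gr_def)
qed

text \<open>A step comes from causality in one component, and that projection of \<open>r\<close> is
  a configuration, hence contains the corresponding component of \<open>p\<close>. Injectivity
  inside \<open>q\<close> then recovers the whole pair \<open>p\<close>.\<close>

lemma F_downclosed:
  assumes q: "q \<in> F" and r: "r \<in> F" and sub: "r \<subseteq> q" and st: "(p, p') \<in> stp q" and p': "p' \<in> r"
  shows "p \<in> r"
proof -
  have pq: "p \<in> q" using st by (auto simp: graph_step_def)
  have m: "matched (fst ` r) (snd ` r)" using F_gr(1)[OF r] .
  from st consider "(fst p, fst p') \<in> Leq S" | "(snd p, snd p') \<in> Leq T"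
    by (auto simp: graph_step_def strictly_def)
  then show ?thesis
  proof cases
    case 1
    have "fst p' \<in> fst ` r" using p' by blast
    then have "fst p \<in> fst ` r" using m confD(4)[of "fst ` r" S] 1 unfolding matched_def by blast
    then obtain p'' where "p'' \<in> r" "fst p = fst p''" by auto
    then show ?thesis using F_inj(1)[OF q pq, of p''] sub by auto
  next
    case 2
    have "snd p' \<in> snd ` r" using p' by blast
    then have "snd p \<in> snd ` r" using m confD(4)[of "snd ` r" T] 2 unfolding matched_def by blast
    then obtain p'' where "p'' \<in> r" "snd p = snd p''" by auto
    then show ?thesis using F_inj(2)[OF q pq, of p''] sub by auto
  qed
qed

text \<open>Converse of \<open>F_downclosed\<close>: within a secured bijection \<open>q\<close>,
  the members of \<open>F\<close> are the subsets closed under predecessors for the step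
  relation.\<close>

lemma F_subI:
  assumes q: "q \<in> F" and sub: "r \<subseteq> q" and dc: "\<And>p p'. (p, p') \<in> stp q \<Longrightarrow> p' \<in> r \<Longrightarrow> p \<in> r"
  shows "r \<in> F"
proof -
  have m: "matched (fst ` q) (snd ` q)" using F_gr(1)[OF q] .
  have fst_dc: "fst ` r \<in> conf S"
  proof (rule conf_sub[OF S, of "fst ` q"])
    show "fst ` q \<in> conf S" using m by (simp add: matched_def)
    show "fst ` r \<subseteq> fst ` q" using sub by blast
    fix s' s assume "s' \<in> fst ` r" and le: "(s, s') \<in> Leq S"
    then obtain p' where p': "p' \<in> r" "s' = fst p'" by blast
    then have "s' \<in> fst ` q" using sub by blast
    then have "s \<in> fst ` q" using m confD(4)[of "fst ` q" S] le unfolding matched_def by blast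
    then obtain p where p: "p \<in> q" "s = fst p" by blast
    show "s \<in> fst ` r"
    proof (cases "s = s'")
      case False
      then have "(p, p') \<in> stp q" using p p' sub le
        unfolding graph_step_def strictly_def by (cases p, cases p') auto
      then show ?thesis using dc p p' by blast
    qed (use p' in blast)
  qed
  have snd_dc: "snd ` r \<in> conf T"
  proof (rule conf_sub[OF T, of "snd ` q"])
    show "snd ` q \<in> conf T" using m by (simp add: matched_def)
    show "snd ` r \<subseteq> snd ` q" using sub by blast
    fix s' s assume "s' \<in> snd ` r" and le: "(s, s') \<in> Leq T"
    then obtain p' where p': "p' \<in> r" "s' = snd p'" by blast
    then have "s' \<in> snd ` q" using sub by blast
    then have "s \<in> snd ` q" using m confD(4)[of "snd ` q" T] le unfolding matched_def by blast
    then obtain p where p: "p \<in> q" "s = snd p" by blast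
    show "s \<in> snd ` r"
    proof (cases "s = s'")
      case False
      then have "(p, p') \<in> stp q" using p p' sub le
        unfolding graph_step_def strictly_def by (cases p, cases p') auto
      then show ?thesis using dc p p' by blast
    qed (use p' in blast)
  qed
  have lab: "\<sigma> (fst p) = \<tau> (snd p)" if "p \<in> r" for p
    using F_lab[OF q, of p] that sub by blast
  have "\<sigma> ` fst ` r = \<tau> ` snd ` r" unfolding image_image using lab by (intro image_cong) auto
  then have m': "matched (fst ` r) (snd ` r)" using fst_dc snd_dc by (simp add: matched_def)
  \<comment> \<open>A pair assembled from two pairs \<open>a\<close> and \<open>b\<close> of
    \<open>r\<close> has equal labels on both sides, and injectivity of labels on \<open>q\<close>
    forces \<open>a = b\<close>.\<close>
  have "gr \<sigma> \<tau> (fst ` r) (snd ` r) \<subseteq> r"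
  proof
    fix p assume "p \<in> gr \<sigma> \<tau> (fst ` r) (snd ` r)"
    then obtain a b where ab: "a \<in> r" "b \<in> r" "p = (fst a, snd b)" "\<sigma> (fst a) = \<tau> (snd b)"
      by (auto simp: gr_def)
    then have "\<sigma> (fst a) = \<sigma> (fst b)" using lab by simp
    then have "a = b" using F_inj(3)[OF q, of a b] ab sub by blast
    then show "p \<in> r" using ab by simp
  qed
  moreover have "r \<subseteq> gr \<sigma> \<tau> (fst ` r) (snd ` r)"
    using lab by (auto simp: gr_def intro: rev_image_eqI)
  ultimately show ?thesis
    using m' secured_subset[OF F_gr(3)[OF q] sub] unfolding F_iff by blast
qed

lemma F_empty: "{} \<in> F"
proof -
  have "matched {} {}" using conf_empty[OF S] conf_empty[OF T] by (simp add: matched_def)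
  moreover have "secured (Leq S) (Leq T) {}" by (rule secured_rankI) (auto simp: graph_step_def)
  ultimately show ?thesis unfolding F_iff by (intro exI[of _ "{}"]) (auto simp: gr_def)
qed

section \<open>Bounded unions and primes of secured bijections\<close>

lemma F_Union:
  assumes q: "q \<in> F" and R: "\<And>r. r \<in> R \<Longrightarrow> r \<in> F \<and> r \<subseteq> q"
  shows "\<Union> R \<in> F"
proof (rule F_subI[OF q])
  show "\<Union> R \<subseteq> q" using R by blast
  fix p p' assume "(p, p') \<in> stp q" "p' \<in> \<Union> R"
  then show "p \<in> \<Union> R" using F_downclosed[OF q] R by blast
qed

text \<open>The closure of \<open>p\<close> is closed under predecessors, so it belongs to
  \<open>F\<close> by \<open>F_subI\<close>. That \<open>p\<close> is its greatest element has to be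
  checked for the order generated inside the closure, which could a priori be smaller than the one
  inherited from \<open>q\<close>.\<close>

lemma cl_in_F:
  assumes q: "q \<in> F" and p: "p \<in> q"
  shows "cl S T q p \<in> F" "is_top S T (cl S T q p) p" "cl S T q p \<subseteq> q"
proof -
  show sub: "cl S T q p \<subseteq> q" by (auto simp: cl_def)
  show "cl S T q p \<in> F"
  proof (rule F_subI[OF q sub])
    fix a b assume ab: "(a, b) \<in> stp q" "b \<in> cl S T q p"
    then have "a \<in> q" "b \<in> q" by (auto simp: graph_step_def)
    then show "a \<in> cl S T q p"
      using ab by (auto simp: cl_def graph_le_def intro: converse_rtrancl_into_rtrancl)
  qed
  \<comment> \<open>A path in \<open>q\<close> that ends at \<open>p\<close> never leaves the
    closure of \<open>p\<close>, so it is also a path of the smaller step relation.\<close>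
  have path: "(a, p) \<in> (stp (cl S T q p))\<^sup>*" if "(a, p) \<in> (stp q)\<^sup>*" for a
    using that
  proof (induction rule: converse_rtrancl_induct)
    case (step y z)
    have "y \<in> q" "z \<in> q" using step by (auto simp: graph_step_def)
    moreover have "(y, p) \<in> (stp q)\<^sup>*" using step by (blast intro: converse_rtrancl_into_rtrancl)
    ultimately have "y \<in> cl S T q p" "z \<in> cl S T q p" using step p by (auto simp: cl_def graph_le_def)
    then have "(y, z) \<in> stp (cl S T q p)" using step(1) by (auto simp: graph_step_def)
    then show ?case using step(3) by (blast intro: converse_rtrancl_into_rtrancl)
  qed simp
  have "p \<in> cl S T q p" using p by (auto simp: cl_def graph_le_def)
  then show "is_top S T (cl S T q p) p"
    unfolding is_top_def using path by (auto simp: cl_def[of S T q] graph_le_def)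
qed

lemma top_unique: "q \<in> F \<Longrightarrow> is_top S T q p \<Longrightarrow> is_top S T q p' \<Longrightarrow> p = p'"
  using F_gr(3)[of q] unfolding secured_iff_antisym is_top_def by (meson antisymD)

lemma wedge_evD:
  assumes "e \<in> wedge_ev S T \<sigma> \<tau>"
  shows "graph_of e \<in> F" "is_top S T (graph_of e) (ptop S T e)" "ptop S T e \<in> graph_of e"
proof -
  obtain q p where e: "e = Graph q" "fset q \<in> F" "is_top S T (fset q) p"
    using assms by (auto simp: wedge_ev_def)
  then show "graph_of e \<in> F" by simp
  show t: "is_top S T (graph_of e) (ptop S T e)"
    unfolding ptop_def by (rule theI[of _ p]) (use e top_unique[OF e(2)] in auto)
  then show "ptop S T e \<in> graph_of e" by (simp add: is_top_def)
qed

lemma ptop_eqI: "e \<in> wedge_ev S T \<sigma> \<tau> \<Longrightarrow> is_top S T (graph_of e) p \<Longrightarrow> ptop S T e = p"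
  using wedge_evD[of e] top_unique by blast

lemma graph_of_inj: "e \<in> wedge_ev S T \<sigma> \<tau> \<Longrightarrow> e' \<in> wedge_ev S T \<sigma> \<tau> \<Longrightarrow> graph_of e = graph_of e' \<Longrightarrow> e = e'"
  by (auto simp: wedge_ev_def fset_inject)

text \<open>A prime inside \<open>q\<close> is closed under predecessors in \<open>q\<close>, so it
  contains every path of \<open>q\<close> that leads to its greatest element: it is determined by
  that element.\<close>

lemma graph_of_cl:
  assumes q: "q \<in> F" and e: "e \<in> wedge_ev S T \<sigma> \<tau>" "graph_of e \<subseteq> q"
  shows "graph_of e = cl S T q (ptop S T e)"
proof
  let ?p = "ptop S T e"
  have p: "?p \<in> graph_of e" "is_top S T (graph_of e) ?p" using wedge_evD[OF e(1)] by auto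
  show "graph_of e \<subseteq> cl S T q ?p"
    using p e(2) graph_le_mono[OF e(2), of "Leq S" "Leq T"] by (auto simp: is_top_def cl_def)
  have "a \<in> graph_of e" if "(a, ?p) \<in> (stp q)\<^sup>*" for a
    using that
  proof (induction rule: converse_rtrancl_induct)
    case (step y z) then show ?case using F_downclosed[OF q wedge_evD(1)[OF e(1)] e(2)] by blast
  qed (use p in simp)
  then show "cl S T q ?p \<subseteq> graph_of e" by (auto simp: cl_def graph_le_def)
qed

lemma prime_at:
  assumes q: "q \<in> F" and p: "p \<in> q"
  shows "\<exists>e\<in>primes S T \<sigma> \<tau> q. ptop S T e = p"
proof -
  let ?c = "cl S T q p"
  have c: "?c \<in> F" "is_top S T ?c p" "?c \<subseteq> q" using cl_in_F[OF q p] by auto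
  then have fin: "finite ?c" using F_finite by blast
  \<comment> \<open>Only finite sets fit under \<open>Graph\<close>; the closure is finite because
    every member of \<open>F\<close> is.\<close>
  define e where "e = Graph (Abs_fset ?c)"
  have g: "graph_of e = ?c" using fin by (simp add: e_def Abs_fset_inverse)
  then have "fset (Abs_fset ?c) \<in> F" "is_top S T (fset (Abs_fset ?c)) p" using c by (simp_all add: e_def)
  then have e: "e \<in> wedge_ev S T \<sigma> \<tau>" unfolding wedge_ev_def e_def by blast
  have "ptop S T e = p" using ptop_eqI[OF e] c g by simp
  then show ?thesis using e c g by (intro bexI[of _ e]) (simp_all add: primes_def)
qed

text \<open>Each pair of \<open>q\<close> is the greatest element of exactly one prime inside
  \<open>q\<close>: existence is \<open>prime_at\<close>, uniqueness is \<open>graph_of_cl\<close>.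
  Hence the configuration of primes has as many events as \<open>q\<close> has pairs.\<close>

lemma primes_top:
  assumes q: "q \<in> F"
  shows "ptop S T ` primes S T \<sigma> \<tau> q = q" "inj_on (ptop S T) (primes S T \<sigma> \<tau> q)"
    "\<Union> (graph_of ` primes S T \<sigma> \<tau> q) = q" "finite (primes S T \<sigma> \<tau> q)"
proof -
  have t: "ptop S T e \<in> q" if "e \<in> primes S T \<sigma> \<tau> q" for e
    using that wedge_evD(3)[of e] by (auto simp: primes_def)
  show im: "ptop S T ` primes S T \<sigma> \<tau> q = q"
  proof
    show "ptop S T ` primes S T \<sigma> \<tau> q \<subseteq> q" using t by blast
    show "q \<subseteq> ptop S T ` primes S T \<sigma> \<tau> q"
    proof
      fix p assume "p \<in> q"
      from prime_at[OF q this] show "p \<in> ptop S T ` primes S T \<sigma> \<tau> q" by blast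
    qed
  qed
  show inj: "inj_on (ptop S T) (primes S T \<sigma> \<tau> q)"
  proof (rule inj_onI)
    fix e e' assume "e \<in> primes S T \<sigma> \<tau> q" "e' \<in> primes S T \<sigma> \<tau> q" "ptop S T e = ptop S T e'"
    then show "e = e'" using graph_of_cl[OF q, of e] graph_of_cl[OF q, of e'] graph_of_inj[of e e']
      by (simp add: primes_def)
  qed
  show "\<Union> (graph_of ` primes S T \<sigma> \<tau> q) = q"
  proof
    show "\<Union> (graph_of ` primes S T \<sigma> \<tau> q) \<subseteq> q" by (auto simp: primes_def)
    show "q \<subseteq> \<Union> (graph_of ` primes S T \<sigma> \<tau> q)"
    proof
      fix p assume "p \<in> q"
      then obtain e where "e \<in> primes S T \<sigma> \<tau> q" "ptop S T e = p" using prime_at[OF q] by blast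
      then show "p \<in> \<Union> (graph_of ` primes S T \<sigma> \<tau> q)"
        using wedge_evD(3)[of e] by (auto simp: primes_def)
    qed
  qed
  show "finite (primes S T \<sigma> \<tau> q)" using finite_imageD[OF _ inj] im F_finite[OF q] by simp
qed

lemma primes_subset_iff: "q \<in> F \<Longrightarrow> q' \<in> F \<Longrightarrow> primes S T \<sigma> \<tau> q \<subseteq> primes S T \<sigma> \<tau> q' \<longleftrightarrow> q \<subseteq> q'"
proof
  assume F: "q \<in> F" "q' \<in> F"
  { assume "primes S T \<sigma> \<tau> q \<subseteq> primes S T \<sigma> \<tau> q'"
    then have "\<Union> (graph_of ` primes S T \<sigma> \<tau> q) \<subseteq> \<Union> (graph_of ` primes S T \<sigma> \<tau> q')" by blast
    then show "q \<subseteq> q'" using primes_top(3) F by simp }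
qed (auto simp: primes_def)

lemma primes_Con: "q \<in> F \<Longrightarrow> primes S T \<sigma> \<tau> q \<in> Con W"
  using primes_top(3,4)[of q] by (auto simp: wedge_def primes_def)

section \<open>The pullback as an event structure and its configurations\<close>

lemma W_simps:
  "Ev W = wedge_ev S T \<sigma> \<tau>"
  "(d, e) \<in> Leq W \<longleftrightarrow> d \<in> wedge_ev S T \<sigma> \<tau> \<and> e \<in> wedge_ev S T \<sigma> \<tau> \<and> graph_of d \<subseteq> graph_of e"
  "X \<in> Con W \<longleftrightarrow> finite X \<and> X \<subseteq> wedge_ev S T \<sigma> \<tau> \<and> \<Union> (graph_of ` X) \<in> F"
  by (auto simp: wedge_def)

lemma W_Con_sub:
  assumes "X \<in> Con W" "Y \<subseteq> X" shows "Y \<in> Con W"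
proof -
  have "\<Union> (graph_of ` Y) \<in> F"
  proof (rule F_Union)
    show "\<Union> (graph_of ` X) \<in> F" using assms by (simp add: W_simps)
    fix r assume "r \<in> graph_of ` Y"
    then show "r \<in> F \<and> r \<subseteq> \<Union> (graph_of ` X)" using assms wedge_evD(1) by (auto simp: W_simps)
  qed
  then show ?thesis using assms by (auto simp: W_simps intro: finite_subset)
qed

lemma wedge_es: "is_es W"
  unfolding is_es_def
proof (intro conjI ballI allI impI)
  show "partial_order_on (Ev W) (Leq W)"
    unfolding order_on_defs refl_on_def
  proof (intro conjI)
    show "trans (Leq W)" unfolding trans_def W_simps by blast
    show "antisym (Leq W)" unfolding antisym_def W_simps using graph_of_inj by (metis subset_antisym)
  qed (auto simp: W_simps)
  have "{} \<in> Con W" using F_empty by (auto simp: W_simps)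
  then show "Con W \<noteq> {}" by blast
  fix e assume e: "e \<in> Ev W"
  show "{e} \<in> Con W" using e wedge_evD(1)[of e] by (auto simp: W_simps)
  have "graph_of e \<in> F" using e wedge_evD(1)[of e] by (auto simp: W_simps)
  \<comment> \<open>The causes of \<open>e\<close> are the primes contained in its own graph, and
    these are in bijection with a finite set.\<close>
  then have "finite (primes S T \<sigma> \<tau> (graph_of e))" using primes_top(4) by blast
  then show "finite {e'. (e', e) \<in> Leq W}"
    by (rule finite_subset[rotated]) (auto simp: W_simps primes_def)
next
  fix X assume X: "X \<in> Con W"
  show "finite X" "X \<subseteq> Ev W" using X by (auto simp: W_simps)
  show "Y \<in> Con W" if "Y \<subseteq> X" for Y using W_Con_sub X that by blast
  fix e e' assume "e \<in> X" "(e', e) \<in> Leq W"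
  then have "\<Union> (graph_of ` (X \<union> {e'})) = \<Union> (graph_of ` X)" by (auto simp: W_simps)
  then show "X \<union> {e'} \<in> Con W" using X \<open>(e', e) \<in> Leq W\<close> by (auto simp: W_simps)
qed

lemma primes_conf: "q \<in> F \<Longrightarrow> primes S T \<sigma> \<tau> q \<in> conf W"
  unfolding conf_def using primes_Con[of q] primes_top(4)[of q]
  by (auto simp: W_simps primes_def)

text \<open>The bijection is the union of the graphs in \<open>z\<close>. The greatest element of
  any prime \<open>e\<close> inside the union lies in the graph of some \<open>d\<close> in
  \<open>z\<close>; then all of \<open>e\<close> lies below it in \<open>d\<close>, and down-closure
  of \<open>z\<close> gives \<open>e\<close>.\<close>

lemma conf_primes:
  assumes z: "z \<in> conf W"
  shows "\<exists>q\<in>F. z = primes S T \<sigma> \<tau> q"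
proof (rule bexI)
  let ?q = "\<Union> (graph_of ` z)"
  show q: "?q \<in> F" using confD(3)[OF z] by (simp add: W_simps)
  have zE: "z \<subseteq> wedge_ev S T \<sigma> \<tau>" using confD(2)[OF z] by (simp add: W_simps)
  show "z = primes S T \<sigma> \<tau> ?q"
  proof
    show "z \<subseteq> primes S T \<sigma> \<tau> ?q" using zE by (auto simp: primes_def)
    show "primes S T \<sigma> \<tau> ?q \<subseteq> z"
    proof
      fix e assume e: "e \<in> primes S T \<sigma> \<tau> ?q"
      then have e': "e \<in> wedge_ev S T \<sigma> \<tau>" "graph_of e \<subseteq> ?q" by (auto simp: primes_def)
      then obtain d where d: "d \<in> z" "ptop S T e \<in> graph_of d" using wedge_evD(3)[of e] by blast
      then have dE: "d \<in> wedge_ev S T \<sigma> \<tau>" "graph_of d \<subseteq> ?q" using zE by auto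
      have "a \<in> graph_of d" if "(a, ptop S T e) \<in> (stp ?q)\<^sup>*" for a
        using that
      proof (induction rule: converse_rtrancl_induct)
        case (step y z') then show ?case using F_downclosed[OF q wedge_evD(1)[OF dE(1)] dE(2)] by blast
      qed (use d in simp)
      then have "graph_of e \<subseteq> graph_of d"
        unfolding graph_of_cl[OF q e'] by (auto simp: cl_def graph_le_def)
      then show "e \<in> z" using confD(4)[OF z d(1), of e] e' dE by (simp add: W_simps)
    qed
  qed
qed

lemma proj_ptop: "e \<in> Ev W \<Longrightarrow> proj1 S T \<sigma> \<tau> e = fst (ptop S T e) \<and> proj2 S T \<sigma> \<tau> e = snd (ptop S T e)"
  by (simp add: proj1_def proj2_def ptop_def)

lemma wedge_commute: "e \<in> Ev W \<Longrightarrow> \<sigma> (proj1 S T \<sigma> \<tau> e) = \<tau> (proj2 S T \<sigma> \<tau> e)"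
proof -
  assume e: "e \<in> Ev W"
  then have "e \<in> wedge_ev S T \<sigma> \<tau>" by (simp add: W_simps)
  then show ?thesis using proj_ptop[OF e] F_lab wedge_evD(1,3) by metis
qed

lemma primes_sub_Ev: "primes S T \<sigma> \<tau> q \<subseteq> Ev W"
  by (auto simp: primes_def W_simps)

lemma proj_primes:
  assumes q: "q \<in> F"
  shows "proj1 S T \<sigma> \<tau> ` primes S T \<sigma> \<tau> q = fst ` q" "proj2 S T \<sigma> \<tau> ` primes S T \<sigma> \<tau> q = snd ` q"
proof -
  have "proj1 S T \<sigma> \<tau> ` primes S T \<sigma> \<tau> q = fst ` ptop S T ` primes S T \<sigma> \<tau> q"
    unfolding image_image using proj_ptop primes_sub_Ev by (intro image_cong) auto
  then show "proj1 S T \<sigma> \<tau> ` primes S T \<sigma> \<tau> q = fst ` q" using primes_top(1)[OF q] by simp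
  have "proj2 S T \<sigma> \<tau> ` primes S T \<sigma> \<tau> q = snd ` ptop S T ` primes S T \<sigma> \<tau> q"
    unfolding image_image using proj_ptop primes_sub_Ev by (intro image_cong) auto
  then show "proj2 S T \<sigma> \<tau> ` primes S T \<sigma> \<tau> q = snd ` q" using primes_top(1)[OF q] by simp
qed

lemma wedge_lab_inj:
  assumes z: "z \<in> conf W" shows "inj_on (\<lambda>e. \<sigma> (proj1 S T \<sigma> \<tau> e)) z"
proof -
  obtain q where q: "q \<in> F" "z = primes S T \<sigma> \<tau> q" using conf_primes[OF z] by blast
  show ?thesis
  proof (rule inj_onI)
    fix a b assume ab: "a \<in> z" "b \<in> z" "\<sigma> (proj1 S T \<sigma> \<tau> a) = \<sigma> (proj1 S T \<sigma> \<tau> b)"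
    then have E: "a \<in> Ev W" "b \<in> Ev W" using confD(2)[OF z] by auto
    have "ptop S T a \<in> q" "ptop S T b \<in> q" using primes_top(1)[OF q(1)] ab q(2) by blast+
    then have "ptop S T a = ptop S T b" using F_inj(3)[OF q(1)] ab(3) E proj_ptop by metis
    then show "a = b" using primes_top(2)[OF q(1)] ab q(2) by (auto dest: inj_onD)
  qed
qed

text \<open>A member of \<open>F\<close> is recovered from its two projections. This is the
  uniqueness part of the pullback property, in terms of configurations.\<close>

lemma conf_eq_proj:
  assumes "z \<in> conf W" "z' \<in> conf W" "proj1 S T \<sigma> \<tau> ` z = proj1 S T \<sigma> \<tau> ` z'"
    "proj2 S T \<sigma> \<tau> ` z = proj2 S T \<sigma> \<tau> ` z'"
  shows "z = z'"
proof -
  obtain q q' where "q \<in> F" "z = primes S T \<sigma> \<tau> q" "q' \<in> F" "z' = primes S T \<sigma> \<tau> q'"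
    using conf_primes assms by metis
  then show ?thesis using F_eqI[of q q'] assms proj_primes by auto
qed

text \<open>Security as the existence of a schedule. The rank lives on labels rather than on pairs,
  so that both components are measured by the same function and no mention of the graph
  remains.\<close>

lemma F_matched_iff_rank:
  assumes m: "matched x y"
  shows "gr \<sigma> \<tau> x y \<in> F \<longleftrightarrow> (\<exists>\<rho> :: 'a \<Rightarrow> nat.
     (\<forall>s\<in>x. \<forall>s'\<in>x. (s, s') \<in> Leq S \<longrightarrow> s \<noteq> s' \<longrightarrow> \<rho> (\<sigma> s) < \<rho> (\<sigma> s')) \<and>
     (\<forall>t\<in>y. \<forall>t'\<in>y. (t, t') \<in> Leq T \<longrightarrow> t \<noteq> t' \<longrightarrow> \<rho> (\<tau> t) < \<rho> (\<tau> t')))"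
    (is "?L \<longleftrightarrow> ?R")
proof
  let ?q = "gr \<sigma> \<tau> x y"
  assume q: ?L
  \<comment> \<open>\<open>at l\<close> is the only pair labelled \<open>l\<close>. The rank of
    \<open>l\<close> is the size of the closure of that pair, which grows strictly along steps
    because the order on the graph is antisymmetric.\<close>
  define at where "at l = (THE p. p \<in> ?q \<and> \<sigma> (fst p) = l)" for l
  define \<rho> where "\<rho> l = card (cl S T ?q (at l))" for l
  have at: "at (\<sigma> (fst p)) = p" if "p \<in> ?q" for p
    unfolding at_def using that gr_inj(3)[OF m] by (intro the_equality) auto
  have less: "\<rho> (\<sigma> (fst p)) < \<rho> (\<sigma> (fst p'))" if "(p, p') \<in> stp ?q" "p \<noteq> p'" for p p'
  proof -
    have pq: "p \<in> ?q" "p' \<in> ?q" using that by (auto simp: graph_step_def)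
    have "cl S T ?q p \<subseteq> cl S T ?q p'"
      using that pq by (auto simp: cl_def graph_le_def intro: rtrancl_into_rtrancl)
    moreover have "p' \<in> cl S T ?q p'" using pq by (auto simp: cl_def graph_le_def)
    moreover have "p' \<notin> cl S T ?q p"
    proof
      assume "p' \<in> cl S T ?q p"
      moreover have "(p, p') \<in> graph_le (Leq S) (Leq T) ?q" using that pq by (auto simp: graph_le_def)
      ultimately show False
        using F_gr(3)[OF q] that(2) unfolding secured_iff_antisym cl_def by (auto dest: antisymD)
    qed
    moreover have "finite (cl S T ?q p')" using F_finite[OF q] by (auto simp: cl_def)
    ultimately have "card (cl S T ?q p) < card (cl S T ?q p')" by (intro psubset_card_mono) auto
    then show ?thesis using at pq by (simp add: \<rho>_def)
  qed
  show ?R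
  proof (intro exI[of _ \<rho>] conjI ballI impI)
    fix s s' assume s: "s \<in> x" "s' \<in> x" "(s, s') \<in> Leq S" "s \<noteq> s'"
    then obtain p p' where p: "p \<in> ?q" "p' \<in> ?q" "s = fst p" "s' = fst p'"
      using gr_fstE[OF m s(1)] gr_fstE[OF m s(2)] by blast
    then have "(p, p') \<in> stp ?q" using s by (cases p, cases p') (auto simp: graph_step_def strictly_def)
    then show "\<rho> (\<sigma> s) < \<rho> (\<sigma> s')" using less p s by blast
  next
    fix t t' assume t: "t \<in> y" "t' \<in> y" "(t, t') \<in> Leq T" "t \<noteq> t'"
    then obtain p p' where p: "p \<in> ?q" "p' \<in> ?q" "t = snd p" "t' = snd p'"
      using gr_sndE[OF m t(1)] gr_sndE[OF m t(2)] by blast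
    then have "(p, p') \<in> stp ?q" using t by (cases p, cases p') (auto simp: graph_step_def strictly_def)
    then have "\<rho> (\<sigma> (fst p)) < \<rho> (\<sigma> (fst p'))" using less p t by blast
    then show "\<rho> (\<tau> t) < \<rho> (\<tau> t')" using F_lab[OF q] p by metis
  qed
next
  let ?q = "gr \<sigma> \<tau> x y"
  assume ?R
  then obtain \<rho> :: "'a \<Rightarrow> nat" where
    \<rho>1: "\<And>s s'. s \<in> x \<Longrightarrow> s' \<in> x \<Longrightarrow> (s, s') \<in> Leq S \<Longrightarrow> s \<noteq> s' \<Longrightarrow> \<rho> (\<sigma> s) < \<rho> (\<sigma> s')" and
    \<rho>2: "\<And>t t'. t \<in> y \<Longrightarrow> t' \<in> y \<Longrightarrow> (t, t') \<in> Leq T \<Longrightarrow> t \<noteq> t' \<Longrightarrow> \<rho> (\<tau> t) < \<rho> (\<tau> t')"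
    by blast
  have "secured (Leq S) (Leq T) ?q"
  proof (rule secured_rankI[of _ _ _ "\<lambda>p. \<rho> (\<sigma> (fst p))"])
    fix p p' assume "(p, p') \<in> stp ?q"
    then show "\<rho> (\<sigma> (fst p)) < \<rho> (\<sigma> (fst p'))"
      using \<rho>1[of "fst p" "fst p'"] \<rho>2[of "snd p" "snd p'"]
      by (cases p, cases p') (auto simp: graph_step_def strictly_def gr_def)
  qed
  then show ?L using m unfolding F_iff by blast
qed

end

section \<open>Restriction, parallel composition and duality\<close>

definition dcl :: "('e, 'x) es_scheme \<Rightarrow> 'e set \<Rightarrow> 'e set" where
  "dcl E X = {e'. \<exists>e\<in>X. (e', e) \<in> Leq E}"

lemma restr_simps [simp]:
  "Ev (restr_es E V) = Ev E \<inter> V"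
  "Leq (restr_es E V) = Leq E \<inter> V \<times> V"
  "Con (restr_es E V) = {X \<in> Con E. X \<subseteq> V}"
  by (simp_all add: restr_es_def)

lemma restr_es: assumes E: "is_es E" shows "is_es (restr_es E V)"
  unfolding is_es_def
proof (intro conjI ballI allI impI)
  show "partial_order_on (Ev (restr_es E V)) (Leq (restr_es E V))"
    using es_partial_order[OF E] unfolding order_on_defs refl_on_def
    by (auto intro!: transI antisymI dest: transD antisymD)
  have "{} \<in> Con E" using confD(3)[OF conf_empty[OF E]] .
  then show "Con (restr_es E V) \<noteq> {}" by auto
  fix e assume e: "e \<in> Ev (restr_es E V)"
  show "finite {e'. (e', e) \<in> Leq (restr_es E V)}"
    using es_finite_dn[OF E, of e] by (rule finite_subset[rotated]) (auto simp: dn_def)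
  show "{e} \<in> Con (restr_es E V)" using e E by (auto simp: is_es_def)
next
  fix X assume X: "X \<in> Con (restr_es E V)"
  show "finite X" "X \<subseteq> Ev (restr_es E V)" using X E by (auto simp: is_es_def)
  show "Y \<in> Con (restr_es E V)" if "Y \<subseteq> X" for Y using X that Con_subset[OF E, of X Y] by auto
  fix e e' assume "e \<in> X" "(e', e) \<in> Leq (restr_es E V)"
  then show "X \<union> {e'} \<in> Con (restr_es E V)" using X Con_insert_below[OF E, of X e e'] by auto
qed

lemma restr_conf_Int: "z \<in> conf E \<Longrightarrow> is_es E \<Longrightarrow> z \<inter> V \<in> conf (restr_es E V)"
  unfolding conf_def by (auto intro: Con_subset)

text \<open>The down-closure of \<open>z\<close> is the least configuration with visible part
  \<open>z\<close>. All the least witnesses for configurations of composites originate here.\<close>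

lemma restr_conf_dcl:
  assumes E: "is_es E" and z: "z \<in> conf (restr_es E V)"
  shows "dcl E z \<in> conf E" "dcl E z \<inter> V = z" "z \<subseteq> dcl E z"
    "\<And>w. w \<in> conf E \<Longrightarrow> z \<subseteq> w \<Longrightarrow> dcl E z \<subseteq> w"
proof -
  have zC: "z \<in> Con E" "z \<subseteq> V" "z \<subseteq> Ev E" using confD(2,3)[OF z] by auto
  show "dcl E z \<in> conf E" unfolding dcl_def by (rule Con_down_closure[OF E zC(1)])
  show s: "z \<subseteq> dcl E z" using es_refl[OF E] zC(3) by (auto simp: dcl_def)
  have "e \<in> z" if e: "e \<in> dcl E z" "e \<in> V" for e
  proof -
    obtain e' where "e' \<in> z" "(e, e') \<in> Leq E" using e by (auto simp: dcl_def)
    then show ?thesis using confD(4)[OF z, of e' e] e zC by auto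
  qed
  then show "dcl E z \<inter> V = z" using s zC by blast
  show "dcl E z \<subseteq> w" if w: "w \<in> conf E" "z \<subseteq> w" for w
    using w(2) confD(4)[OF w(1)] by (auto simp: dcl_def)
qed

lemma ev_split: "X \<subseteq> range In0 \<union> range In1 \<Longrightarrow> X = In0 ` (In0 -` X) \<union> In1 ` (In1 -` X)"
  by auto

text \<open>Subsets of a parallel composition are kept in the form \<open>In0\<close> (In0
  -\<open>X) \<union> In1\<close> (In1 -\<open>X)\<close>; the deleted rule would rewrite the
  summands into intersections with ranges.\<close>

declare image_vimage_eq [simp del]

lemma par_simps:
  "Ev (par E F) = In0 ` Ev E \<union> In1 ` Ev F"
  "(a, b) \<in> Leq (par E F) \<longleftrightarrow> (\<exists>c d. a = In0 c \<and> b = In0 d \<and> (c, d) \<in> Leq E) \<or>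
     (\<exists>c d. a = In1 c \<and> b = In1 d \<and> (c, d) \<in> Leq F)"
  "X \<in> Con (par E F) \<longleftrightarrow> X \<subseteq> range In0 \<union> range In1 \<and> In0 -` X \<in> Con E \<and> In1 -` X \<in> Con F"
proof -
  show "Ev (par E F) = In0 ` Ev E \<union> In1 ` Ev F"
    "(a, b) \<in> Leq (par E F) \<longleftrightarrow> (\<exists>c d. a = In0 c \<and> b = In0 d \<and> (c, d) \<in> Leq E) \<or>
     (\<exists>c d. a = In1 c \<and> b = In1 d \<and> (c, d) \<in> Leq F)"
    by (auto simp: par_def map_prod_def)
  have v: "In0 -` (In0 ` A \<union> In1 ` B) = A" "In1 -` (In0 ` A \<union> In1 ` B) = B" for A B :: "'a ev set" by auto
  show "X \<in> Con (par E F) \<longleftrightarrow> X \<subseteq> range In0 \<union> range In1 \<and> In0 -` X \<in> Con E \<and> In1 -` X \<in> Con F"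
  proof
    assume "X \<in> Con (par E F)"
    then obtain A B where "X = In0 ` A \<union> In1 ` B" "A \<in> Con E" "B \<in> Con F" by (auto simp: par_def)
    then show "X \<subseteq> range In0 \<union> range In1 \<and> In0 -` X \<in> Con E \<and> In1 -` X \<in> Con F"
      using v[of A B] by auto
  next
    assume X: "X \<subseteq> range In0 \<union> range In1 \<and> In0 -` X \<in> Con E \<and> In1 -` X \<in> Con F"
    then have "X = In0 ` (In0 -` X) \<union> In1 ` (In1 -` X)" using ev_split by blast
    then show "X \<in> Con (par E F)" using X unfolding par_def by auto
  qed
qed

lemma vimage_In [simp]:
  "In0 -` (In0 ` A) = A" "In1 -` (In1 ` A) = A" "In0 -` (In1 ` A) = {}" "In1 -` (In0 ` A) = {}"
  by auto

lemma par_es: assumes E: "is_es E" and F: "is_es F" shows "is_es (par E F)"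
  unfolding is_es_def
proof (intro conjI ballI allI impI)
  show "partial_order_on (Ev (par E F)) (Leq (par E F))"
    unfolding order_on_defs refl_on_def
  proof (intro conjI)
    show "trans (Leq (par E F))"
      unfolding trans_def par_simps using es_trans[OF E] es_trans[OF F] by blast
    show "antisym (Leq (par E F))"
      unfolding antisym_def par_simps using es_antisym[OF E] es_antisym[OF F] by blast
    show "Leq (par E F) \<subseteq> Ev (par E F) \<times> Ev (par E F)"
      using es_LeqD[OF E] es_LeqD[OF F] by (auto simp: par_simps)
    show "\<forall>x\<in>Ev (par E F). (x, x) \<in> Leq (par E F)"
      using es_refl[OF E] es_refl[OF F] by (auto simp: par_simps)
  qed
  have "{} \<in> Con E" "{} \<in> Con F" using confD(3)[OF conf_empty[OF E]] confD(3)[OF conf_empty[OF F]] .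
  then have "{} \<in> Con (par E F)" by (simp add: par_simps)
  then show "Con (par E F) \<noteq> {}" by blast
  have s0: "In0 -` {In0 a} = {a}" "In1 -` {In0 a} = {}" "In0 -` {In1 a} = {}" "In1 -` {In1 a} = {a}"
    for a :: "'a ev" by auto
  fix e assume e: "e \<in> Ev (par E F)"
  show "{e} \<in> Con (par E F)"
  proof -
    have c: "{a} \<in> Con E" if "a \<in> Ev E" for a using E that by (simp add: is_es_def)
    have c': "{a} \<in> Con F" if "a \<in> Ev F" for a using F that by (simp add: is_es_def)
    from e consider a where "e = In0 a" "a \<in> Ev E" | a where "e = In1 a" "a \<in> Ev F"
      by (auto simp: par_simps)
    then show ?thesis
      by cases (simp_all add: par_simps s0 c c' \<open>{} \<in> Con E\<close> \<open>{} \<in> Con F\<close>)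
  qed
  have "finite (In0 ` dn E a \<union> In1 ` dn F a)" for a using es_finite_dn[OF E] es_finite_dn[OF F] by blast
  then show "finite {e'. (e', e) \<in> Leq (par E F)}"
    using e by (auto simp: par_simps dn_def setcompr_eq_image intro: finite_subset)
next
  fix X assume X: "X \<in> Con (par E F)"
  have X': "X = In0 ` (In0 -` X) \<union> In1 ` (In1 -` X)" "In0 -` X \<in> Con E" "In1 -` X \<in> Con F"
    "X \<subseteq> range In0 \<union> range In1"
    using X ev_split[of X] by (auto simp: par_simps)
  have "finite (In0 -` X)" "In0 -` X \<subseteq> Ev E" "finite (In1 -` X)" "In1 -` X \<subseteq> Ev F"
    using X' E F by (simp_all add: is_es_def)
  then have "finite (In0 ` (In0 -` X) \<union> In1 ` (In1 -` X))"
    "In0 ` (In0 -` X) \<union> In1 ` (In1 -` X) \<subseteq> Ev (par E F)"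
    by (auto simp: par_simps)
  then show "finite X" "X \<subseteq> Ev (par E F)" using X'(1) by simp_all
  show "Y \<in> Con (par E F)" if "Y \<subseteq> X" for Y
    using X that Con_subset[OF E, of "In0 -` X" "In0 -` Y"] Con_subset[OF F, of "In1 -` X" "In1 -` Y"]
    by (auto simp: par_simps)
  fix e e' assume e: "e \<in> X" "(e', e) \<in> Leq (par E F)"
  have v: "In0 -` insert (In0 c) X = insert c (In0 -` X)" "In1 -` insert (In1 c) X = insert c (In1 -` X)"
    "In1 -` insert (In0 c) X = In1 -` X" "In0 -` insert (In1 c) X = In0 -` X" for c by auto
  from e(2) consider c d where "e' = In0 c" "e = In0 d" "(c, d) \<in> Leq E"
    | c d where "e' = In1 c" "e = In1 d" "(c, d) \<in> Leq F" by (auto simp: par_simps)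
  then show "X \<union> {e'} \<in> Con (par E F)"
  proof cases
    case 1
    then have "insert c (In0 -` X) \<in> Con E" using Con_insert_below[OF E X'(2), of d c] e by simp
    then show ?thesis using 1 X' by (simp add: par_simps v)
  next
    case 2
    then have "insert c (In1 -` X) \<in> Con F" using Con_insert_below[OF F X'(3), of d c] e by simp
    then show ?thesis using 2 X' by (simp add: par_simps v)
  qed
qed

lemma conf_par:
  "L \<in> conf (par E F) \<longleftrightarrow> L \<subseteq> range In0 \<union> range In1 \<and> In0 -` L \<in> conf E \<and> In1 -` L \<in> conf F"
proof
  assume L: "L \<in> conf (par E F)"
  note l = confD[OF L]
  have sp: "L \<subseteq> range In0 \<union> range In1" using l(2) by (auto simp: par_simps)
  have "finite (In0 -` L)" "finite (In1 -` L)"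
    using l(1) by (auto intro!: finite_vimageI injI)
  moreover have "In0 -` L \<subseteq> Ev E" "In1 -` L \<subseteq> Ev F" using l(2) by (auto simp: par_simps)
  moreover have "In0 -` L \<in> Con E" "In1 -` L \<in> Con F" using l(3) by (auto simp: par_simps)
  moreover have "e' \<in> In0 -` L" if "e \<in> In0 -` L" "(e', e) \<in> Leq E" for e e'
    using l(4)[of "In0 e" "In0 e'"] that by (simp add: par_simps)
  moreover have "e' \<in> In1 -` L" if "e \<in> In1 -` L" "(e', e) \<in> Leq F" for e e'
    using l(4)[of "In1 e" "In1 e'"] that by (simp add: par_simps)
  ultimately show "L \<subseteq> range In0 \<union> range In1 \<and> In0 -` L \<in> conf E \<and> In1 -` L \<in> conf F"
    using sp unfolding conf_def by blast
next
  assume R: "L \<subseteq> range In0 \<union> range In1 \<and> In0 -` L \<in> conf E \<and> In1 -` L \<in> conf F"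
  then have l: "In0 -` L \<in> conf E" "In1 -` L \<in> conf F" by auto
  have sp: "L = In0 ` (In0 -` L) \<union> In1 ` (In1 -` L)" using R ev_split by blast
  have "finite (In0 ` (In0 -` L) \<union> In1 ` (In1 -` L))"
    "In0 ` (In0 -` L) \<union> In1 ` (In1 -` L) \<subseteq> Ev (par E F)"
    using confD(1,2)[OF l(1)] confD(1,2)[OF l(2)] by (auto simp: par_simps)
  then have "finite L" "L \<subseteq> Ev (par E F)" using sp by simp_all
  moreover have "L \<in> Con (par E F)" using R confD(3)[OF l(1)] confD(3)[OF l(2)] by (auto simp: par_simps)
  moreover have "e' \<in> L" if "e \<in> L" "(e', e) \<in> Leq (par E F)" for e e'
  proof -
    from that(2) consider c d where "e' = In0 c" "e = In0 d" "(c, d) \<in> Leq E"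
      | c d where "e' = In1 c" "e = In1 d" "(c, d) \<in> Leq F" by (auto simp: par_simps)
    then show ?thesis
    proof cases
      case 1 then show ?thesis using confD(4)[OF l(1), of d c] that(1) by simp
    next
      case 2 then show ?thesis using confD(4)[OF l(2), of d c] that(1) by simp
    qed
  qed
  ultimately show "L \<in> conf (par E F)" unfolding conf_def by blast
qed

lemma par_game_simps [simp]:
  "Ev (A \<parallel> B) = Ev (par A B)" "Leq (A \<parallel> B) = Leq (par A B)" "Con (A \<parallel> B) = Con (par A B)"
  "conf (A \<parallel> B) = conf (par A B)" "is_es (A \<parallel> B) = is_es (par A B)"
  by (simp_all add: par_game_def conf_def is_es_def)

lemma dual_simps [simp]:
  "Ev (dual A) = Ev A" "Leq (dual A) = Leq A" "Con (dual A) = Con A" "conf (dual A) = conf A"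
  "is_es (dual A) = is_es A"
  by (simp_all add: dual_def conf_def is_es_def)

lemma par_dual [simp]: "par (dual A) B = par A B" "par A (dual C) = par A C"
  by (simp_all add: dual_def par_def)

lemma par_pol [simp]:
  "a \<in> Ev A \<Longrightarrow> pol (A \<parallel> B) (In0 a) = pol A a" "b \<in> Ev B \<Longrightarrow> pol (A \<parallel> B) (In1 b) = pol B b"
  by (auto simp: par_game_def par_simps copair_def)

lemma dual_pol [simp]: "a \<in> Ev A \<Longrightarrow> pol (dual A) a = opp (pol A a)"
  by (simp add: dual_def)

lemma opp_simps [simp]: "opp p = Pos \<longleftrightarrow> p = Neg" "opp p = Neg \<longleftrightarrow> p = Pos" "opp (opp p) = p"
  by (cases p; simp)+

lemma esp_dual: "is_esp A \<Longrightarrow> is_esp (dual A)"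
proof -
  have "pol (dual A) \<in> extensional (Ev A)" by (simp add: dual_def)
  then show "is_esp A \<Longrightarrow> is_esp (dual A)" by (simp add: is_esp_def)
qed

lemma esp_par: "is_esp A \<Longrightarrow> is_esp B \<Longrightarrow> is_esp (A \<parallel> B)"
  by (simp add: is_esp_def par_es) (simp add: par_game_def)

section \<open>Pre-strategies\<close>

text \<open>The two end games are required to be well formed separately, since copycats are taken on
  them and they become end games of composites.\<close>

definition prestrategy :: "'u prestrat \<Rightarrow> bool" where
  "prestrategy \<sigma> \<longleftrightarrow> is_esp (src \<sigma>) \<and> is_esp (trg \<sigma>) \<and>
     is_prestrategy_on (dual (src \<sigma>) \<parallel> trg \<sigma>) (st \<sigma>) (lab \<sigma>)"

lemma prestrategyD:
  assumes "prestrategy \<sigma>"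
  shows "is_es (src \<sigma>)" "is_es (trg \<sigma>)" "is_es (st \<sigma>)" "is_esp (src \<sigma>)" "is_esp (trg \<sigma>)" "is_esp (st \<sigma>)"
    "es_map (st \<sigma>) (dual (src \<sigma>) \<parallel> trg \<sigma>) (lab \<sigma>)"
    "\<And>s. s \<in> Ev (st \<sigma>) \<Longrightarrow> pol (dual (src \<sigma>) \<parallel> trg \<sigma>) (lab \<sigma> s) = pol (st \<sigma>) s"
  using assms by (auto simp: prestrategy_def is_prestrategy_on_def is_esp_def esp_map_def)

lemma prestrategy_conf:
  assumes "prestrategy \<sigma>" "x \<in> conf (st \<sigma>)"
  shows "inj_on (lab \<sigma>) x" "In0 -` lab \<sigma> ` x \<in> conf (src \<sigma>)" "In1 -` lab \<sigma> ` x \<in> conf (trg \<sigma>)"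
    "lab \<sigma> ` x \<subseteq> range In0 \<union> range In1"
  using es_mapD(2,3)[OF prestrategyD(7)[OF assms(1)] assms(2)] by (auto simp: conf_par)

lemma prestrategy_reflect:
  assumes "prestrategy \<sigma>" "x \<in> conf (st \<sigma>)" "s \<in> x" "s' \<in> x"
    "(lab \<sigma> s, lab \<sigma> s') \<in> Leq (par (src \<sigma>) (trg \<sigma>))"
  shows "(s, s') \<in> Leq (st \<sigma>)"
  using es_map_reflect[OF prestrategyD(3)[OF assms(1)] prestrategyD(7)[OF assms(1)] assms(2,3,4)] assms(5)
  by simp

section \<open>Configurations of the composition of pre-strategies\<close>

text \<open>The location in \<open>A \<parallel> (B \<parallel> C)\<close> of a label of
  \<open>\<sigma>\<close>; for labels of \<open>\<tau>\<close> the corresponding embedding is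
  \<open>In1\<close>.\<close>

definition lloc :: "'u ev \<Rightarrow> 'u ev" where
  "lloc = copair In0 (In1 \<circ> In0)"

lemma lloc_simps [simp]: "lloc (In0 a) = In0 a" "lloc (In1 a) = In1 (In0 a)"
  by (simp_all add: lloc_def copair_def)

definition match2 :: "'u prestrat \<Rightarrow> 'u prestrat \<Rightarrow> 'u ev set \<Rightarrow> 'u ev set \<Rightarrow> bool" where
  "match2 \<tau> \<sigma> x y \<longleftrightarrow> x \<in> conf (st \<sigma>) \<and> y \<in> conf (st \<tau>) \<and> In1 -` lab \<sigma> ` x = In0 -` lab \<tau> ` y"

text \<open>
  A schedule of the events over \<open>A \<parallel> (B \<parallel> C)\<close>; it exists if and only if the induced bijection is secured.
\<close>

definition rank2 :: "'u prestrat \<Rightarrow> 'u prestrat \<Rightarrow> 'u ev set \<Rightarrow> 'u ev set \<Rightarrow> ('u ev \<Rightarrow> nat) \<Rightarrow> bool" where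
  "rank2 \<tau> \<sigma> x y \<rho> \<longleftrightarrow>
     (\<forall>s\<in>x. \<forall>s'\<in>x. (s, s') \<in> Leq (st \<sigma>) \<longrightarrow> s \<noteq> s' \<longrightarrow> \<rho> (lloc (lab \<sigma> s)) < \<rho> (lloc (lab \<sigma> s'))) \<and>
     (\<forall>t\<in>y. \<forall>t'\<in>y. (t, t') \<in> Leq (st \<tau>) \<longrightarrow> t \<noteq> t' \<longrightarrow> \<rho> (In1 (lab \<tau> t)) < \<rho> (In1 (lab \<tau> t')))"

definition sync2 :: "'u prestrat \<Rightarrow> 'u prestrat \<Rightarrow> 'u ev set \<Rightarrow> 'u ev set \<Rightarrow> bool" where
  "sync2 \<tau> \<sigma> x y \<longleftrightarrow> match2 \<tau> \<sigma> x y \<and> (\<exists>\<rho>. rank2 \<tau> \<sigma> x y \<rho>)"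

text \<open>A pair of configurations of the strategies determines a pair for the pullback: the idle
  copy of \<open>C\<close> beside \<open>\<sigma>\<close> must carry the labels that
  \<open>\<tau>\<close> has there, and dually for \<open>A\<close> in \<open>rpart\<close>.\<close>

definition lpart :: "'u prestrat \<Rightarrow> 'u ev set \<Rightarrow> 'u ev set \<Rightarrow> 'u ev set" where
  "lpart \<tau> x y = In0 ` x \<union> In1 ` (In1 -` lab \<tau> ` y)"

definition rpart :: "'u prestrat \<Rightarrow> 'u ev set \<Rightarrow> 'u ev set \<Rightarrow> 'u ev set" where
  "rpart \<sigma> x y = In0 ` (In0 -` lab \<sigma> ` x) \<union> In1 ` y"

definition qgr :: "'u prestrat \<Rightarrow> 'u prestrat \<Rightarrow> 'u ev set \<Rightarrow> 'u ev set \<Rightarrow> ('u ev \<times> 'u ev) set" where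
  "qgr \<tau> \<sigma> x y = gr (left_map \<tau> \<sigma>) (right_map \<tau> \<sigma>) (lpart \<tau> x y) (rpart \<sigma> x y)"

definition iconf :: "'u prestrat \<Rightarrow> 'u prestrat \<Rightarrow> 'u ev set \<Rightarrow> 'u ev set \<Rightarrow> 'u ev set" where
  "iconf \<tau> \<sigma> x y = primes (left_es \<tau> \<sigma>) (right_es \<tau> \<sigma>) (left_map \<tau> \<sigma>) (right_map \<tau> \<sigma>) (qgr \<tau> \<sigma> x y)"

definition vis :: "'u prestrat \<Rightarrow> 'u prestrat \<Rightarrow> 'u ev set \<Rightarrow> 'u ev set \<Rightarrow> 'u ev set" where
  "vis \<tau> \<sigma> x y = iconf \<tau> \<sigma> x y \<inter> visible \<tau> \<sigma>"

text \<open>The labels that survive hiding, read off from the pair.\<close>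

definition vl :: "'u prestrat \<Rightarrow> 'u prestrat \<Rightarrow> 'u ev set \<Rightarrow> 'u ev set \<Rightarrow> 'u ev set" where
  "vl \<tau> \<sigma> x y = In0 ` (In0 -` lab \<sigma> ` x) \<union> In1 ` (In1 -` lab \<tau> ` y)"

lemma lpart_mono: "x \<subseteq> x' \<Longrightarrow> y \<subseteq> y' \<Longrightarrow> lpart \<tau> x y \<subseteq> lpart \<tau> x' y'"
  unfolding lpart_def by (intro Un_mono image_mono vimage_mono)

lemma rpart_mono: "x \<subseteq> x' \<Longrightarrow> y \<subseteq> y' \<Longrightarrow> rpart \<sigma> x y \<subseteq> rpart \<sigma> x' y'"
  unfolding rpart_def by (intro Un_mono image_mono vimage_mono)

lemma qgr_mono: "x \<subseteq> x' \<Longrightarrow> y \<subseteq> y' \<Longrightarrow> qgr \<tau> \<sigma> x y \<subseteq> qgr \<tau> \<sigma> x' y'"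
  using lpart_mono[of x x' y y' \<tau>] rpart_mono[of x x' y y' \<sigma>] by (auto simp: qgr_def gr_def)

lemma iconf_mono: "x \<subseteq> x' \<Longrightarrow> y \<subseteq> y' \<Longrightarrow> iconf \<tau> \<sigma> x y \<subseteq> iconf \<tau> \<sigma> x' y'"
  using qgr_mono[of x x' y y' \<tau> \<sigma>] by (auto simp: iconf_def primes_def)

lemma vis_mono: "x \<subseteq> x' \<Longrightarrow> y \<subseteq> y' \<Longrightarrow> vis \<tau> \<sigma> x y \<subseteq> vis \<tau> \<sigma> x' y'"
  using iconf_mono[of x x' y y' \<tau> \<sigma>] by (auto simp: vis_def)

lemma sync2_sub: "sync2 \<tau> \<sigma> x y \<Longrightarrow> x' \<subseteq> x \<Longrightarrow> y' \<subseteq> y \<Longrightarrow> match2 \<tau> \<sigma> x' y' \<Longrightarrow> sync2 \<tau> \<sigma> x' y'"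
proof -
  assume c: "sync2 \<tau> \<sigma> x y" and sub: "x' \<subseteq> x" "y' \<subseteq> y" and m: "match2 \<tau> \<sigma> x' y'"
  obtain \<rho> where "rank2 \<tau> \<sigma> x y \<rho>" using c by (auto simp: sync2_def)
  then have "rank2 \<tau> \<sigma> x' y' \<rho>" using sub unfolding rank2_def by (meson subsetD)
  then show ?thesis using m by (auto simp: sync2_def)
qed

locale inter =
  fixes \<sigma> \<tau> :: "'u prestrat"
  assumes pre\<sigma>: "prestrategy \<sigma>" and pre\<tau>: "prestrategy \<tau>" and mid: "trg \<sigma> = src \<tau>"
begin

lemma left_img:
  assumes "x \<in> conf (st \<sigma>)" "c \<subseteq> Ev (trg \<tau>)"
  shows "left_map \<tau> \<sigma> ` (In0 ` x \<union> In1 ` c) = lloc ` lab \<sigma> ` x \<union> In1 ` In1 ` c"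
    "s \<in> Ev (st \<sigma>) \<Longrightarrow> left_map \<tau> \<sigma> (In0 s) = lloc (lab \<sigma> s)"
    "b \<in> Ev (trg \<tau>) \<Longrightarrow> left_map \<tau> \<sigma> (In1 b) = In1 (In1 b)"
proof -
  have 1: "left_map \<tau> \<sigma> (In0 s) = lloc (lab \<sigma> s)" if "s \<in> Ev (st \<sigma>)" for s
    using that by (simp add: left_map_def left_es_def par_map_def par_simps copair_def reassoc_def lloc_def)
  have 2: "left_map \<tau> \<sigma> (In1 s) = In1 (In1 s)" if "s \<in> Ev (trg \<tau>)" for s
    using that by (simp add: left_map_def left_es_def par_map_def par_simps copair_def reassoc_def)
  have "left_map \<tau> \<sigma> ` In0 ` x = lloc ` lab \<sigma> ` x"
    unfolding image_image using confD(2)[OF assms(1)] 1 by (intro image_cong) auto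
  moreover have "left_map \<tau> \<sigma> ` In1 ` c = In1 ` In1 ` c"
    unfolding image_image using assms(2) 2 by (intro image_cong) auto
  ultimately show "left_map \<tau> \<sigma> ` (In0 ` x \<union> In1 ` c) = lloc ` lab \<sigma> ` x \<union> In1 ` In1 ` c"
    by (simp add: image_Un)
  show "s \<in> Ev (st \<sigma>) \<Longrightarrow> left_map \<tau> \<sigma> (In0 s) = lloc (lab \<sigma> s)"
    "b \<in> Ev (trg \<tau>) \<Longrightarrow> left_map \<tau> \<sigma> (In1 b) = In1 (In1 b)" using 1 2 by auto
qed

lemma right_img:
  assumes "y \<in> conf (st \<tau>)" "a \<subseteq> Ev (src \<sigma>)"
  shows "right_map \<tau> \<sigma> ` (In0 ` a \<union> In1 ` y) = In0 ` a \<union> In1 ` lab \<tau> ` y"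
    "t \<in> Ev (st \<tau>) \<Longrightarrow> right_map \<tau> \<sigma> (In1 t) = In1 (lab \<tau> t)"
    "b \<in> Ev (src \<sigma>) \<Longrightarrow> right_map \<tau> \<sigma> (In0 b) = In0 b"
proof -
  have 1: "right_map \<tau> \<sigma> (In1 s) = In1 (lab \<tau> s)" if "s \<in> Ev (st \<tau>)" for s
    using that by (simp add: right_map_def par_map_def par_simps copair_def)
  have 2: "right_map \<tau> \<sigma> (In0 s) = In0 s" if "s \<in> Ev (src \<sigma>)" for s
    using that by (simp add: right_map_def par_map_def par_simps copair_def)
  have "right_map \<tau> \<sigma> ` In1 ` y = In1 ` lab \<tau> ` y"
    unfolding image_image using confD(2)[OF assms(1)] 1 by (intro image_cong) auto
  moreover have "right_map \<tau> \<sigma> ` In0 ` a = In0 ` a"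
    unfolding image_image using assms(2) 2 by (intro image_cong) auto
  ultimately show "right_map \<tau> \<sigma> ` (In0 ` a \<union> In1 ` y) = In0 ` a \<union> In1 ` lab \<tau> ` y"
    by (simp add: image_Un)
  show "t \<in> Ev (st \<tau>) \<Longrightarrow> right_map \<tau> \<sigma> (In1 t) = In1 (lab \<tau> t)"
    "b \<in> Ev (src \<sigma>) \<Longrightarrow> right_map \<tau> \<sigma> (In0 b) = In0 b" using 1 2 by auto
qed

lemma lloc_inj: "inj_on lloc (range In0 \<union> range In1)"
  by (auto simp: inj_on_def)

sublocale P: pull "left_es \<tau> \<sigma>" "right_es \<tau> \<sigma>" "left_map \<tau> \<sigma>" "right_map \<tau> \<sigma>"
proof
  show "is_es (left_es \<tau> \<sigma>)" "is_es (right_es \<tau> \<sigma>)"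
    using prestrategyD[OF pre\<sigma>] prestrategyD[OF pre\<tau>] by (simp_all add: left_es_def right_es_def par_es)
  fix z
  show "inj_on (left_map \<tau> \<sigma>) z" if z: "z \<in> conf (left_es \<tau> \<sigma>)"
  proof -
    have c: "z \<subseteq> range In0 \<union> range In1" "In0 -` z \<in> conf (st \<sigma>)" "In1 -` z \<in> conf (trg \<tau>)"
      using z by (auto simp: left_es_def conf_par)
    note l = left_img(2,3)[OF c(2) confD(2)[OF c(3)]]
    have inj: "inj_on (lloc \<circ> lab \<sigma>) (In0 -` z)"
      using prestrategy_conf(1,4)[OF pre\<sigma> c(2)] lloc_inj by (intro comp_inj_on) (auto intro: inj_on_subset)
    show ?thesis
    proof (rule inj_onI)
      fix a b assume ab: "a \<in> z" "b \<in> z" "left_map \<tau> \<sigma> a = left_map \<tau> \<sigma> b"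
      have mixed: "lloc (lab \<sigma> s) \<noteq> In1 (In1 d)" if "In0 s \<in> z" for s d
      proof -
        have "lab \<sigma> s \<in> range In0 \<union> range In1" using prestrategy_conf(4)[OF pre\<sigma> c(2)] that by blast
        then show ?thesis by auto
      qed
      have e1: "left_map \<tau> \<sigma> (In0 s) = lloc (lab \<sigma> s)" if "In0 s \<in> z" for s
        using l(1) confD(2)[OF c(2)] that by auto
      have e2: "left_map \<tau> \<sigma> (In1 s) = In1 (In1 s)" if "In1 s \<in> z" for s
        using l(2) confD(2)[OF c(3)] that by auto
      have "a \<in> range In0 \<union> range In1" "b \<in> range In0 \<union> range In1" using ab c(1) by auto
      then show "a = b"
        using ab e1 e2 mixed inj by (auto simp: inj_on_def) metis+
    qed
  qed
  show "inj_on (right_map \<tau> \<sigma>) z" if z: "z \<in> conf (right_es \<tau> \<sigma>)"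
  proof -
    have c: "z \<subseteq> range In0 \<union> range In1" "In1 -` z \<in> conf (st \<tau>)" "In0 -` z \<in> conf (src \<sigma>)"
      using z by (auto simp: right_es_def conf_par)
    note l = right_img(2,3)[OF c(2) confD(2)[OF c(3)]]
    have inj: "inj_on (lab \<tau>) (In1 -` z)" using prestrategy_conf(1)[OF pre\<tau> c(2)] .
    show ?thesis
    proof (rule inj_onI)
      fix a b assume ab: "a \<in> z" "b \<in> z" "right_map \<tau> \<sigma> a = right_map \<tau> \<sigma> b"
      have e1: "right_map \<tau> \<sigma> (In1 s) = In1 (lab \<tau> s)" if "In1 s \<in> z" for s
        using l(1) confD(2)[OF c(2)] that by auto
      have e2: "right_map \<tau> \<sigma> (In0 s) = In0 s" if "In0 s \<in> z" for s
        using l(2) confD(2)[OF c(3)] that by auto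
      have "a \<in> range In0 \<union> range In1" "b \<in> range In0 \<union> range In1" using ab c(1) by auto
      then show "a = b"
        using ab e1 e2 inj by (auto simp: inj_on_def)
    qed
  qed
qed

lemma lpart_conf: "match2 \<tau> \<sigma> x y \<Longrightarrow> lpart \<tau> x y \<in> conf (left_es \<tau> \<sigma>)"
  using prestrategy_conf[OF pre\<tau>, of y] by (auto simp: match2_def lpart_def left_es_def conf_par)

lemma rpart_conf: "match2 \<tau> \<sigma> x y \<Longrightarrow> rpart \<sigma> x y \<in> conf (right_es \<tau> \<sigma>)"
  using prestrategy_conf[OF pre\<sigma>, of x] by (auto simp: match2_def rpart_def right_es_def conf_par)

lemma llab_img:
  assumes "x \<in> conf (st \<sigma>)"
  shows "lloc ` lab \<sigma> ` x = In0 ` (In0 -` lab \<sigma> ` x) \<union> In1 ` In0 ` (In1 -` lab \<sigma> ` x)"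
proof -
  have "lloc ` (In0 ` A \<union> In1 ` B) = In0 ` A \<union> In1 ` In0 ` B" for A B :: "'u ev set"
    by (simp add: image_Un image_image)
  then show ?thesis using ev_split[OF prestrategy_conf(4)[OF pre\<sigma> assms]] by metis
qed

lemma rlab_img:
  assumes "y \<in> conf (st \<tau>)"
  shows "In1 ` lab \<tau> ` y = In1 ` In0 ` (In0 -` lab \<tau> ` y) \<union> In1 ` In1 ` (In1 -` lab \<tau> ` y)"
  using ev_split[OF prestrategy_conf(4)[OF pre\<tau> assms]] by (metis image_Un)

lemma left_lpart:
  assumes "match2 \<tau> \<sigma> x y"
  shows "left_map \<tau> \<sigma> ` lpart \<tau> x y = In0 ` (In0 -` lab \<sigma> ` x) \<union>
    (In1 ` In0 ` (In1 -` lab \<sigma> ` x) \<union> In1 ` In1 ` (In1 -` lab \<tau> ` y))"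
proof -
  have x: "x \<in> conf (st \<sigma>)" and y: "y \<in> conf (st \<tau>)" using assms by (auto simp: match2_def)
  show ?thesis
    unfolding lpart_def left_img(1)[OF x confD(2)[OF prestrategy_conf(3)[OF pre\<tau> y]]] llab_img[OF x]
    by (simp add: Un_assoc)
qed

lemma matched_parts: assumes m: "match2 \<tau> \<sigma> x y" shows "P.matched (lpart \<tau> x y) (rpart \<sigma> x y)"
proof -
  have x: "x \<in> conf (st \<sigma>)" and y: "y \<in> conf (st \<tau>)" and e: "In1 -` lab \<sigma> ` x = In0 -` lab \<tau> ` y"
    using m by (auto simp: match2_def)
  have "right_map \<tau> \<sigma> ` rpart \<sigma> x y = In0 ` (In0 -` lab \<sigma> ` x) \<union> In1 ` lab \<tau> ` y"
    unfolding rpart_def right_img(1)[OF y confD(2)[OF prestrategy_conf(2)[OF pre\<sigma> x]]] ..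
  then show ?thesis
    unfolding P.matched_def left_lpart[OF m] using lpart_conf[OF m] rpart_conf[OF m]
      rlab_img[OF y] e by simp
qed

text \<open>Comparing the \<open>A\<close>, \<open>B\<close> and \<open>C\<close> parts of the
  common label set yields three equations: those for \<open>A\<close> and \<open>C\<close> force the
  idle components, and the one for \<open>B\<close> is the matching condition.\<close>

lemma matched_match2:
  assumes "P.matched L R"
  shows "\<exists>x y. match2 \<tau> \<sigma> x y \<and> L = lpart \<tau> x y \<and> R = rpart \<sigma> x y"
proof -
  define x c a y where "x = In0 -` L" and "c = In1 -` L" and "a = In0 -` R" and "y = In1 -` R"
  have L: "L = In0 ` x \<union> In1 ` c" "x \<in> conf (st \<sigma>)" "c \<in> conf (trg \<tau>)"
  proof -
    have "L \<in> conf (par (st \<sigma>) (trg \<tau>))" 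
      using assms[unfolded P.matched_def] unfolding left_es_def by blast
    then show "L = In0 ` x \<union> In1 ` c" "x \<in> conf (st \<sigma>)" "c \<in> conf (trg \<tau>)"
      unfolding conf_par x_def c_def using ev_split by blast+
  qed
  have R: "R = In0 ` a \<union> In1 ` y" "y \<in> conf (st \<tau>)" "a \<in> conf (src \<sigma>)"
  proof -
    have "R \<in> conf (par (src \<sigma>) (st \<tau>))" 
      using assms[unfolded P.matched_def] unfolding right_es_def by blast
    then show "R = In0 ` a \<union> In1 ` y" "y \<in> conf (st \<tau>)" "a \<in> conf (src \<sigma>)"
      unfolding conf_par y_def a_def using ev_split by blast+
  qed
  have "lloc ` lab \<sigma> ` x \<union> In1 ` In1 ` c = In0 ` a \<union> In1 ` lab \<tau> ` y"
    using assms left_img(1)[OF L(2) confD(2)[OF L(3)]] right_img(1)[OF R(2) confD(2)[OF R(3)]]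
    unfolding P.matched_def L(1) R(1) by simp
  then have eq: "In0 ` (In0 -` lab \<sigma> ` x) \<union> In1 ` In0 ` (In1 -` lab \<sigma> ` x) \<union> In1 ` In1 ` c
      = In0 ` a \<union> (In1 ` In0 ` (In0 -` lab \<tau> ` y) \<union> In1 ` In1 ` (In1 -` lab \<tau> ` y))"
    unfolding llab_img[OF L(2)] rlab_img[OF R(2)] .
  have "In0 -` (In0 ` A \<union> In1 ` In0 ` B \<union> In1 ` In1 ` D) = A"
    "In0 -` (In0 ` A \<union> (In1 ` In0 ` B \<union> In1 ` In1 ` D)) = A"
    "In0 -` In1 -` (In0 ` A \<union> In1 ` In0 ` B \<union> In1 ` In1 ` D) = B"
    "In0 -` In1 -` (In0 ` A \<union> (In1 ` In0 ` B \<union> In1 ` In1 ` D)) = B"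
    "In1 -` In1 -` (In0 ` A \<union> In1 ` In0 ` B \<union> In1 ` In1 ` D) = D"
    "In1 -` In1 -` (In0 ` A \<union> (In1 ` In0 ` B \<union> In1 ` In1 ` D)) = D" for A B D :: "'u ev set"
    by auto
  then have "a = In0 -` lab \<sigma> ` x" "In1 -` lab \<sigma> ` x = In0 -` lab \<tau> ` y" "c = In1 -` lab \<tau> ` y"
    using eq by metis+
  then have "match2 \<tau> \<sigma> x y" "L = lpart \<tau> x y" "R = rpart \<sigma> x y"
    using L R by (simp_all add: match2_def lpart_def rpart_def)
  then show ?thesis by blast
qed

text \<open>The pullback also orders the idle copies of \<open>C\<close> and \<open>A\<close>, which
  \<open>rank2\<close> does not mention. That order is reflected into the strategy that plays there,
  so a schedule respecting the strategies respects it as well.\<close>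

lemma sync2_iff_F:
  assumes m: "match2 \<tau> \<sigma> x y"
  shows "sync2 \<tau> \<sigma> x y \<longleftrightarrow> qgr \<tau> \<sigma> x y \<in> P.F"
proof -
  have x: "x \<in> conf (st \<sigma>)" and y: "y \<in> conf (st \<tau>)" using m by (auto simp: match2_def)
  have l1: "left_map \<tau> \<sigma> (In0 s) = lloc (lab \<sigma> s)" if "s \<in> x" for s
    using left_img(2)[OF x, of "{}" s] confD(2)[OF x] that by auto
  have l2: "left_map \<tau> \<sigma> (In1 c) = In1 (In1 c)" if "In1 c \<in> lab \<tau> ` y" for c
    using left_img(3)[OF x, of "{}" c] confD(2)[OF prestrategy_conf(3)[OF pre\<tau> y]] that by auto
  have r1: "right_map \<tau> \<sigma> (In1 t) = In1 (lab \<tau> t)" if "t \<in> y" for t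
    using right_img(2)[OF y, of "{}" t] confD(2)[OF y] that by auto
  have r2: "right_map \<tau> \<sigma> (In0 c) = In0 c" if "In0 c \<in> lab \<sigma> ` x" for c
    using right_img(3)[OF y, of "{}" c] confD(2)[OF prestrategy_conf(2)[OF pre\<sigma> x]] that by auto
  have rank_iff: "rank2 \<tau> \<sigma> x y \<rho> \<longleftrightarrow>
     (\<forall>s\<in>lpart \<tau> x y. \<forall>s'\<in>lpart \<tau> x y. (s, s') \<in> Leq (left_es \<tau> \<sigma>) \<longrightarrow> s \<noteq> s' \<longrightarrow>
        \<rho> (left_map \<tau> \<sigma> s) < \<rho> (left_map \<tau> \<sigma> s')) \<and>
     (\<forall>t\<in>rpart \<sigma> x y. \<forall>t'\<in>rpart \<sigma> x y. (t, t') \<in> Leq (right_es \<tau> \<sigma>) \<longrightarrow> t \<noteq> t' \<longrightarrow>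
        \<rho> (right_map \<tau> \<sigma> t) < \<rho> (right_map \<tau> \<sigma> t'))" (is "_ \<longleftrightarrow> ?A \<and> ?B") for \<rho> :: "'u ev \<Rightarrow> nat"
  proof
    assume rk: "rank2 \<tau> \<sigma> x y \<rho>"
    have ?A
    proof (intro ballI impI)
      fix s s' assume s: "s \<in> lpart \<tau> x y" "s' \<in> lpart \<tau> x y" "(s, s') \<in> Leq (left_es \<tau> \<sigma>)" "s \<noteq> s'"
      from s(3) consider a b where "s = In0 a" "s' = In0 b" "(a, b) \<in> Leq (st \<sigma>)"
        | a b where "s = In1 a" "s' = In1 b" "(a, b) \<in> Leq (trg \<tau>)"
        by (auto simp: left_es_def par_simps)
      then show "\<rho> (left_map \<tau> \<sigma> s) < \<rho> (left_map \<tau> \<sigma> s')"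
      proof cases
        case 1
        then show ?thesis using s rk l1 by (auto simp: rank2_def lpart_def)
      next
        case 2
        then have "In1 a \<in> lab \<tau> ` y" "In1 b \<in> lab \<tau> ` y" using s by (auto simp: lpart_def)
        then obtain t t' where t: "t \<in> y" "t' \<in> y" "In1 a = lab \<tau> t" "In1 b = lab \<tau> t'" by blast
        \<comment> \<open>Causality between two moves of the game \<open>C\<close> is reflected to
          the events of \<open>y\<close> that play them.\<close>
        then have "(t, t') \<in> Leq (st \<tau>)" using prestrategy_reflect[OF pre\<tau> y, of t t'] 2
          by (simp add: par_simps t(3,4)[symmetric])
        moreover have "t \<noteq> t'" using t s(4) 2 by auto
        ultimately have "\<rho> (In1 (lab \<tau> t)) < \<rho> (In1 (lab \<tau> t'))" using rk t by (simp add: rank2_def)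
        then show ?thesis
          using 2 l2 \<open>In1 a \<in> lab \<tau> ` y\<close> \<open>In1 b \<in> lab \<tau> ` y\<close> by (simp add: t(3,4)[symmetric])
      qed
    qed
    moreover have ?B
    proof (intro ballI impI)
      fix s s' assume s: "s \<in> rpart \<sigma> x y" "s' \<in> rpart \<sigma> x y" "(s, s') \<in> Leq (right_es \<tau> \<sigma>)" "s \<noteq> s'"
      from s(3) consider a b where "s = In1 a" "s' = In1 b" "(a, b) \<in> Leq (st \<tau>)"
        | a b where "s = In0 a" "s' = In0 b" "(a, b) \<in> Leq (src \<sigma>)"
        by (auto simp: right_es_def par_simps)
      then show "\<rho> (right_map \<tau> \<sigma> s) < \<rho> (right_map \<tau> \<sigma> s')"
      proof cases
        case 1
        then show ?thesis using s rk r1 by (auto simp: rank2_def rpart_def)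
      next
        case 2
        then have "In0 a \<in> lab \<sigma> ` x" "In0 b \<in> lab \<sigma> ` x" using s by (auto simp: rpart_def)
        then obtain t t' where t: "t \<in> x" "t' \<in> x" "In0 a = lab \<sigma> t" "In0 b = lab \<sigma> t'" by blast
        then have "(t, t') \<in> Leq (st \<sigma>)" using prestrategy_reflect[OF pre\<sigma> x, of t t'] 2
          by (simp add: par_simps t(3,4)[symmetric])
        moreover have "t \<noteq> t'" using t s(4) 2 by auto
        ultimately have "\<rho> (lloc (lab \<sigma> t)) < \<rho> (lloc (lab \<sigma> t'))" using rk t by (simp add: rank2_def)
        then show ?thesis
          using 2 r2 \<open>In0 a \<in> lab \<sigma> ` x\<close> \<open>In0 b \<in> lab \<sigma> ` x\<close> by (simp add: t(3,4)[symmetric])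
      qed
    qed
    ultimately show "?A \<and> ?B" ..
  next
    assume AB: "?A \<and> ?B"
    show "rank2 \<tau> \<sigma> x y \<rho>"
      unfolding rank2_def
    proof (intro conjI ballI impI)
      fix s s' assume "s \<in> x" "s' \<in> x" "(s, s') \<in> Leq (st \<sigma>)" "s \<noteq> s'"
      then show "\<rho> (lloc (lab \<sigma> s)) < \<rho> (lloc (lab \<sigma> s'))"
        using AB[THEN conjunct1, rule_format, of "In0 s" "In0 s'"] l1
        by (simp add: lpart_def left_es_def par_simps)
    next
      fix s s' assume "s \<in> y" "s' \<in> y" "(s, s') \<in> Leq (st \<tau>)" "s \<noteq> s'"
      then show "\<rho> (In1 (lab \<tau> s)) < \<rho> (In1 (lab \<tau> s'))"
        using AB[THEN conjunct2, rule_format, of "In1 s" "In1 s'"] r1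
        by (simp add: rpart_def right_es_def par_simps)
    qed
  qed
  show ?thesis
    unfolding sync2_def qgr_def P.F_matched_iff_rank[OF matched_parts[OF m]] ex_cong1[OF rank_iff]
    using m by simp
qed

lemma F_sync2: assumes "q \<in> P.F" shows "\<exists>x y. sync2 \<tau> \<sigma> x y \<and> q = qgr \<tau> \<sigma> x y"
proof -
  obtain x y where xy: "match2 \<tau> \<sigma> x y" "fst ` q = lpart \<tau> x y" "snd ` q = rpart \<sigma> x y"
    using matched_match2[OF P.F_gr(1)[OF assms]] by blast
  then have "q = qgr \<tau> \<sigma> x y" unfolding qgr_def using P.F_gr(2)[OF assms] by simp
  then show ?thesis using sync2_iff_F[OF xy(1)] assms by blast
qed

lemma sync2_match: "sync2 \<tau> \<sigma> x y \<Longrightarrow> match2 \<tau> \<sigma> x y"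
  by (simp add: sync2_def)

lemma sync2_F: "sync2 \<tau> \<sigma> x y \<Longrightarrow> qgr \<tau> \<sigma> x y \<in> P.F"
  using sync2_iff_F sync2_match by blast

lemma qgr_fst: "match2 \<tau> \<sigma> x y \<Longrightarrow> fst ` qgr \<tau> \<sigma> x y = lpart \<tau> x y"
  unfolding qgr_def by (rule P.gr_fst[OF matched_parts])

lemma qgr_snd: "match2 \<tau> \<sigma> x y \<Longrightarrow> snd ` qgr \<tau> \<sigma> x y = rpart \<sigma> x y"
  unfolding qgr_def by (rule P.gr_snd[OF matched_parts])

lemma qgr_subset:
  assumes m: "match2 \<tau> \<sigma> x y" "match2 \<tau> \<sigma> x' y'" and sub: "qgr \<tau> \<sigma> x y \<subseteq> qgr \<tau> \<sigma> x' y'"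
  shows "x \<subseteq> x'" "y \<subseteq> y'"
proof -
  have "lpart \<tau> x y \<subseteq> lpart \<tau> x' y'" "rpart \<sigma> x y \<subseteq> rpart \<sigma> x' y'"
    using image_mono[OF sub, of fst] image_mono[OF sub, of snd] qgr_fst qgr_snd m by auto
  then show "x \<subseteq> x'" "y \<subseteq> y'" by (auto simp: lpart_def rpart_def)
qed

lemma inter_es_W: "inter_es \<tau> \<sigma> = P.W"
  by (simp add: inter_es_def)

lemma inter_es: "is_es (inter_es \<tau> \<sigma>)"
  unfolding inter_es_W by (rule P.wedge_es)

lemma iconf_conf: "sync2 \<tau> \<sigma> x y \<Longrightarrow> iconf \<tau> \<sigma> x y \<in> conf (inter_es \<tau> \<sigma>)"
  unfolding inter_es_W iconf_def by (rule P.primes_conf[OF sync2_F])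

lemma conf_iconf: "z \<in> conf (inter_es \<tau> \<sigma>) \<Longrightarrow> \<exists>x y. sync2 \<tau> \<sigma> x y \<and> z = iconf \<tau> \<sigma> x y"
  unfolding inter_es_W iconf_def using P.conf_primes[of z] F_sync2 by metis

lemma iconf_subset:
  assumes "sync2 \<tau> \<sigma> x y" "sync2 \<tau> \<sigma> x' y'" "iconf \<tau> \<sigma> x y \<subseteq> iconf \<tau> \<sigma> x' y'"
  shows "x \<subseteq> x' \<and> y \<subseteq> y'"
  using assms P.primes_subset_iff[OF sync2_F[OF assms(1)] sync2_F[OF assms(2)]]
    qgr_subset[OF sync2_match[OF assms(1)] sync2_match[OF assms(2)]]
  by (simp add: iconf_def)

lemma inter_proj_iconf:
  assumes "sync2 \<tau> \<sigma> x y"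
  shows "inter_proj1 \<tau> \<sigma> ` iconf \<tau> \<sigma> x y = lpart \<tau> x y" "inter_proj2 \<tau> \<sigma> ` iconf \<tau> \<sigma> x y = rpart \<sigma> x y"
  unfolding inter_proj1_def inter_proj2_def iconf_def P.proj_primes[OF sync2_F[OF assms]]
  using qgr_fst qgr_snd sync2_match[OF assms] by auto

lemma inter_map_eq: "e \<in> Ev (inter_es \<tau> \<sigma>) \<Longrightarrow> inter_map \<tau> \<sigma> e = left_map \<tau> \<sigma> (inter_proj1 \<tau> \<sigma> e)"
  by (simp add: inter_map_def)

lemma inter_map_iconf:
  assumes "sync2 \<tau> \<sigma> x y"
  shows "inter_map \<tau> \<sigma> ` iconf \<tau> \<sigma> x y = In0 ` (In0 -` lab \<sigma> ` x) \<union>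
    (In1 ` In0 ` (In1 -` lab \<sigma> ` x) \<union> In1 ` In1 ` (In1 -` lab \<tau> ` y))"
proof -
  have "inter_map \<tau> \<sigma> ` iconf \<tau> \<sigma> x y = left_map \<tau> \<sigma> ` inter_proj1 \<tau> \<sigma> ` iconf \<tau> \<sigma> x y"
    unfolding image_image using inter_map_eq confD(2)[OF iconf_conf[OF assms]] by (intro image_cong) auto
  then show ?thesis
    using inter_proj_iconf[OF assms] left_lpart[OF sync2_match[OF assms]] by simp
qed

lemma inter_map_inj: "z \<in> conf (inter_es \<tau> \<sigma>) \<Longrightarrow> inj_on (inter_map \<tau> \<sigma>) z"
proof -
  assume z: "z \<in> conf (inter_es \<tau> \<sigma>)"
  have "inj_on (\<lambda>e. left_map \<tau> \<sigma> (inter_proj1 \<tau> \<sigma> e)) z"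
    unfolding inter_proj1_def by (rule P.wedge_lab_inj) (use z inter_es_W in simp)
  then show ?thesis
    using confD(2)[OF z] inter_map_eq by (subst inj_on_cong[of z _ "\<lambda>e. left_map \<tau> \<sigma> (inter_proj1 \<tau> \<sigma> e)"]) auto
qed

section \<open>Hiding: configurations of the composite\<close>

lemma comp_Ev: "Ev (comp_es \<tau> \<sigma>) = visible \<tau> \<sigma>"
  by (auto simp: comp_es_def visible_def)

lemma comp_simps:
  "src (\<tau> \<odot>\<^sub>s \<sigma>) = src \<sigma>" "trg (\<tau> \<odot>\<^sub>s \<sigma>) = trg \<tau>" "lab (\<tau> \<odot>\<^sub>s \<sigma>) = comp_lab \<tau> \<sigma>"
  "Ev (st (\<tau> \<odot>\<^sub>s \<sigma>)) = visible \<tau> \<sigma>"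
  "Leq (st (\<tau> \<odot>\<^sub>s \<sigma>)) = Leq (comp_es \<tau> \<sigma>)" "Con (st (\<tau> \<odot>\<^sub>s \<sigma>)) = Con (comp_es \<tau> \<sigma>)"
  "conf (st (\<tau> \<odot>\<^sub>s \<sigma>)) = conf (comp_es \<tau> \<sigma>)" "is_es (st (\<tau> \<odot>\<^sub>s \<sigma>)) = is_es (comp_es \<tau> \<sigma>)"
  by (auto simp: comp_strat_def comp_es_def visible_def conf_def is_es_def)

lemma comp_es: "is_es (st (\<tau> \<odot>\<^sub>s \<sigma>))"
  unfolding comp_simps comp_es_def by (rule restr_es[OF inter_es])

lemma vis_conf: "sync2 \<tau> \<sigma> x y \<Longrightarrow> vis \<tau> \<sigma> x y \<in> conf (st (\<tau> \<odot>\<^sub>s \<sigma>))"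
  unfolding comp_simps comp_es_def vis_def by (rule restr_conf_Int[OF iconf_conf inter_es])

text \<open>The down-closure of \<open>z\<close> in the interaction has the form
  \<open>iconf\<close>, and its pair is the witness; leastness holds because every configuration
  that contains \<open>z\<close> contains the down-closure.\<close>

lemma least_sync2:
  assumes z: "z \<in> conf (st (\<tau> \<odot>\<^sub>s \<sigma>))"
  shows "\<exists>x y. sync2 \<tau> \<sigma> x y \<and> vis \<tau> \<sigma> x y = z \<and>
    (\<forall>x' y'. sync2 \<tau> \<sigma> x' y' \<longrightarrow> z \<subseteq> vis \<tau> \<sigma> x' y' \<longrightarrow> x \<subseteq> x' \<and> y \<subseteq> y')"
proof -
  have z': "z \<in> conf (restr_es (inter_es \<tau> \<sigma>) (visible \<tau> \<sigma>))" using z by (simp add: comp_simps comp_es_def)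
  note d = restr_conf_dcl[OF inter_es z']
  obtain x y where xy: "sync2 \<tau> \<sigma> x y" "dcl (inter_es \<tau> \<sigma>) z = iconf \<tau> \<sigma> x y" using conf_iconf[OF d(1)] by blast
  have "x \<subseteq> x' \<and> y \<subseteq> y'" if "sync2 \<tau> \<sigma> x' y'" "z \<subseteq> vis \<tau> \<sigma> x' y'" for x' y'
    using iconf_subset[OF xy(1) that(1)] d(4)[OF iconf_conf[OF that(1)]] that(2) xy(2) by (simp add: vis_def)
  moreover have "vis \<tau> \<sigma> x y = z" using d(2) xy(2) by (simp add: vis_def)
  ultimately show ?thesis using xy(1) by blast
qed

lemma comp_lab_vis:
  assumes c: "sync2 \<tau> \<sigma> x y"
  shows "comp_lab \<tau> \<sigma> ` vis \<tau> \<sigma> x y = vl \<tau> \<sigma> x y"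
proof -
  let ?V = "In0 ` Ev (src \<sigma>) \<union> In1 ` In1 ` Ev (trg \<tau>)"
  have xy: "x \<in> conf (st \<sigma>)" "y \<in> conf (st \<tau>)" using sync2_match[OF c] by (auto simp: match2_def)
  have sub: "In0 -` lab \<sigma> ` x \<subseteq> Ev (src \<sigma>)" "In1 -` lab \<tau> ` y \<subseteq> Ev (trg \<tau>)"
    using confD(2)[OF prestrategy_conf(2)[OF pre\<sigma> xy(1)]] confD(2)[OF prestrategy_conf(3)[OF pre\<tau> xy(2)]] .
  have E: "iconf \<tau> \<sigma> x y \<subseteq> Ev (inter_es \<tau> \<sigma>)" using confD(2)[OF iconf_conf[OF c]] .
  have v: "vis \<tau> \<sigma> x y = {e \<in> iconf \<tau> \<sigma> x y. inter_map \<tau> \<sigma> e \<in> ?V}"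
    using E by (auto simp: vis_def visible_def)
  have "comp_lab \<tau> \<sigma> ` vis \<tau> \<sigma> x y = hide_mid ` inter_map \<tau> \<sigma> ` vis \<tau> \<sigma> x y"
    unfolding image_image using E by (intro image_cong) (auto simp: comp_lab_def comp_es_def vis_def)
  also have "inter_map \<tau> \<sigma> ` vis \<tau> \<sigma> x y = inter_map \<tau> \<sigma> ` iconf \<tau> \<sigma> x y \<inter> ?V"
    unfolding v by blast
  also have "\<dots> = In0 ` (In0 -` lab \<sigma> ` x) \<union> In1 ` In1 ` (In1 -` lab \<tau> ` y)"
    unfolding inter_map_iconf[OF c] using sub by blast
  also have "hide_mid ` \<dots> = vl \<tau> \<sigma> x y"
    by (simp add: image_Un image_image hide_mid_def copair_def vl_def)
  finally show ?thesis .
qed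

lemma conf_vis: "z \<in> conf (st (\<tau> \<odot>\<^sub>s \<sigma>)) \<Longrightarrow> \<exists>x y. sync2 \<tau> \<sigma> x y \<and> z = vis \<tau> \<sigma> x y"
  using least_sync2[of z] by blast

text \<open>Labels are injective on configurations of the interaction, and \<open>hide_mid\<close>
  is injective away from the middle game.\<close>

lemma comp_lab_inj:
  assumes z: "z \<in> conf (st (\<tau> \<odot>\<^sub>s \<sigma>))" shows "inj_on (comp_lab \<tau> \<sigma>) z"
proof -
  obtain x y where xy: "sync2 \<tau> \<sigma> x y" "z = vis \<tau> \<sigma> x y" using conf_vis[OF z] by blast
  have z': "z \<subseteq> iconf \<tau> \<sigma> x y" "z \<subseteq> visible \<tau> \<sigma>" using xy(2) by (auto simp: vis_def)
  have "inj_on (inter_map \<tau> \<sigma>) z"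
    using inter_map_inj[OF iconf_conf[OF xy(1)]] z'(1) by (rule inj_on_subset)
  moreover have "inj_on hide_mid (inter_map \<tau> \<sigma> ` z)"
  proof (rule inj_on_subset[of hide_mid "range In0 \<union> In1 ` range In1"])
    show "inj_on hide_mid (range In0 \<union> In1 ` range In1)"
      by (auto simp: inj_on_def hide_mid_def copair_def)
    show "inter_map \<tau> \<sigma> ` z \<subseteq> range In0 \<union> In1 ` range In1"
      using z'(2) unfolding visible_def by blast
  qed
  ultimately have "inj_on (hide_mid \<circ> inter_map \<tau> \<sigma>) z" by (rule comp_inj_on)
  moreover have "comp_lab \<tau> \<sigma> e = (hide_mid \<circ> inter_map \<tau> \<sigma>) e" if "e \<in> z" for e
    using that z'(2) by (auto simp: comp_lab_def comp_es_def visible_def)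
  ultimately show ?thesis using inj_on_cong[of z "comp_lab \<tau> \<sigma>"] by blast
qed

lemma vl_conf:
  assumes c: "sync2 \<tau> \<sigma> x y" shows "vl \<tau> \<sigma> x y \<in> conf (par (src \<sigma>) (trg \<tau>))"
proof -
  have xy: "x \<in> conf (st \<sigma>)" "y \<in> conf (st \<tau>)" using sync2_match[OF c] by (auto simp: match2_def)
  show ?thesis using prestrategy_conf(2)[OF pre\<sigma> xy(1)] prestrategy_conf(3)[OF pre\<tau> xy(2)]
    by (auto simp: conf_par vl_def)
qed

lemma comp_prestrategy: "prestrategy (\<tau> \<odot>\<^sub>s \<sigma>)"
proof -
  have A: "is_esp (dual (src \<sigma>) \<parallel> trg \<tau>)"
    using prestrategyD[OF pre\<sigma>] prestrategyD[OF pre\<tau>] by (simp add: esp_par esp_dual)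
  have S: "is_esp (st (\<tau> \<odot>\<^sub>s \<sigma>))"
    using comp_es unfolding is_esp_def comp_simps by (auto simp: comp_strat_def comp_es_def visible_def)
  have m: "es_map (st (\<tau> \<odot>\<^sub>s \<sigma>)) (dual (src \<sigma>) \<parallel> trg \<tau>) (comp_lab \<tau> \<sigma>)"
    unfolding es_map_def
  proof (intro conjI ballI)
    fix z assume z: "z \<in> conf (st (\<tau> \<odot>\<^sub>s \<sigma>))"
    show "inj_on (comp_lab \<tau> \<sigma>) z" by (rule comp_lab_inj[OF z])
    show "comp_lab \<tau> \<sigma> ` z \<in> conf (dual (src \<sigma>) \<parallel> trg \<tau>)"
      using conf_vis[OF z] comp_lab_vis vl_conf by auto
  next
    show "comp_lab \<tau> \<sigma> \<in> Ev (st (\<tau> \<odot>\<^sub>s \<sigma>)) \<rightarrow>\<^sub>E Ev (dual (src \<sigma>) \<parallel> trg \<tau>)"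
    proof (rule PiE_I)
      fix e assume "e \<in> Ev (st (\<tau> \<odot>\<^sub>s \<sigma>))"
      then have e: "e \<in> visible \<tau> \<sigma>" by (simp add: comp_simps)
      then have "inter_map \<tau> \<sigma> e \<in> In0 ` Ev (src \<sigma>) \<union> In1 ` In1 ` Ev (trg \<tau>)" by (simp add: visible_def)
      moreover have "comp_lab \<tau> \<sigma> e = hide_mid (inter_map \<tau> \<sigma> e)"
        using e by (simp add: comp_lab_def comp_es_def visible_def)
      ultimately show "comp_lab \<tau> \<sigma> e \<in> Ev (dual (src \<sigma>) \<parallel> trg \<tau>)"
        by (auto simp: hide_mid_def copair_def par_simps)
    next
      fix e assume "e \<notin> Ev (st (\<tau> \<odot>\<^sub>s \<sigma>))"
      then show "comp_lab \<tau> \<sigma> e = undefined"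
        unfolding comp_simps by (simp add: comp_lab_def comp_Ev)
    qed
  qed
  have "pol (dual (src \<sigma>) \<parallel> trg \<tau>) (comp_lab \<tau> \<sigma> e) = pol (st (\<tau> \<odot>\<^sub>s \<sigma>)) e"
    if "e \<in> Ev (st (\<tau> \<odot>\<^sub>s \<sigma>))" for e
    using that unfolding comp_simps by (simp add: comp_strat_def comp_es_def visible_def)
  then have "esp_map (st (\<tau> \<odot>\<^sub>s \<sigma>)) (dual (src \<sigma>) \<parallel> trg \<tau>) (comp_lab \<tau> \<sigma>)"
    using m by (simp add: esp_map_def)
  then show ?thesis
    unfolding prestrategy_def is_prestrategy_on_def comp_simps
    using A S prestrategyD(4,5)[OF pre\<sigma>] prestrategyD(4,5)[OF pre\<tau>] by blast
qed

text \<open>Comparable pairs that differ only by hidden moves present the same configuration of the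
  composite.\<close>

lemma vis_eqI:
  assumes "sync2 \<tau> \<sigma> x y" "sync2 \<tau> \<sigma> x' y'" "x \<subseteq> x'" "y \<subseteq> y'" "vl \<tau> \<sigma> x y = vl \<tau> \<sigma> x' y'"
  shows "vis \<tau> \<sigma> x y = vis \<tau> \<sigma> x' y'"
  using conf_eqI_lab[OF comp_lab_inj[OF vis_conf[OF assms(2)]] vis_mono[OF assms(3,4)]]
    comp_lab_vis[OF assms(1)] comp_lab_vis[OF assms(2)] assms(5) by metis

end

section \<open>2-cells\<close>

lemma two_cellsD:
  assumes "f \<in> two_cells \<sigma> \<sigma>'"
  shows "cdom f = \<sigma>" "ccod f = \<sigma>'" "src \<sigma> = src \<sigma>'" "trg \<sigma> = trg \<sigma>'"
    "es_map (st \<sigma>) (st \<sigma>') (cfun f)" "\<And>s. s \<in> Ev (st \<sigma>) \<Longrightarrow> lab \<sigma>' (cfun f s) = lab \<sigma> s"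
  using assms by (auto simp: two_cells_def esp_map_def)

lemma two_cell_lab:
  assumes "f \<in> two_cells \<sigma> \<sigma>'" "x \<in> conf (st \<sigma>)"
  shows "lab \<sigma>' ` cfun f ` x = lab \<sigma> ` x"
  unfolding image_image using two_cellsD(6)[OF assms(1)] confD(2)[OF assms(2)] by (intro image_cong) auto

lemma two_cell_conf:
  assumes "f \<in> two_cells \<sigma> \<sigma>'" "x \<in> conf (st \<sigma>)"
  shows "cfun f ` x \<in> conf (st \<sigma>')"
  using es_mapD(2)[OF two_cellsD(5)[OF assms(1)] assms(2)] .

text \<open>Preservation of polarity is automatic, because the polarity of an event is that of its
  label in the game.\<close>

lemma two_cellsI:
  assumes \<sigma>: "prestrategy \<sigma>" and \<sigma>': "prestrategy \<sigma>'" and eq: "src \<sigma> = src \<sigma>'" "trg \<sigma> = trg \<sigma>'"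
    and f: "es_map (st \<sigma>) (st \<sigma>') f" and lab: "\<And>s. s \<in> Ev (st \<sigma>) \<Longrightarrow> lab \<sigma>' (f s) = lab \<sigma> s"
  shows "\<lparr>cdom = \<sigma>, ccod = \<sigma>', cfun = f\<rparr> \<in> two_cells \<sigma> \<sigma>'"
proof -
  have "pol (st \<sigma>') (f s) = pol (st \<sigma>) s" if "s \<in> Ev (st \<sigma>)" for s
    using prestrategyD(8)[OF \<sigma> that] prestrategyD(8)[OF \<sigma>' es_mapD(1)[OF f that]] lab[OF that] eq by simp
  then show ?thesis using assms by (simp add: two_cells_def esp_map_def)
qed

lemma two_cell_eqI:
  assumes \<sigma>: "prestrategy \<sigma>" and f: "f \<in> two_cells \<sigma> \<sigma>'" and g: "g \<in> two_cells \<sigma> \<sigma>'"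
    and eq: "\<And>x. x \<in> conf (st \<sigma>) \<Longrightarrow> cfun f ` x = cfun g ` x"
  shows "f = g"
proof -
  have "cfun f = cfun g"
    by (rule es_map_eqI[OF prestrategyD(3)[OF \<sigma>] two_cellsD(5)[OF f] two_cellsD(5)[OF g] eq])
  then show ?thesis using two_cellsD(1,2)[OF f] two_cellsD(1,2)[OF g] by simp
qed

lemma id_cell_in: "prestrategy \<sigma> \<Longrightarrow> id_cell \<sigma> \<in> two_cells \<sigma> \<sigma>"
  unfolding id_cell_def by (rule two_cellsI) (simp_all add: es_map_id)

lemma id_cell_conf: "x \<in> conf (st \<sigma>) \<Longrightarrow> cfun (id_cell \<sigma>) ` x = x"
proof -
  assume "x \<in> conf (st \<sigma>)"
  then have "x \<subseteq> Ev (st \<sigma>)" by (rule confD(2))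
  then have "(\<lambda>s\<in>Ev (st \<sigma>). s) ` x = (\<lambda>s. s) ` x" by (intro image_cong) auto
  then show ?thesis by (simp add: id_cell_def)
qed

lemma vcomp_cell_in:
  assumes f: "f \<in> two_cells \<sigma> \<sigma>'" and g: "g \<in> two_cells \<sigma>' \<sigma>''"
  shows "vcomp_cell g f \<in> two_cells \<sigma> \<sigma>''"
    "\<And>x. x \<in> conf (st \<sigma>) \<Longrightarrow> cfun (vcomp_cell g f) ` x = cfun g ` cfun f ` x"
proof -
  note F = two_cellsD[OF f] and G = two_cellsD[OF g]
  note c = es_map_compose[OF F(5) G(5)]
  have e: "cfun (vcomp_cell g f) = compose (Ev (st \<sigma>)) (cfun g) (cfun f)"
    using F(1) by (simp add: vcomp_cell_def)
  show "cfun (vcomp_cell g f) ` x = cfun g ` cfun f ` x" if "x \<in> conf (st \<sigma>)" for x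
    using c(2)[OF that] e by simp
  have "pol (st \<sigma>'') (cfun g (cfun f s)) = pol (st \<sigma>) s" if "s \<in> Ev (st \<sigma>)" for s
    using f g that es_mapD(1)[OF F(5) that] by (simp add: two_cells_def esp_map_def)
  moreover have "lab \<sigma>'' (cfun g (cfun f s)) = lab \<sigma> s" if "s \<in> Ev (st \<sigma>)" for s
    using F(6)[OF that] G(6) es_mapD(1)[OF F(5) that] by simp
  ultimately show "vcomp_cell g f \<in> two_cells \<sigma> \<sigma>''"
    using c(1) F(1-4) G(1-4) by (simp add: two_cells_def esp_map_def vcomp_cell_def compose_def)
qed

lemma iso_cell_from_conf:
  assumes E: "prestrategy E" and F: "prestrategy F" and eq: "src E = src F" "trg E = trg F"
    and \<Phi>: "\<And>x. x \<in> conf (st E) \<Longrightarrow> \<Phi> x \<in> conf (st F)"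
    and \<Psi>: "\<And>y. y \<in> conf (st F) \<Longrightarrow> \<Psi> y \<in> conf (st E)"
    and mono\<Phi>: "\<And>x y. x \<in> conf (st E) \<Longrightarrow> y \<in> conf (st E) \<Longrightarrow> x \<subseteq> y \<Longrightarrow> \<Phi> x \<subseteq> \<Phi> y"
    and mono\<Psi>: "\<And>x y. x \<in> conf (st F) \<Longrightarrow> y \<in> conf (st F) \<Longrightarrow> x \<subseteq> y \<Longrightarrow> \<Psi> x \<subseteq> \<Psi> y"
    and lab: "\<And>x. x \<in> conf (st E) \<Longrightarrow> lab F ` \<Phi> x = lab E ` x"
    and inv: "\<And>x. x \<in> conf (st E) \<Longrightarrow> \<Psi> (\<Phi> x) = x" "\<And>y. y \<in> conf (st F) \<Longrightarrow> \<Phi> (\<Psi> y) = y"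
  shows "\<exists>h. invertible two_cells id_cell vcomp_cell E F h \<and> (\<forall>x\<in>conf (st E). cfun h ` x = \<Phi> x)"
proof -
  have "\<exists>h k. es_map (st E) (st F) h \<and> es_map (st F) (st E) k \<and> (\<forall>x\<in>conf (st E). h ` x = \<Phi> x) \<and>
    (\<forall>y\<in>conf (st F). k ` y = \<Psi> y) \<and> (\<forall>e\<in>Ev (st E). lab F (h e) = lab E e) \<and>
    (\<forall>e\<in>Ev (st F). lab E (k e) = lab F e) \<and> (\<forall>e\<in>Ev (st E). k (h e) = e) \<and> (\<forall>e\<in>Ev (st F). h (k e) = e)"
    by (rule iso_from_conf[OF prestrategyD(3)[OF E] prestrategyD(3)[OF F]])
      (assumption | rule prestrategy_conf(1)[OF E] prestrategy_conf(1)[OF F] \<Phi> \<Psi> mono\<Phi> mono\<Psi> lab inv)+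
  then obtain h k where h: "es_map (st E) (st F) h" "\<forall>x\<in>conf (st E). h ` x = \<Phi> x"
      "\<forall>e\<in>Ev (st E). lab F (h e) = lab E e"
    and k: "es_map (st F) (st E) k" "\<forall>x\<in>conf (st F). k ` x = \<Psi> x" "\<forall>e\<in>Ev (st F). lab E (k e) = lab F e"
    by (elim exE conjE) (rule that; assumption)
  define H K where "H = \<lparr>cdom = E, ccod = F, cfun = h\<rparr>" and "K = \<lparr>cdom = F, ccod = E, cfun = k\<rparr>"
  have H: "H \<in> two_cells E F" unfolding H_def using two_cellsI[OF E F eq h(1)] h(3) by blast
  have K: "K \<in> two_cells F E" unfolding K_def using two_cellsI[OF F E eq[symmetric] k(1)] k(3) by blast
  have "vcomp_cell K H = id_cell E"
  proof (rule two_cell_eqI[OF E vcomp_cell_in(1)[OF H K] id_cell_in[OF E]])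
    fix x assume x: "x \<in> conf (st E)"
    show "cfun (vcomp_cell K H) ` x = cfun (id_cell E) ` x"
      using vcomp_cell_in(2)[OF H K x] id_cell_conf[OF x] h(2) k(2) x \<Phi>[OF x] inv(1)[OF x]
      by (simp add: H_def K_def)
  qed
  moreover have "vcomp_cell H K = id_cell F"
  proof (rule two_cell_eqI[OF F vcomp_cell_in(1)[OF K H] id_cell_in[OF F]])
    fix x assume x: "x \<in> conf (st F)"
    show "cfun (vcomp_cell H K) ` x = cfun (id_cell F) ` x"
      using vcomp_cell_in(2)[OF K H x] id_cell_conf[OF x] h(2) k(2) x \<Psi>[OF x] inv(2)[OF x]
      by (simp add: H_def K_def)
  qed
  ultimately have "invertible two_cells id_cell vcomp_cell E F H"
    unfolding invertible_def using H K by blast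
  moreover have "\<forall>x\<in>conf (st E). cfun H ` x = \<Phi> x" using h(2) by (simp add: H_def)
  ultimately show ?thesis by blast
qed

section \<open>Horizontal composition of 2-cells\<close>

text \<open>Schedules are functions of labels, so the same one serves for the images; causality in
  the images is reflected back by the maps.\<close>

lemma sync2_image:
  assumes pre: "prestrategy \<sigma>" "prestrategy \<tau>"
    and f: "f \<in> two_cells \<sigma> \<sigma>'" and g: "g \<in> two_cells \<tau> \<tau>'" and c: "sync2 \<tau> \<sigma> x y"
  shows "sync2 \<tau>' \<sigma>' (cfun f ` x) (cfun g ` y)"
proof -
  have xy: "x \<in> conf (st \<sigma>)" "y \<in> conf (st \<tau>)" using c by (auto simp: sync2_def match2_def)
  obtain \<rho> where \<rho>: "rank2 \<tau> \<sigma> x y \<rho>" using c by (auto simp: sync2_def)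
  have "match2 \<tau>' \<sigma>' (cfun f ` x) (cfun g ` y)"
    using c two_cell_conf[OF f xy(1)] two_cell_conf[OF g xy(2)] two_cell_lab[OF f xy(1)] two_cell_lab[OF g xy(2)]
    by (simp add: sync2_def match2_def)
  moreover have "rank2 \<tau>' \<sigma>' (cfun f ` x) (cfun g ` y) \<rho>"
    unfolding rank2_def
  proof (intro conjI ballI impI)
    fix s s' assume s: "s \<in> cfun f ` x" "s' \<in> cfun f ` x" "(s, s') \<in> Leq (st \<sigma>')" "s \<noteq> s'"
    then obtain a b where ab: "a \<in> x" "b \<in> x" "s = cfun f a" "s' = cfun f b" by blast
    then have "(a, b) \<in> Leq (st \<sigma>)" "a \<noteq> b"
      using es_map_reflect[OF prestrategyD(3)[OF pre(1)] two_cellsD(5)[OF f] xy(1)] s by auto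
    then have "\<rho> (lloc (lab \<sigma> a)) < \<rho> (lloc (lab \<sigma> b))" using \<rho> ab by (simp add: rank2_def)
    then show "\<rho> (lloc (lab \<sigma>' s)) < \<rho> (lloc (lab \<sigma>' s'))"
    proof -
      have "a \<in> Ev (st \<sigma>)" "b \<in> Ev (st \<sigma>)" using confD(2)[OF xy(1)] ab by auto
      then show ?thesis using two_cellsD(6)[OF f] ab \<open>\<rho> (lloc (lab \<sigma> a)) < \<rho> (lloc (lab \<sigma> b))\<close> by simp
    qed
  next
    fix s s' assume s: "s \<in> cfun g ` y" "s' \<in> cfun g ` y" "(s, s') \<in> Leq (st \<tau>')" "s \<noteq> s'"
    then obtain a b where ab: "a \<in> y" "b \<in> y" "s = cfun g a" "s' = cfun g b" by blast
    then have "(a, b) \<in> Leq (st \<tau>)" "a \<noteq> b"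
      using es_map_reflect[OF prestrategyD(3)[OF pre(2)] two_cellsD(5)[OF g] xy(2)] s by auto
    then have "\<rho> (In1 (lab \<tau> a)) < \<rho> (In1 (lab \<tau> b))" using \<rho> ab by (simp add: rank2_def)
    then show "\<rho> (In1 (lab \<tau>' s)) < \<rho> (In1 (lab \<tau>' s'))"
    proof -
      have "a \<in> Ev (st \<tau>)" "b \<in> Ev (st \<tau>)" using confD(2)[OF xy(2)] ab by auto
      then show ?thesis using two_cellsD(6)[OF g] ab \<open>\<rho> (In1 (lab \<tau> a)) < \<rho> (In1 (lab \<tau> b))\<close> by simp
    qed
  qed
  ultimately show ?thesis by (auto simp: sync2_def)
qed

locale inter_cells =
  D: inter \<sigma> \<tau> + C: inter \<sigma>' \<tau>' for \<sigma> \<tau> \<sigma>' \<tau>' :: "'u prestrat" +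
  fixes f g :: "'u two_cell"
  assumes f: "f \<in> two_cells \<sigma> \<sigma>'" and g: "g \<in> two_cells \<tau> \<tau>'"
begin

lemma ends: "src \<sigma>' = src \<sigma>" "trg \<tau>' = trg \<tau>"
  using two_cellsD(3)[OF f] two_cellsD(4)[OF g] by simp_all

abbreviation "pf \<equiv> par_map (st \<sigma>) (trg \<tau>) (cfun f) (\<lambda>c. c)"
abbreviation "pg \<equiv> par_map (src \<sigma>) (st \<tau>) (\<lambda>a. a) (cfun g)"

text \<open>The property by which \<open>inter_cell\<close> selects its map through
  \<open>THE\<close>; existence and uniqueness are what has to be shown.\<close>

definition is_inter_map :: "('u ev \<Rightarrow> 'u ev) \<Rightarrow> bool" where
  "is_inter_map h \<longleftrightarrow> es_map (inter_es \<tau> \<sigma>) (inter_es \<tau>' \<sigma>') h \<and>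
     (\<forall>e\<in>Ev (inter_es \<tau> \<sigma>). inter_proj1 \<tau>' \<sigma>' (h e) = pf (inter_proj1 \<tau> \<sigma> e) \<and>
        inter_proj2 \<tau>' \<sigma>' (h e) = pg (inter_proj2 \<tau> \<sigma> e))"

lemma inter_cell_eq: "inter_cell g f = (THE h. is_inter_map h)"
  unfolding inter_cell_def is_inter_map_def Let_def two_cellsD(1,2)[OF f] two_cellsD(1,2)[OF g] ..

lemma pf_simps [simp]: "s \<in> Ev (st \<sigma>) \<Longrightarrow> pf (In0 s) = In0 (cfun f s)" "c \<in> Ev (trg \<tau>) \<Longrightarrow> pf (In1 c) = In1 c"
  by (simp_all add: par_map_def par_simps copair_def)

lemma pg_simps [simp]: "s \<in> Ev (st \<tau>) \<Longrightarrow> pg (In1 s) = In1 (cfun g s)" "c \<in> Ev (src \<sigma>) \<Longrightarrow> pg (In0 c) = In0 c"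
  by (simp_all add: par_map_def par_simps copair_def)

lemma pf_lpart:
  assumes c: "sync2 \<tau> \<sigma> x y" shows "pf ` lpart \<tau> x y = lpart \<tau>' (cfun f ` x) (cfun g ` y)"
proof -
  have xy: "x \<in> conf (st \<sigma>)" "y \<in> conf (st \<tau>)" using c by (auto simp: sync2_def match2_def)
  have "pf ` In0 ` x = In0 ` cfun f ` x"
    unfolding image_image using confD(2)[OF xy(1)] by (intro image_cong) auto
  moreover have "pf ` In1 ` c = In1 ` c" if "c \<subseteq> Ev (trg \<tau>)" for c
    unfolding image_image using that by (intro image_cong) auto
  from this[OF confD(2)[OF prestrategy_conf(3)[OF D.pre\<tau> xy(2)]]]
  have "pf ` In1 ` (In1 -` lab \<tau> ` y) = In1 ` (In1 -` lab \<tau> ` y)" .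
  ultimately show ?thesis by (simp add: lpart_def image_Un two_cell_lab[OF g xy(2)])
qed

lemma pg_rpart:
  assumes c: "sync2 \<tau> \<sigma> x y" shows "pg ` rpart \<sigma> x y = rpart \<sigma>' (cfun f ` x) (cfun g ` y)"
proof -
  have xy: "x \<in> conf (st \<sigma>)" "y \<in> conf (st \<tau>)" using c by (auto simp: sync2_def match2_def)
  have "pg ` In1 ` y = In1 ` cfun g ` y"
    unfolding image_image using confD(2)[OF xy(2)] by (intro image_cong) auto
  moreover have "pg ` In0 ` c = In0 ` c" if "c \<subseteq> Ev (src \<sigma>)" for c
    unfolding image_image using that by (intro image_cong) auto
  from this[OF confD(2)[OF prestrategy_conf(2)[OF D.pre\<sigma> xy(1)]]]
  have "pg ` In0 ` (In0 -` lab \<sigma> ` x) = In0 ` (In0 -` lab \<sigma> ` x)" .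
  ultimately show ?thesis by (simp add: rpart_def image_Un two_cell_lab[OF f xy(1)])
qed

lemma sync2': "sync2 \<tau> \<sigma> x y \<Longrightarrow> sync2 \<tau>' \<sigma>' (cfun f ` x) (cfun g ` y)"
  by (rule sync2_image[OF D.pre\<sigma> D.pre\<tau> f g])

text \<open>The two projections of the image are prescribed, and a configuration of the interaction
  is determined by its projections.\<close>

lemma is_inter_map_conf:
  assumes h: "is_inter_map h" and c: "sync2 \<tau> \<sigma> x y"
  shows "h ` iconf \<tau> \<sigma> x y = iconf \<tau>' \<sigma>' (cfun f ` x) (cfun g ` y)"
proof -
  have z: "iconf \<tau> \<sigma> x y \<in> conf (inter_es \<tau> \<sigma>)" by (rule D.iconf_conf[OF c])
  have hz: "h ` iconf \<tau> \<sigma> x y \<in> conf (inter_es \<tau>' \<sigma>')" using h z by (simp add: is_inter_map_def es_map_def)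
  have "inter_proj1 \<tau>' \<sigma>' ` h ` iconf \<tau> \<sigma> x y = pf ` inter_proj1 \<tau> \<sigma> ` iconf \<tau> \<sigma> x y"
    unfolding image_image using h confD(2)[OF z] by (intro image_cong) (auto simp: is_inter_map_def)
  moreover have "inter_proj2 \<tau>' \<sigma>' ` h ` iconf \<tau> \<sigma> x y = pg ` inter_proj2 \<tau> \<sigma> ` iconf \<tau> \<sigma> x y"
    unfolding image_image using h confD(2)[OF z] by (intro image_cong) (auto simp: is_inter_map_def)
  ultimately show ?thesis
    using C.P.conf_eq_proj[OF hz[unfolded C.inter_es_W] C.iconf_conf[OF sync2'[OF c], unfolded C.inter_es_W]]
      D.inter_proj_iconf[OF c] pf_lpart[OF c] pg_rpart[OF c] C.inter_proj_iconf[OF sync2'[OF c]]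
    by (simp add: inter_proj1_def inter_proj2_def)
qed

text \<open>The map is built from its action on configurations, with \<open>inter_map\<close> as
  labelling. That construction controls labels only; the equations for the projections follow
  because the labelling of each component is injective on configurations.\<close>

lemma is_inter_map_ex: "\<exists>h. is_inter_map h"
proof -
  \<comment> \<open>The pair behind a configuration is read off from its projections:
    \<open>x\<close> is the \<open>In0\<close> part of the first and \<open>y\<close> is the
    \<open>In1\<close> part of the second.\<close>
  define \<Phi> where "\<Phi> z = iconf \<tau>' \<sigma>' (cfun f ` (In0 -` inter_proj1 \<tau> \<sigma> ` z)) (cfun g ` (In1 -` inter_proj2 \<tau> \<sigma> ` z))" for z
  have lr: "In0 -` lpart \<tau> x y = x" "In1 -` rpart \<sigma> x y = y" for x y by (auto simp: lpart_def rpart_def)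
  have \<Phi>: "\<Phi> (iconf \<tau> \<sigma> x y) = iconf \<tau>' \<sigma>' (cfun f ` x) (cfun g ` y)" if "sync2 \<tau> \<sigma> x y" for x y
    unfolding \<Phi>_def D.inter_proj_iconf[OF that] lr ..
  have "\<exists>h. es_map (inter_es \<tau> \<sigma>) (inter_es \<tau>' \<sigma>') h \<and> (\<forall>z\<in>conf (inter_es \<tau> \<sigma>). h ` z = \<Phi> z) \<and>
      (\<forall>e\<in>Ev (inter_es \<tau> \<sigma>). inter_map \<tau>' \<sigma>' (h e) = inter_map \<tau> \<sigma> e)"
  proof (rule map_from_conf[OF D.inter_es C.inter_es D.inter_map_inj C.inter_map_inj])
    fix z assume z: "z \<in> conf (inter_es \<tau> \<sigma>)"
    then obtain x y where c: "sync2 \<tau> \<sigma> x y" "z = iconf \<tau> \<sigma> x y" using D.conf_iconf by blast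
    show "\<Phi> z \<in> conf (inter_es \<tau>' \<sigma>')" using C.iconf_conf[OF sync2'[OF c(1)]] \<Phi>[OF c(1)] c(2) by simp
    have xy: "x \<in> conf (st \<sigma>)" "y \<in> conf (st \<tau>)" using c(1) by (auto simp: sync2_def match2_def)
    show "inter_map \<tau>' \<sigma>' ` \<Phi> z = inter_map \<tau> \<sigma> ` z"
      unfolding c(2) \<Phi>[OF c(1)] D.inter_map_iconf[OF c(1)] C.inter_map_iconf[OF sync2'[OF c(1)]]
        two_cell_lab[OF f xy(1)] two_cell_lab[OF g xy(2)] ..
    fix z' assume z': "z' \<in> conf (inter_es \<tau> \<sigma>)" and sub: "z \<subseteq> z'"
    then obtain x' y' where c': "sync2 \<tau> \<sigma> x' y'" "z' = iconf \<tau> \<sigma> x' y'" using D.conf_iconf by blast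
    then have "x \<subseteq> x'" "y \<subseteq> y'" using D.iconf_subset[OF c(1) c'(1)] c(2) sub by auto
    then have "iconf \<tau>' \<sigma>' (cfun f ` x) (cfun g ` y) \<subseteq> iconf \<tau>' \<sigma>' (cfun f ` x') (cfun g ` y')"
      by (intro iconf_mono image_mono)
    then show "\<Phi> z \<subseteq> \<Phi> z'"
      unfolding c(2) c'(2) \<Phi>[OF c(1)] \<Phi>[OF c'(1)] .
  qed
  then obtain h where h: "es_map (inter_es \<tau> \<sigma>) (inter_es \<tau>' \<sigma>') h"
    "\<forall>z\<in>conf (inter_es \<tau> \<sigma>). h ` z = \<Phi> z"
    "\<forall>e\<in>Ev (inter_es \<tau> \<sigma>). inter_map \<tau>' \<sigma>' (h e) = inter_map \<tau> \<sigma> e"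
    by (elim exE conjE) (rule that; assumption)
  note h = h(1) h(2,3)[rule_format]
  have "inter_proj1 \<tau>' \<sigma>' (h e) = pf (inter_proj1 \<tau> \<sigma> e) \<and> inter_proj2 \<tau>' \<sigma>' (h e) = pg (inter_proj2 \<tau> \<sigma> e)"
    if e: "e \<in> Ev (inter_es \<tau> \<sigma>)" for e
  proof -
    obtain z where z: "z \<in> conf (inter_es \<tau> \<sigma>)" "e \<in> z" using Ev_in_conf[OF D.inter_es e] by blast
    then obtain x y where c: "sync2 \<tau> \<sigma> x y" "z = iconf \<tau> \<sigma> x y" using D.conf_iconf by blast
    have xy: "x \<in> conf (st \<sigma>)" "y \<in> conf (st \<tau>)" using c(1) by (auto simp: sync2_def match2_def)
    have he: "h e \<in> iconf \<tau>' \<sigma>' (cfun f ` x) (cfun g ` y)" "h e \<in> Ev (inter_es \<tau>' \<sigma>')"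
      using h(2)[OF z(1)] z(2) \<Phi>[OF c(1)] c(2) es_mapD(1)[OF h(1) e] by auto
    have p: "inter_proj1 \<tau> \<sigma> e \<in> lpart \<tau> x y" "inter_proj2 \<tau> \<sigma> e \<in> rpart \<sigma> x y"
      using D.inter_proj_iconf[OF c(1)] z(2) c(2) by blast+
    have p': "inter_proj1 \<tau>' \<sigma>' (h e) \<in> lpart \<tau>' (cfun f ` x) (cfun g ` y)"
      "inter_proj2 \<tau>' \<sigma>' (h e) \<in> rpart \<sigma>' (cfun f ` x) (cfun g ` y)"
      using C.inter_proj_iconf[OF sync2'[OF c(1)]] he(1) by blast+
    have pp: "pf (inter_proj1 \<tau> \<sigma> e) \<in> lpart \<tau>' (cfun f ` x) (cfun g ` y)"
      "pg (inter_proj2 \<tau> \<sigma> e) \<in> rpart \<sigma>' (cfun f ` x) (cfun g ` y)"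
      using p pf_lpart[OF c(1)] pg_rpart[OF c(1)] by blast+
    have fx: "cfun f ` x \<in> conf (st \<sigma>')" and gy: "cfun g ` y \<in> conf (st \<tau>')"
      using two_cell_conf[OF f xy(1)] two_cell_conf[OF g xy(2)] .
    have C1: "In1 -` lab \<tau> ` y \<subseteq> Ev (trg \<tau>)" using confD(2)[OF prestrategy_conf(3)[OF D.pre\<tau> xy(2)]] .
    have A1: "In0 -` lab \<sigma> ` x \<subseteq> Ev (src \<sigma>)" using confD(2)[OF prestrategy_conf(2)[OF D.pre\<sigma> xy(1)]] .
    \<comment> \<open>The cells preserve labels, so both candidates for the projection of
      \<open>h e\<close> have the same label in the left component, and both lie in the same
      configuration there. The fact \<open>R\<close> does the same on the right.\<close>
    have L: "left_map \<tau>' \<sigma>' (pf l) = left_map \<tau> \<sigma> l" if "l \<in> lpart \<tau> x y" for l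
    proof -
      from that consider s where "l = In0 s" "s \<in> x" | d where "l = In1 d" "d \<in> Ev (trg \<tau>)"
        using C1 unfolding lpart_def by blast
      then show ?thesis
      proof cases
        case 1
        then have "s \<in> Ev (st \<sigma>)" using confD(2)[OF xy(1)] by blast
        then show ?thesis
          using 1 D.left_img(2)[OF xy(1), of "{}"] C.left_img(2)[OF fx, of "{}"] two_cellsD(6)[OF f]
            es_mapD(1)[OF two_cellsD(5)[OF f]] by simp
      next
        case 2
        then show ?thesis
          using D.left_img(3)[OF xy(1), of "{}"] C.left_img(3)[OF fx, of "{}"] ends by simp
      qed
    qed
    have R: "right_map \<tau>' \<sigma>' (pg l) = right_map \<tau> \<sigma> l" if "l \<in> rpart \<sigma> x y" for l
    proof -
      from that consider s where "l = In1 s" "s \<in> y" | d where "l = In0 d" "d \<in> Ev (src \<sigma>)"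
        using A1 unfolding rpart_def by blast
      then show ?thesis
      proof cases
        case 1
        then have "s \<in> Ev (st \<tau>)" using confD(2)[OF xy(2)] by blast
        then show ?thesis
          using 1 D.right_img(2)[OF xy(2), of "{}"] C.right_img(2)[OF gy, of "{}"] two_cellsD(6)[OF g]
            es_mapD(1)[OF two_cellsD(5)[OF g]] by simp
      next
        case 2
        then show ?thesis
          using D.right_img(3)[OF xy(2), of "{}"] C.right_img(3)[OF gy, of "{}"] ends by simp
      qed
    qed
    have m': "match2 \<tau>' \<sigma>' (cfun f ` x) (cfun g ` y)" using sync2'[OF c(1)] by (simp add: sync2_def)
    have 1: "left_map \<tau>' \<sigma>' (inter_proj1 \<tau>' \<sigma>' (h e)) = left_map \<tau>' \<sigma>' (pf (inter_proj1 \<tau> \<sigma> e))"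
      using C.inter_map_eq[OF he(2)] D.inter_map_eq[OF e] h(3)[OF e] L[OF p(1)] by simp
    have com: "left_map \<tau> \<sigma> (inter_proj1 \<tau> \<sigma> e) = right_map \<tau> \<sigma> (inter_proj2 \<tau> \<sigma> e)"
      using D.P.wedge_commute[of e] e by (simp add: inter_proj1_def inter_proj2_def D.inter_es_W)
    have com': "left_map \<tau>' \<sigma>' (inter_proj1 \<tau>' \<sigma>' (h e)) = right_map \<tau>' \<sigma>' (inter_proj2 \<tau>' \<sigma>' (h e))"
      using C.P.wedge_commute[of "h e"] he(2) by (simp add: inter_proj1_def inter_proj2_def C.inter_es_W)
    have 2: "right_map \<tau>' \<sigma>' (inter_proj2 \<tau>' \<sigma>' (h e)) = right_map \<tau>' \<sigma>' (pg (inter_proj2 \<tau> \<sigma> e))"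
      using 1 com com' L[OF p(1)] R[OF p(2)] by simp
    show ?thesis
      using inj_onD[OF C.P.inj\<sigma>[OF C.lpart_conf[OF m']] 1 p'(1) pp(1)]
        inj_onD[OF C.P.inj\<tau>[OF C.rpart_conf[OF m']] 2 p'(2) pp(2)] by simp
  qed
  then show ?thesis using h(1) unfolding is_inter_map_def by blast
qed

lemma inter_cell_is_map: "is_inter_map (inter_cell g f)"
proof -
  obtain h where h: "is_inter_map h" using is_inter_map_ex by blast
  have "h' = h" if h': "is_inter_map h'" for h'
  proof (rule es_map_eqI[OF D.inter_es])
    show "es_map (inter_es \<tau> \<sigma>) (inter_es \<tau>' \<sigma>') h'" "es_map (inter_es \<tau> \<sigma>) (inter_es \<tau>' \<sigma>') h"
      using h h' by (simp_all add: is_inter_map_def)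
    fix z assume "z \<in> conf (inter_es \<tau> \<sigma>)"
    then obtain x y where "sync2 \<tau> \<sigma> x y" "z = iconf \<tau> \<sigma> x y" using D.conf_iconf by blast
    then show "h' ` z = h ` z" using is_inter_map_conf h h' by simp
  qed
  then show ?thesis unfolding inter_cell_eq using theI[of is_inter_map, OF h] by blast
qed

lemma inter_map_inter_cell:
  assumes e: "e \<in> Ev (inter_es \<tau> \<sigma>)"
  shows "inter_map \<tau>' \<sigma>' (inter_cell g f e) = inter_map \<tau> \<sigma> e"
proof -
  note m = inter_cell_is_map
  have E: "inter_cell g f e \<in> Ev (inter_es \<tau>' \<sigma>')"
    using es_mapD(1)[OF m[unfolded is_inter_map_def, THEN conjunct1] e] .
  have "inter_proj1 \<tau> \<sigma> e \<in> Ev (left_es \<tau> \<sigma>)"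
  proof -
    obtain z where z: "z \<in> conf (inter_es \<tau> \<sigma>)" "e \<in> z" using Ev_in_conf[OF D.inter_es e] by blast
    then obtain x y where c: "sync2 \<tau> \<sigma> x y" "z = iconf \<tau> \<sigma> x y" using D.conf_iconf by blast
    then show ?thesis
      using D.inter_proj_iconf(1)[OF c(1)] z(2) confD(2)[OF D.lpart_conf[OF D.sync2_match[OF c(1)]]] by blast
  qed
  then consider s where "inter_proj1 \<tau> \<sigma> e = In0 s" "s \<in> Ev (st \<sigma>)"
    | d where "inter_proj1 \<tau> \<sigma> e = In1 d" "d \<in> Ev (trg \<tau>)" by (auto simp: left_es_def par_simps)
  then have "left_map \<tau>' \<sigma>' (pf (inter_proj1 \<tau> \<sigma> e)) = left_map \<tau> \<sigma> (inter_proj1 \<tau> \<sigma> e)"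
  proof cases
    case 1
    then show ?thesis
      using D.left_img(2)[OF conf_empty[OF prestrategyD(3)[OF D.pre\<sigma>]], of "{}"]
        C.left_img(2)[OF conf_empty[OF prestrategyD(3)[OF C.pre\<sigma>]], of "{}"]
        two_cellsD(6)[OF f] es_mapD(1)[OF two_cellsD(5)[OF f]] by simp
  next
    case 2
    then show ?thesis
      using D.left_img(3)[OF conf_empty[OF prestrategyD(3)[OF D.pre\<sigma>]], of "{}"]
        C.left_img(3)[OF conf_empty[OF prestrategyD(3)[OF C.pre\<sigma>]], of "{}"] ends by simp
  qed
  then show ?thesis
    using m e C.inter_map_eq[OF E] D.inter_map_eq[OF e] by (simp add: is_inter_map_def)
qed

lemma visible_inter_cell:
  assumes "e \<in> Ev (inter_es \<tau> \<sigma>)"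
  shows "inter_cell g f e \<in> visible \<tau>' \<sigma>' \<longleftrightarrow> e \<in> visible \<tau> \<sigma>"
  using assms inter_map_inter_cell[OF assms] inter_cell_is_map es_mapD(1)[of "inter_es \<tau> \<sigma>" "inter_es \<tau>' \<sigma>'"] ends
  unfolding is_inter_map_def by (simp add: visible_def)

text \<open>Hiding commutes with the interaction map because visibility is preserved and reflected.
  From here on this formula replaces the description of the horizontal composite by
  projections.\<close>

lemma hcomp_vis:
  assumes c: "sync2 \<tau> \<sigma> x y"
  shows "cfun (hcomp_cell g f) ` vis \<tau> \<sigma> x y = vis \<tau>' \<sigma>' (cfun f ` x) (cfun g ` y)"
proof -
  have I: "iconf \<tau> \<sigma> x y \<subseteq> Ev (inter_es \<tau> \<sigma>)" using confD(2)[OF D.iconf_conf[OF c]] .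
  have "cfun (hcomp_cell g f) ` vis \<tau> \<sigma> x y = inter_cell g f ` (iconf \<tau> \<sigma> x y \<inter> visible \<tau> \<sigma>)"
    unfolding vis_def by (intro image_cong) (auto simp: hcomp_cell_def two_cellsD(1)[OF f] two_cellsD(1)[OF g])
  also have "\<dots> = inter_cell g f ` iconf \<tau> \<sigma> x y \<inter> visible \<tau>' \<sigma>'"
    using I visible_inter_cell by blast
  finally show ?thesis by (simp add: is_inter_map_conf[OF inter_cell_is_map c] vis_def)
qed

lemma hcomp_in: "hcomp_cell g f \<in> two_cells (\<tau> \<odot>\<^sub>s \<sigma>) (\<tau>' \<odot>\<^sub>s \<sigma>')"
proof -
  let ?h = "\<lambda>e\<in>visible \<tau> \<sigma>. inter_cell g f e"
  have eq: "hcomp_cell g f = \<lparr>cdom = \<tau> \<odot>\<^sub>s \<sigma>, ccod = \<tau>' \<odot>\<^sub>s \<sigma>', cfun = ?h\<rparr>"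
    by (simp add: hcomp_cell_def two_cellsD[OF f] two_cellsD[OF g])
  have vE: "e \<in> Ev (inter_es \<tau> \<sigma>)" if "e \<in> visible \<tau> \<sigma>" for e using that by (simp add: visible_def)
  have "es_map (st (\<tau> \<odot>\<^sub>s \<sigma>)) (st (\<tau>' \<odot>\<^sub>s \<sigma>')) ?h"
    unfolding es_map_def
  proof (intro conjI ballI)
    show "?h \<in> Ev (st (\<tau> \<odot>\<^sub>s \<sigma>)) \<rightarrow>\<^sub>E Ev (st (\<tau>' \<odot>\<^sub>s \<sigma>'))"
      unfolding D.comp_simps C.comp_simps using visible_inter_cell vE by auto
    fix z assume z: "z \<in> conf (st (\<tau> \<odot>\<^sub>s \<sigma>))"
    then obtain x y where c: "sync2 \<tau> \<sigma> x y" "z = vis \<tau> \<sigma> x y" using D.conf_vis by blast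
    show "?h ` z \<in> conf (st (\<tau>' \<odot>\<^sub>s \<sigma>'))"
      using hcomp_vis[OF c(1)] C.vis_conf[OF sync2'[OF c(1)]] c(2) by (simp add: eq)
    have "inj_on (inter_cell g f) (iconf \<tau> \<sigma> x y)"
      using inter_cell_is_map D.iconf_conf[OF c(1)] by (simp add: is_inter_map_def es_map_def)
    then have "inj_on (inter_cell g f) z" using c(2) by (auto simp: vis_def intro: inj_on_subset)
    then show "inj_on ?h z" using c(2) by (auto simp: vis_def inj_on_def)
  qed
  moreover have "lab (\<tau>' \<odot>\<^sub>s \<sigma>') (?h e) = lab (\<tau> \<odot>\<^sub>s \<sigma>) e" if "e \<in> Ev (st (\<tau> \<odot>\<^sub>s \<sigma>))" for e
    using that visible_inter_cell[OF vE] inter_map_inter_cell[OF vE]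
    unfolding D.comp_simps C.comp_simps by (simp add: comp_lab_def D.comp_Ev C.comp_Ev)
  ultimately show ?thesis
    unfolding eq using ends D.comp_simps C.comp_simps
    by (intro two_cellsI D.comp_prestrategy C.comp_prestrategy) simp_all
qed

end

lemma hcomp_id:
  assumes "inter \<sigma> \<tau>"
  shows "hcomp_cell (id_cell \<tau>) (id_cell \<sigma>) = id_cell (\<tau> \<odot>\<^sub>s \<sigma>)"
proof -
  interpret inter \<sigma> \<tau> by fact
  interpret I: inter_cells \<sigma> \<tau> \<sigma> \<tau> "id_cell \<sigma>" "id_cell \<tau>"
    by unfold_locales (use pre\<sigma> pre\<tau> id_cell_in in auto)
  show ?thesis
  proof (rule two_cell_eqI[OF comp_prestrategy I.hcomp_in id_cell_in[OF comp_prestrategy]])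
    fix z assume z: "z \<in> conf (st (\<tau> \<odot>\<^sub>s \<sigma>))"
    then obtain x y where c: "sync2 \<tau> \<sigma> x y" "z = vis \<tau> \<sigma> x y" using conf_vis by blast
    then have "x \<in> conf (st \<sigma>)" "y \<in> conf (st \<tau>)" by (auto simp: sync2_def match2_def)
    then show "cfun (hcomp_cell (id_cell \<tau>) (id_cell \<sigma>)) ` z = cfun (id_cell (\<tau> \<odot>\<^sub>s \<sigma>)) ` z"
      using I.hcomp_vis[OF c(1)] id_cell_conf[OF z] by (simp add: c(2) id_cell_conf)
  qed
qed

text \<open>On a configuration given by a pair, both sides apply the images of the two cells
  componentwise, so the law is functoriality of images.\<close>

lemma hcomp_interchange:
  assumes "inter \<sigma> \<tau>" "inter \<sigma>' \<tau>'" "inter \<sigma>'' \<tau>''"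
    and f: "f \<in> two_cells \<sigma> \<sigma>'" "f' \<in> two_cells \<sigma>' \<sigma>''" and g: "g \<in> two_cells \<tau> \<tau>'" "g' \<in> two_cells \<tau>' \<tau>''"
  shows "hcomp_cell (vcomp_cell g' g) (vcomp_cell f' f) = vcomp_cell (hcomp_cell g' f') (hcomp_cell g f)"
proof -
  interpret A: inter \<sigma> \<tau> by fact
  interpret B: inter \<sigma>' \<tau>' by fact
  interpret C: inter \<sigma>'' \<tau>'' by fact
  interpret AB: inter_cells \<sigma> \<tau> \<sigma>' \<tau>' f g by unfold_locales (use f g in auto)
  interpret BC: inter_cells \<sigma>' \<tau>' \<sigma>'' \<tau>'' f' g' by unfold_locales (use f g in auto)
  interpret AC: inter_cells \<sigma> \<tau> \<sigma>'' \<tau>'' "vcomp_cell f' f" "vcomp_cell g' g"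
    by unfold_locales (use vcomp_cell_in f g in blast)+
  show ?thesis
  proof (rule two_cell_eqI[OF A.comp_prestrategy AC.hcomp_in vcomp_cell_in(1)[OF AB.hcomp_in BC.hcomp_in]])
    fix z assume z: "z \<in> conf (st (\<tau> \<odot>\<^sub>s \<sigma>))"
    then obtain x y where c: "sync2 \<tau> \<sigma> x y" "z = vis \<tau> \<sigma> x y" using A.conf_vis by blast
    then have xy: "x \<in> conf (st \<sigma>)" "y \<in> conf (st \<tau>)" by (auto simp: sync2_def match2_def)
    show "cfun (hcomp_cell (vcomp_cell g' g) (vcomp_cell f' f)) ` z
        = cfun (vcomp_cell (hcomp_cell g' f') (hcomp_cell g f)) ` z"
      unfolding vcomp_cell_in(2)[OF AB.hcomp_in BC.hcomp_in z]
      unfolding c(2) AC.hcomp_vis[OF c(1)] AB.hcomp_vis[OF c(1)] BC.hcomp_vis[OF AB.sync2'[OF c(1)]]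
        vcomp_cell_in(2)[OF f xy(1)] vcomp_cell_in(2)[OF g xy(2)] ..
  qed
qed

lemma two_cells_category:
  assumes "\<And>\<sigma>. \<sigma> \<in> Ob \<Longrightarrow> prestrategy \<sigma>"
  shows "is_category Ob two_cells id_cell vcomp_cell"
  unfolding is_category_def
proof (intro conjI ballI)
  show "id_cell f \<in> two_cells f f" if "f \<in> Ob" for f using assms that id_cell_in by blast
next
  fix f g h \<phi> \<psi> assume "\<phi> \<in> two_cells f g" "\<psi> \<in> two_cells g h"
  then show "vcomp_cell \<psi> \<phi> \<in> two_cells f h" by (rule vcomp_cell_in(1))
next
  fix f g \<phi> assume fg: "f \<in> Ob" "g \<in> Ob" and \<phi>: "\<phi> \<in> two_cells f g"
  note i = id_cell_in[OF assms[OF fg(1)]] id_cell_in[OF assms[OF fg(2)]]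
  show "vcomp_cell \<phi> (id_cell f) = \<phi>"
    by (rule two_cell_eqI[OF assms[OF fg(1)] vcomp_cell_in(1)[OF i(1) \<phi>] \<phi>])
      (simp add: vcomp_cell_in(2)[OF i(1) \<phi>] id_cell_conf)
  show "vcomp_cell (id_cell g) \<phi> = \<phi>"
    by (rule two_cell_eqI[OF assms[OF fg(1)] vcomp_cell_in(1)[OF \<phi> i(2)] \<phi>])
      (simp add: vcomp_cell_in(2)[OF \<phi> i(2)] id_cell_conf two_cell_conf[OF \<phi>])
next
  fix f g h k \<phi> \<psi> \<chi> assume f: "f \<in> Ob"
    and c: "\<phi> \<in> two_cells f g" "\<psi> \<in> two_cells g h" "\<chi> \<in> two_cells h k"
  note c1 = vcomp_cell_in[OF c(1,2)] and c2 = vcomp_cell_in[OF c(2,3)]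
  show "vcomp_cell \<chi> (vcomp_cell \<psi> \<phi>) = vcomp_cell (vcomp_cell \<chi> \<psi>) \<phi>"
    by (rule two_cell_eqI[OF assms[OF f] vcomp_cell_in(1)[OF c1(1) c(3)] vcomp_cell_in(1)[OF c(1) c2(1)]])
      (simp add: vcomp_cell_in(2)[OF c1(1) c(3)] vcomp_cell_in(2)[OF c(1) c2(1)] c1(2) c2(2) two_cell_conf[OF c(1)])
qed

section \<open>Synchronised states of a chain of pre-strategies\<close>

text \<open>
  A chain \<open>\<Sigma> i, \<dots>, \<Sigma> (j - 1)\<close> of composable pre-strategies, \<open>\<Sigma> k\<close> going from game \<open>k\<close> to game
  \<open>Suc k\<close>, is composed at once: a state consists of configurations of all the \<open>\<Sigma> k\<close> that agree on
  the intermediate games and admit a common schedule \<open>\<rho>\<close>. This does not mention any bracketing, so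
  all bracketed composites are presented by the same states.
\<close>

definition sec :: "nat \<Rightarrow> (nat \<times> 'a) set \<Rightarrow> 'a set" where
  "sec k w = {s. (k, s) \<in> w}"

definition seg :: "nat \<Rightarrow> nat \<Rightarrow> (nat \<times> 'a) set \<Rightarrow> (nat \<times> 'a) set" where
  "seg i j w = {(k, s). (k, s) \<in> w \<and> i \<le> k \<and> k < j}"

text \<open>Moves are located by the index of their game, so that the right side of one pre-strategy
  and the left side of the next are named alike.\<close>

definition dl :: "nat \<Rightarrow> nat \<Rightarrow> 'u ev \<Rightarrow> nat \<times> 'u ev" where
  "dl i j = copair (Pair i) (Pair j)"

lemma dl_simps [simp]: "dl i j (In0 a) = (i, a)" "dl i j (In1 a) = (j, a)"
  by (simp_all add: dl_def copair_def)

definition chain :: "(nat \<Rightarrow> 'u prestrat) \<Rightarrow> nat \<Rightarrow> nat \<Rightarrow> bool" where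
  "chain \<Sigma> i j \<longleftrightarrow> i < j \<and> (\<forall>k. i \<le> k \<and> k < j \<longrightarrow> prestrategy (\<Sigma> k)) \<and>
     (\<forall>k. i \<le> k \<and> Suc k < j \<longrightarrow> trg (\<Sigma> k) = src (\<Sigma> (Suc k)))"

definition matching :: "(nat \<Rightarrow> 'u prestrat) \<Rightarrow> nat \<Rightarrow> nat \<Rightarrow> (nat \<times> 'u ev) set \<Rightarrow> bool" where
  "matching \<Sigma> i j w \<longleftrightarrow> (\<forall>k s. (k, s) \<in> w \<longrightarrow> i \<le> k \<and> k < j) \<and>
     (\<forall>k. i \<le> k \<and> k < j \<longrightarrow> sec k w \<in> conf (st (\<Sigma> k))) \<and>
     (\<forall>k. i \<le> k \<and> Suc k < j \<longrightarrow> In1 -` lab (\<Sigma> k) ` sec k w = In0 -` lab (\<Sigma> (Suc k)) ` sec (Suc k) w)"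

text \<open>Two events of neighbouring pre-strategies that are matched over the shared game have the
  same location; this is how a schedule identifies them.\<close>

definition evloc :: "(nat \<Rightarrow> 'u prestrat) \<Rightarrow> nat \<times> 'u ev \<Rightarrow> nat \<times> 'u ev" where
  "evloc \<Sigma> e = dl (fst e) (Suc (fst e)) (lab (\<Sigma> (fst e)) (snd e))"

definition ranked :: "(nat \<Rightarrow> 'u prestrat) \<Rightarrow> nat \<Rightarrow> nat \<Rightarrow> (nat \<times> 'u ev) set \<Rightarrow> (nat \<times> 'u ev \<Rightarrow> nat) \<Rightarrow> bool" where
  "ranked \<Sigma> i j w \<rho> \<longleftrightarrow> (\<forall>k s s'. i \<le> k \<and> k < j \<and> s \<in> sec k w \<and> s' \<in> sec k w \<and> (s, s') \<in> Leq (st (\<Sigma> k)) \<and> s \<noteq> s'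
     \<longrightarrow> \<rho> (evloc \<Sigma> (k, s)) < \<rho> (evloc \<Sigma> (k, s')))"

definition sync :: "(nat \<Rightarrow> 'u prestrat) \<Rightarrow> nat \<Rightarrow> nat \<Rightarrow> (nat \<times> 'u ev) set \<Rightarrow> bool" where
  "sync \<Sigma> i j w \<longleftrightarrow> matching \<Sigma> i j w \<and> (\<exists>\<rho>. ranked \<Sigma> i j w \<rho>)"

text \<open>The labels on the two outer games, \<open>i\<close> and \<open>j\<close>; the last
  pre-strategy of the half-open chain has index \<open>j - 1\<close>.\<close>

definition vlab :: "(nat \<Rightarrow> 'u prestrat) \<Rightarrow> nat \<Rightarrow> nat \<Rightarrow> (nat \<times> 'u ev) set \<Rightarrow> 'u ev set" where
  "vlab \<Sigma> i j w = In0 ` (In0 -` lab (\<Sigma> i) ` sec i w) \<union> In1 ` (In1 -` lab (\<Sigma> (j - 1)) ` sec (j - 1) w)"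

lemma vlab_vimage [simp]:
  "In0 -` vlab \<Sigma> i j w = In0 -` lab (\<Sigma> i) ` sec i w"
  "In1 -` vlab \<Sigma> i j w = In1 -` lab (\<Sigma> (j - 1)) ` sec (j - 1) w"
  unfolding vlab_def by auto

lemma In_sec_iff: "a \<in> F -` l ` sec k w \<longleftrightarrow> (\<exists>s. (k, s) \<in> w \<and> l s = F a)"
  unfolding sec_def vimage_def image_def by (auto dest: sym)

lemma vlab_iff: "g \<in> vlab \<Sigma> i j w \<longleftrightarrow> (\<exists>a s. g = In0 a \<and> (i, s) \<in> w \<and> lab (\<Sigma> i) s = In0 a) \<or>
    (\<exists>b s. g = In1 b \<and> (j - 1, s) \<in> w \<and> lab (\<Sigma> (j - 1)) s = In1 b)"
  unfolding vlab_def Un_iff image_iff Bex_def In_sec_iff by blast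

lemma seg_mem [simp]: "(k, s) \<in> seg i j w \<longleftrightarrow> (k, s) \<in> w \<and> i \<le> k \<and> k < j"
  by (simp add: seg_def)

lemma sec_Un [simp]: "sec k (w \<union> u) = sec k w \<union> sec k u"
  by (auto simp: sec_def)

lemma sec_empty [simp]: "sec k {} = {}"
  by (auto simp: sec_def)

lemma sec_mono: "w \<subseteq> u \<Longrightarrow> sec k w \<subseteq> sec k u"
  by (auto simp: sec_def)

lemma sec_seg [simp]: "sec k (seg i j w) = (if i \<le> k \<and> k < j then sec k w else {})"
  by (auto simp: sec_def seg_def)

lemma seg_mono: "w \<subseteq> u \<Longrightarrow> seg i j w \<subseteq> seg i j u"
  by (auto simp: seg_def)

lemma seg_seg [simp]: "i \<le> i' \<Longrightarrow> j' \<le> j \<Longrightarrow> seg i' j' (seg i j w) = seg i' j' w"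
  by (auto simp: seg_def)

lemma vlab_seg [simp]: "i < j \<Longrightarrow> vlab \<Sigma> i j (seg i j w) = vlab \<Sigma> i j w"
  by (auto simp: vlab_def)

lemma vlab_Un: "vlab \<Sigma> i j (w \<union> u) = vlab \<Sigma> i j w \<union> vlab \<Sigma> i j u"
  by (simp add: vlab_def image_Un Un_ac)

lemma matchingD:
  assumes "matching \<Sigma> i j w"
  shows "\<And>k s. (k, s) \<in> w \<Longrightarrow> i \<le> k \<and> k < j" "\<And>k. i \<le> k \<Longrightarrow> k < j \<Longrightarrow> sec k w \<in> conf (st (\<Sigma> k))"
    "\<And>k. i \<le> k \<Longrightarrow> Suc k < j \<Longrightarrow> In1 -` lab (\<Sigma> k) ` sec k w = In0 -` lab (\<Sigma> (Suc k)) ` sec (Suc k) w"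
  using assms by (auto simp: matching_def)

lemma chainD:
  assumes "chain \<Sigma> i j"
  shows "i < j" "\<And>k. i \<le> k \<Longrightarrow> k < j \<Longrightarrow> prestrategy (\<Sigma> k)"
    "\<And>k. i \<le> k \<Longrightarrow> Suc k < j \<Longrightarrow> trg (\<Sigma> k) = src (\<Sigma> (Suc k))"
  using assms by (auto simp: chain_def)

lemma chain_sub: "chain \<Sigma> i j \<Longrightarrow> i \<le> i' \<Longrightarrow> i' < j' \<Longrightarrow> j' \<le> j \<Longrightarrow> chain \<Sigma> i' j'"
  by (auto simp: chain_def)

section \<open>Matching states, their unions and their locations\<close>

lemma matching_finite:
  assumes "matching \<Sigma> i j w" shows "finite w"
proof (rule finite_subset)
  show "w \<subseteq> (SIGMA k:{i..<j}. sec k w)" using matchingD(1)[OF assms] by (auto simp: sec_def)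
  show "finite (SIGMA k:{i..<j}. sec k w)"
    using confD(1)[OF matchingD(2)[OF assms]] by auto
qed

lemma matching_empty: "chain \<Sigma> i j \<Longrightarrow> matching \<Sigma> i j {}"
  using conf_empty[OF prestrategyD(3)[OF chainD(2)]] by (auto simp: matching_def)

lemma matching_Un:
  assumes c: "chain \<Sigma> i j" and t: "matching \<Sigma> i j t" and w: "matching \<Sigma> i j w" and u: "matching \<Sigma> i j u"
    and sub: "w \<subseteq> t" "u \<subseteq> t"
  shows "matching \<Sigma> i j (w \<union> u)"
  unfolding matching_def
proof (intro conjI allI impI)
  fix k assume k: "i \<le> k \<and> k < j"
  then show "sec k (w \<union> u) \<in> conf (st (\<Sigma> k))"
    using conf_Un[OF prestrategyD(3)[OF chainD(2)[OF c]] matchingD(2)[OF t] matchingD(2)[OF w] matchingD(2)[OF u], of k]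
      sec_mono[OF sub(1)] sec_mono[OF sub(2)] by simp
next
  fix k assume k: "i \<le> k \<and> Suc k < j"
  then show "In1 -` lab (\<Sigma> k) ` sec k (w \<union> u) = In0 -` lab (\<Sigma> (Suc k)) ` sec (Suc k) (w \<union> u)"
    using matchingD(3)[OF w, of k] matchingD(3)[OF u, of k] by (simp add: image_Un)
next
  fix k s assume "(k, s) \<in> w \<union> u"
  then show "i \<le> k" "k < j" using matchingD(1)[OF w] matchingD(1)[OF u] by auto
qed

lemma sync_matching: "sync \<Sigma> i j w \<Longrightarrow> matching \<Sigma> i j w"
  by (simp add: sync_def)

lemma sync_sub:
  assumes "sync \<Sigma> i j w" "matching \<Sigma> i j u" "u \<subseteq> w" shows "sync \<Sigma> i j u"
proof -
  obtain \<rho> where \<rho>: "ranked \<Sigma> i j w \<rho>" using assms(1) by (auto simp: sync_def)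
  have "ranked \<Sigma> i j u \<rho>"
    unfolding ranked_def
  proof (intro allI impI, elim conjE)
    fix k s s' assume "i \<le> k" "k < j" "s \<in> sec k u" "s' \<in> sec k u" "(s, s') \<in> Leq (st (\<Sigma> k))" "s \<noteq> s'"
    then show "\<rho> (evloc \<Sigma> (k, s)) < \<rho> (evloc \<Sigma> (k, s'))"
      using \<rho> sec_mono[OF assms(3), of k] unfolding ranked_def by blast
  qed
  then show ?thesis using assms(2) by (auto simp: sync_def)
qed

lemma lab_In:
  assumes "chain \<Sigma> i j" "matching \<Sigma> i j w" "(k, s) \<in> w"
  shows "(\<exists>a. lab (\<Sigma> k) s = In0 a) \<or> (\<exists>b. lab (\<Sigma> k) s = In1 b)"
proof -
  have k: "i \<le> k" "k < j" using matchingD(1)[OF assms(2,3)] by auto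
  have "s \<in> sec k w" using assms(3) by (simp add: sec_def)
  then have "lab (\<Sigma> k) s \<in> range In0 \<union> range In1"
    using prestrategy_conf(4)[OF chainD(2)[OF assms(1) k] matchingD(2)[OF assms(2) k]] by blast
  then show ?thesis by auto
qed

lemma lab_inj:
  assumes "chain \<Sigma> i j" "matching \<Sigma> i j w" "(k, s) \<in> w" "(k, s') \<in> w" "lab (\<Sigma> k) s = lab (\<Sigma> k) s'"
  shows "s = s'"
proof -
  have k: "i \<le> k" "k < j" using matchingD(1)[OF assms(2,3)] by auto
  show ?thesis
    using inj_onD[OF prestrategy_conf(1)[OF chainD(2)[OF assms(1) k] matchingD(2)[OF assms(2) k]] assms(5)]
      assms(3,4) by (simp add: sec_def)
qed

lemma evloc_cases:
  assumes "chain \<Sigma> i j" "matching \<Sigma> i j w" "(k, s) \<in> w" "evloc \<Sigma> (k, s) = (m, a)"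
  shows "(m = k \<and> lab (\<Sigma> k) s = In0 a) \<or> (m = Suc k \<and> lab (\<Sigma> k) s = In1 a)"
  using lab_In[OF assms(1-3)] assms(4) by (auto simp: evloc_def)

lemma evloc_inj:
  assumes c: "chain \<Sigma> i j" and w: "matching \<Sigma> i j w" and e: "(k, s) \<in> w" "(k, s') \<in> w"
    and eq: "evloc \<Sigma> (k, s) = evloc \<Sigma> (k, s')"
  shows "s = s'"
proof -
  obtain m a where ma: "evloc \<Sigma> (k, s) = (m, a)" by fastforce
  then have "evloc \<Sigma> (k, s') = (m, a)" using eq by simp
  then have "lab (\<Sigma> k) s = lab (\<Sigma> k) s'"
    using evloc_cases[OF c w e(1) ma] evloc_cases[OF c w e(2)] by auto
  then show ?thesis using lab_inj[OF c w e] by blast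
qed

lemma matched_partner:
  assumes w: "matching \<Sigma> i j w" and k: "i \<le> k" "Suc k < j"
  shows "(k, s) \<in> w \<Longrightarrow> lab (\<Sigma> k) s = In1 b \<Longrightarrow> \<exists>t. (Suc k, t) \<in> w \<and> lab (\<Sigma> (Suc k)) t = In0 b"
    "(Suc k, t) \<in> w \<Longrightarrow> lab (\<Sigma> (Suc k)) t = In0 b \<Longrightarrow> \<exists>s. (k, s) \<in> w \<and> lab (\<Sigma> k) s = In1 b"
proof -
  have m: "In1 -` lab (\<Sigma> k) ` sec k w = In0 -` lab (\<Sigma> (Suc k)) ` sec (Suc k) w" by (rule matchingD(3)[OF w k])
  show "\<exists>t. (Suc k, t) \<in> w \<and> lab (\<Sigma> (Suc k)) t = In0 b" if "(k, s) \<in> w" "lab (\<Sigma> k) s = In1 b"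
  proof -
    have "b \<in> In1 -` lab (\<Sigma> k) ` sec k w" using that by (force simp: sec_def)
    then show ?thesis unfolding m by (force simp: sec_def)
  qed
  show "\<exists>s. (k, s) \<in> w \<and> lab (\<Sigma> k) s = In1 b" if "(Suc k, t) \<in> w" "lab (\<Sigma> (Suc k)) t = In0 b"
  proof -
    have "b \<in> In0 -` lab (\<Sigma> (Suc k)) ` sec (Suc k) w" using that by (force simp: sec_def)
    then show ?thesis unfolding m[symmetric] by (force simp: sec_def)
  qed
qed

text \<open>At most two components meet at a location, the neighbours that share the game, and at an
  inner game a matching state has both or none. As labels are injective, \<open>u\<close> has all
  that \<open>w\<close> has at a location once it has one event there.\<close>

lemma evloc_mem:
  assumes c: "chain \<Sigma> i j" and w: "matching \<Sigma> i j w" and u: "matching \<Sigma> i j u" and sub: "u \<subseteq> w"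
    and e: "e \<in> w" and l: "evloc \<Sigma> e \<in> evloc \<Sigma> ` u"
  shows "e \<in> u"
proof -
  obtain k s where ks: "e = (k, s)" by fastforce
  obtain k' s' where e': "(k', s') \<in> u" "evloc \<Sigma> (k, s) = evloc \<Sigma> (k', s')" using l ks by auto
  obtain m a where ma: "evloc \<Sigma> (k, s) = (m, a)" by fastforce
  have ew: "(k, s) \<in> w" "(k', s') \<in> w" using e ks e' sub by auto
  have r: "i \<le> k" "k < j" "i \<le> k'" "k' < j" using matchingD(1)[OF w ew(1)] matchingD(1)[OF w ew(2)] by auto
  have c1: "(m = k \<and> lab (\<Sigma> k) s = In0 a) \<or> (m = Suc k \<and> lab (\<Sigma> k) s = In1 a)"
    using evloc_cases[OF c w ew(1) ma] .
  have c2: "(m = k' \<and> lab (\<Sigma> k') s' = In0 a) \<or> (m = Suc k' \<and> lab (\<Sigma> k') s' = In1 a)"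
    using evloc_cases[OF c w ew(2)] ma e'(2) by simp
  have "\<exists>t. (k, t) \<in> u \<and> lab (\<Sigma> k) t = lab (\<Sigma> k) s"
  proof (cases "k = k'")
    case True
    then show ?thesis using c1 c2 e'(1) by auto
  next
    case False
    with c1 c2 consider "k = Suc k'" "lab (\<Sigma> k) s = In0 a" "lab (\<Sigma> k') s' = In1 a"
      | "k' = Suc k" "lab (\<Sigma> k) s = In1 a" "lab (\<Sigma> k') s' = In0 a" by auto
    then show ?thesis
    proof cases
      case 1 then show ?thesis using matched_partner(1)[OF u, of k' s' a] e' r by auto
    next
      case 2 then show ?thesis using matched_partner(2)[OF u, of k s' a] e' r by auto
    qed
  qed
  then obtain t where t: "(k, t) \<in> u" "lab (\<Sigma> k) t = lab (\<Sigma> k) s" by blast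
  then have "t = s" using lab_inj[OF c w _ ew(1), of t] sub by blast
  then show ?thesis using t ks by simp
qed

text \<open>All events of \<open>w\<close> at one location are added together, so matched partners
  enter together; \<open>low\<close> says that their strict causes are already present.\<close>

lemma matching_cut:
  assumes c: "chain \<Sigma> i j" and w: "matching \<Sigma> i j w" and u: "matching \<Sigma> i j u" and sub: "u \<subseteq> w"
    and low: "\<And>k s s'. (k, s) \<in> w \<Longrightarrow> evloc \<Sigma> (k, s) = l \<Longrightarrow> (s', s) \<in> Leq (st (\<Sigma> k)) \<Longrightarrow> s' \<noteq> s \<Longrightarrow> (k, s') \<in> u"
  shows "matching \<Sigma> i j (u \<union> {e \<in> w. evloc \<Sigma> e = l})" (is "matching \<Sigma> i j ?v")
  unfolding matching_def
proof (intro conjI allI impI)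
  fix k s assume "(k, s) \<in> ?v"
  then show "i \<le> k" "k < j" using matchingD(1)[OF w] sub by auto
next
  fix k assume k: "i \<le> k \<and> k < j"
  show "sec k ?v \<in> conf (st (\<Sigma> k))"
  proof (rule conf_sub[OF prestrategyD(3)[OF chainD(2)[OF c]] matchingD(2)[OF w]])
    show "i \<le> k" "k < j" "i \<le> k" "k < j" using k by auto
    show "sec k ?v \<subseteq> sec k w" using sub by (auto simp: sec_def)
    fix s s' assume s: "s \<in> sec k ?v" "(s', s) \<in> Leq (st (\<Sigma> k))"
    show "s' \<in> sec k ?v"
    proof (cases "(k, s) \<in> u \<or> s = s'")
      case True
      then show ?thesis
        using s confD(4)[OF matchingD(2)[OF u, of k], of s s'] k by (auto simp: sec_def)
    next
      case False
      then show ?thesis using s low[of k s s'] by (auto simp: sec_def)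
    qed
  qed
next
  fix k assume k: "i \<le> k \<and> Suc k < j"
  have u1: "In1 -` lab (\<Sigma> k) ` sec k u = In0 -` lab (\<Sigma> (Suc k)) ` sec (Suc k) u"
    using matchingD(3)[OF u, of k] k by simp
  have "In1 -` lab (\<Sigma> k) ` sec k {e \<in> w. evloc \<Sigma> e = l}
      = In0 -` lab (\<Sigma> (Suc k)) ` sec (Suc k) {e \<in> w. evloc \<Sigma> e = l}"
  proof (intro set_eqI iffI)
    fix b assume "b \<in> In1 -` lab (\<Sigma> k) ` sec k {e \<in> w. evloc \<Sigma> e = l}"
    then obtain s where s: "(k, s) \<in> w" "evloc \<Sigma> (k, s) = l" "lab (\<Sigma> k) s = In1 b" by (auto simp: sec_def)
    then obtain t where t: "(Suc k, t) \<in> w" "lab (\<Sigma> (Suc k)) t = In0 b"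
      using matched_partner(1)[OF w, of k s b] k by blast
    then have "evloc \<Sigma> (Suc k, t) = l" using s by (simp add: evloc_def)
    then have "t \<in> sec (Suc k) {e \<in> w. evloc \<Sigma> e = l}" using t by (simp add: sec_def)
    then show "b \<in> In0 -` lab (\<Sigma> (Suc k)) ` sec (Suc k) {e \<in> w. evloc \<Sigma> e = l}" using t(2) by force
  next
    fix b assume "b \<in> In0 -` lab (\<Sigma> (Suc k)) ` sec (Suc k) {e \<in> w. evloc \<Sigma> e = l}"
    then obtain s where s: "(Suc k, s) \<in> w" "evloc \<Sigma> (Suc k, s) = l" "lab (\<Sigma> (Suc k)) s = In0 b"
      by (auto simp: sec_def)
    then obtain t where t: "(k, t) \<in> w" "lab (\<Sigma> k) t = In1 b"
      using matched_partner(2)[OF w, of k s b] k by blast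
    then have "evloc \<Sigma> (k, t) = l" using s by (simp add: evloc_def)
    then have "t \<in> sec k {e \<in> w. evloc \<Sigma> e = l}" using t by (simp add: sec_def)
    then show "b \<in> In1 -` lab (\<Sigma> k) ` sec k {e \<in> w. evloc \<Sigma> e = l}" using t(2) by force
  qed
  then show "In1 -` lab (\<Sigma> k) ` sec k ?v = In0 -` lab (\<Sigma> (Suc k)) ` sec (Suc k) ?v"
    using u1 by (simp add: image_Un)
qed

text \<open>The unit of progress is a location and not an event, since a hidden move occupies two
  components at once.\<close>

definition stp :: "(nat \<Rightarrow> 'u prestrat) \<Rightarrow> nat \<Rightarrow> nat \<Rightarrow> (nat \<times> 'u ev) set \<Rightarrow> (nat \<times> 'u ev) set \<Rightarrow> nat \<times> 'u ev \<Rightarrow> bool" where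
  "stp \<Sigma> i j u u' l \<longleftrightarrow> matching \<Sigma> i j u \<and> matching \<Sigma> i j u' \<and> u \<subset> u' \<and> l \<notin> evloc \<Sigma> ` u \<and> evloc \<Sigma> ` (u' - u) = {l}"

text \<open>The next location is one of least rank among those of missing events; strict causes
  there have smaller rank and so are no longer missing.\<close>

lemma sync_progress:
  assumes c: "chain \<Sigma> i j" and w: "sync \<Sigma> i j w" and u: "matching \<Sigma> i j u" and sub: "u \<subset> w"
  shows "\<exists>u' l. stp \<Sigma> i j u u' l \<and> u' \<subseteq> w"
proof -
  obtain \<rho> where \<rho>: "ranked \<Sigma> i j w \<rho>" and wm: "matching \<Sigma> i j w" using w by (auto simp: sync_def)
  obtain e where e: "e \<in> w - u" "\<And>e'. e' \<in> w - u \<Longrightarrow> \<rho> (evloc \<Sigma> e) \<le> \<rho> (evloc \<Sigma> e')"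
    using ex_has_least_nat[of "\<lambda>e. e \<in> w - u" _ "\<lambda>e. \<rho> (evloc \<Sigma> e)"] sub by (metis DiffI psubset_imp_ex_mem)
  let ?l = "evloc \<Sigma> e" let ?v = "u \<union> {e \<in> w. evloc \<Sigma> e = ?l}"
  have v: "matching \<Sigma> i j ?v"
  proof (rule matching_cut[OF c wm u])
    show "u \<subseteq> w" using sub by blast
    fix k s s' assume s: "(k, s) \<in> w" "evloc \<Sigma> (k, s) = ?l" "(s', s) \<in> Leq (st (\<Sigma> k))" "s' \<noteq> s"
    have k: "i \<le> k" "k < j" using matchingD(1)[OF wm s(1)] by auto
    have s': "s \<in> sec k w" "s' \<in> sec k w"
      using s confD(4)[OF matchingD(2)[OF wm k], of s s'] by (auto simp: sec_def)
    then have "\<rho> (evloc \<Sigma> (k, s')) < \<rho> ?l" using \<rho> k s unfolding ranked_def by metis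
    then show "(k, s') \<in> u" using e(2)[of "(k, s')"] s'(2) by (auto simp: sec_def)
  qed
  have "?l \<notin> evloc \<Sigma> ` u" using evloc_mem[OF c wm u _ _, of e] sub e(1) by blast
  then have "stp \<Sigma> i j u ?v ?l" unfolding stp_def using u v e(1) by auto
  then show ?thesis using sub by blast
qed

text \<open>Converse of \<open>sync_progress\<close>, and the tool for producing schedules without
  writing them down: a maximal synchronised part of \<open>w\<close> that is proper could be
  enlarged by one location, scheduled after everything else.\<close>

lemma progress_sync:
  assumes c: "chain \<Sigma> i j" and w: "matching \<Sigma> i j w"
    and prog: "\<And>u. matching \<Sigma> i j u \<Longrightarrow> u \<subset> w \<Longrightarrow> \<exists>u' l. stp \<Sigma> i j u u' l \<and> u' \<subseteq> w"
  shows "sync \<Sigma> i j w"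
proof -
  have fw: "finite w" by (rule matching_finite[OF w])
  have "sync \<Sigma> i j {}" using matching_empty[OF c] by (auto simp: sync_def ranked_def)
  then have "{} \<in> {u. sync \<Sigma> i j u \<and> u \<subseteq> w}" by simp
  moreover have "finite {u. sync \<Sigma> i j u \<and> u \<subseteq> w}" using fw by simp
  ultimately obtain u where "u \<in> {u. sync \<Sigma> i j u \<and> u \<subseteq> w}"
    and mx: "\<forall>u'\<in>{u. sync \<Sigma> i j u \<and> u \<subseteq> w}. u \<subseteq> u' \<longrightarrow> u = u'"
    using finite_has_maximal2[of "{u. sync \<Sigma> i j u \<and> u \<subseteq> w}" "{}"] by blast
  then have u: "sync \<Sigma> i j u" "u \<subseteq> w" by auto
  have "u = w"
  proof (rule ccontr)
    assume "u \<noteq> w"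
    then obtain u' l where st: "stp \<Sigma> i j u u' l" "u' \<subseteq> w" using prog sync_matching[OF u(1)] u(2) by blast
    then have m: "matching \<Sigma> i j u" "matching \<Sigma> i j u'" "u \<subset> u'" "l \<notin> evloc \<Sigma> ` u" "evloc \<Sigma> ` (u' - u) = {l}"
      by (auto simp: stp_def)
    obtain \<rho> where \<rho>: "ranked \<Sigma> i j u \<rho>" using u(1) by (auto simp: sync_def)
    have "finite (\<rho> ` evloc \<Sigma> ` u)" using finite_subset[OF u(2) fw] by simp
    then obtain N where N: "\<forall>n\<in>\<rho> ` evloc \<Sigma> ` u. n < N" using finite_nat_set_iff_bounded by blast
    \<comment> \<open>\<open>N\<close> exceeds all ranks in use, so the new location comes last.
      Overwriting \<open>\<rho>\<close> at \<open>l\<close> changes nothing on \<open>u\<close>,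
      where \<open>l\<close> does not occur.\<close>
    have "ranked \<Sigma> i j u' (\<rho>(l := N))"
      unfolding ranked_def
    proof (intro allI impI, elim conjE)
      fix k s s' assume k: "i \<le> k" "k < j" and s: "s \<in> sec k u'" "s' \<in> sec k u'" and le: "(s, s') \<in> Leq (st (\<Sigma> k))" "s \<noteq> s'"
      show "(\<rho>(l := N)) (evloc \<Sigma> (k, s)) < (\<rho>(l := N)) (evloc \<Sigma> (k, s'))"
      proof (cases "(k, s') \<in> u")
        case True
        then have s2: "s \<in> sec k u" "s' \<in> sec k u"
          using confD(4)[OF matchingD(2)[OF m(1) k], of s' s] le by (auto simp: sec_def)
        then have ne: "evloc \<Sigma> (k, s) \<noteq> l" "evloc \<Sigma> (k, s') \<noteq> l" using m(4) by (auto simp: sec_def)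
        have "\<rho> (evloc \<Sigma> (k, s)) < \<rho> (evloc \<Sigma> (k, s'))" using \<rho> k s2 le unfolding ranked_def by blast
        then show ?thesis using ne by simp
      next
        case False
        then have l': "evloc \<Sigma> (k, s') = l" using m(5) s(2) by (auto simp: sec_def)
        \<comment> \<open>Otherwise \<open>s\<close> and \<open>s'\<close> would be two events of
          one component at the same location \<open>l\<close>, hence equal.\<close>
        have "(k, s) \<in> u"
        proof (rule ccontr)
          assume "(k, s) \<notin> u"
          then have "evloc \<Sigma> (k, s) = l" using m(5) s(1) by (auto simp: sec_def)
          then show False using evloc_inj[OF c m(2), of k s s'] s l' le by (auto simp: sec_def)
        qed
        then have "evloc \<Sigma> (k, s) \<noteq> l" "\<rho> (evloc \<Sigma> (k, s)) < N" using m(4) N by auto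
        then show ?thesis using l' by simp
      qed
    qed
    then have "sync \<Sigma> i j u'" using m(2) by (auto simp: sync_def)
    then show False using mx st(2) m(3) by blast
  qed
  then show ?thesis using u(1) by simp
qed

lemma matching_seg:
  assumes w: "matching \<Sigma> i k w" and ij: "i \<le> i'" "j' \<le> k"
  shows "matching \<Sigma> i' j' (seg i' j' w)"
  using assms unfolding matching_def by simp

lemma sync_seg:
  assumes w: "sync \<Sigma> i k w" and ij: "i \<le> i'" "j' \<le> k"
  shows "sync \<Sigma> i' j' (seg i' j' w)"
proof -
  obtain \<rho> where \<rho>: "ranked \<Sigma> i k w \<rho>" using w by (auto simp: sync_def)
  have "ranked \<Sigma> i' j' (seg i' j' w) \<rho>"
    unfolding ranked_def
  proof (intro allI impI, elim conjE)
    fix m s s' assume "i' \<le> m" "m < j'" "s \<in> sec m (seg i' j' w)" "s' \<in> sec m (seg i' j' w)"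
      "(s, s') \<in> Leq (st (\<Sigma> m))" "s \<noteq> s'"
    then show "\<rho> (evloc \<Sigma> (m, s)) < \<rho> (evloc \<Sigma> (m, s'))"
      using \<rho> ij unfolding ranked_def by auto
  qed
  then show ?thesis using matching_seg[OF sync_matching[OF w] ij] by (auto simp: sync_def)
qed

lemma matching_join:
  assumes a: "matching \<Sigma> i j a" and b: "matching \<Sigma> j k b" and ij: "i < j" "j < k"
    and eq: "In1 -` vlab \<Sigma> i j a = In0 -` vlab \<Sigma> j k b"
  shows "matching \<Sigma> i k (a \<union> b)"
proof -
  have a0: "sec m a = {}" if "\<not> (i \<le> m \<and> m < j)" for m using matchingD(1)[OF a] that by (auto simp: sec_def)
  have b0: "sec m b = {}" if "\<not> (j \<le> m \<and> m < k)" for m using matchingD(1)[OF b] that by (auto simp: sec_def)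
  show ?thesis
    unfolding matching_def
  proof (intro conjI allI impI)
    fix m s assume "(m, s) \<in> a \<union> b"
    then show "i \<le> m" "m < k" using matchingD(1)[OF a, of m s] matchingD(1)[OF b, of m s] ij by auto
  next
    fix m assume m: "i \<le> m \<and> m < k"
    then show "sec m (a \<union> b) \<in> conf (st (\<Sigma> m))"
      using a0[of m] b0[of m] matchingD(2)[OF a, of m] matchingD(2)[OF b, of m] by (cases "m < j") auto
  next
    fix m assume m: "i \<le> m \<and> Suc m < k"
    consider "Suc m < j" | "Suc m = j" | "j \<le> m" by linarith
    then show "In1 -` lab (\<Sigma> m) ` sec m (a \<union> b) = In0 -` lab (\<Sigma> (Suc m)) ` sec (Suc m) (a \<union> b)"
    proof cases
      case 1 then show ?thesis using b0[of m] b0[of "Suc m"] matchingD(3)[OF a, of m] m by simp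
    next
      case 2
      \<comment> \<open>The seam: only at game \<open>j\<close> does matching involve both halves,
        and there it is the assumed equation.\<close>
      have "In1 -` lab (\<Sigma> m) ` sec m a = In0 -` lab (\<Sigma> (Suc m)) ` sec (Suc m) b"
        using eq by (simp add: 2[symmetric])
      then show ?thesis using b0[of m] a0[of "Suc m"] 2 by simp
    next
      case 3 then show ?thesis using a0[of m] a0[of "Suc m"] matchingD(3)[OF b, of m] m by simp
    qed
  qed
qed

lemma matching_mid:
  assumes "matching \<Sigma> i k w" "i < j" "j < k"
  shows "In1 -` vlab \<Sigma> i j (seg i j w) = In0 -` vlab \<Sigma> j k (seg j k w)"
  using matchingD(3)[OF assms(1), of "j - 1"] assms(2,3) by simp

text \<open>A step is felt on the right outer game only if its location lies in that game, and then
  by exactly that move. \<open>stp_In0\<close> is the mirror image for the left outer game; together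
  they tell when steps of two halves can be joined.\<close>

lemma stp_In1:
  assumes c: "chain \<Sigma> i j" and s: "stp \<Sigma> i j u u' l"
  shows "fst l \<noteq> j \<Longrightarrow> In1 -` vlab \<Sigma> i j u' = In1 -` vlab \<Sigma> i j u"
    "l = (j, b) \<Longrightarrow> In1 -` vlab \<Sigma> i j u' = insert b (In1 -` vlab \<Sigma> i j u)"
proof -
  have m: "matching \<Sigma> i j u'" "u \<subseteq> u'" "evloc \<Sigma> ` (u' - u) = {l}" using s by (auto simp: stp_def)
  have ij: "i < j" using chainD(1)[OF c] .
  have sub: "In1 -` vlab \<Sigma> i j u \<subseteq> In1 -` vlab \<Sigma> i j u'"
    using sec_mono[OF m(2), of "j - 1"] by auto
  have new: "l = (j, b)" if B: "b \<in> In1 -` vlab \<Sigma> i j u'" "b \<notin> In1 -` vlab \<Sigma> i j u" for b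
  proof -
    obtain t where t: "(j - 1, t) \<in> u'" "lab (\<Sigma> (j - 1)) t = In1 b"
      using B(1) unfolding vlab_vimage In_sec_iff by blast
    then have "(j - 1, t) \<notin> u" using B(2) unfolding vlab_vimage In_sec_iff by blast
    then have "evloc \<Sigma> (j - 1, t) = l" using m(3) t(1) by blast
    then show ?thesis using t(2) ij by (simp add: evloc_def)
  qed
  show "In1 -` vlab \<Sigma> i j u' = In1 -` vlab \<Sigma> i j u" if "fst l \<noteq> j"
  proof (rule subset_antisym[OF subsetI sub])
    fix b assume "b \<in> In1 -` vlab \<Sigma> i j u'"
    then show "b \<in> In1 -` vlab \<Sigma> i j u" using new[of b] \<open>fst l \<noteq> j\<close> by (metis fst_conv)
  qed
  show "In1 -` vlab \<Sigma> i j u' = insert b (In1 -` vlab \<Sigma> i j u)" if l: "l = (j, b)"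
  proof -
    have "l \<in> evloc \<Sigma> ` (u' - u)" using m(3) by simp
    then obtain k t where kt: "(k, t) \<in> u'" "evloc \<Sigma> (k, t) = (j, b)" using l by auto
    have "k < j" using matchingD(1)[OF m(1) kt(1)] by simp
    then have "k = j - 1" "lab (\<Sigma> k) t = In1 b" using evloc_cases[OF c m(1) kt] by auto
    then have b: "b \<in> In1 -` vlab \<Sigma> i j u'" using kt(1) unfolding vlab_vimage In_sec_iff by blast
    show ?thesis
    proof (rule subset_antisym)
      show "insert b (In1 -` vlab \<Sigma> i j u) \<subseteq> In1 -` vlab \<Sigma> i j u'" using b sub by blast
      show "In1 -` vlab \<Sigma> i j u' \<subseteq> insert b (In1 -` vlab \<Sigma> i j u)"
      proof
        fix b' assume "b' \<in> In1 -` vlab \<Sigma> i j u'"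
        then show "b' \<in> insert b (In1 -` vlab \<Sigma> i j u)" using new[of b'] l by blast
      qed
    qed
  qed
qed

lemma stp_In0:
  assumes c: "chain \<Sigma> j k" and s: "stp \<Sigma> j k u u' l"
  shows "fst l \<noteq> j \<Longrightarrow> In0 -` vlab \<Sigma> j k u' = In0 -` vlab \<Sigma> j k u"
    "l = (j, b) \<Longrightarrow> In0 -` vlab \<Sigma> j k u' = insert b (In0 -` vlab \<Sigma> j k u)"
proof -
  have m: "matching \<Sigma> j k u'" "u \<subseteq> u'" "evloc \<Sigma> ` (u' - u) = {l}" using s by (auto simp: stp_def)
  have sub: "In0 -` vlab \<Sigma> j k u \<subseteq> In0 -` vlab \<Sigma> j k u'"
    using sec_mono[OF m(2), of j] by auto
  have new: "l = (j, b)" if B: "b \<in> In0 -` vlab \<Sigma> j k u'" "b \<notin> In0 -` vlab \<Sigma> j k u" for b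
  proof -
    obtain t where t: "(j, t) \<in> u'" "lab (\<Sigma> j) t = In0 b"
      using B(1) unfolding vlab_vimage In_sec_iff by blast
    then have "(j, t) \<notin> u" using B(2) unfolding vlab_vimage In_sec_iff by blast
    then have "evloc \<Sigma> (j, t) = l" using m(3) t(1) by blast
    then show ?thesis using t(2) by (simp add: evloc_def)
  qed
  show "In0 -` vlab \<Sigma> j k u' = In0 -` vlab \<Sigma> j k u" if "fst l \<noteq> j"
  proof (rule subset_antisym[OF subsetI sub])
    fix b assume "b \<in> In0 -` vlab \<Sigma> j k u'"
    then show "b \<in> In0 -` vlab \<Sigma> j k u" using new[of b] \<open>fst l \<noteq> j\<close> by (metis fst_conv)
  qed
  show "In0 -` vlab \<Sigma> j k u' = insert b (In0 -` vlab \<Sigma> j k u)" if l: "l = (j, b)"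
  proof -
    have "l \<in> evloc \<Sigma> ` (u' - u)" using m(3) by simp
    then obtain m' t where kt: "(m', t) \<in> u'" "evloc \<Sigma> (m', t) = (j, b)" using l by auto
    have "j \<le> m'" using matchingD(1)[OF m(1) kt(1)] by simp
    then have "m' = j" "lab (\<Sigma> m') t = In0 b" using evloc_cases[OF c m(1) kt] by auto
    then have b: "b \<in> In0 -` vlab \<Sigma> j k u'" using kt(1) unfolding vlab_vimage In_sec_iff by blast
    show ?thesis
    proof (rule subset_antisym)
      show "insert b (In0 -` vlab \<Sigma> j k u) \<subseteq> In0 -` vlab \<Sigma> j k u'" using b sub by blast
      show "In0 -` vlab \<Sigma> j k u' \<subseteq> insert b (In0 -` vlab \<Sigma> j k u)"
      proof
        fix b' assume "b' \<in> In0 -` vlab \<Sigma> j k u'"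
        then show "b' \<in> insert b (In0 -` vlab \<Sigma> j k u)" using new[of b'] l by blast
      qed
    qed
  qed
qed

lemma evloc_range:
  assumes "chain \<Sigma> i j" "matching \<Sigma> i j w" "l \<in> evloc \<Sigma> ` w"
  shows "i \<le> fst l \<and> fst l \<le> j"
proof -
  obtain k s where ks: "(k, s) \<in> w" "evloc \<Sigma> (k, s) = (fst l, snd l)" using assms(3) by force
  then show ?thesis using evloc_cases[OF assms(1,2) ks] matchingD(1)[OF assms(2) ks(1)] by auto
qed

section \<open>Presentations of pre-strategies by synchronised states\<close>

text \<open>\<open>v\<close> forgets the hidden moves of a state. Many states may yield the same
  configuration, as hidden moves can occur without visible effect; the last clause provides a least
  one, which makes constructions on states well defined on configurations.\<close>

definition pres :: "(nat \<Rightarrow> 'u prestrat) \<Rightarrow> nat \<Rightarrow> nat \<Rightarrow> 'u prestrat \<Rightarrow> ((nat \<times> 'u ev) set \<Rightarrow> 'u ev set) \<Rightarrow> bool" where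
  "pres \<Sigma> i j E v \<longleftrightarrow> prestrategy E \<and> src E = src (\<Sigma> i) \<and> trg E = trg (\<Sigma> (j - 1)) \<and>
     (\<forall>w. sync \<Sigma> i j w \<longrightarrow> v w \<in> conf (st E) \<and> lab E ` v w = vlab \<Sigma> i j w) \<and>
     (\<forall>w w'. sync \<Sigma> i j w \<longrightarrow> sync \<Sigma> i j w' \<longrightarrow> w \<subseteq> w' \<longrightarrow> v w \<subseteq> v w') \<and>
     (\<forall>z\<in>conf (st E). \<exists>w. sync \<Sigma> i j w \<and> v w = z \<and> (\<forall>w'. sync \<Sigma> i j w' \<longrightarrow> z \<subseteq> v w' \<longrightarrow> w \<subseteq> w'))"

lemma presD:
  assumes "pres \<Sigma> i j E v"
  shows "prestrategy E" "src E = src (\<Sigma> i)" "trg E = trg (\<Sigma> (j - 1))"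
    "\<And>w. sync \<Sigma> i j w \<Longrightarrow> v w \<in> conf (st E)" "\<And>w. sync \<Sigma> i j w \<Longrightarrow> lab E ` v w = vlab \<Sigma> i j w"
    "\<And>w w'. sync \<Sigma> i j w \<Longrightarrow> sync \<Sigma> i j w' \<Longrightarrow> w \<subseteq> w' \<Longrightarrow> v w \<subseteq> v w'"
    "\<And>z. z \<in> conf (st E) \<Longrightarrow> \<exists>w. sync \<Sigma> i j w \<and> v w = z \<and> (\<forall>w'. sync \<Sigma> i j w' \<longrightarrow> z \<subseteq> v w' \<longrightarrow> w \<subseteq> w')"
  using assms by (auto simp: pres_def)

lemma pres_eq:
  assumes p: "pres \<Sigma> i j E v" and "sync \<Sigma> i j w" "sync \<Sigma> i j w'" "w \<subseteq> w'" "vlab \<Sigma> i j w = vlab \<Sigma> i j w'"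
  shows "v w = v w'"
  using conf_eqI_lab[OF prestrategy_conf(1)[OF presD(1)[OF p] presD(4)[OF p]]] presD(5,6)[OF p] assms(2-) by metis

text \<open>A configuration is sent through its least state. The result is independent of this
  choice, since the least state lies below any other state of the configuration and has the same
  outer labels.\<close>

lemma pres_iso:
  assumes p: "pres \<Sigma> i j E v" and q: "pres \<Sigma> i j F u"
  shows "\<exists>h. invertible two_cells id_cell vcomp_cell E F h \<and> (\<forall>w. sync \<Sigma> i j w \<longrightarrow> cfun h ` v w = u w)"
proof -
  define cv where "cv z = (SOME w. sync \<Sigma> i j w \<and> v w = z \<and> (\<forall>w'. sync \<Sigma> i j w' \<longrightarrow> z \<subseteq> v w' \<longrightarrow> w \<subseteq> w'))" for z
  define cu where "cu z = (SOME w. sync \<Sigma> i j w \<and> u w = z \<and> (\<forall>w'. sync \<Sigma> i j w' \<longrightarrow> z \<subseteq> u w' \<longrightarrow> w \<subseteq> w'))" for z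
  have cv: "sync \<Sigma> i j (cv z)" "v (cv z) = z" "\<And>w'. sync \<Sigma> i j w' \<Longrightarrow> z \<subseteq> v w' \<Longrightarrow> cv z \<subseteq> w'"
    if "z \<in> conf (st E)" for z
    using someI_ex[OF presD(7)[OF p that]] unfolding cv_def by blast+
  have cu: "sync \<Sigma> i j (cu z)" "u (cu z) = z" "\<And>w'. sync \<Sigma> i j w' \<Longrightarrow> z \<subseteq> u w' \<Longrightarrow> cu z \<subseteq> w'"
    if "z \<in> conf (st F)" for z
    using someI_ex[OF presD(7)[OF q that]] unfolding cu_def by blast+
  \<comment> \<open>The least \<open>E\<close>-state of \<open>v w\<close> may be smaller than
    \<open>w\<close>, but it has the same outer labels, so \<open>u\<close> cannot tell them
    apart.\<close>
  have uv: "u (cv (v w)) = u w" if w: "sync \<Sigma> i j w" for w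
  proof -
    note z = presD(4)[OF p w]
    have "cv (v w) \<subseteq> w" using cv(3)[OF z w] by simp
    moreover have "vlab \<Sigma> i j (cv (v w)) = vlab \<Sigma> i j w"
      using presD(5)[OF p w] presD(5)[OF p cv(1)[OF z]] cv(2)[OF z] by simp
    ultimately show ?thesis using pres_eq[OF q cv(1)[OF z] w] by blast
  qed
  have vu: "v (cu (u w)) = v w" if w: "sync \<Sigma> i j w" for w
  proof -
    note z = presD(4)[OF q w]
    have "cu (u w) \<subseteq> w" using cu(3)[OF z w] by simp
    moreover have "vlab \<Sigma> i j (cu (u w)) = vlab \<Sigma> i j w"
      using presD(5)[OF q w] presD(5)[OF q cu(1)[OF z]] cu(2)[OF z] by simp
    ultimately show ?thesis using pres_eq[OF p cu(1)[OF z] w] by blast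
  qed
  have "\<exists>h. invertible two_cells id_cell vcomp_cell E F h \<and> (\<forall>x\<in>conf (st E). cfun h ` x = u (cv x))"
  proof (rule iso_cell_from_conf[OF presD(1)[OF p] presD(1)[OF q], where \<Psi> = "\<lambda>z. v (cu z)"])
    show "src E = src F" "trg E = trg F" using presD(2,3)[OF p] presD(2,3)[OF q] by simp_all
    fix x assume x: "x \<in> conf (st E)"
    show "u (cv x) \<in> conf (st F)" using presD(4)[OF q cv(1)[OF x]] .
    show "lab F ` u (cv x) = lab E ` x" using presD(5)[OF q cv(1)[OF x]] presD(5)[OF p cv(1)[OF x]] cv(2)[OF x] by simp
    show "v (cu (u (cv x))) = x" using vu[OF cv(1)[OF x]] cv(2)[OF x] by simp
    fix y assume y: "y \<in> conf (st E)" "x \<subseteq> y"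
    show "u (cv x) \<subseteq> u (cv y)"
      using presD(6)[OF q cv(1)[OF x] cv(1)[OF y(1)]] cv(3)[OF x cv(1)[OF y(1)]] cv(2)[OF y(1)] y(2) by simp
  next
    fix x assume x: "x \<in> conf (st F)"
    show "v (cu x) \<in> conf (st E)" using presD(4)[OF p cu(1)[OF x]] .
    show "u (cv (v (cu x))) = x" using uv[OF cu(1)[OF x]] cu(2)[OF x] by simp
    fix y assume y: "y \<in> conf (st F)" "x \<subseteq> y"
    show "v (cu x) \<subseteq> v (cu y)"
      using presD(6)[OF p cu(1)[OF x] cu(1)[OF y(1)]] cu(3)[OF x cu(1)[OF y(1)]] cu(2)[OF y(1)] y(2) by simp
  qed
  then show ?thesis using uv presD(4)[OF p] by metis
qed

text \<open>Every equation between 2-cells out of a composite is reduced by this rule to an equation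
  between states.\<close>

lemma pres_cell_eqI:
  assumes p: "pres \<Sigma> i j E v" and f: "f \<in> two_cells E F" and g: "g \<in> two_cells E F"
    and eq: "\<And>w. sync \<Sigma> i j w \<Longrightarrow> cfun f ` v w = cfun g ` v w"
  shows "f = g"
proof (rule two_cell_eqI[OF presD(1)[OF p] f g])
  fix x assume "x \<in> conf (st E)"
  then obtain w where "sync \<Sigma> i j w" "v w = x" using presD(7)[OF p] by blast
  then show "cfun f ` x = cfun g ` x" using eq by blast
qed

lemma pres_base:
  assumes p: "prestrategy (\<Sigma> i)"
  shows "pres \<Sigma> i (Suc i) (\<Sigma> i) (sec i)"
proof -
  have vl: "vlab \<Sigma> i (Suc i) w = lab (\<Sigma> i) ` sec i w" if "matching \<Sigma> i (Suc i) w" for w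
    using ev_split[OF prestrategy_conf(4)[OF p matchingD(2)[OF that, of i]]] by (simp add: vlab_def)
  have core: "\<exists>w. sync \<Sigma> i (Suc i) w \<and> sec i w = z \<and> (\<forall>w'. sync \<Sigma> i (Suc i) w' \<longrightarrow> z \<subseteq> sec i w' \<longrightarrow> w \<subseteq> w')"
    if z: "z \<in> conf (st (\<Sigma> i))" for z
  proof -
    let ?w = "{i} \<times> z"
    have s: "sec i ?w = z" by (auto simp: sec_def)
    have m: "matching \<Sigma> i (Suc i) ?w" using z s by (auto simp: matching_def le_less_Suc_eq)
    \<comment> \<open>The schedule of a single pre-strategy: a location inherits the height of the
      unique event of \<open>z\<close> there.\<close>
    define \<rho> where "\<rho> l = rk (st (\<Sigma> i)) (THE s. s \<in> z \<and> evloc \<Sigma> (i, s) = l)" for l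
    have ch: "chain \<Sigma> i (Suc i)" using p by (auto simp: chain_def le_less_Suc_eq)
    have "\<rho> (evloc \<Sigma> (i, s)) = rk (st (\<Sigma> i)) s" if "s \<in> z" for s
    proof -
      have "(THE s'. s' \<in> z \<and> evloc \<Sigma> (i, s') = evloc \<Sigma> (i, s)) = s"
      proof (rule the_equality)
        fix s' assume "s' \<in> z \<and> evloc \<Sigma> (i, s') = evloc \<Sigma> (i, s)"
        then show "s' = s" using evloc_inj[OF ch m, of i s' s] that by simp
      qed (use that in simp)
      then show ?thesis by (simp add: \<rho>_def)
    qed
    then have "ranked \<Sigma> i (Suc i) ?w \<rho>"
      unfolding ranked_def using rk_less[OF prestrategyD(3)[OF p]] s by (auto simp: le_less_Suc_eq)
    then have "sync \<Sigma> i (Suc i) ?w" using m by (auto simp: sync_def)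
    then show ?thesis using s by (intro exI[of _ ?w]) (auto simp: sec_def)
  qed
  show ?thesis
    unfolding pres_def
  proof (intro conjI allI impI ballI)
    fix w assume w: "sync \<Sigma> i (Suc i) w"
    show "sec i w \<in> conf (st (\<Sigma> i))" using matchingD(2)[OF sync_matching[OF w], of i] by simp
    show "lab (\<Sigma> i) ` sec i w = vlab \<Sigma> i (Suc i) w" using vl[OF sync_matching[OF w]] by simp
  qed (simp_all add: p core sec_mono)
qed

text \<open>Causality in a composite may pass through hidden moves, yet any schedule of the state
  respects it. Cutting the state at the location of \<open>e'\<close> leaves a synchronised state
  that still shows \<open>e'\<close>, hence by down-closure also \<open>e\<close>, so the location
  of \<open>e\<close> is within the cut.\<close>

lemma pres_rank:
  assumes c: "chain \<Sigma> i j" and p: "pres \<Sigma> i j E v" and w: "sync \<Sigma> i j w" and \<rho>: "ranked \<Sigma> i j w \<rho>"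
    and e: "e \<in> v w" "e' \<in> v w" "(e, e') \<in> Leq (st E)" "e \<noteq> e'"
  shows "\<rho> (dl i j (lab E e)) < \<rho> (dl i j (lab E e'))"
proof -
  note wm = sync_matching[OF w] and ij = chainD(1)[OF c]
  let ?l = "dl i j (lab E e')"
  let ?low = "{d \<in> w. \<rho> (evloc \<Sigma> d) < \<rho> ?l}"
  have lower: "(k, s') \<in> w \<and> \<rho> (evloc \<Sigma> (k, s')) < \<rho> (evloc \<Sigma> (k, s))"
    if "(k, s) \<in> w" "(s', s) \<in> Leq (st (\<Sigma> k))" "s' \<noteq> s" for k s s'
  proof -
    have k: "i \<le> k" "k < j" using matchingD(1)[OF wm that(1)] by auto
    have "s \<in> sec k w" "s' \<in> sec k w"
      using that confD(4)[OF matchingD(2)[OF wm k], of s s'] by (auto simp: sec_def)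
    then show ?thesis using \<rho> k that unfolding ranked_def by (auto simp: sec_def)
  qed
  have u0: "matching \<Sigma> i j ?low"
    unfolding matching_def
  proof (intro conjI allI impI)
    fix k s assume "(k, s) \<in> ?low"
    then show "i \<le> k" "k < j" using matchingD(1)[OF wm] by auto
  next
    fix k assume k: "i \<le> k \<and> k < j"
    show "sec k ?low \<in> conf (st (\<Sigma> k))"
    proof (rule conf_sub[OF prestrategyD(3)[OF chainD(2)[OF c]] matchingD(2)[OF wm]])
      show "i \<le> k" "k < j" "i \<le> k" "k < j" using k by auto
      show "sec k ?low \<subseteq> sec k w" by (auto simp: sec_def)
      fix s s' assume s: "s \<in> sec k ?low" "(s', s) \<in> Leq (st (\<Sigma> k))"
      then show "s' \<in> sec k ?low" using lower[of k s s'] by (cases "s = s'") (auto simp: sec_def)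
    qed
  next
    fix k assume k: "i \<le> k \<and> Suc k < j"
    show "In1 -` lab (\<Sigma> k) ` sec k ?low = In0 -` lab (\<Sigma> (Suc k)) ` sec (Suc k) ?low"
    proof (intro set_eqI iffI)
      fix b assume "b \<in> In1 -` lab (\<Sigma> k) ` sec k ?low"
      then obtain s where s: "(k, s) \<in> ?low" "lab (\<Sigma> k) s = In1 b" by (auto simp: sec_def)
      then obtain t where t: "(Suc k, t) \<in> w" "lab (\<Sigma> (Suc k)) t = In0 b"
        using matched_partner(1)[OF wm, of k s b] k by blast
      then have "evloc \<Sigma> (Suc k, t) = evloc \<Sigma> (k, s)" using s by (simp add: evloc_def)
      then have "t \<in> sec (Suc k) ?low" using t s by (simp add: sec_def)
      then show "b \<in> In0 -` lab (\<Sigma> (Suc k)) ` sec (Suc k) ?low" using t(2) by force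
    next
      fix b assume "b \<in> In0 -` lab (\<Sigma> (Suc k)) ` sec (Suc k) ?low"
      then obtain s where s: "(Suc k, s) \<in> ?low" "lab (\<Sigma> (Suc k)) s = In0 b" by (auto simp: sec_def)
      then obtain t where t: "(k, t) \<in> w" "lab (\<Sigma> k) t = In1 b"
        using matched_partner(2)[OF wm, of k s b] k by blast
      then have "evloc \<Sigma> (k, t) = evloc \<Sigma> (Suc k, s)" using s by (simp add: evloc_def)
      then have "t \<in> sec k ?low" using t s by (simp add: sec_def)
      then show "b \<in> In1 -` lab (\<Sigma> k) ` sec k ?low" using t(2) by force
    qed
  qed
  \<comment> \<open>Everything ranked strictly below \<open>e'\<close>, together with all that
    happens at the location of \<open>e'\<close> itself; other events of equal rank are left
    out.\<close>
  let ?u = "?low \<union> {d \<in> w. evloc \<Sigma> d = ?l}"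
  have low: "(k, s') \<in> ?low"
    if "(k, s) \<in> w" "evloc \<Sigma> (k, s) = ?l" "(s', s) \<in> Leq (st (\<Sigma> k))" "s' \<noteq> s" for k s s'
    using lower[OF that(1,3,4)] that(2) by simp
  have um: "matching \<Sigma> i j ?u"
    by (rule matching_cut[OF c wm u0 _ low]) auto
  have sub: "?u \<subseteq> w" by blast
  have us: "sync \<Sigma> i j ?u" by (rule sync_sub[OF w um sub])
  have vu: "v ?u \<subseteq> v w" by (rule presD(6)[OF p us w sub])
  have inj: "inj_on (lab E) (v w)" by (rule prestrategy_conf(1)[OF presD(1)[OF p] presD(4)[OF p w]])
  have mem: "\<exists>d\<in>w'. evloc \<Sigma> d = dl i j g" if "g \<in> vlab \<Sigma> i j w'" for g w'
  proof -
    from that consider a t where "g = In0 a" "(i, t) \<in> w'" "lab (\<Sigma> i) t = In0 a"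
      | b t where "g = In1 b" "(j - 1, t) \<in> w'" "lab (\<Sigma> (j - 1)) t = In1 b" unfolding vlab_iff by blast
    then show ?thesis
    proof cases
      case 1
      then show ?thesis by (intro bexI[of _ "(i, t)"]) (auto simp: evloc_def)
    next
      case 2
      then show ?thesis using ij by (intro bexI[of _ "(j - 1, t)"]) (auto simp: evloc_def)
    qed
  qed
  have "lab E e' \<in> vlab \<Sigma> i j w" using presD(5)[OF p w] e(2) by blast
  then have "lab E e' \<in> vlab \<Sigma> i j ?u"
  proof -
    assume "lab E e' \<in> vlab \<Sigma> i j w"
    then consider a t where "lab E e' = In0 a" "(i, t) \<in> w" "lab (\<Sigma> i) t = In0 a"
      | b t where "lab E e' = In1 b" "(j - 1, t) \<in> w" "lab (\<Sigma> (j - 1)) t = In1 b" unfolding vlab_iff by blast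
    then show ?thesis
    proof cases
      case 1
      then have "(i, t) \<in> ?u" by (simp add: evloc_def)
      then show ?thesis using 1 unfolding vlab_iff by blast
    next
      case 2
      then have "(j - 1, t) \<in> ?u" using ij by (simp add: evloc_def)
      then show ?thesis using 2 unfolding vlab_iff by blast
    qed
  qed
  then have "lab E e' \<in> lab E ` v ?u" using presD(5)[OF p us] by simp
  then obtain e2 where "e2 \<in> v ?u" "lab E e2 = lab E e'" by (elim imageE) (rule that; simp)
  then have "e' \<in> v ?u" using inj vu e(2) by (auto dest: inj_onD)
  then have "e \<in> v ?u" using confD(4)[OF presD(4)[OF p us]] e(3) by blast
  then have "lab E e \<in> vlab \<Sigma> i j ?u" using presD(5)[OF p us] by blast
  then obtain d where d: "d \<in> ?u" "evloc \<Sigma> d = dl i j (lab E e)" using mem by blast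
  \<comment> \<open>Equal locations would mean equal labels, because the two outer games have
    different indices; so \<open>e\<close> falls into the strictly lower part of the cut.\<close>
  have "dl i j (lab E e) \<noteq> ?l"
  proof
    assume "dl i j (lab E e) = ?l"
    moreover have "lab E e \<in> range In0 \<union> range In1" "lab E e' \<in> range In0 \<union> range In1"
      using prestrategy_conf(4)[OF presD(1)[OF p] presD(4)[OF p w]] e by auto
    ultimately have "lab E e = lab E e'" using ij by auto
    then show False using inj e by (auto dest: inj_onD)
  qed
  then show ?thesis using d by auto
qed

text \<open>Consecutive runs of a chain, delimited by the breakpoints \<open>p m\<close>, are
  replaced by pre-strategies they present. Matching is inherited at the breakpoints, and
  \<open>pres_rank\<close> lets the old schedule serve.\<close>

lemma coarsen:
  assumes c: "chain \<Sigma> (p 0) (p n)" and mono: "\<And>m. m < n \<Longrightarrow> p m < p (Suc m)"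
    and pr: "\<And>m. m < n \<Longrightarrow> pres \<Sigma> (p m) (p (Suc m)) (\<Sigma>' m) (v m)"
    and w: "sync \<Sigma> (p 0) (p n) w"
  shows "sync \<Sigma>' 0 n {(m, e). m < n \<and> e \<in> v m (seg (p m) (p (Suc m)) w)}" (is "sync \<Sigma>' 0 n ?w")
proof -
  have le: "p m \<le> p m'" if "m \<le> m'" "m' \<le> n" for m m'
    using that
  proof (induction rule: dec_induct)
    case (step k) then show ?case using mono[of k] by linarith
  qed simp
  have bd: "p 0 \<le> p m" "p m < p (Suc m)" "p (Suc m) \<le> p n" if "m < n" for m
    using le[of 0 m] le[of "Suc m" n] mono[of m] that by auto
  have sg: "sync \<Sigma> (p m) (p (Suc m)) (seg (p m) (p (Suc m)) w)" if "m < n" for m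
    using sync_seg[OF w] bd[OF that] by blast
  have s: "sec m ?w = v m (seg (p m) (p (Suc m)) w)" if "m < n" for m using that by (auto simp: sec_def)
  have "matching \<Sigma>' 0 n ?w"
    unfolding matching_def
  proof (intro conjI allI impI)
    fix m assume "0 \<le> m \<and> m < n"
    then show "sec m ?w \<in> conf (st (\<Sigma>' m))" using s presD(4)[OF pr sg] by simp
  next
    fix m assume m: "0 \<le> m \<and> Suc m < n"
    have "In1 -` lab (\<Sigma>' m) ` sec m ?w = In1 -` vlab \<Sigma> (p m) (p (Suc m)) w"
      using m s[of m] presD(5)[OF pr sg, of m] bd[of m] by simp
    also have "\<dots> = In0 -` vlab \<Sigma> (p (Suc m)) (p (Suc (Suc m))) w"
      using matchingD(3)[OF sync_matching[OF w], of "p (Suc m) - 1"] bd[of m] bd[of "Suc m"] m by simp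
    also have "\<dots> = In0 -` lab (\<Sigma>' (Suc m)) ` sec (Suc m) ?w"
      using m s[of "Suc m"] presD(5)[OF pr sg, of "Suc m"] bd[of "Suc m"] by simp
    finally show "In1 -` lab (\<Sigma>' m) ` sec m ?w = In0 -` lab (\<Sigma>' (Suc m)) ` sec (Suc m) ?w" .
  qed auto
  moreover obtain \<rho> where \<rho>: "ranked \<Sigma> (p 0) (p n) w \<rho>" using w by (auto simp: sync_def)
  \<comment> \<open>Game \<open>m\<close> of the coarse chain is game \<open>p m\<close> of the fine
    one, so the schedule is only reindexed.\<close>
  have "ranked \<Sigma>' 0 n ?w (\<lambda>l. \<rho> (p (fst l), snd l))"
    unfolding ranked_def
  proof (intro allI impI, elim conjE)
    fix m s1 s2 assume m: "m < n" and ss: "s1 \<in> sec m ?w" "s2 \<in> sec m ?w" "(s1, s2) \<in> Leq (st (\<Sigma>' m))" "s1 \<noteq> s2"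
    have "ranked \<Sigma> (p m) (p (Suc m)) (seg (p m) (p (Suc m)) w) \<rho>"
      using \<rho> bd[OF m] unfolding ranked_def by auto
    from pres_rank[OF chain_sub[OF c] pr[OF m] sg[OF m] this, of s1 s2]
    have r: "\<rho> (dl (p m) (p (Suc m)) (lab (\<Sigma>' m) s1)) < \<rho> (dl (p m) (p (Suc m)) (lab (\<Sigma>' m) s2))"
      using ss s[OF m] bd[OF m] by simp
    have "sec m ?w \<in> conf (st (\<Sigma>' m))" using s[OF m] presD(4)[OF pr[OF m] sg[OF m]] by simp
    then have rg: "lab (\<Sigma>' m) ` sec m ?w \<subseteq> range In0 \<union> range In1"
      by (rule prestrategy_conf(4)[OF presD(1)[OF pr[OF m]]])
    have "(p (fst (evloc \<Sigma>' (m, t))), snd (evloc \<Sigma>' (m, t))) = dl (p m) (p (Suc m)) (lab (\<Sigma>' m) t)"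
      if "t \<in> sec m ?w" for t
    proof -
      have "lab (\<Sigma>' m) t \<in> range In0 \<union> range In1" using rg that by blast
      then show ?thesis by (auto simp: evloc_def)
    qed
    then show "\<rho> (p (fst (evloc \<Sigma>' (m, s1))), snd (evloc \<Sigma>' (m, s1)))
        < \<rho> (p (fst (evloc \<Sigma>' (m, s2))), snd (evloc \<Sigma>' (m, s2)))"
      using r ss by simp
  qed
  ultimately show ?thesis by (auto simp: sync_def)
qed

lemma pres_sync2:
  assumes ch: "chain \<Sigma> i k" and ij: "i < j" "j < k" and p: "pres \<Sigma> i j E v" and q: "pres \<Sigma> j k F u"
    and w: "sync \<Sigma> i k w"
  shows "sync2 F E (v (seg i j w)) (u (seg j k w))"
proof -
  have c1: "chain \<Sigma> i j" and c2: "chain \<Sigma> j k" using chain_sub[OF ch] ij by auto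
  have s1: "sync \<Sigma> i j (seg i j w)" and s2: "sync \<Sigma> j k (seg j k w)" using sync_seg[OF w] ij by auto
  obtain \<rho> where \<rho>: "ranked \<Sigma> i k w \<rho>" using w by (auto simp: sync_def)
  have r1: "ranked \<Sigma> i j (seg i j w) \<rho>" and r2: "ranked \<Sigma> j k (seg j k w) \<rho>"
    using \<rho> ij unfolding ranked_def by auto
  \<comment> \<open>The fine schedule read at the three games \<open>i\<close>, \<open>j\<close> and
    \<open>k\<close> that remain.\<close>
  define r where "r = copair (\<lambda>a. \<rho> (i, a)) (copair (\<lambda>b. \<rho> (j, b)) (\<lambda>c. \<rho> (k, c)))"
  have x: "v (seg i j w) \<in> conf (st E)" "u (seg j k w) \<in> conf (st F)"
    using presD(4)[OF p s1] presD(4)[OF q s2] .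
  have e1: "r (lloc (lab E e)) = \<rho> (dl i j (lab E e))" if "e \<in> v (seg i j w)" for e
  proof -
    have "lab E e \<in> range In0 \<union> range In1" using prestrategy_conf(4)[OF presD(1)[OF p] x(1)] that by blast
    then show ?thesis by (auto simp: r_def copair_def)
  qed
  have e2: "r (In1 (lab F e)) = \<rho> (dl j k (lab F e))" if "e \<in> u (seg j k w)" for e
  proof -
    have "lab F e \<in> range In0 \<union> range In1" using prestrategy_conf(4)[OF presD(1)[OF q] x(2)] that by blast
    then show ?thesis by (auto simp: r_def copair_def)
  qed
  have "rank2 F E (v (seg i j w)) (u (seg j k w)) r"
    unfolding rank2_def using pres_rank[OF c1 p s1 r1] pres_rank[OF c2 q s2 r2] e1 e2 by simp
  moreover have "match2 F E (v (seg i j w)) (u (seg j k w))"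
    unfolding match2_def presD(5)[OF p s1] presD(5)[OF q s2]
    using x matching_mid[OF sync_matching[OF w] ij] by blast
  ultimately show ?thesis by (auto simp: sync2_def)
qed

text \<open>The difficult converse of \<open>pres_sync2\<close>. Three schedules are given, for
  \<open>a\<close>, for \<open>b\<close> and for the pair \<open>x\<close>, \<open>y\<close>, with
  no common scale. By \<open>progress_sync\<close> it suffices to move any smaller matching state
  \<open>t\<close> one location forward; the schedule of the pair names the visible move
  \<open>l\<close> to aim at, and the schedules of \<open>a\<close> and \<open>b\<close> name hidden
  steps leading towards it.\<close>

lemma sync_join:
  assumes ch: "chain \<Sigma> i k" and ij: "i < j" "j < k" and p: "pres \<Sigma> i j E v" and q: "pres \<Sigma> j k F u"
    and xy: "sync2 F E x y"
    and a: "sync \<Sigma> i j a" "v a = x" "\<And>w'. sync \<Sigma> i j w' \<Longrightarrow> x \<subseteq> v w' \<Longrightarrow> a \<subseteq> w'"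
    and b: "sync \<Sigma> j k b" "u b = y" "\<And>w'. sync \<Sigma> j k w' \<Longrightarrow> y \<subseteq> u w' \<Longrightarrow> b \<subseteq> w'"
  shows "sync \<Sigma> i k (a \<union> b)"
proof (rule progress_sync[OF ch])
  have c1: "chain \<Sigma> i j" and c2: "chain \<Sigma> j k" using chain_sub[OF ch] ij by auto
  note am = sync_matching[OF a(1)] and bm = sync_matching[OF b(1)]
  have xc: "x \<in> conf (st E)" and yc: "y \<in> conf (st F)"
    and mt: "In1 -` lab E ` x = In0 -` lab F ` y" using xy by (auto simp: sync2_def match2_def)
  have injE: "inj_on (lab E) x" and injF: "inj_on (lab F) y"
    using prestrategy_conf(1)[OF presD(1)[OF p] xc] prestrategy_conf(1)[OF presD(1)[OF q] yc] .
  show "matching \<Sigma> i k (a \<union> b)"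
  proof (rule matching_join[OF am bm ij])
    show "In1 -` vlab \<Sigma> i j a = In0 -` vlab \<Sigma> j k b"
      using presD(5)[OF p a(1)] presD(5)[OF q b(1)] a(2) b(2) mt by simp
  qed
  obtain \<rho> where \<rho>: "rank2 F E x y \<rho>" using xy by (auto simp: sync2_def)
  have sa: "seg i j (a \<union> b) = a" and sb: "seg j k (a \<union> b) = b"
    using matchingD(1)[OF am] matchingD(1)[OF bm] unfolding seg_def by fastforce+
  fix t assume t: "matching \<Sigma> i k t" and sub: "t \<subset> a \<union> b"
  let ?t1 = "seg i j t" and ?t2 = "seg j k t"
  have m1: "matching \<Sigma> i j ?t1" and m2: "matching \<Sigma> j k ?t2" using matching_seg[OF t] ij by auto
  have tt: "t = ?t1 \<union> ?t2" using matchingD(1)[OF t] unfolding seg_def by force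
  have sub1: "?t1 \<subseteq> a" and sub2: "?t2 \<subseteq> b"
    using seg_mono[of t "a \<union> b" i j] seg_mono[of t "a \<union> b" j k] sub sa sb by auto
  have s1: "sync \<Sigma> i j ?t1" and s2: "sync \<Sigma> j k ?t2" using sync_sub[OF a(1) m1 sub1] sync_sub[OF b(1) m2 sub2] .
  have tmid: "In1 -` vlab \<Sigma> i j ?t1 = In0 -` vlab \<Sigma> j k ?t2" by (rule matching_mid[OF t ij])
  define x0 y0 where "x0 = v ?t1" and "y0 = u ?t2"
  have x0: "x0 \<in> conf (st E)" "x0 \<subseteq> x" and lx0: "lab E ` x0 = vlab \<Sigma> i j ?t1"
    using presD(4)[OF p s1] presD(6)[OF p s1 a(1) sub1] presD(5)[OF p s1] a(2) by (auto simp: x0_def)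
  have y0: "y0 \<in> conf (st F)" "y0 \<subseteq> y" and ly0: "lab F ` y0 = vlab \<Sigma> j k ?t2"
    using presD(4)[OF q s2] presD(6)[OF q s2 b(1) sub2] presD(5)[OF q s2] b(2) by (auto simp: y0_def)
  have mt0: "In1 -` lab E ` x0 = In0 -` lab F ` y0" using tmid lx0 ly0 by simp
  \<comment> \<open>The locations of \<open>x\<close> and \<open>y\<close> that \<open>t\<close> has
    not yet made visible; \<open>l\<close> is taken of least rank among them.\<close>
  define L where "L = lloc ` lab E ` (x - x0) \<union> In1 ` lab F ` (y - y0)"
  have "L \<noteq> {}"
  proof
    assume "L = {}"
    then have "x0 = x" "y0 = y" using x0(2) y0(2) by (auto simp: L_def)
    \<comment> \<open>Here the leastness of \<open>a\<close> and \<open>b\<close> enters: a state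
      already showing all of \<open>x\<close> and \<open>y\<close> has nothing left to do.\<close>
    then have "a = ?t1" "b = ?t2" using a(3)[OF s1] b(3)[OF s2] sub1 sub2 by (auto simp: x0_def y0_def)
    then show False using tt sub by auto
  qed
  then obtain l where l: "l \<in> L" "\<And>l'. l' \<in> L \<Longrightarrow> \<rho> l \<le> \<rho> l'"
    using ex_has_least_nat[of "\<lambda>l. l \<in> L" _ \<rho>] by (metis ex_in_conv)
  \<comment> \<open>One visible move further on each side. These are configurations because, by the
    choice of \<open>l\<close>, strict causes of the new events are already in \<open>x0\<close> or
    \<open>y0\<close>.\<close>
  define x1 y1 where "x1 = x0 \<union> {s \<in> x. lloc (lab E s) = l}" and "y1 = y0 \<union> {s \<in> y. In1 (lab F s) = l}"
  have x1: "x1 \<in> conf (st E)" "x1 \<subseteq> x" "x0 \<subseteq> x1"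
  proof -
    show sx: "x1 \<subseteq> x" "x0 \<subseteq> x1" using x0(2) by (auto simp: x1_def)
    show "x1 \<in> conf (st E)"
    proof (rule conf_sub[OF prestrategyD(3)[OF presD(1)[OF p]] xc sx(1)])
      fix e e' assume e: "e \<in> x1" "(e', e) \<in> Leq (st E)"
      show "e' \<in> x1"
      proof (cases "e \<in> x0 \<or> e = e'")
        case True then show ?thesis using e confD(4)[OF x0(1), of e e'] by (auto simp: x1_def)
      next
        case False
        then have "e \<in> x" "lloc (lab E e) = l" "e' \<noteq> e" using e(1) by (auto simp: x1_def)
        moreover have "e' \<in> x" using confD(4)[OF xc \<open>e \<in> x\<close> e(2)] .
        ultimately have "\<rho> (lloc (lab E e')) < \<rho> l" using \<rho> e(2) unfolding rank2_def by metis
        then have "lloc (lab E e') \<notin> L" using l(2) by fastforce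
        then show ?thesis using \<open>e' \<in> x\<close> by (auto simp: L_def x1_def)
      qed
    qed
  qed
  have y1: "y1 \<in> conf (st F)" "y1 \<subseteq> y" "y0 \<subseteq> y1"
  proof -
    show sx: "y1 \<subseteq> y" "y0 \<subseteq> y1" using y0(2) by (auto simp: y1_def)
    show "y1 \<in> conf (st F)"
    proof (rule conf_sub[OF prestrategyD(3)[OF presD(1)[OF q]] yc sx(1)])
      fix e e' assume e: "e \<in> y1" "(e', e) \<in> Leq (st F)"
      show "e' \<in> y1"
      proof (cases "e \<in> y0 \<or> e = e'")
        case True then show ?thesis using e confD(4)[OF y0(1), of e e'] by (auto simp: y1_def)
      next
        case False
        then have "e \<in> y" "In1 (lab F e) = l" "e' \<noteq> e" using e(1) by (auto simp: y1_def)
        moreover have "e' \<in> y" using confD(4)[OF yc \<open>e \<in> y\<close> e(2)] .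
        ultimately have "\<rho> (In1 (lab F e')) < \<rho> l" using \<rho> e(2) unfolding rank2_def by metis
        then have "In1 (lab F e') \<notin> L" using l(2) by fastforce
        then show ?thesis using \<open>e' \<in> y\<close> by (auto simp: L_def y1_def)
      qed
    qed
  qed
  obtain c1' where cx: "sync \<Sigma> i j c1'" "v c1' = x1" "\<And>w'. sync \<Sigma> i j w' \<Longrightarrow> x1 \<subseteq> v w' \<Longrightarrow> c1' \<subseteq> w'"
    using presD(7)[OF p x1(1)] by blast
  obtain c2' where cy: "sync \<Sigma> j k c2'" "u c2' = y1" "\<And>w'. sync \<Sigma> j k w' \<Longrightarrow> y1 \<subseteq> u w' \<Longrightarrow> c2' \<subseteq> w'"
    using presD(7)[OF q y1(1)] by blast
  have ca: "c1' \<subseteq> a" using cx(3)[OF a(1)] x1(2) a(2) by simp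
  have cb: "c2' \<subseteq> b" using cy(3)[OF b(1)] y1(2) b(2) by simp
  \<comment> \<open>The goals of the two halves: \<open>t\<close> enlarged by what is needed to show
    \<open>x1\<close> and \<open>y1\<close>, so that \<open>l\<close> is the only location that can
    newly appear at the interfaces.\<close>
  let ?z1 = "?t1 \<union> c1'" and ?z2 = "?t2 \<union> c2'"
  have z1: "sync \<Sigma> i j ?z1" "?z1 \<subseteq> a"
    using sync_sub[OF a(1) matching_Un[OF c1 am m1 sync_matching[OF cx(1)] sub1 ca]] sub1 ca by auto
  have z2: "sync \<Sigma> j k ?z2" "?z2 \<subseteq> b"
    using sync_sub[OF b(1) matching_Un[OF c2 bm m2 sync_matching[OF cy(1)] sub2 cb]] sub2 cb by auto
  have lz1: "vlab \<Sigma> i j ?z1 = lab E ` x1"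
    using presD(5)[OF p cx(1)] cx(2) lx0 x1(3) by (simp add: vlab_Un) blast
  have lz2: "vlab \<Sigma> j k ?z2 = lab F ` y1"
    using presD(5)[OF q cy(1)] cy(2) ly0 y1(3) by (simp add: vlab_Un) blast
  have p1: "?t1 \<subset> ?z1" if "x1 \<noteq> x0"
  proof -
    have "\<not> c1' \<subseteq> ?t1"
      using presD(6)[OF p cx(1) s1] cx(2) that x1(3) by (auto simp: x0_def)
    then show ?thesis by blast
  qed
  have p2: "?t2 \<subset> ?z2" if "y1 \<noteq> y0"
  proof -
    have "\<not> c2' \<subseteq> ?t2"
      using presD(6)[OF q cy(1) s2] cy(2) that y1(3) by (auto simp: y0_def)
    then show ?thesis by blast
  qed
  \<comment> \<open>A step of the left half away from the shared game concerns that half alone, so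
    the right half may stay as it is.\<close>
  have lift1: "stp \<Sigma> i k t (u1 \<union> ?t2) l1" if st: "stp \<Sigma> i j ?t1 u1 l1" and ne: "fst l1 \<noteq> j" for u1 l1
  proof -
    have s: "matching \<Sigma> i j u1" "?t1 \<subset> u1" "l1 \<notin> evloc \<Sigma> ` ?t1" "evloc \<Sigma> ` (u1 - ?t1) = {l1}"
      using st by (auto simp: stp_def)
    have m: "matching \<Sigma> i k (u1 \<union> ?t2)"
      using matching_join[OF s(1) m2 ij] stp_In1(1)[OF c1 st ne] tmid by simp
    have "l1 \<in> evloc \<Sigma> ` u1" using s(4) by blast
    then have "fst l1 < j" using evloc_range[OF c1 s(1)] ne by fastforce
    then have "l1 \<notin> evloc \<Sigma> ` ?t2" using evloc_range[OF c2 m2, of l1] by auto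
    then have nl: "l1 \<notin> evloc \<Sigma> ` t" using s(3) tt by (metis UnE image_Un)
    have dj: "u1 \<inter> ?t2 = {}" using matchingD(1)[OF s(1)] by fastforce
    have "u1 \<union> ?t2 - t = u1 - ?t1" using tt dj s(2) by blast
    moreover have "t \<subset> u1 \<union> ?t2" using tt s(2) dj by blast
    ultimately show ?thesis unfolding stp_def using t m nl s(4) by simp
  qed
  have lift2: "stp \<Sigma> i k t (?t1 \<union> u2) l2" if st: "stp \<Sigma> j k ?t2 u2 l2" and ne: "fst l2 \<noteq> j" for u2 l2
  proof -
    have s: "matching \<Sigma> j k u2" "?t2 \<subset> u2" "l2 \<notin> evloc \<Sigma> ` ?t2" "evloc \<Sigma> ` (u2 - ?t2) = {l2}"
      using st by (auto simp: stp_def)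
    have m: "matching \<Sigma> i k (?t1 \<union> u2)"
      using matching_join[OF m1 s(1) ij] stp_In0(1)[OF c2 st ne] tmid by simp
    have "l2 \<in> evloc \<Sigma> ` u2" using s(4) by blast
    then have "j < fst l2" using evloc_range[OF c2 s(1)] ne by fastforce
    then have "l2 \<notin> evloc \<Sigma> ` ?t1" using evloc_range[OF c1 m1, of l2] by auto
    then have nl: "l2 \<notin> evloc \<Sigma> ` t" using s(3) tt by (metis UnE image_Un)
    have dj: "u2 \<inter> ?t1 = {}" using matchingD(1)[OF s(1)] by fastforce
    have "?t1 \<union> u2 - t = u2 - ?t2" using tt dj s(2) by blast
    moreover have "t \<subset> ?t1 \<union> u2" using tt s(2) dj by blast
    ultimately show ?thesis unfolding stp_def using t m nl s(4) by simp
  qed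
  \<comment> \<open>A step that does touch the shared game inside the goal \<open>?z1\<close> must
    be the move \<open>l\<close>, as \<open>x1\<close> shows no other new label.\<close>
  have at1: "l = In1 (In0 c)" if st: "stp \<Sigma> i j ?t1 u1 (j, c)" and su: "u1 \<subseteq> ?z1" for u1 c
  proof -
    have "In1 -` vlab \<Sigma> i j u1 \<subseteq> In1 -` vlab \<Sigma> i j ?z1" using sec_mono[OF su, of "j - 1"]
      unfolding vlab_vimage by (intro vimage_mono image_mono)
    then have "c \<in> In1 -` lab E ` x1" using stp_In1(2)[OF c1 st refl] lz1 by auto
    moreover have "c \<notin> In1 -` lab E ` x0"
    proof
      assume "c \<in> In1 -` lab E ` x0"
      then have "c \<in> In1 -` vlab \<Sigma> i j ?t1" using lx0 by simp
      then obtain s where s: "(j - 1, s) \<in> ?t1" "lab (\<Sigma> (j - 1)) s = In1 c"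
        unfolding vlab_vimage In_sec_iff by blast
      then have "evloc \<Sigma> (j - 1, s) = (j, c)" using ij by (simp add: evloc_def)
      then show False using st s(1) unfolding stp_def by (metis image_eqI)
    qed
    ultimately obtain s where "s \<in> x1" "s \<notin> x0" "lab E s = In1 c" by (auto dest: sym)
    then show ?thesis by (auto simp: x1_def)
  qed
  have at2: "l = In1 (In0 c)" if st: "stp \<Sigma> j k ?t2 u2 (j, c)" and su: "u2 \<subseteq> ?z2" for u2 c
  proof -
    have "In0 -` vlab \<Sigma> j k u2 \<subseteq> In0 -` vlab \<Sigma> j k ?z2" using sec_mono[OF su, of j]
      unfolding vlab_vimage by (intro vimage_mono image_mono)
    then have "c \<in> In0 -` lab F ` y1" using stp_In0(2)[OF c2 st refl] lz2 by auto
    moreover have "c \<notin> In0 -` lab F ` y0"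
    proof
      assume "c \<in> In0 -` lab F ` y0"
      then have "c \<in> In0 -` vlab \<Sigma> j k ?t2" using ly0 by simp
      then obtain s where s: "(j, s) \<in> ?t2" "lab (\<Sigma> j) s = In0 c"
        unfolding vlab_vimage In_sec_iff by blast
      then have "evloc \<Sigma> (j, s) = (j, c)" by (simp add: evloc_def)
      then show False using st s(1) unfolding stp_def by (metis image_eqI)
    qed
    ultimately obtain s where "s \<in> y1" "s \<notin> y0" "lab F s = In0 c" by (auto dest: sym)
    then show ?thesis by (auto simp: y1_def)
  qed
  \<comment> \<open>A move \<open>l\<close> of the shared game is missing on both sides at once,
    because \<open>x\<close>, \<open>y\<close> and also \<open>x0\<close>, \<open>y0\<close> agree
    there. So both halves have to advance.\<close>
  have mid: "x1 \<noteq> x0 \<and> y1 \<noteq> y0" if lc: "l = In1 (In0 c)" for c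
  proof -
    have "c \<in> In1 -` lab E ` x \<and> c \<notin> In1 -` lab E ` x0"
      using l(1)
      unfolding L_def
    proof
      assume "l \<in> lloc ` lab E ` (x - x0)"
      then obtain s where s: "s \<in> x" "s \<notin> x0" "lloc (lab E s) = l" by auto
      have "lab E s \<in> range In0 \<union> range In1" using prestrategy_conf(4)[OF presD(1)[OF p] xc] s(1) by blast
      then have ls: "lab E s = In1 c" using s(3) lc by auto
      have "In1 c \<notin> lab E ` x0"
      proof
        assume "In1 c \<in> lab E ` x0"
        then obtain s' where "s' \<in> x0" "lab E s' = lab E s" using ls by auto
        then show False using inj_onD[OF injE, of s' s] s x0(2) by auto
      qed
      then show ?thesis using s(1) ls by force
    next
      assume "l \<in> In1 ` lab F ` (y - y0)"
      then obtain s where s: "s \<in> y" "s \<notin> y0" "lab F s = In0 c" using lc by auto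
      have "In0 c \<notin> lab F ` y0"
      proof
        assume "In0 c \<in> lab F ` y0"
        then obtain s' where "s' \<in> y0" "lab F s' = lab F s" using s(3) by auto
        then show False using inj_onD[OF injF, of s' s] s y0(2) by auto
      qed
      moreover have "In0 c \<in> lab F ` y" using s by force
      ultimately show ?thesis unfolding mt mt0 by simp
    qed
    then have "In1 c \<in> lab E ` x" "In1 c \<notin> lab E ` x0" by simp_all
    moreover have "In0 c \<in> lab F ` y" "In0 c \<notin> lab F ` y0"
      using \<open>c \<in> In1 -` lab E ` x \<and> c \<notin> In1 -` lab E ` x0\<close> unfolding mt mt0 by simp_all
    ultimately obtain s t where "s \<in> x" "In1 c = lab E s" "In1 c \<notin> lab E ` x0"
      and "t \<in> y" "In0 c = lab F t" "In0 c \<notin> lab F ` y0" by (elim imageE)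
    then have "s \<in> x1" "s \<notin> x0" "t \<in> y1" "t \<notin> y0" using lc by (auto simp: x1_def y1_def dest: sym)
    then show ?thesis by blast
  qed
  \<comment> \<open>Both halves are ready for the same shared move, and are advanced
    simultaneously.\<close>
  have both: "stp \<Sigma> i k t (u1 \<union> u2) (j, c)"
    if st1: "stp \<Sigma> i j ?t1 u1 (j, c)" and st2: "stp \<Sigma> j k ?t2 u2 (j, c)" for u1 u2 c
  proof -
    have s: "matching \<Sigma> i j u1" "?t1 \<subset> u1" "(j, c) \<notin> evloc \<Sigma> ` ?t1" "evloc \<Sigma> ` (u1 - ?t1) = {(j, c)}"
      using st1 by (auto simp: stp_def)
    have s': "matching \<Sigma> j k u2" "?t2 \<subset> u2" "(j, c) \<notin> evloc \<Sigma> ` ?t2" "evloc \<Sigma> ` (u2 - ?t2) = {(j, c)}"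
      using st2 by (auto simp: stp_def)
    have m: "matching \<Sigma> i k (u1 \<union> u2)"
      using matching_join[OF s(1) s'(1) ij] stp_In1(2)[OF c1 st1 refl] stp_In0(2)[OF c2 st2 refl] tmid by simp
    have nl: "(j, c) \<notin> evloc \<Sigma> ` t" using s(3) s'(3) tt by (metis UnE image_Un)
    have dj: "u1 \<inter> u2 = {}" using matchingD(1)[OF s(1)] matchingD(1)[OF s'(1)] by fastforce
    have "u1 \<union> u2 - t = (u1 - ?t1) \<union> (u2 - ?t2)" using tt dj s(2) s'(2) by blast
    moreover have "t \<subset> u1 \<union> u2" using tt s(2) s'(2) dj by blast
    ultimately show ?thesis unfolding stp_def using t m nl s(4) s'(4) by (simp add: image_Un)
  qed
  show "\<exists>t' l'. stp \<Sigma> i k t t' l' \<and> t' \<subseteq> a \<union> b"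
  proof (cases "x1 = x0")
    case False
    then obtain u1 l1 where st1: "stp \<Sigma> i j ?t1 u1 l1" "u1 \<subseteq> ?z1"
      using sync_progress[OF c1 z1(1) m1 p1] by blast
    show ?thesis
    proof (cases "fst l1 = j")
      case False
      have "u1 \<union> ?t2 \<subseteq> a \<union> b" using st1(2) z1(2) sub2 by blast
      then show ?thesis using lift1[OF st1(1) False] by blast
    next
      case True
      then obtain c where c: "l1 = (j, c)" by (metis prod.collapse)
      have lc: "l = In1 (In0 c)" using at1 st1 c by blast
      then have "y1 \<noteq> y0" using mid by blast
      then obtain u2 l2 where st2: "stp \<Sigma> j k ?t2 u2 l2" "u2 \<subseteq> ?z2"
        using sync_progress[OF c2 z2(1) m2 p2] by blast
      show ?thesis
      proof (cases "fst l2 = j")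
        case False
        have "?t1 \<union> u2 \<subseteq> a \<union> b" using st2(2) z2(2) sub1 by blast
        then show ?thesis using lift2[OF st2(1) False] by blast
      next
        case True
        then obtain c' where c': "l2 = (j, c')" by (metis prod.collapse)
        have "l = In1 (In0 c')" using at2 st2 c' by blast
        then have "stp \<Sigma> i k t (u1 \<union> u2) (j, c)" using both st1(1) st2(1) c c' lc by simp
        moreover have "u1 \<union> u2 \<subseteq> a \<union> b" using st1(2) st2(2) z1(2) z2(2) by blast
        ultimately show ?thesis by blast
      qed
    qed
  next
    case True
    \<comment> \<open>The location \<open>l\<close> is missing on at least one side. In this case
      only the right half advances, and \<open>mid\<close> rules out that its step touches the
      shared game.\<close>
    have "y1 \<noteq> y0"
    proof
      assume "y1 = y0"
      then have "l \<notin> L" using True x0(2) y0(2) by (auto simp: L_def x1_def y1_def)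
      then show False using l(1) by simp
    qed
    then obtain u2 l2 where st2: "stp \<Sigma> j k ?t2 u2 l2" "u2 \<subseteq> ?z2"
      using sync_progress[OF c2 z2(1) m2 p2] by blast
    have ne: "fst l2 \<noteq> j"
    proof
      assume "fst l2 = j"
      then obtain c where c: "l2 = (j, c)" by (metis prod.collapse)
      then have "l = In1 (In0 c)" using at2 st2 by blast
      then show False using mid True by blast
    qed
    have "?t1 \<union> u2 \<subseteq> a \<union> b" using st2(2) z2(2) sub1 by blast
    then show ?thesis using lift2[OF st2(1) ne] by blast
  qed
qed

lemma pres_inter:
  assumes ch: "chain \<Sigma> i k" and ij: "i < j" "j < k" and p: "pres \<Sigma> i j E v" and q: "pres \<Sigma> j k F u"
  shows "inter E F"
proof
  show "prestrategy E" "prestrategy F" using presD(1)[OF p] presD(1)[OF q] .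
  show "trg E = src F" using presD(3)[OF p] presD(2)[OF q] chainD(3)[OF ch, of "j - 1"] ij by simp
qed

text \<open>The inductive step for arbitrary bracketings: composites of presented pre-strategies are
  presented by the states of the joined chain.\<close>

lemma pres_comp:
  assumes ch: "chain \<Sigma> i k" and ij: "i < j" "j < k" and p: "pres \<Sigma> i j E v" and q: "pres \<Sigma> j k F u"
  shows "pres \<Sigma> i k (F \<odot>\<^sub>s E) (\<lambda>w. vis F E (v (seg i j w)) (u (seg j k w)))"
proof -
  interpret inter E F by (rule pres_inter[OF assms])
  have s1: "sync \<Sigma> i j (seg i j w)" and s2: "sync \<Sigma> j k (seg j k w)" if "sync \<Sigma> i k w" for w
    using sync_seg[OF that] ij by auto
  note sync2 = pres_sync2[OF assms]
  show ?thesis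
    unfolding pres_def
  proof (intro conjI allI impI ballI)
    show "prestrategy (F \<odot>\<^sub>s E)" by (rule comp_prestrategy)
    show "src (F \<odot>\<^sub>s E) = src (\<Sigma> i)" "trg (F \<odot>\<^sub>s E) = trg (\<Sigma> (k - 1))"
      using presD(2)[OF p] presD(3)[OF q] by (simp_all add: comp_simps)
    fix w assume w: "sync \<Sigma> i k w"
    show "vis F E (v (seg i j w)) (u (seg j k w)) \<in> conf (st (F \<odot>\<^sub>s E))" by (rule vis_conf[OF sync2[OF w]])
    show "lab (F \<odot>\<^sub>s E) ` vis F E (v (seg i j w)) (u (seg j k w)) = vlab \<Sigma> i k w"
      unfolding comp_simps comp_lab_vis[OF sync2[OF w]] vl_def presD(5)[OF p s1[OF w]] presD(5)[OF q s2[OF w]]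
    proof -
      have "j \<le> k - 1" "k - 1 < k" using ij by auto
      then show "In0 ` (In0 -` vlab \<Sigma> i j (seg i j w)) \<union> In1 ` (In1 -` vlab \<Sigma> j k (seg j k w)) = vlab \<Sigma> i k w"
        using ij by (simp add: vlab_def[of \<Sigma> i k])
    qed
    fix w' assume w': "sync \<Sigma> i k w'" "w \<subseteq> w'"
    show "vis F E (v (seg i j w)) (u (seg j k w)) \<subseteq> vis F E (v (seg i j w')) (u (seg j k w'))"
      using presD(6)[OF p s1[OF w] s1[OF w'(1)] seg_mono[OF w'(2)]]
        presD(6)[OF q s2[OF w] s2[OF w'(1)] seg_mono[OF w'(2)]] by (rule vis_mono)
  next
    fix z assume z: "z \<in> conf (st (F \<odot>\<^sub>s E))"
    obtain x y where xy: "sync2 F E x y" "vis F E x y = z"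
      "\<And>x' y'. sync2 F E x' y' \<Longrightarrow> z \<subseteq> vis F E x' y' \<Longrightarrow> x \<subseteq> x' \<and> y \<subseteq> y'"
      using least_sync2[OF z] by blast
    have xyc: "x \<in> conf (st E)" "y \<in> conf (st F)" using xy(1) by (auto simp: sync2_def match2_def)
    obtain a where a: "sync \<Sigma> i j a" "v a = x" "\<And>w'. sync \<Sigma> i j w' \<Longrightarrow> x \<subseteq> v w' \<Longrightarrow> a \<subseteq> w'"
      using presD(7)[OF p xyc(1)] by blast
    obtain b where b: "sync \<Sigma> j k b" "u b = y" "\<And>w'. sync \<Sigma> j k w' \<Longrightarrow> y \<subseteq> u w' \<Longrightarrow> b \<subseteq> w'"
      using presD(7)[OF q xyc(2)] by blast
    \<comment> \<open>The least pair for \<open>z\<close> is refined by the least states of its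
      members; their union is the least state for \<open>z\<close>.\<close>
    have ab: "sync \<Sigma> i k (a \<union> b)" by (rule sync_join[OF assms xy(1) a b])
    have sa: "seg i j (a \<union> b) = a" and sb: "seg j k (a \<union> b) = b"
      using matchingD(1)[OF sync_matching[OF a(1)]] matchingD(1)[OF sync_matching[OF b(1)]]
      unfolding seg_def by fastforce+
    have "a \<union> b \<subseteq> w'" if w': "sync \<Sigma> i k w'" "z \<subseteq> vis F E (v (seg i j w')) (u (seg j k w'))" for w'
    proof -
      have "x \<subseteq> v (seg i j w')" "y \<subseteq> u (seg j k w')" using xy(3)[OF sync2[OF w'(1)] w'(2)] by auto
      then have "a \<subseteq> seg i j w'" "b \<subseteq> seg j k w'" using a(3)[OF s1[OF w'(1)]] b(3)[OF s2[OF w'(1)]] by auto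
      then show ?thesis by (auto simp: seg_def)
    qed
    then show "\<exists>w. sync \<Sigma> i k w \<and> vis F E (v (seg i j w)) (u (seg j k w)) = z \<and>
        (\<forall>w'. sync \<Sigma> i k w' \<longrightarrow> z \<subseteq> vis F E (v (seg i j w')) (u (seg j k w')) \<longrightarrow> w \<subseteq> w')"
      using ab sa sb a(2) b(2) xy(2) by (intro exI[of _ "a \<union> b"]) simp
  qed
qed

section \<open>The associator\<close>

lemma hcomp_cell_vis:
  assumes "inter \<sigma> \<tau>" "inter \<sigma>' \<tau>'" "f \<in> two_cells \<sigma> \<sigma>'" "g \<in> two_cells \<tau> \<tau>'"
  shows "hcomp_cell g f \<in> two_cells (\<tau> \<odot>\<^sub>s \<sigma>) (\<tau>' \<odot>\<^sub>s \<sigma>')"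
    "sync2 \<tau> \<sigma> x y \<Longrightarrow> cfun (hcomp_cell g f) ` vis \<tau> \<sigma> x y = vis \<tau>' \<sigma>' (cfun f ` x) (cfun g ` y)"
proof -
  interpret A: inter \<sigma> \<tau> by fact
  interpret B: inter \<sigma>' \<tau>' by fact
  interpret AB: inter_cells \<sigma> \<tau> \<sigma>' \<tau>' f g by unfold_locales (use assms(3,4) in auto)
  show "hcomp_cell g f \<in> two_cells (\<tau> \<odot>\<^sub>s \<sigma>) (\<tau>' \<odot>\<^sub>s \<sigma>')" by (rule AB.hcomp_in)
  show "cfun (hcomp_cell g f) ` vis \<tau> \<sigma> x y = vis \<tau>' \<sigma>' (cfun f ` x) (cfun g ` y)" if "sync2 \<tau> \<sigma> x y"
    using that by (rule AB.hcomp_vis)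
qed

text \<open>The analogue of \<open>sync2_image\<close> for a chain: one 2-cell per component, with
  the schedule unchanged.\<close>

lemma sync_image:
  assumes c: "chain \<Sigma> i j" and \<Phi>: "\<And>k. i \<le> k \<Longrightarrow> k < j \<Longrightarrow> \<Phi> k \<in> two_cells (\<Sigma> k) (\<Sigma>' k)" and w: "sync \<Sigma> i j w"
  shows "sync \<Sigma>' i j ((\<lambda>(k, s). (k, cfun (\<Phi> k) s)) ` w)" (is "sync \<Sigma>' i j ?w")
    "\<And>k. sec k ((\<lambda>(k, s). (k, cfun (\<Phi> k) s)) ` w) = cfun (\<Phi> k) ` sec k w"
proof -
  show s: "\<And>k. sec k ?w = cfun (\<Phi> k) ` sec k w" unfolding sec_def by force
  note m = matchingD[OF sync_matching[OF w]]
  obtain \<rho> where \<rho>: "ranked \<Sigma> i j w \<rho>" using w by (auto simp: sync_def)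
  have "matching \<Sigma>' i j ?w"
    unfolding matching_def s
  proof (intro conjI allI impI)
    fix k t assume "(k, t) \<in> ?w"
    then obtain s where "(k, s) \<in> w" by auto
    then show "i \<le> k" "k < j" using m(1) by auto
  next
    fix k assume "i \<le> k \<and> k < j"
    then show "cfun (\<Phi> k) ` sec k w \<in> conf (st (\<Sigma>' k))" using two_cell_conf[OF \<Phi>[of k] m(2)[of k]] by simp
  next
    fix k assume k: "i \<le> k \<and> Suc k < j"
    then show "In1 -` lab (\<Sigma>' k) ` cfun (\<Phi> k) ` sec k w = In0 -` lab (\<Sigma>' (Suc k)) ` cfun (\<Phi> (Suc k)) ` sec (Suc k) w"
      using two_cell_lab[OF \<Phi>[of k] m(2)[of k]] two_cell_lab[OF \<Phi>[of "Suc k"] m(2)[of "Suc k"]] m(3)[of k] by simp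
  qed
  moreover have "ranked \<Sigma>' i j ?w \<rho>"
    unfolding ranked_def s
  proof (intro allI impI, elim conjE)
    fix k t t' assume k: "i \<le> k" "k < j" and t: "t \<in> cfun (\<Phi> k) ` sec k w" "t' \<in> cfun (\<Phi> k) ` sec k w"
      "(t, t') \<in> Leq (st (\<Sigma>' k))" "t \<noteq> t'"
    then obtain s s' where s: "s \<in> sec k w" "s' \<in> sec k w" "t = cfun (\<Phi> k) s" "t' = cfun (\<Phi> k) s'" by auto
    have le: "(s, s') \<in> Leq (st (\<Sigma> k))"
      using es_map_reflect[OF prestrategyD(3)[OF chainD(2)[OF c k]] two_cellsD(5)[OF \<Phi>[OF k]] m(2)[OF k] s(1,2)] t s
      by simp
    then have "\<rho> (evloc \<Sigma> (k, s)) < \<rho> (evloc \<Sigma> (k, s'))" using \<rho> k s t(4) unfolding ranked_def by blast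
    moreover have "s \<in> Ev (st (\<Sigma> k))" "s' \<in> Ev (st (\<Sigma> k))" using confD(2)[OF m(2)[OF k]] s by auto
    ultimately show "\<rho> (evloc \<Sigma>' (k, t)) < \<rho> (evloc \<Sigma>' (k, t'))"
      using two_cellsD(6)[OF \<Phi>[OF k]] s(3,4) by (simp add: evloc_def)
  qed
  ultimately show "sync \<Sigma>' i j ?w" by (auto simp: sync_def)
qed

text \<open>Chains are indexed by all natural numbers; from index 2 on the value is constant, and a
  chain from 0 to 3 reads only the indices below 3.\<close>

definition three :: "'a \<Rightarrow> 'a \<Rightarrow> 'a \<Rightarrow> nat \<Rightarrow> 'a" where
  "three f g h n = (if n = 0 then f else if n = 1 then g else h)"

lemma three_simps [simp]: "three f g h 0 = f" "three f g h (Suc 0) = g" "three f g h 2 = h" "three f g h 3 = h"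
  by (simp_all add: three_def)

lemma less3: "n < 3 \<longleftrightarrow> n = 0 \<or> n = Suc 0 \<or> n = (2::nat)"
  by auto

lemma chain_three:
  assumes "inter f g" "inter g h" shows "chain (three f g h) 0 3"
proof -
  interpret A: inter f g by fact
  interpret B: inter g h by fact
  have "Suc k < 3 \<longleftrightarrow> k = 0 \<or> k = Suc 0" for k by auto
  then show ?thesis using A.pre\<sigma> A.pre\<tau> B.pre\<tau> A.mid B.mid by (auto simp: chain_def less3 numeral_2_eq_2[symmetric])
qed

lemma pres_one: "prestrategy (\<Sigma> i) \<Longrightarrow> j = Suc i \<Longrightarrow> pres \<Sigma> i j (\<Sigma> i) (sec i)"
  using pres_base by simp

lemma pres_pair:
  assumes c: "chain \<Sigma> i j" and j: "j = Suc (Suc i)"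
  shows "pres \<Sigma> i j (\<Sigma> (Suc i) \<odot>\<^sub>s \<Sigma> i) (\<lambda>w. vis (\<Sigma> (Suc i)) (\<Sigma> i) (sec i w) (sec (Suc i) w))"
  using pres_comp[OF c _ _ pres_one pres_one, of "Suc i"] chainD(2)[OF c] j by simp

lemma pres_left:
  assumes c: "chain \<Sigma> i j" and j: "j = Suc (Suc (Suc i))"
  shows "pres \<Sigma> i j ((\<Sigma> (Suc (Suc i)) \<odot>\<^sub>s \<Sigma> (Suc i)) \<odot>\<^sub>s \<Sigma> i)
    (\<lambda>w. vis (\<Sigma> (Suc (Suc i)) \<odot>\<^sub>s \<Sigma> (Suc i)) (\<Sigma> i) (sec i w) (vis (\<Sigma> (Suc (Suc i))) (\<Sigma> (Suc i)) (sec (Suc i) w) (sec (Suc (Suc i)) w)))"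
  using pres_comp[OF c _ _ pres_one pres_pair[OF chain_sub[OF c]], of "Suc i"] chainD(2)[OF c] j by simp

lemma pres_right:
  assumes c: "chain \<Sigma> i j" and j: "j = Suc (Suc (Suc i))"
  shows "pres \<Sigma> i j (\<Sigma> (Suc (Suc i)) \<odot>\<^sub>s (\<Sigma> (Suc i) \<odot>\<^sub>s \<Sigma> i))
    (\<lambda>w. vis (\<Sigma> (Suc (Suc i))) (\<Sigma> (Suc i) \<odot>\<^sub>s \<Sigma> i) (vis (\<Sigma> (Suc i)) (\<Sigma> i) (sec i w) (sec (Suc i) w)) (sec (Suc (Suc i)) w))"
  using pres_comp[OF c _ _ pres_pair[OF chain_sub[OF c]] pres_one, of "Suc (Suc i)"] chainD(2)[OF c] j by simp

text \<open>The action on states is recorded with invertibility, since a cell picked by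
  \<open>SOME\<close> is known only through its specification. On a state the cell merely changes
  the bracketing.\<close>

definition assoc_spec :: "'u prestrat \<Rightarrow> 'u prestrat \<Rightarrow> 'u prestrat \<Rightarrow> 'u two_cell \<Rightarrow> bool" where
  "assoc_spec f g h a \<longleftrightarrow> invertible two_cells id_cell vcomp_cell ((h \<odot>\<^sub>s g) \<odot>\<^sub>s f) (h \<odot>\<^sub>s (g \<odot>\<^sub>s f)) a \<and>
     (\<forall>w. sync (three f g h) 0 3 w \<longrightarrow>
        cfun a ` vis (h \<odot>\<^sub>s g) f (sec 0 w) (vis h g (sec 1 w) (sec 2 w))
          = vis h (g \<odot>\<^sub>s f) (vis g f (sec 0 w) (sec 1 w)) (sec 2 w))"

definition assoc_cell :: "'u prestrat \<Rightarrow> 'u prestrat \<Rightarrow> 'u prestrat \<Rightarrow> 'u two_cell" where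
  "assoc_cell f g h = (SOME a. assoc_spec f g h a)"

lemma assoc_cell:
  assumes "inter f g" "inter g h" shows "assoc_spec f g h (assoc_cell f g h)"
proof -
  have c: "chain (three f g h) 0 3" by (rule chain_three[OF assms])
  have l: "pres (three f g h) 0 3 ((h \<odot>\<^sub>s g) \<odot>\<^sub>s f) (\<lambda>w. vis (h \<odot>\<^sub>s g) f (sec 0 w) (vis h g (sec 1 w) (sec 2 w)))"
    using pres_left[OF c] by (simp add: numeral_2_eq_2[symmetric])
  have r: "pres (three f g h) 0 3 (h \<odot>\<^sub>s (g \<odot>\<^sub>s f)) (\<lambda>w. vis h (g \<odot>\<^sub>s f) (vis g f (sec 0 w) (sec 1 w)) (sec 2 w))"
    using pres_right[OF c] by (simp add: numeral_2_eq_2[symmetric])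
  have "\<exists>a. assoc_spec f g h a" using pres_iso[OF l r] unfolding assoc_spec_def by blast
  then show ?thesis unfolding assoc_cell_def by (rule someI_ex)
qed

lemma inter_comp: "inter f g \<Longrightarrow> inter g h \<Longrightarrow> inter (g \<odot>\<^sub>s f) h" "inter f g \<Longrightarrow> inter g h \<Longrightarrow> inter f (h \<odot>\<^sub>s g)"
  using inter.comp_prestrategy[of f g] inter.comp_prestrategy[of g h] inter.comp_simps(2)[of f g] inter.comp_simps(1)[of g h]
  unfolding inter_def by simp_all

text \<open>The components are named by equations so that any state with the given components can
  serve, in particular a coarsened one.\<close>

lemma assoc_cellD:
  assumes "inter f g" "inter g h"
  shows "invertible two_cells id_cell vcomp_cell ((h \<odot>\<^sub>s g) \<odot>\<^sub>s f) (h \<odot>\<^sub>s (g \<odot>\<^sub>s f)) (assoc_cell f g h)"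
    "assoc_cell f g h \<in> two_cells ((h \<odot>\<^sub>s g) \<odot>\<^sub>s f) (h \<odot>\<^sub>s (g \<odot>\<^sub>s f))"
    "\<And>w x y z. sync (three f g h) 0 3 w \<Longrightarrow> sec 0 w = x \<Longrightarrow> sec 1 w = y \<Longrightarrow> sec 2 w = z \<Longrightarrow>
       cfun (assoc_cell f g h) ` vis (h \<odot>\<^sub>s g) f x (vis h g y z) = vis h (g \<odot>\<^sub>s f) (vis g f x y) z"
  using assoc_cell[OF assms] unfolding assoc_spec_def invertible_def by blast+

lemma sync2_left:
  assumes c: "chain \<Sigma> i j" and j: "j = Suc (Suc (Suc i))" and w: "sync \<Sigma> i j w"
  shows "sync2 (\<Sigma> (Suc (Suc i)) \<odot>\<^sub>s \<Sigma> (Suc i)) (\<Sigma> i) (sec i w) (vis (\<Sigma> (Suc (Suc i))) (\<Sigma> (Suc i)) (sec (Suc i) w) (sec (Suc (Suc i)) w))"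
  using pres_sync2[OF c _ _ pres_one pres_pair[OF chain_sub[OF c]] w, of "Suc i"] chainD(2)[OF c] j by simp

lemma sync2_right:
  assumes c: "chain \<Sigma> i j" and j: "j = Suc (Suc (Suc i))" and w: "sync \<Sigma> i j w"
  shows "sync2 (\<Sigma> (Suc (Suc i))) (\<Sigma> (Suc i) \<odot>\<^sub>s \<Sigma> i) (vis (\<Sigma> (Suc i)) (\<Sigma> i) (sec i w) (sec (Suc i) w)) (sec (Suc (Suc i)) w)"
  using pres_sync2[OF c _ _ pres_pair[OF chain_sub[OF c]] pres_one w, of "Suc (Suc i)"] chainD(2)[OF c] j by simp

lemma sync2_pair:
  assumes c: "chain \<Sigma> i j" and j: "i \<le> m" "Suc m < j" and w: "sync \<Sigma> i j w"
  shows "sync2 (\<Sigma> (Suc m)) (\<Sigma> m) (sec m w) (sec (Suc m) w)"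
proof -
  have c': "chain \<Sigma> m (Suc (Suc m))" using chain_sub[OF c] j by simp
  have w': "sync \<Sigma> m (Suc (Suc m)) (seg m (Suc (Suc m)) w)" using sync_seg[OF w] j by simp
  show ?thesis
    using pres_sync2[OF c' _ _ pres_one pres_one w', of "Suc m"] chainD(2)[OF c'] by simp
qed

lemma sync2_three:
  assumes "inter f g" "inter g h" and w: "sync (three f g h) 0 3 w"
  shows "sync2 (h \<odot>\<^sub>s g) f (sec 0 w) (vis h g (sec 1 w) (sec 2 w))" "sync2 h (g \<odot>\<^sub>s f) (vis g f (sec 0 w) (sec 1 w)) (sec 2 w)"
    "sync2 g f (sec 0 w) (sec 1 w)" "sync2 h g (sec 1 w) (sec 2 w)"
proof -
  note c = chain_three[OF assms(1,2)]
  show "sync2 (h \<odot>\<^sub>s g) f (sec 0 w) (vis h g (sec 1 w) (sec 2 w))" "sync2 h (g \<odot>\<^sub>s f) (vis g f (sec 0 w) (sec 1 w)) (sec 2 w)"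
    "sync2 g f (sec 0 w) (sec 1 w)" "sync2 h g (sec 1 w) (sec 2 w)"
    using sync2_left[OF c _ w] sync2_right[OF c _ w] sync2_pair[OF c _ _ w, of 0] sync2_pair[OF c _ _ w, of 1]
    by (simp_all add: numeral_2_eq_2[symmetric])
qed

lemma assoc_cell_natural:
  assumes fg: "inter f g" and gh: "inter g h" and fg': "inter f' g'" and gh': "inter g' h'"
    and \<phi>: "\<phi> \<in> two_cells f f'" and \<psi>: "\<psi> \<in> two_cells g g'" and \<chi>: "\<chi> \<in> two_cells h h'"
  shows "vcomp_cell (assoc_cell f' g' h') (hcomp_cell (hcomp_cell \<chi> \<psi>) \<phi>)
    = vcomp_cell (hcomp_cell \<chi> (hcomp_cell \<psi> \<phi>)) (assoc_cell f g h)"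
proof -
  note c = chain_three[OF fg gh]
  note a = assoc_cellD[OF fg gh] and a' = assoc_cellD[OF fg' gh']
  note i = inter_comp[OF fg gh] and i' = inter_comp[OF fg' gh']
  note h1 = hcomp_cell_vis[OF gh gh' \<psi> \<chi>] and h2 = hcomp_cell_vis[OF fg fg' \<phi> \<psi>]
  note h3 = hcomp_cell_vis[OF i(2) i'(2) \<phi> h1(1)] and h4 = hcomp_cell_vis[OF i(1) i'(1) h2(1) \<chi>]
  have l: "pres (three f g h) 0 3 ((h \<odot>\<^sub>s g) \<odot>\<^sub>s f) (\<lambda>w. vis (h \<odot>\<^sub>s g) f (sec 0 w) (vis h g (sec 1 w) (sec 2 w)))"
    using pres_left[OF c] by (simp add: numeral_2_eq_2[symmetric])
  show ?thesis
  proof (rule pres_cell_eqI[OF l vcomp_cell_in(1)[OF h3(1) a'(2)] vcomp_cell_in(1)[OF a(2) h4(1)]])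
    fix w assume w: "sync (three f g h) 0 3 w"
    note cw = sync2_three[OF fg gh w] and z = presD(4)[OF l w]
    have \<Phi>: "three \<phi> \<psi> \<chi> k \<in> two_cells (three f g h k) (three f' g' h' k)" for k
      using \<phi> \<psi> \<chi> by (simp add: three_def)
    note im = sync_image[of "three f g h" 0 3 "three \<phi> \<psi> \<chi>" "three f' g' h'" w, OF c \<Phi> w]
    have "cfun (assoc_cell f' g' h') ` vis (h' \<odot>\<^sub>s g') f' (cfun \<phi> ` sec 0 w) (vis h' g' (cfun \<psi> ` sec 1 w) (cfun \<chi> ` sec 2 w))
        = vis h' (g' \<odot>\<^sub>s f') (vis g' f' (cfun \<phi> ` sec 0 w) (cfun \<psi> ` sec 1 w)) (cfun \<chi> ` sec 2 w)"
      by (rule a'(3)[OF im(1)]) (simp_all add: im(2))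
    then show "cfun (vcomp_cell (assoc_cell f' g' h') (hcomp_cell (hcomp_cell \<chi> \<psi>) \<phi>)) `
          vis (h \<odot>\<^sub>s g) f (sec 0 w) (vis h g (sec 1 w) (sec 2 w)) =
        cfun (vcomp_cell (hcomp_cell \<chi> (hcomp_cell \<psi> \<phi>)) (assoc_cell f g h)) `
          vis (h \<odot>\<^sub>s g) f (sec 0 w) (vis h g (sec 1 w) (sec 2 w))"
      unfolding vcomp_cell_in(2)[OF h3(1) a'(2) z] vcomp_cell_in(2)[OF a(2) h4(1) z]
        a(3)[OF w refl refl refl] h3(2)[OF cw(1)] h4(2)[OF cw(2)] h1(2)[OF cw(4)] h2(2)[OF cw(3)] .
  qed
qed

text \<open>An associator between composites acts on states of a chain whose entries are composites;
  such a state is obtained from a state of the underlying longer chain.\<close>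

lemma coarsen_three:
  assumes c: "chain \<Sigma> i l" and ij: "i < j" "j < k" "k < l"
    and p: "pres \<Sigma> i j E v1" "pres \<Sigma> j k F v2" "pres \<Sigma> k l G v3" and w: "sync \<Sigma> i l w"
  shows "\<exists>w'. sync (three E F G) 0 3 w' \<and> sec 0 w' = v1 (seg i j w) \<and> sec 1 w' = v2 (seg j k w) \<and> sec 2 w' = v3 (seg k l w)"
proof -
  \<comment> \<open>The breakpoints \<open>i < j < k < l\<close> as a function, as required by
    \<open>coarsen\<close>.\<close>
  define p where "p m = (if m = 0 then i else if m = 1 then j else if m = 2 then k else l)" for m :: nat
  have p: "p 0 = i" "p (Suc 0) = j" "p 2 = k" "p 3 = l" by (simp_all add: p_def)
  have S: "Suc 2 = 3" "Suc (Suc 0) = 2" by simp_all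
  have "sync (three E F G) 0 3 {(m, e). m < 3 \<and> e \<in> three v1 v2 v3 m (seg (p m) (p (Suc m)) w)}"
  proof (rule coarsen[of \<Sigma> p 3])
    show "chain \<Sigma> (p 0) (p 3)" "sync \<Sigma> (p 0) (p 3) w" using c w p by simp_all
    fix m :: nat assume "m < 3"
    then show "p m < p (Suc m)" "pres \<Sigma> (p m) (p (Suc m)) (three E F G m) (three v1 v2 v3 m)"
      using ij assms(5-7) unfolding less3 by (auto simp: p S)
  qed
  then show ?thesis
    by (intro exI[of _ "{(m, e). m < 3 \<and> e \<in> three v1 v2 v3 m (seg (p m) (p (Suc m)) w)}"])
      (auto simp: sec_def p S)
qed

definition four :: "'a \<Rightarrow> 'a \<Rightarrow> 'a \<Rightarrow> 'a \<Rightarrow> nat \<Rightarrow> 'a" where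
  "four f g h k n = (if n = 0 then f else if n = 1 then g else if n = 2 then h else k)"

lemma four_simps [simp]: "four f g h k 0 = f" "four f g h k (Suc 0) = g" "four f g h k 2 = h" "four f g h k 3 = k"
  by (simp_all add: four_def)

lemma chain_four:
  assumes "inter f g" "inter g h" "inter h k" shows "chain (four f g h k) 0 4"
proof -
  interpret A: inter f g by fact
  interpret B: inter g h by fact
  interpret C: inter h k by fact
  have 1: "m < 4 \<longleftrightarrow> m = 0 \<or> m = Suc 0 \<or> m = 2 \<or> m = 3" for m :: nat by auto
  have 2: "Suc m < 4 \<longleftrightarrow> m = 0 \<or> m = Suc 0 \<or> m = 2" for m by auto
  have S: "Suc 2 = 3" "Suc (Suc 0) = 2" by simp_all
  show ?thesis using A.pre\<sigma> A.pre\<tau> B.pre\<tau> C.pre\<tau> A.mid B.mid C.mid unfolding chain_def 1 2 by (auto simp: S)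
qed

text \<open>Both paths are evaluated on an arbitrary state of the chain of four. Each of the five
  associators rebrackets a coarsening of that state, so both paths end in the same
  expression.\<close>

lemma assoc_cell_pentagon:
  assumes fg: "inter f g" and gh: "inter g h" and hk: "inter h k"
  shows "vcomp_cell (assoc_cell (g \<odot>\<^sub>s f) h k) (assoc_cell f g (k \<odot>\<^sub>s h))
    = vcomp_cell (hcomp_cell (id_cell k) (assoc_cell f g h))
        (vcomp_cell (assoc_cell f (h \<odot>\<^sub>s g) k) (hcomp_cell (assoc_cell g h k) (id_cell f)))"
proof -
  let ?S = "four f g h k"
  note c = chain_four[OF assms]
  have f1: "?S 1 = g" by (simp add: four_def)
  have pf: "prestrategy f" "prestrategy g" "prestrategy h" "prestrategy k"
    using fg gh hk by (auto simp: inter_def)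
  have p01: "pres ?S 0 1 f (sec 0)" using pres_one[of ?S 0 1] pf by simp
  have p12: "pres ?S 1 2 g (sec 1)" using pres_one[of ?S 1 2] pf by (simp add: f1)
  have p23: "pres ?S 2 3 h (sec 2)" using pres_one[of ?S 2 3] pf by simp
  have p34: "pres ?S 3 4 k (sec 3)" using pres_one[of ?S 3 4] pf by simp
  have c02: "chain ?S 0 2" and c13: "chain ?S 1 3" and c24: "chain ?S 2 4" and c14: "chain ?S 1 4" and c03: "chain ?S 0 3"
    using chain_sub[OF c] by auto
  have p02: "pres ?S 0 2 (g \<odot>\<^sub>s f) (\<lambda>w. vis g f (sec 0 w) (sec 1 w))"
    using pres_comp[OF c02 _ _ p01 p12] by simp
  have p13: "pres ?S 1 3 (h \<odot>\<^sub>s g) (\<lambda>w. vis h g (sec 1 w) (sec 2 w))"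
    using pres_comp[OF c13 _ _ p12 p23] by simp
  have p24: "pres ?S 2 4 (k \<odot>\<^sub>s h) (\<lambda>w. vis k h (sec 2 w) (sec 3 w))"
    using pres_comp[OF c24 _ _ p23 p34] by simp
  have p14: "pres ?S 1 4 ((k \<odot>\<^sub>s h) \<odot>\<^sub>s g) (\<lambda>w. vis (k \<odot>\<^sub>s h) g (sec 1 w) (vis k h (sec 2 w) (sec 3 w)))"
    using pres_comp[OF c14 _ _ p12 p24] by simp
  have p03: "pres ?S 0 3 ((h \<odot>\<^sub>s g) \<odot>\<^sub>s f) (\<lambda>w. vis (h \<odot>\<^sub>s g) f (sec 0 w) (vis h g (sec 1 w) (sec 2 w)))"
    using pres_comp[OF c03 _ _ p01 p13] by simp
  have p04: "pres ?S 0 4 (((k \<odot>\<^sub>s h) \<odot>\<^sub>s g) \<odot>\<^sub>s f)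
      (\<lambda>w. vis ((k \<odot>\<^sub>s h) \<odot>\<^sub>s g) f (sec 0 w) (vis (k \<odot>\<^sub>s h) g (sec 1 w) (vis k h (sec 2 w) (sec 3 w))))"
    using pres_comp[OF c _ _ p01 p14] by simp
  note i_gf_h = inter_comp(1)[OF fg gh] and i_f_hg = inter_comp(2)[OF fg gh]
    and i_hg_k = inter_comp(1)[OF gh hk] and i_g_kh = inter_comp(2)[OF gh hk]
  note a1 = assoc_cellD[OF fg i_g_kh] and a2 = assoc_cellD[OF i_gf_h hk] and a3 = assoc_cellD[OF gh hk]
    and a4 = assoc_cellD[OF i_f_hg i_hg_k] and a5 = assoc_cellD[OF fg gh]
  have i1: "inter f ((k \<odot>\<^sub>s h) \<odot>\<^sub>s g)" "inter f (k \<odot>\<^sub>s (h \<odot>\<^sub>s g))" "inter ((h \<odot>\<^sub>s g) \<odot>\<^sub>s f) k" "inter (h \<odot>\<^sub>s (g \<odot>\<^sub>s f)) k"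
    using inter_comp(2)[OF fg i_g_kh] inter_comp(2)[OF i_f_hg i_hg_k] inter_comp(1)[OF i_f_hg i_hg_k] inter_comp(1)[OF i_gf_h hk] .
  note h1 = hcomp_cell_vis[OF i1(1,2) id_cell_in[OF pf(1)] a3(2)]
  note h2 = hcomp_cell_vis[OF i1(3,4) a5(2) id_cell_in[OF pf(4)]]
  have v1: "vcomp_cell (assoc_cell f (h \<odot>\<^sub>s g) k) (hcomp_cell (assoc_cell g h k) (id_cell f))
      \<in> two_cells (((k \<odot>\<^sub>s h) \<odot>\<^sub>s g) \<odot>\<^sub>s f) (k \<odot>\<^sub>s ((h \<odot>\<^sub>s g) \<odot>\<^sub>s f))"
    by (rule vcomp_cell_in(1)[OF h1(1) a4(2)])
  show ?thesis
  proof (rule pres_cell_eqI[OF p04 vcomp_cell_in(1)[OF a1(2) a2(2)] vcomp_cell_in(1)[OF v1 h2(1)]])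
    fix w assume w: "sync ?S 0 4 w"
    have w14: "sync ?S 1 4 (seg 1 4 w)" and w03: "sync ?S 0 3 (seg 0 3 w)" using sync_seg[OF w] by auto
    define x y z t where "x = sec 0 w" and "y = sec 1 w" and "z = sec 2 w" and "t = sec 3 w"
    have X: "x \<in> conf (st f)" "t \<in> conf (st k)"
      using presD(4)[OF p01 sync_seg[OF w]] presD(4)[OF p34 sync_seg[OF w]] by (simp_all add: x_def t_def)
    have V: "vis ((k \<odot>\<^sub>s h) \<odot>\<^sub>s g) f x (vis (k \<odot>\<^sub>s h) g y (vis k h z t)) \<in> conf (st (((k \<odot>\<^sub>s h) \<odot>\<^sub>s g) \<odot>\<^sub>s f))"
      using presD(4)[OF p04 w] by (simp add: x_def y_def z_def t_def)
    \<comment> \<open>One coarsened state for each of the five associators, \<open>w1\<close> and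
      \<open>w2\<close> for the short path, \<open>w3\<close>, \<open>w4\<close> and
      \<open>w5\<close> for the long one.\<close>
    obtain w1 where w1: "sync (three f g (k \<odot>\<^sub>s h)) 0 3 w1" "sec 0 w1 = x" "sec 1 w1 = y" "sec 2 w1 = vis k h z t"
      using coarsen_three[OF c _ _ _ p01 p12 p24 w] by (auto simp: x_def y_def z_def t_def)
    obtain w2 where w2: "sync (three (g \<odot>\<^sub>s f) h k) 0 3 w2" "sec 0 w2 = vis g f x y" "sec 1 w2 = z" "sec 2 w2 = t"
      using coarsen_three[OF c _ _ _ p02 p23 p34 w] by (auto simp: x_def y_def z_def t_def)
    obtain w3 where w3: "sync (three g h k) 0 3 w3" "sec 0 w3 = y" "sec 1 w3 = z" "sec 2 w3 = t"
      using coarsen_three[OF c14 _ _ _ p12 p23 p34 w14] by (auto simp: x_def y_def z_def t_def)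
    obtain w4 where w4: "sync (three f (h \<odot>\<^sub>s g) k) 0 3 w4" "sec 0 w4 = x" "sec 1 w4 = vis h g y z" "sec 2 w4 = t"
      using coarsen_three[OF c _ _ _ p01 p13 p34 w] by (auto simp: x_def y_def z_def t_def)
    obtain w5 where w5: "sync (three f g h) 0 3 w5" "sec 0 w5 = x" "sec 1 w5 = y" "sec 2 w5 = z"
      using coarsen_three[OF c03 _ _ _ p01 p12 p23 w03] by (auto simp: x_def y_def z_def t_def)
    have cc1: "sync2 ((k \<odot>\<^sub>s h) \<odot>\<^sub>s g) f x (vis (k \<odot>\<^sub>s h) g y (vis k h z t))"
      using pres_sync2[OF c _ _ p01 p14 w] by (simp add: x_def y_def z_def t_def)
    have cc2: "sync2 k ((h \<odot>\<^sub>s g) \<odot>\<^sub>s f) (vis (h \<odot>\<^sub>s g) f x (vis h g y z)) t"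
      using pres_sync2[OF c _ _ p03 p34 w] by (simp add: x_def y_def z_def t_def)
    have "cfun (vcomp_cell (assoc_cell (g \<odot>\<^sub>s f) h k) (assoc_cell f g (k \<odot>\<^sub>s h))) `
        vis ((k \<odot>\<^sub>s h) \<odot>\<^sub>s g) f x (vis (k \<odot>\<^sub>s h) g y (vis k h z t)) =
      cfun (vcomp_cell (hcomp_cell (id_cell k) (assoc_cell f g h))
        (vcomp_cell (assoc_cell f (h \<odot>\<^sub>s g) k) (hcomp_cell (assoc_cell g h k) (id_cell f)))) `
        vis ((k \<odot>\<^sub>s h) \<odot>\<^sub>s g) f x (vis (k \<odot>\<^sub>s h) g y (vis k h z t))"
      unfolding vcomp_cell_in(2)[OF a1(2) a2(2) V] vcomp_cell_in(2)[OF v1 h2(1) V] vcomp_cell_in(2)[OF h1(1) a4(2) V]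
        a1(3)[OF w1] a2(3)[OF w2] h1(2)[OF cc1] a3(3)[OF w3] id_cell_conf[OF X(1)] a4(3)[OF w4]
        h2(2)[OF cc2] a5(3)[OF w5] id_cell_conf[OF X(2)] ..
    then show "cfun (vcomp_cell (assoc_cell (g \<odot>\<^sub>s f) h k) (assoc_cell f g (k \<odot>\<^sub>s h))) `
        vis ((k \<odot>\<^sub>s h) \<odot>\<^sub>s g) f (sec 0 w) (vis (k \<odot>\<^sub>s h) g (sec 1 w) (vis k h (sec 2 w) (sec 3 w))) =
      cfun (vcomp_cell (hcomp_cell (id_cell k) (assoc_cell f g h))
        (vcomp_cell (assoc_cell f (h \<odot>\<^sub>s g) k) (hcomp_cell (assoc_cell g h k) (id_cell f)))) `
        vis ((k \<odot>\<^sub>s h) \<odot>\<^sub>s g) f (sec 0 w) (vis (k \<odot>\<^sub>s h) g (sec 1 w) (vis k h (sec 2 w) (sec 3 w)))"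
      by (simp add: x_def y_def z_def t_def)
  qed
qed

section \<open>Copycat\<close>

text \<open>At most one crossing is ever needed: every generating relation projects to causality or
  equality in \<open>A\<close>, so a path that crosses and returns is already a causality on one
  side. A rightward crossing happens at a positive \<open>c\<close>, a leftward one at a negative
  \<open>c\<close>.\<close>

lemma copycat_leq_iff:
  assumes A: "is_es A"
  shows "(e, e') \<in> copycat_leq A \<longleftrightarrow>
    (\<exists>a b. e = In0 a \<and> e' = In0 b \<and> (a, b) \<in> Leq A) \<or>
    (\<exists>a b. e = In1 a \<and> e' = In1 b \<and> (a, b) \<in> Leq A) \<or>
    (\<exists>a b c. e = In0 a \<and> e' = In1 b \<and> (a, c) \<in> Leq A \<and> (c, b) \<in> Leq A \<and> pol A c = Pos) \<or>
    (\<exists>a b c. e = In1 a \<and> e' = In0 b \<and> (a, c) \<in> Leq A \<and> (c, b) \<in> Leq A \<and> pol A c = Neg)"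
    (is "_ \<longleftrightarrow> ?R e e'")
proof -
  let ?G = "Leq (dual A \<parallel> A) \<union> {(swap_side e, e) | e. e \<in> Ev (dual A \<parallel> A) \<and> pol (dual A \<parallel> A) e = Pos}"
  have G: "(e, e') \<in> ?G \<longleftrightarrow> (\<exists>a b. e = In0 a \<and> e' = In0 b \<and> (a, b) \<in> Leq A) \<or>
    (\<exists>a b. e = In1 a \<and> e' = In1 b \<and> (a, b) \<in> Leq A) \<or>
    (\<exists>c. e = In0 c \<and> e' = In1 c \<and> c \<in> Ev A \<and> pol A c = Pos) \<or>
    (\<exists>c. e = In1 c \<and> e' = In0 c \<and> c \<in> Ev A \<and> pol A c = Neg)" for e e'
    by (auto simp: par_simps swap_side_def copair_def)
  show ?thesis
  proof
    assume "(e, e') \<in> copycat_leq A"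
    then have "(e, e') \<in> ?G\<^sup>+" by (simp add: copycat_leq_def)
    then show "?R e e'"
    proof (induction rule: trancl_induct)
      case (base y)
      then show ?case unfolding G using es_refl[OF A] by blast
    next
      case (step y z)
      show ?case using step(2,3) unfolding G 
        by (elim disjE exE conjE; simp; metis es_trans[OF A] es_refl[OF A])
    qed
  next
    have b: "(e, e') \<in> copycat_leq A" if "(e, e') \<in> ?G" for e e'
      using that unfolding copycat_leq_def by (rule r_into_trancl)
    have t: "(e, e'') \<in> copycat_leq A" if "(e, e') \<in> copycat_leq A" "(e', e'') \<in> copycat_leq A" for e e' e''
      using that unfolding copycat_leq_def by (rule trancl_trans)
    assume "?R e e'"
    then consider a b' where "e = In0 a" "e' = In0 b'" "(a, b') \<in> Leq A"
      | a b' where "e = In1 a" "e' = In1 b'" "(a, b') \<in> Leq A"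
      | a b' c where "e = In0 a" "e' = In1 b'" "(a, c) \<in> Leq A" "(c, b') \<in> Leq A" "pol A c = Pos"
      | a b' c where "e = In1 a" "e' = In0 b'" "(a, c) \<in> Leq A" "(c, b') \<in> Leq A" "pol A c = Neg" by blast
    then show "(e, e') \<in> copycat_leq A"
    proof cases
      case 1 then show ?thesis using b[of "In0 a" "In0 b'"] unfolding G by simp
    next
      case 2 then show ?thesis using b[of "In1 a" "In1 b'"] unfolding G by simp
    next
      case 3
      have c: "c \<in> Ev A" using es_LeqD[OF A 3(3)] by simp
      have "(In0 a, In0 c) \<in> copycat_leq A" "(In0 c, In1 c) \<in> copycat_leq A" "(In1 c, In1 b') \<in> copycat_leq A"
        using b[of "In0 a" "In0 c"] b[of "In0 c" "In1 c"] b[of "In1 c" "In1 b'"] 3 c unfolding G by simp_all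
      then show ?thesis using t 3 by blast
    next
      case 4
      have c: "c \<in> Ev A" using es_LeqD[OF A 4(3)] by simp
      have "(In1 a, In1 c) \<in> copycat_leq A" "(In1 c, In0 c) \<in> copycat_leq A" "(In0 c, In0 b') \<in> copycat_leq A"
        using b[of "In1 a" "In1 c"] b[of "In1 c" "In0 c"] b[of "In0 c" "In0 b'"] 4 c unfolding G by simp_all
      then show ?thesis using t 4 by blast
    qed
  qed
qed

lemma copycat_leq_project:
  assumes A: "is_es A" and e: "(e', e) \<in> copycat_leq A"
  shows "\<exists>a b. (e' = In0 a \<or> e' = In1 a) \<and> (e = In0 b \<or> e = In1 b) \<and> (a, b) \<in> Leq A"
  using e unfolding copycat_leq_iff[OF A] by (elim disjE exE conjE; simp; metis es_trans[OF A])

lemma copycat_leq_dn: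
  assumes A: "is_es A" and e: "e = In0 b \<or> e = In1 b"
  shows "{e'. (e', e) \<in> copycat_leq A} \<subseteq> In0 ` dn A b \<union> In1 ` dn A b"
proof
  fix e' assume "e' \<in> {e'. (e', e) \<in> copycat_leq A}"
  then obtain a c where "e' = In0 a \<or> e' = In1 a" "e = In0 c \<or> e = In1 c" "(a, c) \<in> Leq A"
    using copycat_leq_project[OF A, of e' e] by blast
  then show "e' \<in> In0 ` dn A b \<union> In1 ` dn A b" using e by (auto simp: dn_def)
qed

lemma copycat_game_simps:
  "Ev (copycat_game A) = Ev (par A A)" "Leq (copycat_game A) = copycat_leq A"
  "X \<in> Con (copycat_game A) \<longleftrightarrow> finite X \<and> X \<subseteq> Ev (par A A) \<and>
    {e'. \<exists>e\<in>X. (e', e) \<in> copycat_leq A} \<in> Con (par A A)"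
  by (simp_all add: copycat_game_def)

lemma copycat_es:
  assumes A: "is_es A" shows "is_es (copycat_game A)"
proof -
  note L = copycat_leq_iff[OF A]
  have P: "is_es (par A A)" by (rule par_es[OF A A])
  have tr: "(x, z) \<in> copycat_leq A" if "(x, y) \<in> copycat_leq A" "(y, z) \<in> copycat_leq A" for x y z
    using that unfolding copycat_leq_def by (rule trancl_trans)
  have rf: "(x, x) \<in> copycat_leq A" if "x \<in> Ev (par A A)" for x
    using that es_refl[OF A] unfolding L by (auto simp: par_simps)
  have LE: "x \<in> Ev (par A A) \<and> y \<in> Ev (par A A)" if "(x, y) \<in> copycat_leq A" for x y
    using that es_LeqD[OF A] unfolding L by (auto simp: par_simps)
  have fin: "finite {e'. (e', e) \<in> copycat_leq A}" for e
  proof -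
    obtain b where b: "{e'. (e', e) \<in> copycat_leq A} \<subseteq> In0 ` dn A b \<union> In1 ` dn A b"
    proof (cases "\<exists>b. e = In0 b \<or> e = In1 b")
      case True then show ?thesis using copycat_leq_dn[OF A] that by blast
    next
      case False
      then have "{e'. (e', e) \<in> copycat_leq A} = {}" using copycat_leq_project[OF A, of _ e] by blast
      then show ?thesis using that by blast
    qed
    then show ?thesis using es_finite_dn[OF A] by (auto intro: finite_subset)
  qed
  show ?thesis
    unfolding is_es_def copycat_game_simps
  proof (intro conjI ballI allI impI)
    show "partial_order_on (Ev (par A A)) (copycat_leq A)"
      unfolding order_on_defs refl_on_def
    proof (intro conjI)
      show "copycat_leq A \<subseteq> Ev (par A A) \<times> Ev (par A A)" using LE by auto
      show "\<forall>x\<in>Ev (par A A). (x, x) \<in> copycat_leq A" using rf by blast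
      show "trans (copycat_leq A)" using tr by (rule transI)
      show "antisym (copycat_leq A)"
      proof (rule antisymI)
        fix x y assume "(x, y) \<in> copycat_leq A" "(y, x) \<in> copycat_leq A"
        then consider a b where "x = In0 a" "y = In0 b" "(a, b) \<in> Leq A" "(b, a) \<in> Leq A"
          | a b where "x = In1 a" "y = In1 b" "(a, b) \<in> Leq A" "(b, a) \<in> Leq A"
          | a b c d where "(a, c) \<in> Leq A" "(c, b) \<in> Leq A" "pol A c = Pos" "(b, d) \<in> Leq A" "(d, a) \<in> Leq A" "pol A d = Neg"
          unfolding L by (elim disjE exE conjE; simp; blast)
        then show "x = y"
        proof cases
          \<comment> \<open>The two crossing points \<open>c\<close> and \<open>d\<close> lie below
            each other, so they coincide, but their polarities differ.\<close>
          case 3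
          have "(c, d) \<in> Leq A" "(d, c) \<in> Leq A" using 3 es_trans[OF A] by blast+
          then have "c = d" by (rule es_antisym[OF A])
          then show ?thesis using 3 by simp
        qed (use es_antisym[OF A] in auto)
      qed
    qed
    have "{} \<in> Con (par A A)" by (rule confD(3)[OF conf_empty[OF P]])
    then have "{} \<in> Con (copycat_game A)" by (simp add: copycat_game_simps)
    then show "Con (copycat_game A) \<noteq> {}" by blast
    show "finite {e'. (e', e) \<in> copycat_leq A}" for e by (rule fin)
    fix e assume e: "e \<in> Ev (par A A)"
    have "{e'. (e', e) \<in> copycat_leq A} \<in> Con (par A A)"
    proof -
      obtain b where b: "e = In0 b \<or> e = In1 b" "b \<in> Ev A" using e by (auto simp: par_simps)
      \<comment> \<open>The causes of an event of copycat lie in the two copies of a single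
        principal down-set, and these are jointly consistent as consistency of the parallel
        composition is componentwise.\<close>
      have "In0 ` dn A b \<union> In1 ` dn A b \<in> Con (par A A)"
        using confD(3)[OF dn_conf[OF A b(2)]] by (auto simp: par_simps)
      then show ?thesis using copycat_leq_dn[OF A b(1)] by (rule Con_subset[OF P])
    qed
    then show "finite {e}" "{e} \<subseteq> Ev (par A A)" "{e'. \<exists>e\<in>{e}. (e', e) \<in> copycat_leq A} \<in> Con (par A A)"
      using e by simp_all
  next
    fix X assume X: "X \<in> Con (copycat_game A)"
    then show "finite X" "X \<subseteq> Ev (par A A)" by (simp_all add: copycat_game_simps)
    have XC: "{e'. \<exists>e\<in>X. (e', e) \<in> copycat_leq A} \<in> Con (par A A)" using X by (simp add: copycat_game_simps)
    show "finite Y" "Y \<subseteq> Ev (par A A)" "{e'. \<exists>e\<in>Y. (e', e) \<in> copycat_leq A} \<in> Con (par A A)" if "Y \<subseteq> X" for Y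
      using X that Con_subset[OF P XC, of "{e'. \<exists>e\<in>Y. (e', e) \<in> copycat_leq A}"]
      by (auto simp: copycat_game_simps intro: finite_subset)
    fix e e' assume e: "e \<in> X" "(e', e) \<in> copycat_leq A"
    have "{d. \<exists>e\<in>X \<union> {e'}. (d, e) \<in> copycat_leq A} = {e'. \<exists>e\<in>X. (e', e) \<in> copycat_leq A}"
      using e tr by blast
    then show "finite (X \<union> {e'})" "X \<union> {e'} \<subseteq> Ev (par A A)"
      "{d. \<exists>e\<in>X \<union> {e'}. (d, e) \<in> copycat_leq A} \<in> Con (par A A)"
      using X XC LE[OF e(2)] by (simp_all add: copycat_game_simps)
  qed
qed

text \<open>Down-closure along longer crossings follows from the direct ones, since each side is
  already down-closed. The left side carries the dual game, so its positive moves are those with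
  \<open>pol A c = Neg\<close>.\<close>

lemma conf_copycat:
  assumes A: "is_es A"
  shows "y \<in> conf (copycat_game A) \<longleftrightarrow> y \<in> conf (par A A) \<and>
    (\<forall>c. In1 c \<in> y \<longrightarrow> pol A c = Pos \<longrightarrow> In0 c \<in> y) \<and> (\<forall>c. In0 c \<in> y \<longrightarrow> pol A c = Neg \<longrightarrow> In1 c \<in> y)"
proof
  note L = copycat_leq_iff[OF A]
  assume y: "y \<in> conf (copycat_game A)"
  note d = confD[OF y, unfolded copycat_game_simps]
  have yE: "c \<in> Ev A" if "In0 c \<in> y \<or> In1 c \<in> y" for c using d(2) that by (auto simp: par_simps)
  have "{e'. \<exists>e\<in>y. (e', e) \<in> copycat_leq A} = y"
  proof
    show "{e'. \<exists>e\<in>y. (e', e) \<in> copycat_leq A} \<subseteq> y" using d(4) by blast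
    show "y \<subseteq> {e'. \<exists>e\<in>y. (e', e) \<in> copycat_leq A}"
    proof
      fix e assume e: "e \<in> y"
      then have "(e, e) \<in> copycat_leq A" using d(2) es_refl[OF A] unfolding L by (auto simp: par_simps)
      then show "e \<in> {e'. \<exists>e\<in>y. (e', e) \<in> copycat_leq A}" using e by blast
    qed
  qed
  then have "y \<in> Con (par A A)" using d(3) by simp
  moreover have "e' \<in> y" if "e \<in> y" "(e', e) \<in> Leq (par A A)" for e e'
    using d(4)[OF that(1), of e'] that(2) unfolding L by (auto simp: par_simps)
  ultimately have "y \<in> conf (par A A)" using d(1,2) unfolding conf_def by blast
  moreover have "In0 c \<in> y" if "In1 c \<in> y" "pol A c = Pos" for c
    using d(4)[OF that(1), of "In0 c"] that es_refl[OF A yE, of c] unfolding L by blast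
  moreover have "In1 c \<in> y" if "In0 c \<in> y" "pol A c = Neg" for c
    using d(4)[OF that(1), of "In1 c"] that es_refl[OF A yE, of c] unfolding L by blast
  ultimately show "y \<in> conf (par A A) \<and> (\<forall>c. In1 c \<in> y \<longrightarrow> pol A c = Pos \<longrightarrow> In0 c \<in> y) \<and>
      (\<forall>c. In0 c \<in> y \<longrightarrow> pol A c = Neg \<longrightarrow> In1 c \<in> y)" by blast
next
  note L = copycat_leq_iff[OF A]
  assume R: "y \<in> conf (par A A) \<and> (\<forall>c. In1 c \<in> y \<longrightarrow> pol A c = Pos \<longrightarrow> In0 c \<in> y) \<and>
      (\<forall>c. In0 c \<in> y \<longrightarrow> pol A c = Neg \<longrightarrow> In1 c \<in> y)"
  then have y: "y \<in> conf (par A A)" by blast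
  note d = confD[OF y]
  have y0: "In0 a \<in> y" if "In0 b \<in> y" "(a, b) \<in> Leq A" for a b using d(4)[OF that(1), of "In0 a"] that by (simp add: par_simps)
  have y1: "In1 a \<in> y" if "In1 b \<in> y" "(a, b) \<in> Leq A" for a b using d(4)[OF that(1), of "In1 a"] that by (simp add: par_simps)
  have dc: "e' \<in> y" if "e \<in> y" "(e', e) \<in> copycat_leq A" for e e'
    using that R y0 y1 unfolding L by blast
  have "{e'. \<exists>e\<in>y. (e', e) \<in> copycat_leq A} \<subseteq> y" using dc by blast
  then have "{e'. \<exists>e\<in>y. (e', e) \<in> copycat_leq A} \<in> Con (par A A)"
    by (rule Con_subset[OF par_es[OF A A] d(3)])
  then show "y \<in> conf (copycat_game A)"
    unfolding conf_def copycat_game_simps using d(1,2) dc by blast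
qed

lemma copycat_simps [simp]: "src (copycat A) = A" "trg (copycat A) = A" "st (copycat A) = copycat_game A"
  by (simp_all add: copycat_def)

lemma copycat_lab: "e \<in> Ev (par A A) \<Longrightarrow> lab (copycat A) e = e"
  by (simp add: copycat_def copycat_game_simps)

lemma copycat_lab_conf: "y \<in> conf (copycat_game A) \<Longrightarrow> lab (copycat A) ` y = y"
proof -
  assume "y \<in> conf (copycat_game A)"
  then have "y \<subseteq> Ev (par A A)" using confD(2)[of y "copycat_game A"] by (simp add: copycat_game_simps)
  then have "lab (copycat A) ` y = (\<lambda>e. e) ` y" using copycat_lab by (intro image_cong) auto
  then show ?thesis by simp
qed

lemma copycat_prestrategy:
  assumes A: "is_esp A" shows "prestrategy (copycat A)"
proof -
  have A': "is_es A" using A by (simp add: is_esp_def)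
  have G: "is_esp (dual A \<parallel> A)" using A by (simp add: esp_par esp_dual)
  have S: "is_esp (copycat_game A)"
    using copycat_es[OF A'] G unfolding is_esp_def by (simp add: copycat_game_simps) (simp add: copycat_game_def)
  have m: "es_map (copycat_game A) (dual A \<parallel> A) (lab (copycat A))"
    unfolding es_map_def
  proof (intro conjI ballI)
    show "lab (copycat A) \<in> Ev (copycat_game A) \<rightarrow>\<^sub>E Ev (dual A \<parallel> A)"
      by (auto simp: copycat_def copycat_game_simps)
    fix y assume y: "y \<in> conf (copycat_game A)"
    show "lab (copycat A) ` y \<in> conf (dual A \<parallel> A)"
      using y conf_copycat[OF A'] copycat_lab_conf[OF y] by simp
    show "inj_on (lab (copycat A)) y"
    proof -
      have "lab (copycat A) e = e" if "e \<in> y" for e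
        using copycat_lab[of e A] confD(2)[OF y] that unfolding copycat_game_simps by blast
      then show ?thesis by (simp add: inj_on_def)
    qed
  qed
  have "pol (dual A \<parallel> A) (lab (copycat A) e) = pol (copycat_game A) e" if "e \<in> Ev (copycat_game A)" for e
    using that copycat_lab[of e A] by (simp add: copycat_game_simps) (simp add: copycat_game_def)
  then show ?thesis
    using A G S m by (simp add: prestrategy_def is_prestrategy_on_def esp_map_def)
qed

section \<open>Courtesy and receptivity\<close>

text \<open>
  Courtesy and receptivity at the labels in \<open>V\<close>, phrased on configurations: a positive event that
  is maximal in the game can be removed, a negative event only waits for its causes in the game, and
  negative moves of the game lift uniquely.
\<close>

definition courteous_receptive_on :: "'a set \<Rightarrow> 'u game \<Rightarrow> 'a esp \<Rightarrow> ('u ev \<Rightarrow> 'a) \<Rightarrow> bool" where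
  "courteous_receptive_on V S G l \<longleftrightarrow>
     (\<forall>x s. x \<in> conf S \<longrightarrow> s \<in> x \<longrightarrow> l s \<in> V \<longrightarrow> pol G (l s) = Pos \<longrightarrow> l ` x - {l s} \<in> conf G \<longrightarrow> x - {s} \<in> conf S) \<and>
     (\<forall>x y s. x \<in> conf S \<longrightarrow> y \<in> conf S \<longrightarrow> x \<subseteq> y \<longrightarrow> s \<in> y \<longrightarrow> l s \<in> V \<longrightarrow> pol G (l s) = Neg \<longrightarrow>
        insert (l s) (l ` x) \<in> conf G \<longrightarrow> insert s x \<in> conf S) \<and>
     (\<forall>x g. x \<in> conf S \<longrightarrow> g \<in> V \<longrightarrow> g \<notin> l ` x \<longrightarrow> pol G g = Neg \<longrightarrow> insert g (l ` x) \<in> conf G \<longrightarrow>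
        (\<exists>s. l s = g \<and> insert s x \<in> conf S)) \<and>
     (\<forall>x s s'. x \<in> conf S \<longrightarrow> insert s x \<in> conf S \<longrightarrow> insert s' x \<in> conf S \<longrightarrow> s \<notin> x \<longrightarrow> s' \<notin> x \<longrightarrow>
        l s = l s' \<longrightarrow> l s \<in> V \<longrightarrow> pol G (l s) = Neg \<longrightarrow> s = s')"

lemma courteous_receptive_onD:
  assumes "courteous_receptive_on V S G l"
  shows "\<And>x s. x \<in> conf S \<Longrightarrow> s \<in> x \<Longrightarrow> l s \<in> V \<Longrightarrow> pol G (l s) = Pos \<Longrightarrow> l ` x - {l s} \<in> conf G \<Longrightarrow> x - {s} \<in> conf S"
    "\<And>x y s. x \<in> conf S \<Longrightarrow> y \<in> conf S \<Longrightarrow> x \<subseteq> y \<Longrightarrow> s \<in> y \<Longrightarrow> l s \<in> V \<Longrightarrow> pol G (l s) = Neg \<Longrightarrow>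
        insert (l s) (l ` x) \<in> conf G \<Longrightarrow> insert s x \<in> conf S"
    "\<And>x g. x \<in> conf S \<Longrightarrow> g \<in> V \<Longrightarrow> g \<notin> l ` x \<Longrightarrow> pol G g = Neg \<Longrightarrow> insert g (l ` x) \<in> conf G \<Longrightarrow>
        \<exists>s. l s = g \<and> insert s x \<in> conf S"
    "\<And>x s s'. x \<in> conf S \<Longrightarrow> insert s x \<in> conf S \<Longrightarrow> insert s' x \<in> conf S \<Longrightarrow> s \<notin> x \<Longrightarrow> s' \<notin> x \<Longrightarrow>
        l s = l s' \<Longrightarrow> l s \<in> V \<Longrightarrow> pol G (l s) = Neg \<Longrightarrow> s = s'"
proof -
  show "\<And>x s. x \<in> conf S \<Longrightarrow> s \<in> x \<Longrightarrow> l s \<in> V \<Longrightarrow> pol G (l s) = Pos \<Longrightarrow> l ` x - {l s} \<in> conf G \<Longrightarrow> x - {s} \<in> conf S"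
    using assms[unfolded courteous_receptive_on_def, THEN conjunct1] by blast
  show "\<And>x y s. x \<in> conf S \<Longrightarrow> y \<in> conf S \<Longrightarrow> x \<subseteq> y \<Longrightarrow> s \<in> y \<Longrightarrow> l s \<in> V \<Longrightarrow> pol G (l s) = Neg \<Longrightarrow>
        insert (l s) (l ` x) \<in> conf G \<Longrightarrow> insert s x \<in> conf S"
    using assms[unfolded courteous_receptive_on_def, THEN conjunct2, THEN conjunct1] by blast
  show "\<And>x g. x \<in> conf S \<Longrightarrow> g \<in> V \<Longrightarrow> g \<notin> l ` x \<Longrightarrow> pol G g = Neg \<Longrightarrow> insert g (l ` x) \<in> conf G \<Longrightarrow>
        \<exists>s. l s = g \<and> insert s x \<in> conf S"
    using assms[unfolded courteous_receptive_on_def, THEN conjunct2, THEN conjunct2, THEN conjunct1] by blast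
  show "\<And>x s s'. x \<in> conf S \<Longrightarrow> insert s x \<in> conf S \<Longrightarrow> insert s' x \<in> conf S \<Longrightarrow> s \<notin> x \<Longrightarrow> s' \<notin> x \<Longrightarrow>
        l s = l s' \<Longrightarrow> l s \<in> V \<Longrightarrow> pol G (l s) = Neg \<Longrightarrow> s = s'"
    using assms[unfolded courteous_receptive_on_def, THEN conjunct2, THEN conjunct2, THEN conjunct2] by blast
qed

abbreviation game_of :: "'u prestrat \<Rightarrow> 'u game" where
  "game_of \<sigma> \<equiv> dual (src \<sigma>) \<parallel> trg \<sigma>"

text \<open>Relative to a set of labels because a composite inherits the property for its left game
  from one factor and for its right game from the other.\<close>

definition courteous_receptive :: "'u ev set \<Rightarrow> 'u prestrat \<Rightarrow> bool" where
  "courteous_receptive V \<sigma> \<longleftrightarrow> courteous_receptive_on V (st \<sigma>) (game_of \<sigma>) (lab \<sigma>)"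

lemma courteous_receptive_UNIV:
  assumes p: "prestrategy \<sigma>" and g0: "courteous_receptive (range In0) \<sigma>" and g1: "courteous_receptive (range In1) \<sigma>"
  shows "courteous_receptive UNIV \<sigma>"
proof -
  note d0 = courteous_receptive_onD[OF g0[unfolded courteous_receptive_def]] and d1 = courteous_receptive_onD[OF g1[unfolded courteous_receptive_def]]
  have V: "g \<in> range In0 \<or> g \<in> range In1" if "L \<in> conf (game_of \<sigma>)" "g \<in> L" for g L
    using that by (auto simp: conf_par)
  have Vl: "lab \<sigma> s \<in> range In0 \<or> lab \<sigma> s \<in> range In1" if "x \<in> conf (st \<sigma>)" "s \<in> x" for x s
    using prestrategy_conf(4)[OF p that(1)] that(2) by blast
  show ?thesis
    unfolding courteous_receptive_def courteous_receptive_on_def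
  proof (intro conjI allI impI)
    fix x s assume *: "x \<in> conf (st \<sigma>)" "s \<in> x" "pol (game_of \<sigma>) (lab \<sigma> s) = Pos" "lab \<sigma> ` x - {lab \<sigma> s} \<in> conf (game_of \<sigma>)"
    show "x - {s} \<in> conf (st \<sigma>)" using Vl[OF *(1,2)] d0(1)[OF *(1,2) _ *(3,4)] d1(1)[OF *(1,2) _ *(3,4)] by blast
  next
    fix x y s assume *: "x \<in> conf (st \<sigma>)" "y \<in> conf (st \<sigma>)" "x \<subseteq> y" "s \<in> y" "pol (game_of \<sigma>) (lab \<sigma> s) = Neg"
      "insert (lab \<sigma> s) (lab \<sigma> ` x) \<in> conf (game_of \<sigma>)"
    show "insert s x \<in> conf (st \<sigma>)" using Vl[OF *(2,4)] d0(2)[OF *(1-4) _ *(5,6)] d1(2)[OF *(1-4) _ *(5,6)] by blast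
  next
    fix x g assume *: "x \<in> conf (st \<sigma>)" "g \<notin> lab \<sigma> ` x" "pol (game_of \<sigma>) g = Neg"
      "insert g (lab \<sigma> ` x) \<in> conf (game_of \<sigma>)"
    show "\<exists>s. lab \<sigma> s = g \<and> insert s x \<in> conf (st \<sigma>)"
      using V[OF *(4), of g] d0(3)[OF *(1) _ *(2-4)] d1(3)[OF *(1) _ *(2-4)] by blast
  next
    fix x s s' assume *: "x \<in> conf (st \<sigma>)" "insert s x \<in> conf (st \<sigma>)" "insert s' x \<in> conf (st \<sigma>)" "s \<notin> x" "s' \<notin> x"
      "lab \<sigma> s = lab \<sigma> s'" "pol (game_of \<sigma>) (lab \<sigma> s) = Neg"
    show "s = s'" using Vl[OF *(2), of s] d0(4)[OF *(1-6) _ *(7)] d1(4)[OF *(1-6) _ *(7)] by blast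
  qed
qed

lemma courteous_receptive_mono: assumes "courteous_receptive UNIV \<sigma>" shows "courteous_receptive V \<sigma>"
proof -
  note d = courteous_receptive_onD[OF assms[unfolded courteous_receptive_def]]
  show ?thesis
    unfolding courteous_receptive_def courteous_receptive_on_def
  proof (intro conjI allI impI)
    show "x - {s} \<in> conf (st \<sigma>)" if "x \<in> conf (st \<sigma>)" "s \<in> x" "pol (game_of \<sigma>) (lab \<sigma> s) = Pos"
      "lab \<sigma> ` x - {lab \<sigma> s} \<in> conf (game_of \<sigma>)" for x s
      by (rule d(1)[OF that(1,2) UNIV_I that(3,4)])
    show "insert s x \<in> conf (st \<sigma>)" if "x \<in> conf (st \<sigma>)" "y \<in> conf (st \<sigma>)" "x \<subseteq> y" "s \<in> y"
      "pol (game_of \<sigma>) (lab \<sigma> s) = Neg" "insert (lab \<sigma> s) (lab \<sigma> ` x) \<in> conf (game_of \<sigma>)" for x y s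
      by (rule d(2)[OF that(1-4) UNIV_I that(5,6)])
    show "\<exists>s. lab \<sigma> s = g \<and> insert s x \<in> conf (st \<sigma>)" if "x \<in> conf (st \<sigma>)" "g \<notin> lab \<sigma> ` x"
      "pol (game_of \<sigma>) g = Neg" "insert g (lab \<sigma> ` x) \<in> conf (game_of \<sigma>)" for x g
      by (rule d(3)[OF that(1) UNIV_I that(2-4)])
    show "s = s'" if "x \<in> conf (st \<sigma>)" "insert s x \<in> conf (st \<sigma>)" "insert s' x \<in> conf (st \<sigma>)" "s \<notin> x" "s' \<notin> x"
      "lab \<sigma> s = lab \<sigma> s'" "pol (game_of \<sigma>) (lab \<sigma> s) = Neg" for x s s'
      by (rule d(4)[OF that(1-6) UNIV_I that(7)])
  qed
qed

lemma courteous_receptive_copycat: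
  assumes A: "is_esp A" shows "courteous_receptive UNIV (copycat A)"
proof -
  have A': "is_es A" using A by (simp add: is_esp_def)
  note c = conf_copycat[OF A'] and l = copycat_lab_conf[of _ A]
  have E: "e \<in> Ev (par A A)" if "y \<in> conf (par A A)" "e \<in> y" for y e using confD(2)[OF that(1)] that(2) by blast
  have lb: "lab (copycat A) e = e" if "y \<in> conf (copycat_game A)" "e \<in> y" for y e
    using copycat_lab[OF E[of y e]] that c by blast
  have p0: "pol (dual A \<parallel> A) (In0 a) = opp (pol A a)" "pol (dual A \<parallel> A) (In1 a) = pol A a" if "a \<in> Ev A" for a
    using that by simp_all
  have split: "(\<exists>a. e = In0 a \<and> a \<in> Ev A) \<or> (\<exists>a. e = In1 a \<and> a \<in> Ev A)" if "y \<in> conf (par A A)" "e \<in> y" for y e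
    using E[OF that] by (auto simp: par_simps)
  have np: "p = Pos \<longleftrightarrow> p \<noteq> Neg" for p by (cases p) auto
  \<comment> \<open>The copycat conditions restrict only the entry of positive events, so a negative
    event enters whenever the game allows it.\<close>
  have ins: "insert e x \<in> conf (copycat_game A)"
    if "x \<in> conf (copycat_game A)" "insert e x \<in> conf (par A A)" "pol (dual A \<parallel> A) e = Neg" for x e
    using split[OF that(2), of e] that unfolding c by (auto simp: p0 np)
  show ?thesis
    unfolding courteous_receptive_def courteous_receptive_on_def copycat_simps
  proof (intro conjI allI impI)
    fix x s assume *: "x \<in> conf (copycat_game A)" "s \<in> x" "pol (dual A \<parallel> A) (lab (copycat A) s) = Pos"
      "lab (copycat A) ` x - {lab (copycat A) s} \<in> conf (dual A \<parallel> A)"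
    have "x \<in> conf (par A A)" using *(1) c by blast
    from split[OF this *(2)] show "x - {s} \<in> conf (copycat_game A)"
      using * unfolding l[OF *(1)] lb[OF *(1,2)] c by (auto simp: p0)
  next
    fix x y s assume *: "x \<in> conf (copycat_game A)" "y \<in> conf (copycat_game A)" "x \<subseteq> y" "s \<in> y"
      "pol (dual A \<parallel> A) (lab (copycat A) s) = Neg" "insert (lab (copycat A) s) (lab (copycat A) ` x) \<in> conf (dual A \<parallel> A)"
    then show "insert s x \<in> conf (copycat_game A)" using ins[OF *(1), of s] l[OF *(1)] lb[OF *(2,4)] by simp
  next
    fix x g assume *: "x \<in> conf (copycat_game A)" "g \<notin> lab (copycat A) ` x" "pol (dual A \<parallel> A) g = Neg"
      "insert g (lab (copycat A) ` x) \<in> conf (dual A \<parallel> A)"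
    then have i: "insert g x \<in> conf (copycat_game A)" using ins[OF *(1), of g] l[OF *(1)] by simp
    then show "\<exists>s. lab (copycat A) s = g \<and> insert s x \<in> conf (copycat_game A)" using lb[OF i, of g] by blast
  next
    fix x s s' assume *: "insert s x \<in> conf (copycat_game A)" "insert s' x \<in> conf (copycat_game A)"
      "lab (copycat A) s = lab (copycat A) s'"
    then show "s = s'" using lb[OF *(1), of s] lb[OF *(2), of s'] by simp
  qed
qed

text \<open>Common form of the two inheritance results. \<open>K\<close> is the factor that owns the
  outer side tagged by \<open>Fi\<close>, \<open>r\<close> is a configuration of the other factor,
  and \<open>V k r\<close> is the configuration of the composite \<open>H\<close>. A move on that
  side changes \<open>k\<close> alone, so every clause for \<open>H\<close> reduces to the same
  clause for \<open>K\<close>.\<close>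

lemma courteous_receptive_transfer:
  fixes C :: "'u ev set \<Rightarrow> 'u ev set \<Rightarrow> bool" and Fi :: "'u ev \<Rightarrow> 'u ev"
  assumes H: "prestrategy H" and K: "prestrategy K"
    and cf: "\<And>k r. C k r \<Longrightarrow> V k r \<in> conf (st H)" "\<And>k r. C k r \<Longrightarrow> k \<in> conf (st K)"
    and lb: "\<And>k r. C k r \<Longrightarrow> Fi -` lab H ` V k r = Fi -` lab K ` k"
    and core: "\<And>z. z \<in> conf (st H) \<Longrightarrow> \<exists>k r. C k r \<and> V k r = z \<and> (\<forall>k' r'. C k' r' \<longrightarrow> z \<subseteq> V k' r' \<longrightarrow> k \<subseteq> k' \<and> r \<subseteq> r')"
    and mono: "\<And>k r k' r'. k \<subseteq> k' \<Longrightarrow> r \<subseteq> r' \<Longrightarrow> V k r \<subseteq> V k' r'"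
    and sub: "\<And>k r t c. C k r \<Longrightarrow> t \<in> k \<Longrightarrow> lab K t = Fi c \<Longrightarrow> k - {t} \<in> conf (st K) \<Longrightarrow> C (k - {t}) r"
    and ext: "\<And>k r t c. C k r \<Longrightarrow> t \<notin> k \<Longrightarrow> lab K t = Fi c \<Longrightarrow> insert t k \<in> conf (st K) \<Longrightarrow> C (insert t k) r"
    and extl: "\<And>k r t c. C k r \<Longrightarrow> lab K t = Fi c \<Longrightarrow> C (insert t k) r \<Longrightarrow> lab H ` V (insert t k) r = insert (Fi c) (lab H ` V k r)"
    and gm: "\<And>k r c. C k r \<Longrightarrow> lab H ` V k r - {Fi c} \<in> conf (game_of H) \<Longrightarrow> lab K ` k - {Fi c} \<in> conf (game_of K)"
    and gi: "\<And>k r c. C k r \<Longrightarrow> insert (Fi c) (lab H ` V k r) \<in> conf (game_of H) \<Longrightarrow> insert (Fi c) (lab K ` k) \<in> conf (game_of K)"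
    and pl: "\<And>c. Fi c \<in> Ev (game_of H) \<Longrightarrow> pol (game_of K) (Fi c) = pol (game_of H) (Fi c)"
    and good: "courteous_receptive (range Fi) K"
  shows "courteous_receptive (range Fi) H"
proof -
  note gd = courteous_receptive_onD[OF good[unfolded courteous_receptive_def]]
  have injH: "inj_on (lab H) z" if "z \<in> conf (st H)" for z by (rule prestrategy_conf(1)[OF H that])
  \<comment> \<open>One more event of the factor is one more event of the composite, since exactly
    one visible label is added.\<close>
  have extV: "\<exists>e. e \<notin> V k r \<and> V (insert t k) r = insert e (V k r) \<and> lab H e = Fi c"
    if C: "C k r" "C (insert t k) r" and t: "t \<notin> k" "lab K t = Fi c" for k r t c
  proof -
    have "Fi c \<notin> lab K ` k"
    proof
      assume "Fi c \<in> lab K ` k"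
      then obtain t' where "t' \<in> k" "lab K t' = lab K t" using t by auto
      then show False using inj_onD[OF prestrategy_conf(1)[OF K cf(2)[OF C(2)]], of t' t] t by auto
    qed
    then have n: "Fi c \<notin> lab H ` V k r" using lb[OF C(1)] by blast
    have l: "lab H ` V (insert t k) r = insert (Fi c) (lab H ` V k r)" by (rule extl[OF C(1) t(2) C(2)])
    then obtain e where e: "e \<in> V (insert t k) r" "lab H e = Fi c" by (metis imageE insertI1)
    have s: "V k r \<subseteq> V (insert t k) r" by (rule mono) auto
    have "insert e (V k r) = V (insert t k) r"
      by (rule conf_eqI_lab[OF injH[OF cf(1)[OF C(2)]]]) (use e s l in auto)
    moreover have "e \<notin> V k r" using e(2) n by force
    ultimately show ?thesis using e(2) by (intro exI[of _ e]) simp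
  qed
  have labK: "\<exists>t\<in>k. lab K t = Fi c" if "C k r" "e \<in> V k r" "lab H e = Fi c" for k r e c
  proof -
    have "c \<in> Fi -` lab H ` V k r" using that by force
    then show ?thesis unfolding lb[OF that(1)] by force
  qed
  have inE: "lab H e \<in> Ev (game_of H)" if "z \<in> conf (st H)" "e \<in> z" for z e
    using es_mapD(1)[OF prestrategyD(7)[OF H]] confD(2)[OF that(1)] that(2) by blast
  show ?thesis
    unfolding courteous_receptive_def courteous_receptive_on_def
  proof (intro conjI allI impI)
    fix z e assume z: "z \<in> conf (st H)" "e \<in> z" "lab H e \<in> range Fi" "pol (game_of H) (lab H e) = Pos"
      "lab H ` z - {lab H e} \<in> conf (game_of H)"
    obtain c where c: "lab H e = Fi c" using z(3) by blast
    obtain k r where kr: "C k r" "V k r = z" using core[OF z(1)] by blast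
    obtain t where t: "t \<in> k" "lab K t = Fi c" using labK[OF kr(1), of e c] z(2) c kr(2) by blast
    have "pol (game_of K) (Fi c) = Pos" using pl[of c] inE[OF z(1,2)] z(4) c by simp
    then have kt: "k - {t} \<in> conf (st K)"
      using gd(1)[OF cf(2)[OF kr(1)] t(1)] t(2) gm[OF kr(1), of c] z(5) kr(2) c by simp
    have C': "C (k - {t}) r" by (rule sub[OF kr(1) t kt])
    have "C (insert t (k - {t})) r" using kr(1) t(1) by (simp add: insert_absorb)
    then obtain e' where e': "e' \<notin> V (k - {t}) r" "V (insert t (k - {t})) r = insert e' (V (k - {t}) r)" "lab H e' = Fi c"
      using extV[OF C'] t(2) by blast
    then have z': "z = insert e' (V (k - {t}) r)" using t(1) kr(2) by (simp add: insert_absorb)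
    then have "e' \<in> z" by blast
    then have "e' = e" using inj_onD[OF injH[OF z(1)], of e' e] z(2) e'(3) c by simp
    then have "z - {e} = V (k - {t}) r" using z' e'(1) by auto
    then show "z - {e} \<in> conf (st H)" using cf(1)[OF C'] by simp
  next
    fix z z' e assume z: "z \<in> conf (st H)" "z' \<in> conf (st H)" "z \<subseteq> z'" "e \<in> z'" "lab H e \<in> range Fi"
      "pol (game_of H) (lab H e) = Neg" "insert (lab H e) (lab H ` z) \<in> conf (game_of H)"
    obtain c where c: "lab H e = Fi c" using z(5) by blast
    show "insert e z \<in> conf (st H)"
    proof (cases "e \<in> z")
      case True then show ?thesis using z(1) by (simp add: insert_absorb)
    next
      case False
      obtain k r where kr: "C k r" "V k r = z" "\<And>k' r'. C k' r' \<Longrightarrow> z \<subseteq> V k' r' \<Longrightarrow> k \<subseteq> k' \<and> r \<subseteq> r'" using core[OF z(1)] by blast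
      obtain k' r' where kr': "C k' r'" "V k' r' = z'" using core[OF z(2)] by blast
      \<comment> \<open>Comparison with the larger configuration is possible because the pair for
        \<open>z\<close> was taken least.\<close>
      have s: "k \<subseteq> k'" "r \<subseteq> r'" using kr(3)[OF kr'(1)] kr'(2) z(3) by auto
      obtain t where t: "t \<in> k'" "lab K t = Fi c" using labK[OF kr'(1), of e c] z(4) c kr'(2) by blast
      have "pol (game_of K) (Fi c) = Neg" using pl[of c] inE[OF z(2,4)] z(6) c by simp
      then have kt: "insert t k \<in> conf (st K)"
        using gd(2)[OF cf(2)[OF kr(1)] cf(2)[OF kr'(1)] s(1) t(1)] t(2) gi[OF kr(1), of c] z(7) kr(2) c by simp
      have tk: "t \<notin> k"
      proof
        assume "t \<in> k"
        then have "c \<in> Fi -` lab H ` V k r" unfolding lb[OF kr(1)] using t(2) by force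
        then obtain e' where "e' \<in> z" "lab H e' = lab H e" using kr(2) c by auto
        then show False using inj_onD[OF injH[OF z(2)], of e' e] z(3,4) False by blast
      qed
      have C': "C (insert t k) r" by (rule ext[OF kr(1) tk t(2) kt])
      obtain e' where e': "V (insert t k) r = insert e' z" "lab H e' = Fi c" using extV[OF kr(1) C' tk t(2)] kr(2) by blast
      have "insert e' z \<subseteq> z'" using mono[of "insert t k" k' r r'] s t(1) kr'(2) e'(1) by simp
      then have "e' = e" using inj_onD[OF injH[OF z(2)], of e' e] z(4) e'(2) c by simp
      then show ?thesis using cf(1)[OF C'] e'(1) by simp
    qed
  next
    fix z g assume z: "z \<in> conf (st H)" "g \<in> range Fi" "g \<notin> lab H ` z" "pol (game_of H) g = Neg"
      "insert g (lab H ` z) \<in> conf (game_of H)"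
    obtain c where c: "g = Fi c" using z(2) by blast
    obtain k r where kr: "C k r" "V k r = z" using core[OF z(1)] by blast
    have "g \<in> Ev (game_of H)" using confD(2)[OF z(5)] by blast
    then have p: "pol (game_of K) (Fi c) = Neg" using pl[of c] z(4) c by simp
    have n: "Fi c \<notin> lab K ` k" using lb[OF kr(1)] z(3) c kr(2) by blast
    obtain t where t: "lab K t = Fi c" "insert t k \<in> conf (st K)"
      using gd(3)[OF cf(2)[OF kr(1)] _ n p] gi[OF kr(1), of c] z(5) kr(2) c by blast
    have tk: "t \<notin> k" using n t(1) by force
    have C': "C (insert t k) r" by (rule ext[OF kr(1) tk t])
    obtain e where e: "V (insert t k) r = insert e z" "lab H e = Fi c" using extV[OF kr(1) C' tk t(1)] kr(2) by blast
    then show "\<exists>e. lab H e = g \<and> insert e z \<in> conf (st H)" using cf(1)[OF C'] c by auto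
  next
    fix z e e' assume z: "z \<in> conf (st H)" "insert e z \<in> conf (st H)" "insert e' z \<in> conf (st H)" "e \<notin> z" "e' \<notin> z"
      "lab H e = lab H e'" "lab H e \<in> range Fi" "pol (game_of H) (lab H e) = Neg"
    obtain c where c: "lab H e = Fi c" "lab H e' = Fi c" using z(6,7) by auto
    obtain k r where kr: "C k r" "V k r = z" "\<And>k' r'. C k' r' \<Longrightarrow> z \<subseteq> V k' r' \<Longrightarrow> k \<subseteq> k' \<and> r \<subseteq> r'" using core[OF z(1)] by blast
    have p: "pol (game_of K) (Fi c) = Neg" using pl[of c] inE[OF z(2), of e] z(8) c by simp
    have n: "Fi c \<notin> lab K ` k"
    proof
      assume "Fi c \<in> lab K ` k"
      then have "c \<in> Fi -` lab H ` V k r" unfolding lb[OF kr(1)] by simp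
      then obtain d where "d \<in> z" "lab H d = lab H e" using kr(2) c by auto
      then show False using inj_onD[OF injH[OF z(2)], of d e] z(4) by blast
    qed
    \<comment> \<open>Every extension of \<open>z\<close> at this label stems from an extension of
      \<open>k\<close>, so uniqueness in the factor gives uniqueness in the composite.\<close>
    have main: "\<exists>t. t \<notin> k \<and> lab K t = Fi c \<and> insert t k \<in> conf (st K) \<and> V (insert t k) r = insert d z"
      if d: "insert d z \<in> conf (st H)" "d \<notin> z" "lab H d = Fi c" for d
    proof -
      obtain k' r' where kr': "C k' r'" "V k' r' = insert d z" using core[OF d(1)] by blast
      have s: "k \<subseteq> k'" "r \<subseteq> r'" using kr(3)[OF kr'(1)] kr'(2) by auto
      obtain t where t: "t \<in> k'" "lab K t = Fi c" using labK[OF kr'(1), of d c] d(3) kr'(2) by blast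
      have "insert (lab H d) (lab H ` z) \<in> conf (game_of H)"
        using es_mapD(2)[OF prestrategyD(7)[OF H] d(1)] by simp
      then have kt: "insert t k \<in> conf (st K)"
        using gd(2)[OF cf(2)[OF kr(1)] cf(2)[OF kr'(1)] s(1) t(1)] t(2) gi[OF kr(1), of c] kr(2) d(3) p by simp
      have tk: "t \<notin> k" using n t(2) by force
      have C': "C (insert t k) r" by (rule ext[OF kr(1) tk t(2) kt])
      obtain e' where e': "V (insert t k) r = insert e' z" "lab H e' = Fi c" using extV[OF kr(1) C' tk t(2)] kr(2) by blast
      have "insert e' z \<subseteq> insert d z" using mono[of "insert t k" k' r r'] s t(1) kr'(2) e'(1) by simp
      then have "e' = d" using inj_onD[OF injH[OF d(1)], of e' d] e'(2) d(3) by auto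
      then show ?thesis using tk t(2) kt e'(1) by blast
    qed
    obtain t where t: "t \<notin> k" "lab K t = Fi c" "insert t k \<in> conf (st K)" "V (insert t k) r = insert e z"
      using main[OF z(2,4) c(1)] by blast
    obtain t' where t': "t' \<notin> k" "lab K t' = Fi c" "insert t' k \<in> conf (st K)" "V (insert t' k) r = insert e' z"
      using main[OF z(3,5) c(2)] by blast
    have "t = t'" using gd(4)[OF cf(2)[OF kr(1)] t(3) t'(3) t(1) t'(1)] t(2) t'(2) p by simp
    then have "insert e z = insert e' z" using t(4) t'(4) by simp
    then show "e = e'" using z(4,5) by (metis insertE insertI1)
  qed
qed

lemma rank_extend:
  fixes \<rho> :: "'a \<Rightarrow> nat"
  assumes "finite X" shows "\<exists>N. \<forall>x\<in>X. \<rho> x < N"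
proof -
  have "finite (\<rho> ` X)" using assms by simp
  then show ?thesis using finite_nat_set_iff_bounded[of "\<rho> ` X"] by blast
qed

section \<open>Courtesy and receptivity of a composite, one side at a time\<close>

context inter
begin

text \<open>A move on the outer game involves one strategy only, so it can be scheduled after all
  events of \<open>y\<close>, with rank \<open>N\<close>; its location is new to both
  strategies.\<close>

lemma sync2_ext_right:
  assumes c: "sync2 \<tau> \<sigma> x y" and t: "t \<notin> y" "lab \<tau> t = In1 d" "insert t y \<in> conf (st \<tau>)"
  shows "sync2 \<tau> \<sigma> x (insert t y)"
proof -
  have m: "match2 \<tau> \<sigma> x y" using c by (simp add: sync2_def)
  then have xy: "x \<in> conf (st \<sigma>)" "y \<in> conf (st \<tau>)" by (auto simp: match2_def)
  obtain \<rho> where \<rho>: "rank2 \<tau> \<sigma> x y \<rho>" using c by (auto simp: sync2_def)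
  obtain N where N: "\<forall>l\<in>In1 ` lab \<tau> ` y. \<rho> l < N" using rank_extend[of "In1 ` lab \<tau> ` y" \<rho>] confD(1)[OF xy(2)] by auto
  let ?l = "In1 (In1 d)"
  have n1: "lloc (lab \<sigma> s) \<noteq> ?l" if "s \<in> x" for s
  proof -
    have "lab \<sigma> s \<in> range In0 \<union> range In1" using prestrategy_conf(4)[OF pre\<sigma> xy(1)] that by blast
    then show ?thesis by auto
  qed
  have n2: "In1 (lab \<tau> s) \<noteq> ?l" if "s \<in> y" for s
    using inj_onD[OF prestrategy_conf(1)[OF pre\<tau> t(3)], of s t] that t by auto
  have "rank2 \<tau> \<sigma> x (insert t y) (\<rho>(?l := N))"
    unfolding rank2_def
  proof (intro conjI ballI impI)
    fix s s' assume "s \<in> x" "s' \<in> x" "(s, s') \<in> Leq (st \<sigma>)" "s \<noteq> s'"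
    then show "(\<rho>(?l := N)) (lloc (lab \<sigma> s)) < (\<rho>(?l := N)) (lloc (lab \<sigma> s'))"
      using \<rho> n1 by (simp add: rank2_def)
  next
    fix s s' assume s: "s \<in> insert t y" "s' \<in> insert t y" "(s, s') \<in> Leq (st \<tau>)" "s \<noteq> s'"
    show "(\<rho>(?l := N)) (In1 (lab \<tau> s)) < (\<rho>(?l := N)) (In1 (lab \<tau> s'))"
    proof (cases "s' = t")
      case True
      then have "s \<in> y" using s by blast
      then show ?thesis using True t(2) n2[of s] N by simp
    next
      case False
      then have "s' \<in> y" using s by blast
      moreover have "s \<in> y" using confD(4)[OF xy(2) \<open>s' \<in> y\<close> s(3)] .
      ultimately show ?thesis using n2 \<rho> s by (simp add: rank2_def)
    qed
  qed
  moreover have "In0 -` lab \<tau> ` insert t y = In0 -` lab \<tau> ` y" using t(2) by auto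
  then have "match2 \<tau> \<sigma> x (insert t y)" using m t by (simp add: match2_def)
  ultimately show ?thesis by (auto simp: sync2_def)
qed

lemma sync2_ext_left:
  assumes c: "sync2 \<tau> \<sigma> x y" and t: "t \<notin> x" "lab \<sigma> t = In0 d" "insert t x \<in> conf (st \<sigma>)"
  shows "sync2 \<tau> \<sigma> (insert t x) y"
proof -
  have m: "match2 \<tau> \<sigma> x y" using c by (simp add: sync2_def)
  then have xy: "x \<in> conf (st \<sigma>)" "y \<in> conf (st \<tau>)" by (auto simp: match2_def)
  obtain \<rho> where \<rho>: "rank2 \<tau> \<sigma> x y \<rho>" using c by (auto simp: sync2_def)
  obtain N where N: "\<forall>l\<in>lloc ` lab \<sigma> ` x. \<rho> l < N" using rank_extend[of "lloc ` lab \<sigma> ` x" \<rho>] confD(1)[OF xy(1)] by auto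
  let ?l = "In0 d"
  have n2: "lloc (lab \<sigma> s) \<noteq> ?l" if "s \<in> x" for s
  proof
    assume e: "lloc (lab \<sigma> s) = ?l"
    have "lab \<sigma> s \<in> range In0 \<union> range In1" using prestrategy_conf(4)[OF pre\<sigma> xy(1)] that by blast
    then have "lab \<sigma> s = lab \<sigma> t" using e t(2) by auto
    then show False using inj_onD[OF prestrategy_conf(1)[OF pre\<sigma> t(3)], of s t] that t by auto
  qed
  have "rank2 \<tau> \<sigma> (insert t x) y (\<rho>(?l := N))"
    unfolding rank2_def
  proof (intro conjI ballI impI)
    fix s s' assume "s \<in> y" "s' \<in> y" "(s, s') \<in> Leq (st \<tau>)" "s \<noteq> s'"
    then show "(\<rho>(?l := N)) (In1 (lab \<tau> s)) < (\<rho>(?l := N)) (In1 (lab \<tau> s'))"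
      using \<rho> by (simp add: rank2_def)
  next
    fix s s' assume s: "s \<in> insert t x" "s' \<in> insert t x" "(s, s') \<in> Leq (st \<sigma>)" "s \<noteq> s'"
    show "(\<rho>(?l := N)) (lloc (lab \<sigma> s)) < (\<rho>(?l := N)) (lloc (lab \<sigma> s'))"
    proof (cases "s' = t")
      case True
      then have "s \<in> x" using s by blast
      then show ?thesis using True t(2) n2[of s] N by simp
    next
      case False
      then have "s' \<in> x" using s by blast
      moreover have "s \<in> x" using confD(4)[OF xy(1) \<open>s' \<in> x\<close> s(3)] .
      ultimately show ?thesis using n2 \<rho> s by (simp add: rank2_def)
    qed
  qed
  moreover have "In1 -` lab \<sigma> ` insert t x = In1 -` lab \<sigma> ` x" using t(2) by auto
  then have "match2 \<tau> \<sigma> (insert t x) y" using m t by (simp add: match2_def)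
  ultimately show ?thesis by (auto simp: sync2_def)
qed

lemma vl_vimage [simp]: "In0 -` vl \<tau> \<sigma> x y = In0 -` lab \<sigma> ` x" "In1 -` vl \<tau> \<sigma> x y = In1 -` lab \<tau> ` y"
  unfolding vl_def by auto

lemma courteous_receptive_comp_right:
  assumes g: "courteous_receptive (range In1) \<tau>" shows "courteous_receptive (range In1) (\<tau> \<odot>\<^sub>s \<sigma>)"
proof (rule courteous_receptive_transfer[OF comp_prestrategy pre\<tau>, where C = "\<lambda>y x. sync2 \<tau> \<sigma> x y" and V = "\<lambda>y x. vis \<tau> \<sigma> x y", OF _ _ _ _ _ _ _ _ _ _ _ g])
  fix y x assume c: "sync2 \<tau> \<sigma> x y"
  note m = sync2_match[OF c]
  have xy: "x \<in> conf (st \<sigma>)" "y \<in> conf (st \<tau>)" using m by (auto simp: match2_def)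
  have l: "lab (\<tau> \<odot>\<^sub>s \<sigma>) ` vis \<tau> \<sigma> x y = vl \<tau> \<sigma> x y" using comp_lab_vis[OF c] by (simp add: comp_simps)
  show "vis \<tau> \<sigma> x y \<in> conf (st (\<tau> \<odot>\<^sub>s \<sigma>))" by (rule vis_conf[OF c])
  show "y \<in> conf (st \<tau>)" by (rule xy(2))
  show "In1 -` lab (\<tau> \<odot>\<^sub>s \<sigma>) ` vis \<tau> \<sigma> x y = In1 -` lab \<tau> ` y" by (simp add: l)
  have B: "In0 -` lab \<tau> ` y \<in> conf (src \<tau>)" by (rule prestrategy_conf(2)[OF pre\<tau> xy(2)])
  note R = prestrategy_conf(4)[OF pre\<tau> xy(2)]
  fix d :: "'u ev"
  have v: "In0 -` (X - {In1 d}) = In0 -` X" "In1 -` (X - {In1 d}) = In1 -` X - {d}"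
    "In0 -` insert (In1 d) X = In0 -` X" "In1 -` insert (In1 d) X = insert d (In1 -` X)" for X by auto
  show "lab \<tau> ` y - {In1 d} \<in> conf (game_of \<tau>)" if "lab (\<tau> \<odot>\<^sub>s \<sigma>) ` vis \<tau> \<sigma> x y - {In1 d} \<in> conf (game_of (\<tau> \<odot>\<^sub>s \<sigma>))"
    using that B R unfolding l par_game_simps conf_par v by (auto simp: comp_simps)
  show "insert (In1 d) (lab \<tau> ` y) \<in> conf (game_of \<tau>)"
    if "insert (In1 d) (lab (\<tau> \<odot>\<^sub>s \<sigma>) ` vis \<tau> \<sigma> x y) \<in> conf (game_of (\<tau> \<odot>\<^sub>s \<sigma>))"
    using that B R unfolding l par_game_simps conf_par v by (auto simp: comp_simps)
  fix t assume t: "lab \<tau> t = In1 d"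
  show "sync2 \<tau> \<sigma> x (y - {t})" if "t \<in> y" "y - {t} \<in> conf (st \<tau>)"
  proof (rule sync2_sub[OF c])
    have "In0 -` lab \<tau> ` y = In0 -` lab \<tau> ` (y - {t})" using t by auto (metis Diff_iff ev.distinct(7) image_eqI singletonD)
    then show "match2 \<tau> \<sigma> x (y - {t})" using m that by (simp add: match2_def)
  qed auto
  show "sync2 \<tau> \<sigma> x (insert t y)" if "t \<notin> y" "insert t y \<in> conf (st \<tau>)" by (rule sync2_ext_right[OF c that(1) t that(2)])
  show "lab (\<tau> \<odot>\<^sub>s \<sigma>) ` vis \<tau> \<sigma> x (insert t y) = insert (In1 d) (lab (\<tau> \<odot>\<^sub>s \<sigma>) ` vis \<tau> \<sigma> x y)"
    if "sync2 \<tau> \<sigma> x (insert t y)"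
    unfolding l using comp_lab_vis[OF that] t by (simp add: comp_simps vl_def v)
next
  fix z assume "z \<in> conf (st (\<tau> \<odot>\<^sub>s \<sigma>))"
  then show "\<exists>k r. sync2 \<tau> \<sigma> r k \<and> vis \<tau> \<sigma> r k = z \<and> (\<forall>k' r'. sync2 \<tau> \<sigma> r' k' \<longrightarrow> z \<subseteq> vis \<tau> \<sigma> r' k' \<longrightarrow> k \<subseteq> k' \<and> r \<subseteq> r')"
    using least_sync2[of z] by blast
next
  fix k r k' r' :: "'u ev set" assume "k \<subseteq> k'" "r \<subseteq> r'"
  then show "vis \<tau> \<sigma> r k \<subseteq> vis \<tau> \<sigma> r' k'" by (intro vis_mono)
next
  fix d assume "In1 d \<in> Ev (game_of (\<tau> \<odot>\<^sub>s \<sigma>))"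
  then have "d \<in> Ev (trg \<tau>)" by (auto simp: par_simps comp_simps)
  then show "pol (game_of \<tau>) (In1 d) = pol (game_of (\<tau> \<odot>\<^sub>s \<sigma>)) (In1 d)" by (simp add: comp_simps)
qed

lemma courteous_receptive_comp_left:
  assumes g: "courteous_receptive (range In0) \<sigma>" shows "courteous_receptive (range In0) (\<tau> \<odot>\<^sub>s \<sigma>)"
proof (rule courteous_receptive_transfer[OF comp_prestrategy pre\<sigma>, where C = "\<lambda>x y. sync2 \<tau> \<sigma> x y" and V = "\<lambda>x y. vis \<tau> \<sigma> x y", OF _ _ _ _ _ _ _ _ _ _ _ g])
  fix y x assume c: "sync2 \<tau> \<sigma> x y"
  note m = sync2_match[OF c]
  have xy: "x \<in> conf (st \<sigma>)" "y \<in> conf (st \<tau>)" using m by (auto simp: match2_def)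
  have l: "lab (\<tau> \<odot>\<^sub>s \<sigma>) ` vis \<tau> \<sigma> x y = vl \<tau> \<sigma> x y" using comp_lab_vis[OF c] by (simp add: comp_simps)
  show "vis \<tau> \<sigma> x y \<in> conf (st (\<tau> \<odot>\<^sub>s \<sigma>))" by (rule vis_conf[OF c])
  show "x \<in> conf (st \<sigma>)" by (rule xy(1))
  show "In0 -` lab (\<tau> \<odot>\<^sub>s \<sigma>) ` vis \<tau> \<sigma> x y = In0 -` lab \<sigma> ` x" by (simp add: l)
  have B: "In1 -` lab \<sigma> ` x \<in> conf (trg \<sigma>)" by (rule prestrategy_conf(3)[OF pre\<sigma> xy(1)])
  note R = prestrategy_conf(4)[OF pre\<sigma> xy(1)]
  fix d :: "'u ev"
  have v: "In1 -` (X - {In0 d}) = In1 -` X" "In0 -` (X - {In0 d}) = In0 -` X - {d}"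
    "In1 -` insert (In0 d) X = In1 -` X" "In0 -` insert (In0 d) X = insert d (In0 -` X)" for X by auto
  show "lab \<sigma> ` x - {In0 d} \<in> conf (game_of \<sigma>)" if "lab (\<tau> \<odot>\<^sub>s \<sigma>) ` vis \<tau> \<sigma> x y - {In0 d} \<in> conf (game_of (\<tau> \<odot>\<^sub>s \<sigma>))"
    using that B R unfolding l par_game_simps conf_par v by (auto simp: comp_simps)
  show "insert (In0 d) (lab \<sigma> ` x) \<in> conf (game_of \<sigma>)"
    if "insert (In0 d) (lab (\<tau> \<odot>\<^sub>s \<sigma>) ` vis \<tau> \<sigma> x y) \<in> conf (game_of (\<tau> \<odot>\<^sub>s \<sigma>))"
    using that B R unfolding l par_game_simps conf_par v by (auto simp: comp_simps)
  fix t assume t: "lab \<sigma> t = In0 d"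
  show "sync2 \<tau> \<sigma> (x - {t}) y" if "t \<in> x" "x - {t} \<in> conf (st \<sigma>)"
  proof (rule sync2_sub[OF c])
    have "In1 -` lab \<sigma> ` x = In1 -` lab \<sigma> ` (x - {t})" using t by auto (metis Diff_iff ev.distinct(7) image_eqI singletonD)
    then show "match2 \<tau> \<sigma> (x - {t}) y" using m that by (simp add: match2_def)
  qed auto
  show "sync2 \<tau> \<sigma> (insert t x) y" if "t \<notin> x" "insert t x \<in> conf (st \<sigma>)" by (rule sync2_ext_left[OF c that(1) t that(2)])
  show "lab (\<tau> \<odot>\<^sub>s \<sigma>) ` vis \<tau> \<sigma> (insert t x) y = insert (In0 d) (lab (\<tau> \<odot>\<^sub>s \<sigma>) ` vis \<tau> \<sigma> x y)"
    if "sync2 \<tau> \<sigma> (insert t x) y"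
    unfolding l using comp_lab_vis[OF that] t by (simp add: comp_simps vl_def v)
next
  fix z assume "z \<in> conf (st (\<tau> \<odot>\<^sub>s \<sigma>))"
  then show "\<exists>k r. sync2 \<tau> \<sigma> k r \<and> vis \<tau> \<sigma> k r = z \<and> (\<forall>k' r'. sync2 \<tau> \<sigma> k' r' \<longrightarrow> z \<subseteq> vis \<tau> \<sigma> k' r' \<longrightarrow> k \<subseteq> k' \<and> r \<subseteq> r')"
    using least_sync2[of z] by blast
next
  fix k r k' r' :: "'u ev set" assume "k \<subseteq> k'" "r \<subseteq> r'"
  then show "vis \<tau> \<sigma> k r \<subseteq> vis \<tau> \<sigma> k' r'" by (intro vis_mono)
next
  fix d assume "In0 d \<in> Ev (game_of (\<tau> \<odot>\<^sub>s \<sigma>))"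
  then have "d \<in> Ev (src \<sigma>)" by (auto simp: par_simps comp_simps)
  then show "pol (game_of \<sigma>) (In0 d) = pol (game_of (\<tau> \<odot>\<^sub>s \<sigma>)) (In0 d)" by (simp add: comp_simps)
qed

end

section \<open>Strategies lift the Scott order\<close>

text \<open>\<open>L\<close> is below \<open>M\<close> in the Scott order: to get from
  \<open>M\<close> down to \<open>L\<close>, positive moves are withdrawn and negative ones are
  added.\<close>

definition scott :: "'u game \<Rightarrow> 'u ev set \<Rightarrow> 'u ev set \<Rightarrow> bool" where
  "scott G L M \<longleftrightarrow> (\<forall>g\<in>L - M. pol G g = Neg) \<and> (\<forall>g\<in>M - L. pol G g = Pos)"

definition is_lift :: "'u prestrat \<Rightarrow> 'u ev set \<Rightarrow> 'u ev set \<Rightarrow> 'u ev set \<Rightarrow> bool" where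
  "is_lift \<sigma> x L x' \<longleftrightarrow> x' \<in> conf (st \<sigma>) \<and> lab \<sigma> ` x' = L \<and>
     (\<forall>s\<in>x' - x. pol (game_of \<sigma>) (lab \<sigma> s) = Neg) \<and> (\<forall>s\<in>x - x'. pol (game_of \<sigma>) (lab \<sigma> s) = Pos)"

definition lift :: "'u prestrat \<Rightarrow> 'u ev set \<Rightarrow> 'u ev set \<Rightarrow> 'u ev set" where
  "lift \<sigma> x L = (THE x'. is_lift \<sigma> x L x')"

lemma copair_simps [simp]: "copair f g (In0 a) = f a" "copair f g (In1 a) = g a"
  by (simp_all add: copair_def)

text \<open>A common label played by different events in \<open>x\<close> and \<open>x'\<close>
  would belong to a removed event and to an added one, hence be both positive and negative.\<close>

lemma is_lift_Int:
  assumes "is_lift \<sigma> x L x'" shows "lab \<sigma> ` (x \<inter> x') = lab \<sigma> ` x \<inter> L"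
proof
  show "lab \<sigma> ` (x \<inter> x') \<subseteq> lab \<sigma> ` x \<inter> L" using assms by (auto simp: is_lift_def)
  show "lab \<sigma> ` x \<inter> L \<subseteq> lab \<sigma> ` (x \<inter> x')"
  proof
    fix g assume "g \<in> lab \<sigma> ` x \<inter> L"
    then have "g \<in> lab \<sigma> ` x" "g \<in> lab \<sigma> ` x'" using assms by (auto simp: is_lift_def)
    then obtain s s' where s: "s \<in> x" "g = lab \<sigma> s" "s' \<in> x'" "g = lab \<sigma> s'" by blast
    have "s \<in> x' \<or> s' \<in> x"
    proof (rule ccontr)
      assume "\<not> (s \<in> x' \<or> s' \<in> x)"
      then have "s \<in> x - x'" "s' \<in> x' - x" using s by auto
      then have "pol (game_of \<sigma>) (lab \<sigma> s) = Pos" "pol (game_of \<sigma>) (lab \<sigma> s') = Neg"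
        using assms unfolding is_lift_def by blast+
      then show False using s(2,4) by simp
    qed
    then show "g \<in> lab \<sigma> ` (x \<inter> x')" using s by blast
  qed
qed

text \<open>The common part \<open>x \<inter> x'\<close> is contained in \<open>x1'\<close>, and
  \<open>x'\<close> arises from it by negative events. Each of these is matched in
  \<open>x1'\<close> by an event with the same label, which courtesy makes available at the same
  stage; uniqueness in receptivity identifies the two. Uniqueness of lifts is the case of equal
  data.\<close>

lemma is_lift_mono:
  assumes p: "prestrategy \<sigma>" and gd: "courteous_receptive UNIV \<sigma>" and x: "x \<in> conf (st \<sigma>)" "x1 \<in> conf (st \<sigma>)" "x \<subseteq> x1" "L \<subseteq> L1"
    and l: "is_lift \<sigma> x L x'" "is_lift \<sigma> x1 L1 x1'"
  shows "x' \<subseteq> x1'"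
proof -
  note g = courteous_receptive_onD[OF gd[unfolded courteous_receptive_def]] and E = prestrategyD(3)[OF p]
  have x': "x' \<in> conf (st \<sigma>)" "x1' \<in> conf (st \<sigma>)" using l by (auto simp: is_lift_def)
  have i: "x \<inter> x' \<in> conf (st \<sigma>)" by (rule conf_Int[OF E x(1) x'(1)])
  have base: "x \<inter> x' \<subseteq> x1'"
  proof
    fix s assume s: "s \<in> x \<inter> x'"
    then have "lab \<sigma> s \<in> lab \<sigma> ` x1 \<inter> L1" using l x(3,4) by (auto simp: is_lift_def)
    then have "lab \<sigma> s \<in> lab \<sigma> ` (x1 \<inter> x1')" unfolding is_lift_Int[OF l(2)] .
    then obtain s' where "s' \<in> x1 \<inter> x1'" "lab \<sigma> s' = lab \<sigma> s" by auto
    then show "s \<in> x1'" using inj_onD[OF prestrategy_conf(1)[OF p x(2)], of s' s] s x(3) by auto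
  qed
  show ?thesis
  proof (rule conf_chain_induct[OF E i x'(1), where P = "\<lambda>u. u \<subseteq> x1'"])
    show "x \<inter> x' \<subseteq> x'" by simp
    show "x \<inter> x' \<subseteq> x1'" by (rule base)
    fix u s assume u: "u \<in> conf (st \<sigma>)" "x \<inter> x' \<subseteq> u" "s \<notin> u" "insert s u \<in> conf (st \<sigma>)" "insert s u \<subseteq> x'" "u \<subseteq> x1'"
    have s: "s \<in> x' - x" using u by blast
    then have neg: "pol (game_of \<sigma>) (lab \<sigma> s) = Neg" using l(1) by (simp add: is_lift_def)
    have "lab \<sigma> s \<in> lab \<sigma> ` x1'" using l s x(4) unfolding is_lift_def by blast
    then obtain s1 where s1: "s1 \<in> x1'" "lab \<sigma> s1 = lab \<sigma> s" by auto
    have "insert (lab \<sigma> s1) (lab \<sigma> ` u) \<in> conf (game_of \<sigma>)"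
      using es_mapD(2)[OF prestrategyD(7)[OF p] u(4)] s1(2) by simp
    then have c: "insert s1 u \<in> conf (st \<sigma>)" using g(2)[OF u(1) x'(2) u(6) s1(1)] neg s1(2) by simp
    have n: "s1 \<notin> u"
    proof
      assume "s1 \<in> u"
      then show False using inj_onD[OF prestrategy_conf(1)[OF p u(4)], of s1 s] s1(2) u(3) by auto
    qed
    have "s = s1" by (rule g(4)[OF u(1) u(4) c u(3) n s1(2)[symmetric] UNIV_I neg])
    then show "insert s u \<subseteq> x1'" using s1(1) u(6) by simp
  qed
qed

lemma lift_remove:
  assumes p: "prestrategy \<sigma>" and gd: "courteous_receptive UNIV \<sigma>" and L: "L \<in> conf (game_of \<sigma>)"
  shows "x \<in> conf (st \<sigma>) \<Longrightarrow> \<forall>g\<in>lab \<sigma> ` x - L. pol (game_of \<sigma>) g = Pos \<Longrightarrow> {s \<in> x. lab \<sigma> s \<in> L} \<in> conf (st \<sigma>)"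
proof (induction "card (lab \<sigma> ` x - L)" arbitrary: x)
  case 0
  have "finite (lab \<sigma> ` x - L)" using confD(1)[OF 0(2)] by simp
  then have "lab \<sigma> ` x - L = {}" using 0(1) by simp
  then have "{s \<in> x. lab \<sigma> s \<in> L} = x" by blast
  then show ?case using 0 by simp
next
  case (Suc n)
  note g = courteous_receptive_onD[OF gd[unfolded courteous_receptive_def]]
  have G: "is_es (game_of \<sigma>)" using prestrategyD(1,2)[OF p] by (simp add: par_es)
  have fin: "finite (lab \<sigma> ` x - L)" using confD(1)[OF Suc(3)] by simp
  have ne: "lab \<sigma> ` x - L \<noteq> {}"
  proof
    assume "lab \<sigma> ` x - L = {}" then show False using Suc(2) by (metis card.empty nat.distinct(1))
  qed
  \<comment> \<open>Any label above \<open>h\<close> has larger rank, so it lies in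
    \<open>L\<close>; then \<open>h\<close> would lie in \<open>L\<close> too.\<close>
  obtain h where h: "h \<in> lab \<sigma> ` x - L" "\<And>h'. h' \<in> lab \<sigma> ` x - L \<Longrightarrow> rk (game_of \<sigma>) h' \<le> rk (game_of \<sigma>) h"
  proof -
    let ?R = "rk (game_of \<sigma>) ` (lab \<sigma> ` x - L)"
    have R: "finite ?R" "?R \<noteq> {}" using fin ne by auto
    obtain h where h: "h \<in> lab \<sigma> ` x - L" "Max ?R = rk (game_of \<sigma>) h" using Max_in[OF R] by (elim imageE)
    have "rk (game_of \<sigma>) h' \<le> rk (game_of \<sigma>) h" if "h' \<in> lab \<sigma> ` x - L" for h'
      using Max_ge[OF R(1) imageI[OF that]] h(2) by simp
    then show ?thesis using that h(1) by blast
  qed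
  obtain s where s: "s \<in> x" "lab \<sigma> s = h" using h(1) by auto
  have lx: "lab \<sigma> ` x \<in> conf (game_of \<sigma>)" by (rule es_mapD(2)[OF prestrategyD(7)[OF p] Suc(3)])
  have "lab \<sigma> ` x - {h} \<in> conf (game_of \<sigma>)"
  proof (rule conf_remove[OF G lx])
    fix h' assume h': "h' \<in> lab \<sigma> ` x" "(h, h') \<in> Leq (game_of \<sigma>)"
    show "h' = h"
    proof (rule ccontr)
      assume "h' \<noteq> h"
      then have "rk (game_of \<sigma>) h < rk (game_of \<sigma>) h'" using rk_less[OF G h'(2)] by simp
      then have "h' \<in> L" using h(2)[of h'] h'(1) by fastforce
      then have "h \<in> L" using confD(4)[OF L] h'(2) by blast
      then show False using h(1) by simp
    qed
  qed
  then have xs: "x - {s} \<in> conf (st \<sigma>)" using g(1)[OF Suc(3) s(1)] s(2) Suc(4) h(1) by simp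
  have "lab \<sigma> ` (x - {s}) = lab \<sigma> ` x - {h}"
    using inj_on_image_set_diff[OF prestrategy_conf(1)[OF p Suc(3)], of x "{s}"] s by auto
  then have im: "lab \<sigma> ` (x - {s}) - L = (lab \<sigma> ` x - L) - {h}" by blast
  then have "card (lab \<sigma> ` (x - {s}) - L) = n" using Suc(2) h(1) fin by simp
  then have "{s' \<in> x - {s}. lab \<sigma> s' \<in> L} \<in> conf (st \<sigma>)" using Suc(1)[of "x - {s}"] xs im Suc(4) by simp
  moreover have "{s' \<in> x - {s}. lab \<sigma> s' \<in> L} = {s' \<in> x. lab \<sigma> s' \<in> L}" using s(2) h(1) by blast
  ultimately show ?case by simp
qed

lemma is_lift_ex:
  assumes p: "prestrategy \<sigma>" and gd: "courteous_receptive UNIV \<sigma>" and x: "x \<in> conf (st \<sigma>)"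
    and L: "L \<in> conf (game_of \<sigma>)" and sc: "scott (game_of \<sigma>) L (lab \<sigma> ` x)"
  shows "\<exists>x'. is_lift \<sigma> x L x'"
proof -
  note g = courteous_receptive_onD[OF gd[unfolded courteous_receptive_def]]
  have G: "is_es (game_of \<sigma>)" using prestrategyD(1,2)[OF p] by (simp add: par_es)
  \<comment> \<open>What remains after withdrawing the positive moves outside \<open>L\<close>; the
    missing negative moves are then restored along a chain in the game, by receptivity.\<close>
  define u where "u = {s \<in> x. lab \<sigma> s \<in> L}"
  have u: "u \<in> conf (st \<sigma>)" unfolding u_def using lift_remove[OF p gd L x] sc by (simp add: scott_def)
  have lu: "lab \<sigma> ` u \<in> conf (game_of \<sigma>)" by (rule es_mapD(2)[OF prestrategyD(7)[OF p] u])
  have lu': "lab \<sigma> ` u = lab \<sigma> ` x \<inter> L" by (auto simp: u_def)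
  have "\<exists>v. u \<subseteq> v \<and> v \<in> conf (st \<sigma>) \<and> lab \<sigma> ` v = L \<and> (\<forall>s\<in>v - u. pol (game_of \<sigma>) (lab \<sigma> s) = Neg)"
  proof (rule conf_chain_induct[OF G lu L, where P = "\<lambda>M. \<exists>v. u \<subseteq> v \<and> v \<in> conf (st \<sigma>) \<and> lab \<sigma> ` v = M \<and>
      (\<forall>s\<in>v - u. pol (game_of \<sigma>) (lab \<sigma> s) = Neg)"])
    show "lab \<sigma> ` u \<subseteq> L" using lu' by blast
    show "\<exists>v. u \<subseteq> v \<and> v \<in> conf (st \<sigma>) \<and> lab \<sigma> ` v = lab \<sigma> ` u \<and> (\<forall>s\<in>v - u. pol (game_of \<sigma>) (lab \<sigma> s) = Neg)"
      using u by blast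
    fix M h assume M: "M \<in> conf (game_of \<sigma>)" "lab \<sigma> ` u \<subseteq> M" "h \<notin> M" "insert h M \<in> conf (game_of \<sigma>)" "insert h M \<subseteq> L"
      and "\<exists>v. u \<subseteq> v \<and> v \<in> conf (st \<sigma>) \<and> lab \<sigma> ` v = M \<and> (\<forall>s\<in>v - u. pol (game_of \<sigma>) (lab \<sigma> s) = Neg)"
    then obtain v where v: "u \<subseteq> v" "v \<in> conf (st \<sigma>)" "lab \<sigma> ` v = M" "\<forall>s\<in>v - u. pol (game_of \<sigma>) (lab \<sigma> s) = Neg" by blast
    have "h \<in> L" using M(5) by blast
    moreover have "h \<notin> lab \<sigma> ` x"
    proof
      assume "h \<in> lab \<sigma> ` x"
      then have "h \<in> lab \<sigma> ` u" using \<open>h \<in> L\<close> lu' by blast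
      then show False using M(2,3) by blast
    qed
    ultimately have "h \<in> L - lab \<sigma> ` x" by blast
    then have neg: "pol (game_of \<sigma>) h = Neg" using sc by (simp add: scott_def)
    then obtain s where "lab \<sigma> s = h" "insert s v \<in> conf (st \<sigma>)" using g(3)[OF v(2), of h] M(3,4) v(3) by blast
    then show "\<exists>v. u \<subseteq> v \<and> v \<in> conf (st \<sigma>) \<and> lab \<sigma> ` v = insert h M \<and> (\<forall>s\<in>v - u. pol (game_of \<sigma>) (lab \<sigma> s) = Neg)"
      using v neg by (intro exI[of _ "insert s v"]) auto
  qed
  then obtain v where v: "u \<subseteq> v" "v \<in> conf (st \<sigma>)" "lab \<sigma> ` v = L" "\<forall>s\<in>v - u. pol (game_of \<sigma>) (lab \<sigma> s) = Neg" by blast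
  have "is_lift \<sigma> x L v"
    unfolding is_lift_def
  proof (intro conjI ballI)
    fix s assume "s \<in> v - x"
    then show "pol (game_of \<sigma>) (lab \<sigma> s) = Neg" using v(4) by (auto simp: u_def)
  next
    fix s assume "s \<in> x - v"
    then have "lab \<sigma> s \<in> lab \<sigma> ` x - L" using v(1) by (auto simp: u_def)
    then show "pol (game_of \<sigma>) (lab \<sigma> s) = Pos" using sc by (simp add: scott_def)
  qed (use v in auto)
  then show ?thesis by blast
qed

lemma is_lift_unique:
  assumes p: "prestrategy \<sigma>" and gd: "courteous_receptive UNIV \<sigma>" and x: "x \<in> conf (st \<sigma>)"
    and l: "is_lift \<sigma> x L x'" "is_lift \<sigma> x L x''"
  shows "x' = x''"
  using is_lift_mono[OF p gd x x order_refl order_refl l] is_lift_mono[OF p gd x x order_refl order_refl l(2,1)]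
  by (rule subset_antisym)

lemma lift_eqI:
  assumes p: "prestrategy \<sigma>" and gd: "courteous_receptive UNIV \<sigma>" and x: "x \<in> conf (st \<sigma>)" and l: "is_lift \<sigma> x L x'"
  shows "lift \<sigma> x L = x'"
  unfolding lift_def
proof (rule the_equality)
  show "is_lift \<sigma> x L x'" by (rule l)
  show "x'' = x'" if "is_lift \<sigma> x L x''" for x'' by (rule is_lift_unique[OF p gd x that l])
qed

lemma is_lift_refl: "x \<in> conf (st \<sigma>) \<Longrightarrow> is_lift \<sigma> x (lab \<sigma> ` x) x"
  by (simp add: is_lift_def)

text \<open>Being a lift is expressed by labels and polarities, which 2-cells preserve. Naturality
  of the unitors rests on this.\<close>

lemma is_lift_image:
  assumes f: "f \<in> two_cells \<sigma> \<sigma>'" and l: "is_lift \<sigma> x L x'" and x: "x \<in> conf (st \<sigma>)"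
  shows "is_lift \<sigma>' (cfun f ` x) L (cfun f ` x')"
proof -
  have x': "x' \<in> conf (st \<sigma>)" using l by (simp add: is_lift_def)
  have G: "game_of \<sigma>' = game_of \<sigma>" using two_cellsD(3,4)[OF f] by simp
  have lb: "lab \<sigma>' (cfun f s) = lab \<sigma> s" if "s \<in> x \<union> x'" for s
    using two_cellsD(6)[OF f, of s] confD(2)[OF x] confD(2)[OF x'] that by blast
  show ?thesis
    unfolding is_lift_def G
  proof (intro conjI ballI)
    show "cfun f ` x' \<in> conf (st \<sigma>')" by (rule two_cell_conf[OF f x'])
    show "lab \<sigma>' ` cfun f ` x' = L" using two_cell_lab[OF f x'] l by (simp add: is_lift_def)
    fix t assume "t \<in> cfun f ` x' - cfun f ` x"
    then obtain s where "s \<in> x' - x" "t = cfun f s" by blast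
    then show "pol (game_of \<sigma>) (lab \<sigma>' t) = Neg" using l lb[of s] by (simp add: is_lift_def)
  next
    fix t assume "t \<in> cfun f ` x - cfun f ` x'"
    then obtain s where "s \<in> x - x'" "t = cfun f s" by blast
    then show "pol (game_of \<sigma>) (lab \<sigma>' t) = Pos" using l lb[of s] by (simp add: is_lift_def)
  qed
qed

section \<open>The unitors\<close>

text \<open>
  \<open>V k r\<close> is the configuration of a composite of \<open>\<sigma>\<close> and copycat given by a configuration \<open>k\<close> of \<open>\<sigma>\<close>
  and \<open>r\<close> of copycat. Its visible labels are below those of \<open>k\<close> in the Scott order, and it is sent to
  the corresponding lift of \<open>k\<close>; conversely \<open>\<kappa> x\<close> is the configuration of copycat in which both sides
  agree with \<open>x\<close>.
\<close>

lemma unit_iso: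
  fixes C :: "'u ev set \<Rightarrow> 'u ev set \<Rightarrow> bool"
  assumes H: "prestrategy H" and p: "prestrategy \<sigma>" and eq: "src H = src \<sigma>" "trg H = trg \<sigma>" and gd: "courteous_receptive UNIV \<sigma>"
    and cf: "\<And>k r. C k r \<Longrightarrow> V k r \<in> conf (st H)" "\<And>k r. C k r \<Longrightarrow> k \<in> conf (st \<sigma>)"
    and core: "\<And>z. z \<in> conf (st H) \<Longrightarrow> \<exists>k r. C k r \<and> V k r = z \<and> (\<forall>k' r'. C k' r' \<longrightarrow> z \<subseteq> V k' r' \<longrightarrow> k \<subseteq> k' \<and> r \<subseteq> r')"
    and mono: "\<And>k r k' r'. k \<subseteq> k' \<Longrightarrow> r \<subseteq> r' \<Longrightarrow> V k r \<subseteq> V k' r'"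
    and sc: "\<And>k r. C k r \<Longrightarrow> scott (game_of \<sigma>) (lab H ` V k r) (lab \<sigma> ` k)"
    and \<kappa>: "\<And>x. x \<in> conf (st \<sigma>) \<Longrightarrow> C x (\<kappa> x)" "\<And>x. x \<in> conf (st \<sigma>) \<Longrightarrow> lab H ` V x (\<kappa> x) = lab \<sigma> ` x"
    and \<kappa>m: "\<And>x x'. x \<subseteq> x' \<Longrightarrow> \<kappa> x \<subseteq> \<kappa> x'"
    and meet: "\<And>k r x'. C k r \<Longrightarrow> is_lift \<sigma> k (lab H ` V k r) x' \<Longrightarrow>
      \<exists>m. C (k \<inter> x') m \<and> m \<subseteq> r \<and> m \<subseteq> \<kappa> x' \<and> lab H ` V (k \<inter> x') m = lab H ` V k r"
  shows "\<exists>h. invertible two_cells id_cell vcomp_cell H \<sigma> h \<and>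
    (\<forall>k r. C k r \<longrightarrow> is_lift \<sigma> k (lab H ` V k r) (cfun h ` V k r))"
proof -
  have injH: "inj_on (lab H) z" if "z \<in> conf (st H)" for z by (rule prestrategy_conf(1)[OF H that])
  have lf: "is_lift \<sigma> k (lab H ` V k r) (lift \<sigma> k (lab H ` V k r))" if C: "C k r" for k r
  proof -
    have "lab H ` V k r \<in> conf (game_of \<sigma>)" using es_mapD(2)[OF prestrategyD(7)[OF H] cf(1)[OF C]] eq by simp
    then obtain x' where x': "is_lift \<sigma> k (lab H ` V k r) x'" using is_lift_ex[OF p gd cf(2)[OF C] _ sc[OF C]] by blast
    then show ?thesis using lift_eqI[OF p gd cf(2)[OF C] x'] by simp
  qed
  define P where "P k r = lift \<sigma> k (lab H ` V k r)" for k r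
  have Pc: "P k r \<in> conf (st \<sigma>)" "lab \<sigma> ` P k r = lab H ` V k r" if "C k r" for k r
    using lf[OF that] by (auto simp: P_def is_lift_def)
  have Pm: "P k r \<subseteq> P k' r'" if "C k r" "C k' r'" "k \<subseteq> k'" "V k r \<subseteq> V k' r'" for k r k' r'
    unfolding P_def using is_lift_mono[OF p gd cf(2)[OF that(1)] cf(2)[OF that(2)] that(3) _ lf[OF that(1)] lf[OF that(2)]] that(4) by blast
  \<comment> \<open>The lift depends on the configuration of the composite only, not on the pair
    that presents it.\<close>
  have eqP: "P k r = P k' r'" if "C k r" "C k' r'" "k \<subseteq> k'" "V k r = V k' r'" for k r k' r'
    by (rule conf_eqI_lab[OF prestrategy_conf(1)[OF p Pc(1)[OF that(2)]]])
      (use Pm[OF that(1-3)] Pc(2) that in auto)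
  define K where "K z = (SOME kr. C (fst kr) (snd kr) \<and> V (fst kr) (snd kr) = z \<and>
      (\<forall>k' r'. C k' r' \<longrightarrow> z \<subseteq> V k' r' \<longrightarrow> fst kr \<subseteq> k' \<and> snd kr \<subseteq> r'))" for z
  have K: "C (fst (K z)) (snd (K z))" "V (fst (K z)) (snd (K z)) = z"
    "\<And>k' r'. C k' r' \<Longrightarrow> z \<subseteq> V k' r' \<Longrightarrow> fst (K z) \<subseteq> k' \<and> snd (K z) \<subseteq> r'" if z: "z \<in> conf (st H)" for z
  proof -
    obtain k r where "C k r \<and> V k r = z \<and> (\<forall>k' r'. C k' r' \<longrightarrow> z \<subseteq> V k' r' \<longrightarrow> k \<subseteq> k' \<and> r \<subseteq> r')" using core[OF z] by blast
    then have "\<exists>kr. C (fst kr) (snd kr) \<and> V (fst kr) (snd kr) = z \<and>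
      (\<forall>k' r'. C k' r' \<longrightarrow> z \<subseteq> V k' r' \<longrightarrow> fst kr \<subseteq> k' \<and> snd kr \<subseteq> r')" by (intro exI[of _ "(k, r)"]) simp
    from someI_ex[OF this] show "C (fst (K z)) (snd (K z))" "V (fst (K z)) (snd (K z)) = z"
      "\<And>k' r'. C k' r' \<Longrightarrow> z \<subseteq> V k' r' \<Longrightarrow> fst (K z) \<subseteq> k' \<and> snd (K z) \<subseteq> r'" unfolding K_def by blast+
  qed
  define \<Phi> where "\<Phi> z = P (fst (K z)) (snd (K z))" for z
  have \<Phi>V: "\<Phi> (V k r) = P k r" if C: "C k r" for k r
  proof -
    note z = cf(1)[OF C]
    show ?thesis unfolding \<Phi>_def using eqP[OF K(1)[OF z] C] K(2)[OF z] K(3)[OF z C] by simp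
  qed
  \<comment> \<open>The pair obtained by intersecting with the lift lies below both pairs and shows
    the same labels, so all three present one configuration.\<close>
  have VP: "V (P k r) (\<kappa> (P k r)) = V k r" if C: "C k r" for k r
  proof -
    obtain m where m: "C (k \<inter> P k r) m" "m \<subseteq> r" "m \<subseteq> \<kappa> (P k r)" "lab H ` V (k \<inter> P k r) m = lab H ` V k r"
      using meet[OF C lf[OF C]] unfolding P_def by blast
    have "V (k \<inter> P k r) m = V k r"
      by (rule conf_eqI_lab[OF injH[OF cf(1)[OF C]] mono m(4)]) (use m(2) in auto)
    moreover have "V (k \<inter> P k r) m = V (P k r) (\<kappa> (P k r))"
      by (rule conf_eqI_lab[OF injH[OF cf(1)[OF \<kappa>(1)[OF Pc(1)[OF C]]]] mono])
        (use m Pc(2)[OF C] \<kappa>(2)[OF Pc(1)[OF C]] in auto)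
    ultimately show ?thesis by simp
  qed
  have "\<exists>h. invertible two_cells id_cell vcomp_cell H \<sigma> h \<and> (\<forall>x\<in>conf (st H). cfun h ` x = \<Phi> x)"
  proof (rule iso_cell_from_conf[OF H p eq, where \<Psi> = "\<lambda>x. V x (\<kappa> x)"])
    fix z assume z: "z \<in> conf (st H)"
    show "\<Phi> z \<in> conf (st \<sigma>)" "lab \<sigma> ` \<Phi> z = lab H ` z" using Pc[OF K(1)[OF z]] K(2)[OF z] by (simp_all add: \<Phi>_def)
    show "V (\<Phi> z) (\<kappa> (\<Phi> z)) = z" using VP[OF K(1)[OF z]] K(2)[OF z] by (simp add: \<Phi>_def)
    fix z' assume z': "z' \<in> conf (st H)" "z \<subseteq> z'"
    show "\<Phi> z \<subseteq> \<Phi> z'"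
      unfolding \<Phi>_def using Pm[OF K(1)[OF z] K(1)[OF z'(1)]] K(3)[OF z K(1)[OF z'(1)]] K(2)[OF z] K(2)[OF z'(1)] z'(2) by simp
  next
    fix x assume x: "x \<in> conf (st \<sigma>)"
    show "V x (\<kappa> x) \<in> conf (st H)" by (rule cf(1)[OF \<kappa>(1)[OF x]])
    show "\<Phi> (V x (\<kappa> x)) = x"
      using \<Phi>V[OF \<kappa>(1)[OF x]] lift_eqI[OF p gd x is_lift_refl[OF x]] \<kappa>(2)[OF x] by (simp add: P_def)
    fix x' assume "x' \<in> conf (st \<sigma>)" "x \<subseteq> x'"
    then show "V x (\<kappa> x) \<subseteq> V x' (\<kappa> x')" using mono \<kappa>m by simp
  qed
  then obtain h where h: "invertible two_cells id_cell vcomp_cell H \<sigma> h" "\<forall>x\<in>conf (st H). cfun h ` x = \<Phi> x" by blast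
  have "is_lift \<sigma> k (lab H ` V k r) (cfun h ` V k r)" if "C k r" for k r
    using h(2) cf(1)[OF that] \<Phi>V[OF that] lf[OF that] by (simp add: P_def)
  then show ?thesis using h(1) by blast
qed

section \<open>Schedules against copycat\<close>

definition ev_rank :: "'u prestrat \<Rightarrow> 'u ev set \<Rightarrow> 'u ev \<Rightarrow> nat" where
  "ev_rank \<sigma> x g = rk (st \<sigma>) (THE s. s \<in> x \<and> lab \<sigma> s = g)"

text \<open>Within a configuration the height of events can be transported to labels. It respects
  the order of the game because labels reflect causality.\<close>

lemma ev_rank:
  assumes p: "prestrategy \<sigma>" and x: "x \<in> conf (st \<sigma>)"
  shows "s \<in> x \<Longrightarrow> ev_rank \<sigma> x (lab \<sigma> s) = rk (st \<sigma>) s"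
    "g \<in> lab \<sigma> ` x \<Longrightarrow> g' \<in> lab \<sigma> ` x \<Longrightarrow> (g, g') \<in> Leq (game_of \<sigma>) \<Longrightarrow> g \<noteq> g' \<Longrightarrow> ev_rank \<sigma> x g < ev_rank \<sigma> x g'"
proof -
  have e: "ev_rank \<sigma> x (lab \<sigma> s) = rk (st \<sigma>) s" if s: "s \<in> x" for s
  proof -
    have "(THE s'. s' \<in> x \<and> lab \<sigma> s' = lab \<sigma> s) = s"
    proof (rule the_equality)
      fix s' assume "s' \<in> x \<and> lab \<sigma> s' = lab \<sigma> s"
      then show "s' = s" using inj_onD[OF prestrategy_conf(1)[OF p x], of s' s] s by simp
    qed (use s in simp)
    then show ?thesis by (simp add: ev_rank_def)
  qed
  then show "s \<in> x \<Longrightarrow> ev_rank \<sigma> x (lab \<sigma> s) = rk (st \<sigma>) s" by blast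
  assume g: "g \<in> lab \<sigma> ` x" "g' \<in> lab \<sigma> ` x" "(g, g') \<in> Leq (game_of \<sigma>)" "g \<noteq> g'"
  then obtain s s' where s: "s \<in> x" "s' \<in> x" "g = lab \<sigma> s" "g' = lab \<sigma> s'" by blast
  then have "(s, s') \<in> Leq (st \<sigma>)" using prestrategy_reflect[OF p x, of s s'] g(3) by simp
  moreover have "s \<noteq> s'" using s g(4) by blast
  ultimately show "ev_rank \<sigma> x g < ev_rank \<sigma> x g'" using rk_less[OF prestrategyD(3)[OF p]] e s by simp
qed

definition both :: "'u ev set \<Rightarrow> 'u ev set" where
  "both b = In0 ` b \<union> In1 ` b"

lemma both_vimage [simp]: "In0 -` both b = b" "In1 -` both b = b" "both b \<subseteq> range In0 \<union> range In1"
  unfolding both_def by auto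

lemma both_mem [simp]: "In0 a \<in> both b \<longleftrightarrow> a \<in> b" "In1 a \<in> both b \<longleftrightarrow> a \<in> b"
  unfolding both_def by auto

lemma both_conf: "is_es A \<Longrightarrow> b \<in> conf A \<Longrightarrow> both b \<in> conf (copycat_game A)"
  by (simp add: conf_copycat conf_par)

text \<open>
  The schedule of a configuration against copycat: on each side of copycat the negative copy comes
  just before, the positive one just after the move they are copies of.
\<close>

lemma copycat_rank:
  assumes A: "is_es A" and r: "\<And>a b. a \<in> X \<Longrightarrow> b \<in> X \<Longrightarrow> (a, b) \<in> Leq A \<Longrightarrow> a \<noteq> b \<Longrightarrow> r a < (r b :: nat)"
    and e: "e \<in> both X" "e' \<in> both X" "(e, e') \<in> copycat_leq A" "e \<noteq> e'"
  shows "copair (\<lambda>a. 3 * r a + 1) (\<lambda>a. 3 * r a + (if pol A a = Pos then 2 else 0)) e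
      < copair (\<lambda>a. 3 * r a + 1) (\<lambda>a. 3 * r a + (if pol A a = Pos then 2 else 0)) e'"
    "copair (\<lambda>a. 3 * r a + (if pol A a = Neg then 2 else 0)) (\<lambda>a. 3 * r a + 1) e
      < copair (\<lambda>a. 3 * r a + (if pol A a = Neg then 2 else 0)) (\<lambda>a. 3 * r a + 1) e'"
proof -
  have le: "a = b \<or> r a < r b" if "a \<in> X" "b \<in> X" "(a, b) \<in> Leq A" for a b using r that by blast
  from e(3) consider a b where "e = In0 a" "e' = In0 b" "(a, b) \<in> Leq A"
    | a b where "e = In1 a" "e' = In1 b" "(a, b) \<in> Leq A"
    | a b where "e = In0 a" "e' = In1 b" "(a, b) \<in> Leq A" "a = b \<longrightarrow> pol A b = Pos"
    | a b where "e = In1 a" "e' = In0 b" "(a, b) \<in> Leq A" "a = b \<longrightarrow> pol A b = Neg"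
  proof -
    \<comment> \<open>A crossing between copies of different moves is strict in the game, where the
      factor 3 leaves room for any offset; between copies of one move the offset decides, and there
      the crossing point is the move itself.\<close>
    have mid: "(a, b) \<in> Leq A \<and> (a = b \<longrightarrow> c = b)" if "(a, c) \<in> Leq A" "(c, b) \<in> Leq A" for a b c
      using es_trans[OF A that] es_antisym[OF A] that by blast
    from e(3)[unfolded copycat_leq_iff[OF A]] show ?thesis
      by (elim disjE exE conjE; metis that mid)
  qed
  then have "copair (\<lambda>a. 3 * r a + 1) (\<lambda>a. 3 * r a + (if pol A a = Pos then 2 else 0)) e
      < copair (\<lambda>a. 3 * r a + 1) (\<lambda>a. 3 * r a + (if pol A a = Pos then 2 else 0)) e' \<and>
    copair (\<lambda>a. 3 * r a + (if pol A a = Neg then 2 else 0)) (\<lambda>a. 3 * r a + 1) e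
      < copair (\<lambda>a. 3 * r a + (if pol A a = Neg then 2 else 0)) (\<lambda>a. 3 * r a + 1) e'"
  proof cases
    case 1
    then show ?thesis using le[of a b] e by auto
  next
    case 2
    then show ?thesis using le[of a b] e by auto
  next
    case 3
    then show ?thesis using le[of a b] e by auto
  next
    case 4
    then show ?thesis using le[of a b] e by auto
  qed
  then show "copair (\<lambda>a. 3 * r a + 1) (\<lambda>a. 3 * r a + (if pol A a = Pos then 2 else 0)) e
      < copair (\<lambda>a. 3 * r a + 1) (\<lambda>a. 3 * r a + (if pol A a = Pos then 2 else 0)) e'"
    "copair (\<lambda>a. 3 * r a + (if pol A a = Neg then 2 else 0)) (\<lambda>a. 3 * r a + 1) e
      < copair (\<lambda>a. 3 * r a + (if pol A a = Neg then 2 else 0)) (\<lambda>a. 3 * r a + 1) e'" by blast+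
qed

lemma inter_copycat:
  assumes "prestrategy \<sigma>" shows "inter \<sigma> (copycat (trg \<sigma>))" "inter (copycat (src \<sigma>)) \<sigma>"
  using assms copycat_prestrategy[OF prestrategyD(4)[OF assms]] copycat_prestrategy[OF prestrategyD(5)[OF assms]]
  by (simp_all add: inter_def)

text \<open>\<open>unit_iso\<close> with copycat on the right: its left copy is matched with
  \<open>\<sigma>\<close> over the middle game, and its right copy is what remains visible.\<close>

lemma lunit_ex:
  assumes p: "prestrategy \<sigma>" and gd: "courteous_receptive UNIV \<sigma>"
  defines "\<gamma> \<equiv> copycat (trg \<sigma>)"
  shows "\<exists>h. invertible two_cells id_cell vcomp_cell (\<gamma> \<odot>\<^sub>s \<sigma>) \<sigma> h \<and>
    (\<forall>x y. sync2 \<gamma> \<sigma> x y \<longrightarrow> is_lift \<sigma> x (vl \<gamma> \<sigma> x y) (cfun h ` vis \<gamma> \<sigma> x y))"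
proof -
  interpret inter \<sigma> \<gamma> unfolding \<gamma>_def by (rule inter_copycat(1)[OF p])
  let ?B = "trg \<sigma>"
  have B: "is_es ?B" by (rule prestrategyD(2)[OF p])
  have \<gamma>: "st \<gamma> = copycat_game ?B" by (simp add: \<gamma>_def)
  have lg: "lab \<gamma> ` y = y" if "y \<in> conf (copycat_game ?B)" for y unfolding \<gamma>_def by (rule copycat_lab_conf[OF that])
  have V: "lab (\<gamma> \<odot>\<^sub>s \<sigma>) ` vis \<gamma> \<sigma> x y = vl \<gamma> \<sigma> x y" if "sync2 \<gamma> \<sigma> x y" for x y
    using comp_lab_vis[OF that] by (simp add: comp_simps)
  define \<kappa> where "\<kappa> x = both (In1 -` lab \<sigma> ` x)" for x
  have ccD: "x \<in> conf (st \<sigma>)" "y \<in> conf (copycat_game ?B)" "In1 -` lab \<sigma> ` x = In0 -` y"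
    "vl \<gamma> \<sigma> x y = In0 ` (In0 -` lab \<sigma> ` x) \<union> In1 ` (In1 -` y)" if "sync2 \<gamma> \<sigma> x y" for x y
    using sync2_match[OF that] lg by (auto simp: match2_def \<gamma> vl_def)
  have \<kappa>conf: "\<kappa> x \<in> conf (copycat_game ?B)" if "x \<in> conf (st \<sigma>)" for x
    unfolding \<kappa>_def by (rule both_conf[OF B prestrategy_conf(3)[OF p that]])
  have \<kappa>sync2: "sync2 \<gamma> \<sigma> x (\<kappa> x)" if x: "x \<in> conf (st \<sigma>)" for x
  proof -
    have m: "match2 \<gamma> \<sigma> x (\<kappa> x)" using x \<kappa>conf[OF x] lg[OF \<kappa>conf[OF x]] by (simp add: match2_def \<gamma> \<kappa>_def)
    let ?r = "\<lambda>b. ev_rank \<sigma> x (In1 b)"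
    let ?c = "copair (\<lambda>a. 3 * ?r a + 1) (\<lambda>a. 3 * ?r a + (if pol ?B a = Pos then 2 else 0))"
    \<comment> \<open>Events of \<open>\<sigma>\<close> get ranks congruent to 1 modulo 3, so that
      the outer copy of a move fits immediately before or after the move.\<close>
    define \<rho> where "\<rho> = copair (\<lambda>a. 3 * ev_rank \<sigma> x (In0 a) + 1) ?c"
    have 1: "\<rho> (lloc (lab \<sigma> s)) = 3 * rk (st \<sigma>) s + 1" if "s \<in> x" for s
    proof -
      have "lab \<sigma> s \<in> range In0 \<union> range In1" using prestrategy_conf(4)[OF p x] that by blast
      then have "\<rho> (lloc (lab \<sigma> s)) = 3 * ev_rank \<sigma> x (lab \<sigma> s) + 1" by (auto simp: \<rho>_def)
      then show ?thesis using ev_rank(1)[OF p x that] by simp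
    qed
    have 2: "\<rho> (In1 (lab \<gamma> e)) = ?c e" if "e \<in> \<kappa> x" for e
    proof -
      have "e \<in> Ev (par ?B ?B)" using confD(2)[OF \<kappa>conf[OF x]] that by (auto simp: copycat_game_simps)
      then have "lab \<gamma> e = e" unfolding \<gamma>_def by (rule copycat_lab)
      then show ?thesis by (simp add: \<rho>_def)
    qed
    have r: "?r a < ?r b" if "a \<in> In1 -` lab \<sigma> ` x" "b \<in> In1 -` lab \<sigma> ` x" "(a, b) \<in> Leq ?B" "a \<noteq> b" for a b
      using ev_rank(2)[OF p x, of "In1 a" "In1 b"] that by (simp add: par_simps)
    have "rank2 \<gamma> \<sigma> x (\<kappa> x) \<rho>"
      unfolding rank2_def
    proof (intro conjI ballI impI)
      fix s s' assume "s \<in> x" "s' \<in> x" "(s, s') \<in> Leq (st \<sigma>)" "s \<noteq> s'"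
      then show "\<rho> (lloc (lab \<sigma> s)) < \<rho> (lloc (lab \<sigma> s'))" using 1 rk_less[OF prestrategyD(3)[OF p]] by simp
    next
      fix e e' assume e: "e \<in> \<kappa> x" "e' \<in> \<kappa> x" "(e, e') \<in> Leq (st \<gamma>)" "e \<noteq> e'"
      then have "(e, e') \<in> copycat_leq ?B" by (simp add: \<gamma> copycat_game_simps)
      then show "\<rho> (In1 (lab \<gamma> e)) < \<rho> (In1 (lab \<gamma> e'))"
        using copycat_rank(1)[OF B r e(1)[unfolded \<kappa>_def] e(2)[unfolded \<kappa>_def] _ e(4)] 2 e(1,2) by simp
    qed
    then show ?thesis using m by (auto simp: sync2_def)
  qed
  have "\<exists>h. invertible two_cells id_cell vcomp_cell (\<gamma> \<odot>\<^sub>s \<sigma>) \<sigma> h \<and>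
    (\<forall>k r. sync2 \<gamma> \<sigma> k r \<longrightarrow> is_lift \<sigma> k (lab (\<gamma> \<odot>\<^sub>s \<sigma>) ` vis \<gamma> \<sigma> k r) (cfun h ` vis \<gamma> \<sigma> k r))"
  proof (rule unit_iso[OF comp_prestrategy p _ _ gd, where \<kappa> = \<kappa>])
    show "src (\<gamma> \<odot>\<^sub>s \<sigma>) = src \<sigma>" "trg (\<gamma> \<odot>\<^sub>s \<sigma>) = trg \<sigma>" unfolding comp_simps by (simp_all add: \<gamma>_def)
    fix k r assume c: "sync2 \<gamma> \<sigma> k r"
    note d = ccD[OF c]
    show "vis \<gamma> \<sigma> k r \<in> conf (st (\<gamma> \<odot>\<^sub>s \<sigma>))" by (rule vis_conf[OF c])
    show "k \<in> conf (st \<sigma>)" by (rule d(1))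
    have rE: "b \<in> Ev ?B" if "In0 b \<in> r \<or> In1 b \<in> r" for b
      using confD(2)[OF d(2)] that by (auto simp: copycat_game_simps par_simps)
    have k1: "In1 b \<in> lab \<sigma> ` k \<longleftrightarrow> In0 b \<in> r" for b using d(3) by blast
    note cp = d(2)[unfolded conf_copycat[OF B], THEN conjunct2]
    have np: "q = Pos \<longleftrightarrow> q \<noteq> Neg" for q by (cases q) auto
    have ksp: "g \<in> range In0 \<union> range In1" if "g \<in> lab \<sigma> ` k" for g using prestrategy_conf(4)[OF p d(1)] that by blast
    show "scott (game_of \<sigma>) (lab (\<gamma> \<odot>\<^sub>s \<sigma>) ` vis \<gamma> \<sigma> k r) (lab \<sigma> ` k)"
      unfolding scott_def V[OF c] d(4)
    proof (intro conjI ballI)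
      fix g assume g: "g \<in> In0 ` (In0 -` lab \<sigma> ` k) \<union> In1 ` (In1 -` r) - lab \<sigma> ` k"
      \<comment> \<open>A visible move that \<open>k\<close> lacks is on the right of copycat
        without its left copy. Positive moves on the right wait for that copy, so this one is
        negative; the other inclusion is dual.\<close>
      then obtain b where b: "g = In1 b" "In1 b \<in> r" "In0 b \<notin> r" using k1 by blast
      then have "pol ?B b = Neg" using cp np by blast
      then show "pol (game_of \<sigma>) g = Neg" using b rE[of b] by simp
    next
      fix g assume g: "g \<in> lab \<sigma> ` k - (In0 ` (In0 -` lab \<sigma> ` k) \<union> In1 ` (In1 -` r))"
      have "g \<notin> range In0"
      proof
        assume "g \<in> range In0"
        then have "g \<in> In0 ` (In0 -` lab \<sigma> ` k)" using g by auto
        then show False using g by blast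
      qed
      then obtain b where gb: "g = In1 b" using ksp[of g] g by auto
      then have b: "g = In1 b" "In1 b \<notin> r" "In0 b \<in> r" using g k1[of b] by auto
      then have "pol ?B b = Pos" using cp np by blast
      then show "pol (game_of \<sigma>) g = Pos" using b rE[of b] by simp
    qed
    fix x' assume l: "is_lift \<sigma> k (lab (\<gamma> \<odot>\<^sub>s \<sigma>) ` vis \<gamma> \<sigma> k r) x'"
    have l': "is_lift \<sigma> k (vl \<gamma> \<sigma> k r) x'" using l V[OF c] by simp
    have x': "x' \<in> conf (st \<sigma>)" "lab \<sigma> ` x' = vl \<gamma> \<sigma> k r" using l' by (auto simp: is_lift_def)
    have li: "lab \<sigma> ` (k \<inter> x') = lab \<sigma> ` k \<inter> vl \<gamma> \<sigma> k r" by (rule is_lift_Int[OF l'])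
    \<comment> \<open>Only the moves present on both sides of copycat are kept. This matches
      \<open>k \<inter> x'\<close> and loses only hidden moves or moves no longer claimed by the
      visible label set.\<close>
    let ?m = "r \<inter> \<kappa> x'"
    have mc: "?m \<in> conf (copycat_game ?B)" by (rule conf_Int[OF copycat_es[OF B] d(2) \<kappa>conf[OF x'(1)]])
    have kx: "\<kappa> x' = both (In1 -` r)" unfolding \<kappa>_def x'(2) d(4) by (intro arg_cong[where f = both]) auto
    have v1: "In1 -` lab \<sigma> ` (k \<inter> x') = In0 -` r \<inter> In1 -` r" unfolding li d(4) using k1 by auto
    have v0: "In0 -` lab \<sigma> ` (k \<inter> x') = In0 -` lab \<sigma> ` k" unfolding li d(4) by auto
    have "match2 \<gamma> \<sigma> (k \<inter> x') ?m"
      unfolding match2_def \<gamma> lg[OF mc] v1 using conf_Int[OF prestrategyD(3)[OF p] d(1) x'(1)] mc by (auto simp: kx)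
    then have cm: "sync2 \<gamma> \<sigma> (k \<inter> x') ?m" by (rule sync2_sub[OF c, rotated 2]) auto
    have "vl \<gamma> \<sigma> (k \<inter> x') ?m = vl \<gamma> \<sigma> k r"
      unfolding ccD(4)[OF cm] d(4) v0 by (simp add: kx vimage_Int)
    then show "\<exists>m. sync2 \<gamma> \<sigma> (k \<inter> x') m \<and> m \<subseteq> r \<and> m \<subseteq> \<kappa> x' \<and>
        lab (\<gamma> \<odot>\<^sub>s \<sigma>) ` vis \<gamma> \<sigma> (k \<inter> x') m = lab (\<gamma> \<odot>\<^sub>s \<sigma>) ` vis \<gamma> \<sigma> k r"
      using cm V[OF c] V[OF cm] by (intro exI[of _ ?m]) auto
  next
    fix x assume x: "x \<in> conf (st \<sigma>)"
    show "sync2 \<gamma> \<sigma> x (\<kappa> x)" by (rule \<kappa>sync2[OF x])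
    show "lab (\<gamma> \<odot>\<^sub>s \<sigma>) ` vis \<gamma> \<sigma> x (\<kappa> x) = lab \<sigma> ` x"
      unfolding V[OF \<kappa>sync2[OF x]] ccD(4)[OF \<kappa>sync2[OF x]] using ev_split[OF prestrategy_conf(4)[OF p x]] by (simp add: \<kappa>_def)
  next
    fix x x' :: "'a ev set" assume "x \<subseteq> x'"
    then show "\<kappa> x \<subseteq> \<kappa> x'" unfolding \<kappa>_def both_def by (intro Un_mono image_mono vimage_mono)
  next
    fix z assume "z \<in> conf (st (\<gamma> \<odot>\<^sub>s \<sigma>))"
    then show "\<exists>k r. sync2 \<gamma> \<sigma> k r \<and> vis \<gamma> \<sigma> k r = z \<and> (\<forall>k' r'. sync2 \<gamma> \<sigma> k' r' \<longrightarrow> z \<subseteq> vis \<gamma> \<sigma> k' r' \<longrightarrow> k \<subseteq> k' \<and> r \<subseteq> r')"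
      by (rule least_sync2)
  qed (rule vis_mono)
  then show ?thesis using V by simp
qed

text \<open>Mirror image of \<open>lunit_ex\<close>: copycat is on the left, its right copy is
  matched with \<open>\<sigma>\<close> and its left copy is visible.\<close>

lemma runit_ex:
  assumes p: "prestrategy \<sigma>" and gd: "courteous_receptive UNIV \<sigma>"
  defines "\<gamma> \<equiv> copycat (src \<sigma>)"
  shows "\<exists>h. invertible two_cells id_cell vcomp_cell (\<sigma> \<odot>\<^sub>s \<gamma>) \<sigma> h \<and>
    (\<forall>x y. sync2 \<sigma> \<gamma> x y \<longrightarrow> is_lift \<sigma> y (vl \<sigma> \<gamma> x y) (cfun h ` vis \<sigma> \<gamma> x y))"
proof -
  interpret inter \<gamma> \<sigma> unfolding \<gamma>_def by (rule inter_copycat(2)[OF p])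
  let ?A = "src \<sigma>"
  have A: "is_es ?A" by (rule prestrategyD(1)[OF p])
  have \<gamma>: "st \<gamma> = copycat_game ?A" by (simp add: \<gamma>_def)
  have lg: "lab \<gamma> ` y = y" if "y \<in> conf (copycat_game ?A)" for y unfolding \<gamma>_def by (rule copycat_lab_conf[OF that])
  have V: "lab (\<sigma> \<odot>\<^sub>s \<gamma>) ` vis \<sigma> \<gamma> x y = vl \<sigma> \<gamma> x y" if "sync2 \<sigma> \<gamma> x y" for x y
    using comp_lab_vis[OF that] by (simp add: comp_simps)
  define \<kappa> where "\<kappa> x = both (In0 -` lab \<sigma> ` x)" for x
  have ccD: "y \<in> conf (st \<sigma>)" "x \<in> conf (copycat_game ?A)" "In0 -` lab \<sigma> ` y = In1 -` x"
    "vl \<sigma> \<gamma> x y = In0 ` (In0 -` x) \<union> In1 ` (In1 -` lab \<sigma> ` y)" if "sync2 \<sigma> \<gamma> x y" for x y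
  proof -
    have m: "match2 \<sigma> \<gamma> x y" by (rule sync2_match[OF that])
    then show c: "y \<in> conf (st \<sigma>)" "x \<in> conf (copycat_game ?A)" by (simp_all add: match2_def \<gamma>)
    show "In0 -` lab \<sigma> ` y = In1 -` x" using m lg[OF c(2)] by (simp add: match2_def)
    show "vl \<sigma> \<gamma> x y = In0 ` (In0 -` x) \<union> In1 ` (In1 -` lab \<sigma> ` y)" using lg[OF c(2)] by (simp add: vl_def)
  qed
  have \<kappa>conf: "\<kappa> x \<in> conf (copycat_game ?A)" if "x \<in> conf (st \<sigma>)" for x
    unfolding \<kappa>_def by (rule both_conf[OF A prestrategy_conf(2)[OF p that]])
  have \<kappa>sync2: "sync2 \<sigma> \<gamma> (\<kappa> x) x" if x: "x \<in> conf (st \<sigma>)" for x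
  proof -
    have m: "match2 \<sigma> \<gamma> (\<kappa> x) x" using x \<kappa>conf[OF x] lg[OF \<kappa>conf[OF x]] by (simp add: match2_def \<gamma> \<kappa>_def)
    let ?r = "\<lambda>b. ev_rank \<sigma> x (In0 b)"
    \<comment> \<open>The visible copy is now on the dual side, so the late offset 2 goes to the
      moves that are negative in the source game.\<close>
    let ?below = "\<lambda>a. 3 * ?r a + (if pol ?A a = Neg then 2 else 0)"
    let ?above = "\<lambda>a. 3 * ?r a + 1"
    let ?c = "copair ?below ?above"
    define \<rho> where "\<rho> = copair ?below (copair ?above (\<lambda>a. 3 * ev_rank \<sigma> x (In1 a) + 1))"
    have 1: "\<rho> (In1 (lab \<sigma> s)) = 3 * rk (st \<sigma>) s + 1" if "s \<in> x" for s
    proof -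
      have "lab \<sigma> s \<in> range In0 \<union> range In1" using prestrategy_conf(4)[OF p x] that by blast
      then have "\<rho> (In1 (lab \<sigma> s)) = 3 * ev_rank \<sigma> x (lab \<sigma> s) + 1" by (auto simp: \<rho>_def)
      then show ?thesis using ev_rank(1)[OF p x that] by simp
    qed
    have 2: "\<rho> (lloc (lab \<gamma> e)) = ?c e" if "e \<in> \<kappa> x" for e
    proof -
      have "e \<in> Ev (par ?A ?A)" using confD(2)[OF \<kappa>conf[OF x]] that by (auto simp: copycat_game_simps)
      then have "lab \<gamma> e = e" "e \<in> range In0 \<union> range In1" unfolding \<gamma>_def using copycat_lab[of e ?A] by (auto simp: par_simps)
      then show ?thesis by (auto simp: \<rho>_def)
    qed
    have r: "?r a < ?r b" if "a \<in> In0 -` lab \<sigma> ` x" "b \<in> In0 -` lab \<sigma> ` x" "(a, b) \<in> Leq ?A" "a \<noteq> b" for a b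
      using ev_rank(2)[OF p x, of "In0 a" "In0 b"] that by (simp add: par_simps)
    have "rank2 \<sigma> \<gamma> (\<kappa> x) x \<rho>"
      unfolding rank2_def
    proof (intro conjI ballI impI)
      fix s s' assume "s \<in> x" "s' \<in> x" "(s, s') \<in> Leq (st \<sigma>)" "s \<noteq> s'"
      then show "\<rho> (In1 (lab \<sigma> s)) < \<rho> (In1 (lab \<sigma> s'))" using 1 rk_less[OF prestrategyD(3)[OF p]] by simp
    next
      fix e e' assume e: "e \<in> \<kappa> x" "e' \<in> \<kappa> x" "(e, e') \<in> Leq (st \<gamma>)" "e \<noteq> e'"
      then have "(e, e') \<in> copycat_leq ?A" by (simp add: \<gamma> copycat_game_simps)
      then show "\<rho> (lloc (lab \<gamma> e)) < \<rho> (lloc (lab \<gamma> e'))"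
        using copycat_rank(2)[OF A r e(1)[unfolded \<kappa>_def] e(2)[unfolded \<kappa>_def] _ e(4)] 2 e(1,2) by simp
    qed
    then show ?thesis using m by (auto simp: sync2_def)
  qed
  have "\<exists>h. invertible two_cells id_cell vcomp_cell (\<sigma> \<odot>\<^sub>s \<gamma>) \<sigma> h \<and>
    (\<forall>k r. sync2 \<sigma> \<gamma> r k \<longrightarrow> is_lift \<sigma> k (lab (\<sigma> \<odot>\<^sub>s \<gamma>) ` vis \<sigma> \<gamma> r k) (cfun h ` vis \<sigma> \<gamma> r k))"
  proof (rule unit_iso[OF comp_prestrategy p _ _ gd, where \<kappa> = \<kappa> and C = "\<lambda>k r. sync2 \<sigma> \<gamma> r k" and V = "\<lambda>k r. vis \<sigma> \<gamma> r k"])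
    show "src (\<sigma> \<odot>\<^sub>s \<gamma>) = src \<sigma>" "trg (\<sigma> \<odot>\<^sub>s \<gamma>) = trg \<sigma>" unfolding comp_simps by (simp_all add: \<gamma>_def)
    fix k r assume c: "sync2 \<sigma> \<gamma> r k"
    note d = ccD[OF c]
    show "vis \<sigma> \<gamma> r k \<in> conf (st (\<sigma> \<odot>\<^sub>s \<gamma>))" by (rule vis_conf[OF c])
    show "k \<in> conf (st \<sigma>)" by (rule d(1))
    have rE: "b \<in> Ev ?A" if "In0 b \<in> r \<or> In1 b \<in> r" for b
      using confD(2)[OF d(2)] that by (auto simp: copycat_game_simps par_simps)
    have k1: "In0 b \<in> lab \<sigma> ` k \<longleftrightarrow> In1 b \<in> r" for b using d(3) by blast
    note cp = d(2)[unfolded conf_copycat[OF A], THEN conjunct2]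
    have np: "q = Pos \<longleftrightarrow> q \<noteq> Neg" for q by (cases q) auto
    have ksp: "g \<in> range In0 \<union> range In1" if "g \<in> lab \<sigma> ` k" for g using prestrategy_conf(4)[OF p d(1)] that by blast
    show "scott (game_of \<sigma>) (lab (\<sigma> \<odot>\<^sub>s \<gamma>) ` vis \<sigma> \<gamma> r k) (lab \<sigma> ` k)"
      unfolding scott_def V[OF c] d(4)
    proof (intro conjI ballI)
      fix g assume g: "g \<in> In0 ` (In0 -` r) \<union> In1 ` (In1 -` lab \<sigma> ` k) - lab \<sigma> ` k"
      then obtain b where b: "g = In0 b" "In0 b \<in> r" "In1 b \<notin> r" using k1 by blast
      then have "pol ?A b = Pos" using cp np by blast
      then show "pol (game_of \<sigma>) g = Neg" using b rE[of b] by simp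
    next
      fix g assume g: "g \<in> lab \<sigma> ` k - (In0 ` (In0 -` r) \<union> In1 ` (In1 -` lab \<sigma> ` k))"
      have "g \<notin> range In1"
      proof
        assume "g \<in> range In1"
        then have "g \<in> In1 ` (In1 -` lab \<sigma> ` k)" using g by auto
        then show False using g by blast
      qed
      then obtain b where gb: "g = In0 b" using ksp[of g] g by auto
      then have b: "g = In0 b" "In0 b \<notin> r" "In1 b \<in> r" using g k1[of b] by auto
      then have "pol ?A b = Neg" using cp np by blast
      then show "pol (game_of \<sigma>) g = Pos" using b rE[of b] by simp
    qed
    fix x' assume l: "is_lift \<sigma> k (lab (\<sigma> \<odot>\<^sub>s \<gamma>) ` vis \<sigma> \<gamma> r k) x'"
    have l': "is_lift \<sigma> k (vl \<sigma> \<gamma> r k) x'" using l V[OF c] by simp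
    have x': "x' \<in> conf (st \<sigma>)" "lab \<sigma> ` x' = vl \<sigma> \<gamma> r k" using l' by (auto simp: is_lift_def)
    have li: "lab \<sigma> ` (k \<inter> x') = lab \<sigma> ` k \<inter> vl \<sigma> \<gamma> r k" by (rule is_lift_Int[OF l'])
    let ?m = "r \<inter> \<kappa> x'"
    have mc: "?m \<in> conf (copycat_game ?A)" by (rule conf_Int[OF copycat_es[OF A] d(2) \<kappa>conf[OF x'(1)]])
    have kx: "\<kappa> x' = both (In0 -` r)" unfolding \<kappa>_def x'(2) d(4) by (intro arg_cong[where f = both]) auto
    have v1: "In0 -` lab \<sigma> ` (k \<inter> x') = In1 -` r \<inter> In0 -` r" unfolding li d(4) using k1 by auto
    have v0: "In1 -` lab \<sigma> ` (k \<inter> x') = In1 -` lab \<sigma> ` k" unfolding li d(4) by auto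
    have "match2 \<sigma> \<gamma> ?m (k \<inter> x')"
      unfolding match2_def \<gamma> lg[OF mc] v1 using conf_Int[OF prestrategyD(3)[OF p] d(1) x'(1)] mc by (auto simp: kx)
    then have cm: "sync2 \<sigma> \<gamma> ?m (k \<inter> x')" by (rule sync2_sub[OF c, rotated 2]) auto
    have "vl \<sigma> \<gamma> ?m (k \<inter> x') = vl \<sigma> \<gamma> r k"
      unfolding ccD(4)[OF cm] d(4) v0 by (simp add: kx vimage_Int)
    then show "\<exists>m. sync2 \<sigma> \<gamma> m (k \<inter> x') \<and> m \<subseteq> r \<and> m \<subseteq> \<kappa> x' \<and>
        lab (\<sigma> \<odot>\<^sub>s \<gamma>) ` vis \<sigma> \<gamma> m (k \<inter> x') = lab (\<sigma> \<odot>\<^sub>s \<gamma>) ` vis \<sigma> \<gamma> r k"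
      using cm V[OF c] V[OF cm] by (intro exI[of _ ?m]) auto
  next
    fix x assume x: "x \<in> conf (st \<sigma>)"
    show "sync2 \<sigma> \<gamma> (\<kappa> x) x" by (rule \<kappa>sync2[OF x])
    show "lab (\<sigma> \<odot>\<^sub>s \<gamma>) ` vis \<sigma> \<gamma> (\<kappa> x) x = lab \<sigma> ` x"
      unfolding V[OF \<kappa>sync2[OF x]] ccD(4)[OF \<kappa>sync2[OF x]] using ev_split[OF prestrategy_conf(4)[OF p x]] by (simp add: \<kappa>_def)
  next
    fix x x' :: "'a ev set" assume "x \<subseteq> x'"
    then show "\<kappa> x \<subseteq> \<kappa> x'" unfolding \<kappa>_def both_def by (intro Un_mono image_mono vimage_mono)
  next
    fix z assume "z \<in> conf (st (\<sigma> \<odot>\<^sub>s \<gamma>))"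
    then show "\<exists>k r. sync2 \<sigma> \<gamma> r k \<and> vis \<sigma> \<gamma> r k = z \<and> (\<forall>k' r'. sync2 \<sigma> \<gamma> r' k' \<longrightarrow> z \<subseteq> vis \<sigma> \<gamma> r' k' \<longrightarrow> k \<subseteq> k' \<and> r \<subseteq> r')"
      using least_sync2[of z] by blast
  next
    fix k r k' r' :: "'a ev set" assume "k \<subseteq> k'" "r \<subseteq> r'"
    then show "vis \<sigma> \<gamma> r k \<subseteq> vis \<sigma> \<gamma> r' k'" by (intro vis_mono)
  qed
  then obtain h where h: "invertible two_cells id_cell vcomp_cell (\<sigma> \<odot>\<^sub>s \<gamma>) \<sigma> h"
    "\<forall>k r. sync2 \<sigma> \<gamma> r k \<longrightarrow> is_lift \<sigma> k (lab (\<sigma> \<odot>\<^sub>s \<gamma>) ` vis \<sigma> \<gamma> r k) (cfun h ` vis \<sigma> \<gamma> r k)" by blast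
  have "\<forall>x y. sync2 \<sigma> \<gamma> x y \<longrightarrow> is_lift \<sigma> y (vl \<sigma> \<gamma> x y) (cfun h ` vis \<sigma> \<gamma> x y)" using h(2) V by simp
  then show ?thesis using h(1) by blast
qed

section \<open>The unitors as 2-cells, their naturality and the triangle\<close>

definition lunit_cell :: "'u prestrat \<Rightarrow> 'u two_cell" where
  "lunit_cell \<sigma> = (SOME h. invertible two_cells id_cell vcomp_cell (copycat (trg \<sigma>) \<odot>\<^sub>s \<sigma>) \<sigma> h \<and>
     (\<forall>x y. sync2 (copycat (trg \<sigma>)) \<sigma> x y \<longrightarrow>
        is_lift \<sigma> x (vl (copycat (trg \<sigma>)) \<sigma> x y) (cfun h ` vis (copycat (trg \<sigma>)) \<sigma> x y)))"

definition runit_cell :: "'u prestrat \<Rightarrow> 'u two_cell" where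
  "runit_cell \<sigma> = (SOME h. invertible two_cells id_cell vcomp_cell (\<sigma> \<odot>\<^sub>s copycat (src \<sigma>)) \<sigma> h \<and>
     (\<forall>x y. sync2 \<sigma> (copycat (src \<sigma>)) x y \<longrightarrow>
        is_lift \<sigma> y (vl \<sigma> (copycat (src \<sigma>)) x y) (cfun h ` vis \<sigma> (copycat (src \<sigma>)) x y)))"

lemma lunit_cell:
  assumes "prestrategy \<sigma>" "courteous_receptive UNIV \<sigma>"
  shows "invertible two_cells id_cell vcomp_cell (copycat (trg \<sigma>) \<odot>\<^sub>s \<sigma>) \<sigma> (lunit_cell \<sigma>)"
    "lunit_cell \<sigma> \<in> two_cells (copycat (trg \<sigma>) \<odot>\<^sub>s \<sigma>) \<sigma>"
    "sync2 (copycat (trg \<sigma>)) \<sigma> x y \<Longrightarrow>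
      is_lift \<sigma> x (vl (copycat (trg \<sigma>)) \<sigma> x y) (cfun (lunit_cell \<sigma>) ` vis (copycat (trg \<sigma>)) \<sigma> x y)"
proof -
  have s: "invertible two_cells id_cell vcomp_cell (copycat (trg \<sigma>) \<odot>\<^sub>s \<sigma>) \<sigma> (lunit_cell \<sigma>) \<and>
      (\<forall>x y. sync2 (copycat (trg \<sigma>)) \<sigma> x y \<longrightarrow> is_lift \<sigma> x (vl (copycat (trg \<sigma>)) \<sigma> x y) (cfun (lunit_cell \<sigma>) ` vis (copycat (trg \<sigma>)) \<sigma> x y))"
    unfolding lunit_cell_def by (rule someI_ex[OF lunit_ex[OF assms]])
  show i: "invertible two_cells id_cell vcomp_cell (copycat (trg \<sigma>) \<odot>\<^sub>s \<sigma>) \<sigma> (lunit_cell \<sigma>)" using s by blast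
  show "lunit_cell \<sigma> \<in> two_cells (copycat (trg \<sigma>) \<odot>\<^sub>s \<sigma>) \<sigma>" using i by (simp add: invertible_def)
  show "is_lift \<sigma> x (vl (copycat (trg \<sigma>)) \<sigma> x y) (cfun (lunit_cell \<sigma>) ` vis (copycat (trg \<sigma>)) \<sigma> x y)" if "sync2 (copycat (trg \<sigma>)) \<sigma> x y"
    using s that by blast
qed

lemma runit_cell:
  assumes "prestrategy \<sigma>" "courteous_receptive UNIV \<sigma>"
  shows "invertible two_cells id_cell vcomp_cell (\<sigma> \<odot>\<^sub>s copycat (src \<sigma>)) \<sigma> (runit_cell \<sigma>)"
    "runit_cell \<sigma> \<in> two_cells (\<sigma> \<odot>\<^sub>s copycat (src \<sigma>)) \<sigma>"
    "sync2 \<sigma> (copycat (src \<sigma>)) x y \<Longrightarrow>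
      is_lift \<sigma> y (vl \<sigma> (copycat (src \<sigma>)) x y) (cfun (runit_cell \<sigma>) ` vis \<sigma> (copycat (src \<sigma>)) x y)"
proof -
  have s: "invertible two_cells id_cell vcomp_cell (\<sigma> \<odot>\<^sub>s copycat (src \<sigma>)) \<sigma> (runit_cell \<sigma>) \<and>
      (\<forall>x y. sync2 \<sigma> (copycat (src \<sigma>)) x y \<longrightarrow> is_lift \<sigma> y (vl \<sigma> (copycat (src \<sigma>)) x y) (cfun (runit_cell \<sigma>) ` vis \<sigma> (copycat (src \<sigma>)) x y))"
    unfolding runit_cell_def by (rule someI_ex[OF runit_ex[OF assms]])
  show i: "invertible two_cells id_cell vcomp_cell (\<sigma> \<odot>\<^sub>s copycat (src \<sigma>)) \<sigma> (runit_cell \<sigma>)" using s by blast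
  show "runit_cell \<sigma> \<in> two_cells (\<sigma> \<odot>\<^sub>s copycat (src \<sigma>)) \<sigma>" using i by (simp add: invertible_def)
  show "is_lift \<sigma> y (vl \<sigma> (copycat (src \<sigma>)) x y) (cfun (runit_cell \<sigma>) ` vis \<sigma> (copycat (src \<sigma>)) x y)" if "sync2 \<sigma> (copycat (src \<sigma>)) x y"
    using s that by blast
qed

lemma lunit_cell_natural:
  assumes f: "prestrategy f" "courteous_receptive UNIV f" and f': "prestrategy f'" "courteous_receptive UNIV f'" and \<phi>: "\<phi> \<in> two_cells f f'"
  shows "vcomp_cell (lunit_cell f') (hcomp_cell (id_cell (copycat (trg f))) \<phi>) = vcomp_cell \<phi> (lunit_cell f)"
proof -
  let ?\<gamma> = "copycat (trg f)"
  have e: "trg f' = trg f" using two_cellsD(4)[OF \<phi>] by simp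
  have i: "inter f ?\<gamma>" "inter f' ?\<gamma>" using inter_copycat(1)[OF f(1)] inter_copycat(1)[OF f'(1)] e by simp_all
  interpret inter f ?\<gamma> by (rule i(1))
  note h = hcomp_cell_vis[OF i \<phi> id_cell_in[OF pre\<tau>]]
  note l = lunit_cell[OF f] and l' = lunit_cell[OF f', unfolded e]
  show ?thesis
  proof (rule two_cell_eqI[OF comp_prestrategy vcomp_cell_in(1)[OF h(1) l'(2)] vcomp_cell_in(1)[OF l(2) \<phi>]])
    fix z assume z: "z \<in> conf (st (?\<gamma> \<odot>\<^sub>s f))"
    then obtain x y where c: "sync2 ?\<gamma> f x y" "z = vis ?\<gamma> f x y" using conf_vis by blast
    have xy: "x \<in> conf (st f)" "y \<in> conf (st ?\<gamma>)" using sync2_match[OF c(1)] by (auto simp: match2_def)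
    have c': "sync2 ?\<gamma> f' (cfun \<phi> ` x) y"
      using sync2_image[OF f(1) pre\<tau> \<phi> id_cell_in[OF pre\<tau>] c(1)] id_cell_conf[OF xy(2)] by simp
    have v: "vl ?\<gamma> f' (cfun \<phi> ` x) y = vl ?\<gamma> f x y" by (simp add: vl_def two_cell_lab[OF \<phi> xy(1)])
    \<comment> \<open>Both sides of the naturality square produce a lift of the same configuration
      to the same labels, and lifts are unique.\<close>
    have "is_lift f' (cfun \<phi> ` x) (vl ?\<gamma> f x y) (cfun \<phi> ` cfun (lunit_cell f) ` vis ?\<gamma> f x y)"
      by (rule is_lift_image[OF \<phi> l(3)[OF c(1)] xy(1)])
    moreover have "is_lift f' (cfun \<phi> ` x) (vl ?\<gamma> f x y) (cfun (lunit_cell f') ` vis ?\<gamma> f' (cfun \<phi> ` x) y)"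
      using l'(3)[OF c'] v by simp
    ultimately have eq: "cfun (lunit_cell f') ` vis ?\<gamma> f' (cfun \<phi> ` x) y = cfun \<phi> ` cfun (lunit_cell f) ` vis ?\<gamma> f x y"
      using is_lift_unique[OF f' two_cell_conf[OF \<phi> xy(1)]] by blast
    show "cfun (vcomp_cell (lunit_cell f') (hcomp_cell (id_cell ?\<gamma>) \<phi>)) ` z = cfun (vcomp_cell \<phi> (lunit_cell f)) ` z"
      unfolding vcomp_cell_in(2)[OF h(1) l'(2) z] vcomp_cell_in(2)[OF l(2) \<phi> z]
      unfolding c(2) h(2)[OF c(1)] id_cell_conf[OF xy(2)] by (rule eq)
  qed
qed

lemma runit_cell_natural:
  assumes f: "prestrategy f" "courteous_receptive UNIV f" and f': "prestrategy f'" "courteous_receptive UNIV f'" and \<phi>: "\<phi> \<in> two_cells f f'"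
  shows "vcomp_cell (runit_cell f') (hcomp_cell \<phi> (id_cell (copycat (src f)))) = vcomp_cell \<phi> (runit_cell f)"
proof -
  let ?\<gamma> = "copycat (src f)"
  have e: "src f' = src f" using two_cellsD(3)[OF \<phi>] by simp
  have i: "inter ?\<gamma> f" "inter ?\<gamma> f'" using inter_copycat(2)[OF f(1)] inter_copycat(2)[OF f'(1)] e by simp_all
  interpret inter ?\<gamma> f by (rule i(1))
  note h = hcomp_cell_vis[OF i id_cell_in[OF pre\<sigma>] \<phi>]
  note l = runit_cell[OF f] and l' = runit_cell[OF f', unfolded e]
  show ?thesis
  proof (rule two_cell_eqI[OF comp_prestrategy vcomp_cell_in(1)[OF h(1) l'(2)] vcomp_cell_in(1)[OF l(2) \<phi>]])
    fix z assume z: "z \<in> conf (st (f \<odot>\<^sub>s ?\<gamma>))"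
    then obtain x y where c: "sync2 f ?\<gamma> x y" "z = vis f ?\<gamma> x y" using conf_vis by blast
    have xy: "x \<in> conf (st ?\<gamma>)" "y \<in> conf (st f)" using sync2_match[OF c(1)] by (auto simp: match2_def)
    have c': "sync2 f' ?\<gamma> x (cfun \<phi> ` y)"
      using sync2_image[OF pre\<sigma> f(1) id_cell_in[OF pre\<sigma>] \<phi> c(1)] id_cell_conf[OF xy(1)] by simp
    have v: "vl f' ?\<gamma> x (cfun \<phi> ` y) = vl f ?\<gamma> x y" by (simp add: vl_def two_cell_lab[OF \<phi> xy(2)])
    have "is_lift f' (cfun \<phi> ` y) (vl f ?\<gamma> x y) (cfun \<phi> ` cfun (runit_cell f) ` vis f ?\<gamma> x y)"
      by (rule is_lift_image[OF \<phi> l(3)[OF c(1)] xy(2)])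
    moreover have "is_lift f' (cfun \<phi> ` y) (vl f ?\<gamma> x y) (cfun (runit_cell f') ` vis f' ?\<gamma> x (cfun \<phi> ` y))"
      using l'(3)[OF c'] v by simp
    ultimately have eq: "cfun (runit_cell f') ` vis f' ?\<gamma> x (cfun \<phi> ` y) = cfun \<phi> ` cfun (runit_cell f) ` vis f ?\<gamma> x y"
      using is_lift_unique[OF f' two_cell_conf[OF \<phi> xy(2)]] by blast
    show "cfun (vcomp_cell (runit_cell f') (hcomp_cell \<phi> (id_cell ?\<gamma>))) ` z = cfun (vcomp_cell \<phi> (runit_cell f)) ` z"
      unfolding vcomp_cell_in(2)[OF h(1) l'(2) z] vcomp_cell_in(2)[OF l(2) \<phi> z]
      unfolding c(2) h(2)[OF c(1)] id_cell_conf[OF xy(1)] by (rule eq)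
  qed
qed

text \<open>On a state \<open>x\<close>, \<open>y\<close>, \<open>z\<close> with copycat in the
  middle, one path moves \<open>x\<close> to the lift \<open>x'\<close> and the other moves
  \<open>z\<close> to the lift \<open>z'\<close>. The pairs differ, but only by hidden moves of the
  shared game.\<close>

lemma unit_triangle:
  assumes fg: "inter f g" and gf: "courteous_receptive UNIV f" and gg: "courteous_receptive UNIV g"
  shows "vcomp_cell (hcomp_cell (id_cell g) (lunit_cell f)) (assoc_cell f (copycat (trg f)) g)
    = hcomp_cell (runit_cell g) (id_cell f)"
proof -
  interpret inter f g by fact
  let ?\<gamma> = "copycat (trg f)"
  have i1: "inter f ?\<gamma>" by (rule inter_copycat(1)[OF pre\<sigma>])
  have i2: "inter ?\<gamma> g" using inter_copycat(2)[OF pre\<tau>] mid by simp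
  note ic = inter_comp[OF i1 i2]
  note a = assoc_cellD[OF i1 i2]
  note l = lunit_cell[OF pre\<sigma> gf] and r = runit_cell[OF pre\<tau> gg, folded mid]
  note h1 = hcomp_cell_vis[OF ic(1) fg l(2) id_cell_in[OF pre\<tau>]]
  note h2 = hcomp_cell_vis[OF ic(2) fg id_cell_in[OF pre\<sigma>] r(2)]
  note c = chain_three[OF i1 i2]
  have pl: "pres (three f ?\<gamma> g) 0 3 ((g \<odot>\<^sub>s ?\<gamma>) \<odot>\<^sub>s f) (\<lambda>w. vis (g \<odot>\<^sub>s ?\<gamma>) f (sec 0 w) (vis g ?\<gamma> (sec 1 w) (sec 2 w)))"
    using pres_left[OF c] by (simp add: numeral_2_eq_2[symmetric])
  show ?thesis
  proof (rule pres_cell_eqI[OF pl vcomp_cell_in(1)[OF a(2) h1(1)] h2(1)])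
    fix w assume w: "sync (three f ?\<gamma> g) 0 3 w"
    define x y z where "x = sec 0 w" and "y = sec 1 w" and "z = sec 2 w"
    note cw = sync2_three[OF i1 i2 w, folded x_def y_def z_def]
    note vc = presD(4)[OF pl w, folded x_def y_def z_def]
    have xc: "x \<in> conf (st f)" and zc: "z \<in> conf (st g)" and yc: "y \<in> conf (copycat_game (trg f))"
      and m1: "In1 -` lab f ` x = In0 -` y" and m2: "In0 -` lab g ` z = In1 -` y"
      using cw(3,4) copycat_lab_conf[of y "trg f"] by (auto simp: sync2_def match2_def)
    have ly: "lab ?\<gamma> ` y = y" by (rule copycat_lab_conf[OF yc])
    define x' where "x' = cfun (lunit_cell f) ` vis ?\<gamma> f x y"
    define z' where "z' = cfun (runit_cell g) ` vis g ?\<gamma> y z"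
    have lx: "is_lift f x (vl ?\<gamma> f x y) x'" unfolding x'_def by (rule l(3)[OF cw(3)])
    have lz: "is_lift g z (vl g ?\<gamma> y z) z'" unfolding z'_def by (rule r(3)[OF cw(4)])
    have c1: "sync2 g f x' z"
      using sync2_image[OF _ pre\<tau> l(2) id_cell_in[OF pre\<tau>] cw(2)] inter.comp_prestrategy[OF i1] id_cell_conf[OF zc]
      by (simp add: x'_def)
    have c2: "sync2 g f x z'"
      using sync2_image[OF pre\<sigma> _ id_cell_in[OF pre\<sigma>] r(2) cw(1)] inter.comp_prestrategy[OF i2] id_cell_conf[OF xc]
      by (simp add: z'_def)
    have Lx: "lab f ` (x \<inter> x') = lab f ` x \<inter> vl ?\<gamma> f x y" by (rule is_lift_Int[OF lx])
    have Lz: "lab g ` (z \<inter> z') = lab g ` z \<inter> vl g ?\<gamma> y z" by (rule is_lift_Int[OF lz])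
    have vx: "vl ?\<gamma> f x y = In0 ` (In0 -` lab f ` x) \<union> In1 ` (In1 -` y)" by (simp add: vl_def ly)
    have vz: "vl g ?\<gamma> y z = In0 ` (In0 -` y) \<union> In1 ` (In1 -` lab g ` z)" by (simp add: vl_def ly)
    have lx': "lab f ` x' = vl ?\<gamma> f x y" "x' \<in> conf (st f)" using lx by (auto simp: is_lift_def)
    have lz': "lab g ` z' = vl g ?\<gamma> y z" "z' \<in> conf (st g)" using lz by (auto simp: is_lift_def)
    have e1: "In1 -` lab f ` (x \<inter> x') = In0 -` y \<inter> In1 -` y" unfolding Lx vx vimage_Int m1 by auto
    have e2: "In0 -` lab g ` (z \<inter> z') = In0 -` y \<inter> In1 -` y" unfolding Lz vz vimage_Int m2 by auto
    have e3: "In0 -` lab f ` (x \<inter> x') = In0 -` lab f ` x" unfolding Lx vx by auto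
    have e4: "In1 -` lab g ` (z \<inter> z') = In1 -` lab g ` z" unfolding Lz vz by auto
    have m: "match2 g f (x \<inter> x') (z \<inter> z')"
      unfolding match2_def e1 e2
      using conf_Int[OF prestrategyD(3)[OF pre\<sigma>] xc lx'(2)] conf_Int[OF prestrategyD(3)[OF pre\<tau>] zc lz'(2)] by blast
    have cm: "sync2 g f (x \<inter> x') (z \<inter> z')" by (rule sync2_sub[OF c1 _ _ m]) auto
    \<comment> \<open>The pair of intersections lies below both results and has the same visible
      labels, so \<open>vis_eqI\<close> identifies all three.\<close>
    have "vl g f (x \<inter> x') (z \<inter> z') = vl g f x' z" "vl g f (x \<inter> x') (z \<inter> z') = vl g f x z'"
      unfolding vl_def e3 e4 lx'(1) lz'(1) by simp_all
    then have "vis g f (x \<inter> x') (z \<inter> z') = vis g f x' z" "vis g f (x \<inter> x') (z \<inter> z') = vis g f x z'"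
      using vis_eqI[OF cm c1] vis_eqI[OF cm c2] by auto
    then have eq: "vis g f x' z = vis g f x z'" by simp
    have "cfun (vcomp_cell (hcomp_cell (id_cell g) (lunit_cell f)) (assoc_cell f ?\<gamma> g)) `
          vis (g \<odot>\<^sub>s ?\<gamma>) f x (vis g ?\<gamma> y z) =
        cfun (hcomp_cell (runit_cell g) (id_cell f)) ` vis (g \<odot>\<^sub>s ?\<gamma>) f x (vis g ?\<gamma> y z)"
      unfolding vcomp_cell_in(2)[OF a(2) h1(1) vc] a(3)[OF w x_def[symmetric] y_def[symmetric] z_def[symmetric]]
        h1(2)[OF cw(2)] h2(2)[OF cw(1)] id_cell_conf[OF xc] id_cell_conf[OF zc] x'_def[symmetric] z'_def[symmetric]
      by (rule eq)
    then show "cfun (vcomp_cell (hcomp_cell (id_cell g) (lunit_cell f)) (assoc_cell f ?\<gamma> g)) `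
          vis (g \<odot>\<^sub>s ?\<gamma>) f (sec 0 w) (vis g ?\<gamma> (sec 1 w) (sec 2 w)) =
        cfun (hcomp_cell (runit_cell g) (id_cell f)) ` vis (g \<odot>\<^sub>s ?\<gamma>) f (sec 0 w) (vis g ?\<gamma> (sec 1 w) (sec 2 w))"
      by (simp add: x_def y_def z_def)
  qed
qed

section \<open>Strategies are the courteous and receptive pre-strategies\<close>

lemma empty_game_esp: "is_esp empty_game"
  by (auto simp: is_esp_def is_es_def empty_game_def order_on_defs refl_on_def trans_def antisym_def)

lemma conf_empty_game: "conf empty_game = {{}}"
  by (auto simp: conf_def empty_game_def)

lemma from_empty_simps [simp]:
  "src (from_empty G S l) = empty_game" "trg (from_empty G S l) = G" "st (from_empty G S l) = S"
  "lab (from_empty G S l) = (\<lambda>s\<in>Ev S. In1 (l s))"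
  by (simp_all add: from_empty_def)

lemma from_empty_img: "x \<in> conf S \<Longrightarrow> (\<lambda>s\<in>Ev S. In1 (l s)) ` x = In1 ` l ` x"
  unfolding image_image using confD(2)[of x S] by (intro image_cong) auto

lemma from_empty_conf: "In1 ` M \<in> conf (dual empty_game \<parallel> G) \<longleftrightarrow> M \<in> conf G"
  by (auto simp: conf_par conf_empty_game)

lemma from_empty_prestrategy:
  assumes "is_prestrategy_on G S l" shows "prestrategy (from_empty G S l)"
proof -
  have G: "is_esp G" "is_esp S" "es_map S G l" "\<And>s. s \<in> Ev S \<Longrightarrow> pol G (l s) = pol S s"
    using assms by (auto simp: is_prestrategy_on_def esp_map_def)
  have "es_map S (dual empty_game \<parallel> G) (\<lambda>s\<in>Ev S. In1 (l s))"
    unfolding es_map_def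
  proof (intro conjI ballI)
    show "(\<lambda>s\<in>Ev S. In1 (l s)) \<in> Ev S \<rightarrow>\<^sub>E Ev (dual empty_game \<parallel> G)"
      using es_mapD(1)[OF G(3)] by (auto simp: par_simps)
    fix x assume x: "x \<in> conf S"
    show "(\<lambda>s\<in>Ev S. In1 (l s)) ` x \<in> conf (dual empty_game \<parallel> G)"
      unfolding from_empty_img[OF x] from_empty_conf by (rule es_mapD(2)[OF G(3) x])
    show "inj_on (\<lambda>s\<in>Ev S. In1 (l s)) x"
    proof (rule inj_onI)
      fix s s' assume s: "s \<in> x" "s' \<in> x" "(\<lambda>s\<in>Ev S. In1 (l s)) s = (\<lambda>s\<in>Ev S. In1 (l s)) s'"
      then have "s \<in> Ev S" "s' \<in> Ev S" using confD(2)[OF x] by auto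
      then show "s = s'" using inj_onD[OF es_mapD(3)[OF G(3) x], of s s'] s by simp
    qed
  qed
  moreover have "pol (dual empty_game \<parallel> G) ((\<lambda>s\<in>Ev S. In1 (l s)) s) = pol S s" if "s \<in> Ev S" for s
    using that es_mapD(1)[OF G(3) that] G(4)[OF that] by simp
  ultimately show ?thesis
    using G(1,2)
    by (simp add: prestrategy_def is_prestrategy_on_def esp_map_def esp_par esp_dual empty_game_esp)
qed

lemma courteous_receptive_from_empty:
  assumes "is_prestrategy_on G S l"
  shows "courteous_receptive (range In1) (from_empty G S l) \<longleftrightarrow> courteous_receptive_on UNIV S G l"
proof -
  let ?G = "dual empty_game \<parallel> G" and ?l = "\<lambda>s\<in>Ev S. In1 (l s)"
  have G: "es_map S G l" using assms by (auto simp: is_prestrategy_on_def esp_map_def)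
  have ls: "?l s = In1 (l s)" "l s \<in> Ev G" if "x \<in> conf S" "s \<in> x" for x s
    using confD(2)[OF that(1)] that(2) es_mapD(1)[OF G] by auto
  have pl: "pol ?G (In1 g) = pol G g" if "g \<in> Ev G" for g using that by simp
  have gE: "g \<in> Ev G" if "insert g M \<in> conf G" for g M using confD(2)[OF that] by blast
  have di: "In1 ` M - {In1 g} = In1 ` (M - {g})" for M and g :: "'a ev" by auto
  have ii: "insert (In1 g) (In1 ` M) = In1 ` insert g M" for M and g :: "'a ev" by auto
  show ?thesis
    unfolding courteous_receptive_def from_empty_simps
  proof
    assume gd: "courteous_receptive_on (range In1) S ?G ?l"
    note d = courteous_receptive_onD[OF gd]
    show "courteous_receptive_on UNIV S G l"
      unfolding courteous_receptive_on_def
    proof (intro conjI allI impI)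
      fix x s assume *: "x \<in> conf S" "s \<in> x" "pol G (l s) = Pos" "l ` x - {l s} \<in> conf G"
      show "x - {s} \<in> conf S"
        by (rule d(1)[OF *(1,2)]) (simp_all only: ls[OF *(1,2)] from_empty_img[OF *(1)] di from_empty_conf pl *(3,4) rangeI)
    next
      fix x y s assume *: "x \<in> conf S" "y \<in> conf S" "x \<subseteq> y" "s \<in> y" "pol G (l s) = Neg" "insert (l s) (l ` x) \<in> conf G"
      show "insert s x \<in> conf S"
        by (rule d(2)[OF *(1-4)]) (simp_all only: ls[OF *(2,4)] from_empty_img[OF *(1)] ii from_empty_conf pl *(5,6) rangeI)
    next
      fix x g assume *: "x \<in> conf S" "g \<notin> l ` x" "pol G g = Neg" "insert g (l ` x) \<in> conf G"
      have "\<exists>s. ?l s = In1 g \<and> insert s x \<in> conf S"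
        by (rule d(3)[OF *(1)]) (use *(2) in \<open>auto simp only: from_empty_img[OF *(1)] ii from_empty_conf pl[OF gE[OF *(4)]] *(3,4)\<close>)
      then obtain s where s: "?l s = In1 g" "insert s x \<in> conf S" by blast
      then show "\<exists>s. l s = g \<and> insert s x \<in> conf S" using ls(1)[OF s(2), of s] by auto
    next
      fix x s s' assume *: "x \<in> conf S" "insert s x \<in> conf S" "insert s' x \<in> conf S" "s \<notin> x" "s' \<notin> x"
        "l s = l s'" "pol G (l s) = Neg"
      have 1: "?l s = In1 (l s)" "?l s' = In1 (l s')" "l s \<in> Ev G" using ls[OF *(2), of s] ls[OF *(3), of s'] by simp_all
      show "s = s'" by (rule d(4)[OF *(1-5)]) (simp_all only: 1 *(6,7) pl[OF 1(3)] rangeI pl[OF 1(3)[unfolded *(6)]] *(7)[unfolded *(6)])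
    qed
  next
    assume gd: "courteous_receptive_on UNIV S G l"
    note d = courteous_receptive_onD[OF gd]
    show "courteous_receptive_on (range In1) S ?G ?l"
      unfolding courteous_receptive_on_def
    proof (intro conjI allI impI)
      fix x s assume *: "x \<in> conf S" "s \<in> x" "pol ?G (?l s) = Pos" "?l ` x - {?l s} \<in> conf ?G"
      have "pol G (l s) = Pos" "l ` x - {l s} \<in> conf G"
        using *(3,4) unfolding ls(1)[OF *(1,2)] from_empty_img[OF *(1)] di from_empty_conf pl[OF ls(2)[OF *(1,2)]] .
      then show "x - {s} \<in> conf S" by (rule d(1)[OF *(1,2) UNIV_I])
    next
      fix x y s assume *: "x \<in> conf S" "y \<in> conf S" "x \<subseteq> y" "s \<in> y" "pol ?G (?l s) = Neg" "insert (?l s) (?l ` x) \<in> conf ?G"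
      have "pol G (l s) = Neg" "insert (l s) (l ` x) \<in> conf G"
        using *(5,6) unfolding ls(1)[OF *(2,4)] from_empty_img[OF *(1)] ii from_empty_conf pl[OF ls(2)[OF *(2,4)]] .
      then show "insert s x \<in> conf S" by (rule d(2)[OF *(1-4) UNIV_I])
    next
      fix x g assume *: "x \<in> conf S" "g \<in> range In1" "g \<notin> ?l ` x" "pol ?G g = Neg" "insert g (?l ` x) \<in> conf ?G"
      then obtain h where h: "g = In1 h" by blast
      have c: "insert h (l ` x) \<in> conf G" using *(5) unfolding h from_empty_img[OF *(1)] ii from_empty_conf .
      have n: "h \<notin> l ` x" using *(3) unfolding h from_empty_img[OF *(1)] by blast
      have "pol G h = Neg" using *(4) unfolding h pl[OF gE[OF c]] .
      then obtain s where s: "l s = h" "insert s x \<in> conf S" using d(3)[OF *(1) UNIV_I n _ c] by blast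
      then have "?l s = g" using ls(1)[OF s(2), of s] h by simp
      then show "\<exists>s. ?l s = g \<and> insert s x \<in> conf S" using s(2) by blast
    next
      fix x s s' assume *: "x \<in> conf S" "insert s x \<in> conf S" "insert s' x \<in> conf S" "s \<notin> x" "s' \<notin> x"
        "?l s = ?l s'" "pol ?G (?l s) = Neg"
      have 1: "?l s = In1 (l s)" "?l s' = In1 (l s')" "l s \<in> Ev G" using ls[OF *(2), of s] ls[OF *(3), of s'] by simp_all
      have "l s = l s'" using *(6) unfolding 1 by simp
      moreover have "pol G (l s) = Neg" using *(7) unfolding 1(1) pl[OF 1(3)] .
      ultimately show "s = s'" using d(4)[OF *(1-5)] by blast
    qed
  qed
qed

text \<open>The left game is empty, so neither labels of events nor configurations of the game reach
  the left side, and its clauses hold vacuously.\<close>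

lemma courteous_receptive_from_empty_UNIV:
  assumes p: "is_prestrategy_on G S l" and g: "courteous_receptive_on UNIV S G l"
  shows "courteous_receptive UNIV (from_empty G S l)"
proof (rule courteous_receptive_UNIV[OF from_empty_prestrategy[OF p]])
  show "courteous_receptive (range In1) (from_empty G S l)" using courteous_receptive_from_empty[OF p] g by blast
  have G: "es_map S G l" using p by (auto simp: is_prestrategy_on_def esp_map_def)
  have ls: "(\<lambda>s\<in>Ev S. In1 (l s)) s \<notin> range In0" if "x \<in> conf S" "s \<in> x" for x s
    using confD(2)[OF that(1)] that(2) by auto
  have no: "g \<notin> range In0" if "insert g M \<in> conf (dual empty_game \<parallel> G)" for g M
    using that by (auto simp: conf_par conf_empty_game)
  show "courteous_receptive (range In0) (from_empty G S l)"
    unfolding courteous_receptive_def courteous_receptive_on_def from_empty_simps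
  proof (intro conjI allI impI)
    fix x s assume "x \<in> conf S" "s \<in> x" "(\<lambda>s\<in>Ev S. In1 (l s)) s \<in> range In0"
    then show "x - {s} \<in> conf S" using ls by blast
  next
    fix x y s assume "y \<in> conf S" "s \<in> y" "(\<lambda>s\<in>Ev S. In1 (l s)) s \<in> range In0"
    then show "insert s x \<in> conf S" using ls by blast
  next
    fix x g assume "g \<in> range In0" "insert g ((\<lambda>s\<in>Ev S. In1 (l s)) ` x) \<in> conf (dual empty_game \<parallel> G)"
    then show "\<exists>s. (\<lambda>s\<in>Ev S. In1 (l s)) s = g \<and> insert s x \<in> conf S" using no by blast
  next
    fix x s s' assume "insert s x \<in> conf S" "(\<lambda>s\<in>Ev S. In1 (l s)) s \<in> range In0"
    then show "s = s'" using ls[of "insert s x" s] by blast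
  qed
qed

text \<open>Each clause is carried to \<open>F\<close> by \<open>a\<close>, solved there and carried
  back by \<open>b\<close>; labels and the game are the same on both sides.\<close>

lemma courteous_receptive_iso:
  assumes ends: "src E = src F" "trg E = trg F" and F: "courteous_receptive V F"
    and a: "es_map (st E) (st F) a" and b: "es_map (st F) (st E) b"
    and ba: "\<And>s. s \<in> Ev (st E) \<Longrightarrow> b (a s) = s"
    and lb: "\<And>t. t \<in> Ev (st F) \<Longrightarrow> lab E (b t) = lab F t"
  shows "courteous_receptive V E"
proof -
  note d = courteous_receptive_onD[OF F[unfolded courteous_receptive_def]]
  have G: "game_of E = game_of F" using ends by simp
  have E: "s \<in> Ev (st E)" if "x \<in> conf (st E)" "s \<in> x" for x s using confD(2)[OF that(1)] that(2) by blast
  have la: "lab F (a s) = lab E s" if "s \<in> Ev (st E)" for s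
    using lb[OF es_mapD(1)[OF a that]] ba[OF that] by simp
  have lab: "lab F ` a ` x = lab E ` x" if "x \<in> conf (st E)" for x
    unfolding image_image using la E[OF that] by (intro image_cong) auto
  have bax: "b ` a ` x = x" if "x \<in> conf (st E)" for x
  proof -
    have "b ` a ` x = (\<lambda>s. s) ` x" unfolding image_image using ba E[OF that] by (intro image_cong) auto
    then show ?thesis by simp
  qed
  note ac = es_mapD(2)[OF a] and bc = es_mapD(2)[OF b]
  have na: "a s \<notin> a ` x" if "x \<in> conf (st E)" "s \<in> Ev (st E)" "s \<notin> x" for x s
  proof
    assume "a s \<in> a ` x"
    then have "b (a s) \<in> b ` a ` x" by blast
    then show False using bax[OF that(1)] ba[OF that(2)] that(3) by simp
  qed
  show ?thesis
    unfolding courteous_receptive_def courteous_receptive_on_def G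
  proof (intro conjI allI impI)
    fix x s assume *: "x \<in> conf (st E)" "s \<in> x" "lab E s \<in> V" "pol (game_of F) (lab E s) = Pos"
      "lab E ` x - {lab E s} \<in> conf (game_of F)"
    note s = E[OF *(1,2)]
    have "a ` x - {a s} \<in> conf (st F)"
      by (rule d(1)[OF ac[OF *(1)] imageI[OF *(2)]]) (simp_all only: la[OF s] lab[OF *(1)] *(3,4,5))
    then have "b ` (a ` x - {a s}) \<in> conf (st E)" by (rule bc)
    moreover have "b ` (a ` x - {a s}) = x - {s}"
    proof -
      have "a ` x - {a s} = a ` (x - {s})"
      proof -
        have "inj_on a x" by (rule es_mapD(3)[OF a *(1)])
        then show ?thesis using inj_on_image_set_diff[of a x x "{s}"] *(2) by auto
      qed
      moreover have "b ` a ` (x - {s}) = (\<lambda>s. s) ` (x - {s})"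
        unfolding image_image using ba E[OF *(1)] by (intro image_cong) auto
      ultimately show ?thesis by simp
    qed
    ultimately show "x - {s} \<in> conf (st E)" by simp
  next
    fix x y s assume *: "x \<in> conf (st E)" "y \<in> conf (st E)" "x \<subseteq> y" "s \<in> y" "lab E s \<in> V"
      "pol (game_of F) (lab E s) = Neg" "insert (lab E s) (lab E ` x) \<in> conf (game_of F)"
    note s = E[OF *(2,4)]
    have "insert (a s) (a ` x) \<in> conf (st F)"
      by (rule d(2)[OF ac[OF *(1)] ac[OF *(2)] image_mono[OF *(3)] imageI[OF *(4)]])
        (simp_all only: la[OF s] lab[OF *(1)] *(5,6,7))
    then have "b ` insert (a s) (a ` x) \<in> conf (st E)" by (rule bc)
    then show "insert s x \<in> conf (st E)" by (simp add: bax[OF *(1)] ba[OF s])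
  next
    fix x g assume *: "x \<in> conf (st E)" "g \<in> V" "g \<notin> lab E ` x" "pol (game_of F) g = Neg"
      "insert g (lab E ` x) \<in> conf (game_of F)"
    obtain t where t: "lab F t = g" "insert t (a ` x) \<in> conf (st F)"
      using d(3)[OF ac[OF *(1)] *(2), unfolded lab[OF *(1)], OF *(3-5)] by blast
    have "t \<in> Ev (st F)" using confD(2)[OF t(2)] by blast
    moreover have "b ` insert t (a ` x) \<in> conf (st E)" by (rule bc[OF t(2)])
    ultimately show "\<exists>s. lab E s = g \<and> insert s x \<in> conf (st E)"
      using lb t(1) by (intro exI[of _ "b t"]) (simp add: bax[OF *(1)])
  next
    fix x s s' assume *: "x \<in> conf (st E)" "insert s x \<in> conf (st E)" "insert s' x \<in> conf (st E)" "s \<notin> x" "s' \<notin> x"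
      "lab E s = lab E s'" "lab E s \<in> V" "pol (game_of F) (lab E s) = Neg"
    have s: "s \<in> Ev (st E)" "s' \<in> Ev (st E)" using E[OF *(2)] E[OF *(3)] by auto
    have "a s = a s'"
    proof (rule d(4)[OF ac[OF *(1)]])
      show "insert (a s) (a ` x) \<in> conf (st F)" "insert (a s') (a ` x) \<in> conf (st F)"
        using ac[OF *(2)] ac[OF *(3)] by simp_all
      show "a s \<notin> a ` x" "a s' \<notin> a ` x" using na[OF *(1) s(1) *(4)] na[OF *(1) s(2) *(5)] .
      show "lab F (a s) = lab F (a s')" "lab F (a s) \<in> V" "pol (game_of F) (lab F (a s)) = Neg"
        using *(6-8) unfolding la[OF s(1)] la[OF s(2)] .
    qed
    then show "s = s'" using ba s by metis
  qed
qed

text \<open>The given isomorphism is arbitrary, but any isomorphism over the game transports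
  courtesy and receptivity. Conversely the left unitor of the strategy, read as a pre-strategy from
  the empty game, is the required isomorphism.\<close>

lemma is_strategy_iff_courteous_receptive:
  assumes p: "prestrategy \<sigma>"
  shows "is_strategy_on (game_of \<sigma>) (st \<sigma>) (lab \<sigma>) \<longleftrightarrow> courteous_receptive UNIV \<sigma>"
proof -
  let ?G = "game_of \<sigma>"
  define E where "E = from_empty ?G (st \<sigma>) (lab \<sigma>)"
  have ps: "is_prestrategy_on ?G (st \<sigma>) (lab \<sigma>)" using p by (simp add: prestrategy_def)
  have E: "prestrategy E" unfolding E_def by (rule from_empty_prestrategy[OF ps])
  have tE: "trg E = ?G" by (simp add: E_def)
  have i: "inter E (copycat ?G)" using inter_copycat(1)[OF E] by (simp add: tE)
  interpret inter E "copycat ?G" by (rule i)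
  let ?H = "copycat ?G \<odot>\<^sub>s E"
  have eH: "src E = src ?H" "trg E = trg ?H" by (simp_all add: comp_simps tE)
  have iff: "is_strategy_on ?G (st \<sigma>) (lab \<sigma>) \<longleftrightarrow> ?H \<cong>\<^sub>s E"
    using ps by (simp add: is_strategy_on_def E_def)
  show ?thesis
  proof
    assume "is_strategy_on ?G (st \<sigma>) (lab \<sigma>)"
    then obtain \<phi> where \<phi>: "esp_iso (st ?H) (st E) \<phi>" "\<forall>s\<in>Ev (st ?H). lab E (\<phi> s) = lab ?H s"
      unfolding iff prestrat_iso_def by blast
    then obtain \<psi> where m: "es_map (st ?H) (st E) \<phi>" "es_map (st E) (st ?H) \<psi>"
      and inv: "\<forall>e\<in>Ev (st ?H). \<psi> (\<phi> e) = e" "\<forall>e\<in>Ev (st E). \<phi> (\<psi> e) = e"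
      unfolding esp_iso_def esp_map_def by blast
    have "is_esp ?G" using ps by (simp add: is_prestrategy_on_def)
    \<comment> \<open>The visible right side of the composite belongs to copycat, so nothing about
      \<open>\<sigma>\<close> beyond being a pre-strategy enters here.\<close>
    then have "courteous_receptive (range In1) ?H"
      using courteous_receptive_comp_right[OF courteous_receptive_mono[OF courteous_receptive_copycat]] by blast
    then have "courteous_receptive (range In1) E"
      using courteous_receptive_iso[OF eH _ m(2,1)] inv \<phi>(2) by blast
    then have "courteous_receptive_on UNIV (st \<sigma>) ?G (lab \<sigma>)"
      unfolding E_def by (simp only: courteous_receptive_from_empty[OF ps])
    then show "courteous_receptive UNIV \<sigma>" by (simp add: courteous_receptive_def)
  next
    assume "courteous_receptive UNIV \<sigma>"
    then have "courteous_receptive UNIV E"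
      unfolding E_def courteous_receptive_def[of _ \<sigma>] by (rule courteous_receptive_from_empty_UNIV[OF ps])
    then obtain h where "invertible two_cells id_cell vcomp_cell ?H E h"
      using lunit_ex[OF E] unfolding tE by blast
    then obtain k where h: "h \<in> two_cells ?H E" and k: "k \<in> two_cells E ?H"
      and hk: "vcomp_cell k h = id_cell ?H" "vcomp_cell h k = id_cell E" unfolding invertible_def by blast
    have c1: "cfun k (cfun h e) = e" if "e \<in> Ev (st ?H)" for e
    proof -
      have "cfun (vcomp_cell k h) e = cfun (id_cell ?H) e" using hk by simp
      then show ?thesis using that two_cellsD(1)[OF h] by (simp add: vcomp_cell_def id_cell_def compose_def)
    qed
    have c2: "cfun h (cfun k e) = e" if "e \<in> Ev (st E)" for e
    proof -
      have "cfun (vcomp_cell h k) e = cfun (id_cell E) e" using hk by simp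
      then show ?thesis using that two_cellsD(1)[OF k] by (simp add: vcomp_cell_def id_cell_def compose_def)
    qed
    have "esp_iso (st ?H) (st E) (cfun h)"
      unfolding esp_iso_def using h k c1 c2 by (auto simp: two_cells_def)
    then show "is_strategy_on ?G (st \<sigma>) (lab \<sigma>)"
      unfolding iff prestrat_iso_def using eH two_cellsD(6)[OF h] by metis
  qed
qed

section \<open>Closure of strategies under composition and assembly of the bicategory\<close>

lemma strategiesD:
  assumes "A \<in> games" "B \<in> games" "\<sigma> \<in> strategies A B"
  shows "src \<sigma> = A" "trg \<sigma> = B" "prestrategy \<sigma>" "courteous_receptive UNIV \<sigma>"
proof -
  show e: "src \<sigma> = A" "trg \<sigma> = B" using assms(3) by (auto simp: strategies_def)
  have s: "is_strategy_on (game_of \<sigma>) (st \<sigma>) (lab \<sigma>)" using assms(3) e by (auto simp: strategies_def)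
  show p: "prestrategy \<sigma>" using s assms(1,2) e by (simp add: prestrategy_def is_strategy_on_def games_def)
  show "courteous_receptive UNIV \<sigma>" using is_strategy_iff_courteous_receptive[OF p] s by blast
qed

lemma strategiesI:
  assumes "prestrategy \<sigma>" "courteous_receptive UNIV \<sigma>" "src \<sigma> = A" "trg \<sigma> = B"
  shows "\<sigma> \<in> strategies A B"
  using is_strategy_iff_courteous_receptive[OF assms(1)] assms by (simp add: strategies_def)

lemma strategies_inter:
  assumes "A \<in> games" "B \<in> games" "C \<in> games" "f \<in> strategies A B" "g \<in> strategies B C"
  shows "inter f g"
  using strategiesD[OF assms(1,2,4)] strategiesD[OF assms(2,3,5)] by (simp add: inter_def)

text \<open>By the characterization, closure amounts to courtesy and receptivity, inherited on the
  left game from \<open>f\<close> and on the right game from \<open>g\<close>.\<close>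

lemma comp_strategies:
  assumes "A \<in> games" "B \<in> games" "C \<in> games" "f \<in> strategies A B" "g \<in> strategies B C"
  shows "g \<odot>\<^sub>s f \<in> strategies A C"
proof -
  interpret inter f g by (rule strategies_inter[OF assms])
  note f = strategiesD[OF assms(1,2,4)] and g = strategiesD[OF assms(2,3,5)]
  show ?thesis
  proof (rule strategiesI[OF comp_prestrategy])
    show "courteous_receptive UNIV (g \<odot>\<^sub>s f)"
      by (rule courteous_receptive_UNIV[OF comp_prestrategy courteous_receptive_comp_left[OF courteous_receptive_mono[OF f(4)]]
            courteous_receptive_comp_right[OF courteous_receptive_mono[OF g(4)]]])
  qed (simp_all add: comp_simps f g)
qed

theorem mainTheorem2:
  shows "\<exists>\<alpha> \<rho> l. bicategory (games :: 'u game set) strategies two_cells id_cell vcomp_cell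
           copycat comp_strat hcomp_cell \<alpha> \<rho> l"
proof (intro exI)
  note S = strategiesD and I = strategies_inter
  show "bicategory (games :: 'u game set) strategies two_cells id_cell vcomp_cell
           copycat comp_strat hcomp_cell assoc_cell runit_cell lunit_cell"
  proof
    fix A B :: "'u game" assume AB: "A \<in> games" "B \<in> games"
    show "is_category (strategies A B) two_cells id_cell vcomp_cell"
      by (rule two_cells_category) (rule S(3)[OF AB])
  next
    fix A :: "'u game" assume "A \<in> games"
    then have A: "is_esp A" by (simp add: games_def)
    show "copycat A \<in> strategies A A"
      by (rule strategiesI[OF copycat_prestrategy[OF A] courteous_receptive_copycat[OF A]]) simp_all
  next
    fix A B C :: "'u game" and f g assume "A \<in> games" "B \<in> games" "C \<in> games" "f \<in> strategies A B" "g \<in> strategies B C"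
    then show "g \<odot>\<^sub>s f \<in> strategies A C" by (rule comp_strategies)
  next
    fix A B C :: "'u game" and f f' g g' \<phi> \<psi>
    assume G: "A \<in> games" "B \<in> games" "C \<in> games" and f: "f \<in> strategies A B" "f' \<in> strategies A B"
      and g: "g \<in> strategies B C" "g' \<in> strategies B C" and c: "\<phi> \<in> two_cells f f'" "\<psi> \<in> two_cells g g'"
    show "hcomp_cell \<psi> \<phi> \<in> two_cells (g \<odot>\<^sub>s f) (g' \<odot>\<^sub>s f')"
      by (rule hcomp_cell_vis(1)[OF I[OF G f(1) g(1)] I[OF G f(2) g(2)] c])
  next
    fix A B C :: "'u game" and f g assume "A \<in> games" "B \<in> games" "C \<in> games" "f \<in> strategies A B" "g \<in> strategies B C"
    then show "hcomp_cell (id_cell g) (id_cell f) = id_cell (g \<odot>\<^sub>s f)" by (intro hcomp_id I)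
  next
    fix A B C :: "'u game" and f f' f'' g g' g'' \<phi> \<phi>' \<psi> \<psi>'
    assume G: "A \<in> games" "B \<in> games" "C \<in> games" and f: "f \<in> strategies A B" "f' \<in> strategies A B" "f'' \<in> strategies A B"
      and g: "g \<in> strategies B C" "g' \<in> strategies B C" "g'' \<in> strategies B C"
      and c: "\<phi> \<in> two_cells f f'" "\<phi>' \<in> two_cells f' f''" "\<psi> \<in> two_cells g g'" "\<psi>' \<in> two_cells g' g''"
    show "hcomp_cell (vcomp_cell \<psi>' \<psi>) (vcomp_cell \<phi>' \<phi>) = vcomp_cell (hcomp_cell \<psi>' \<phi>') (hcomp_cell \<psi> \<phi>)"
      by (rule hcomp_interchange[OF I[OF G f(1) g(1)] I[OF G f(2) g(2)] I[OF G f(3) g(3)] c])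
  next
    fix A B C D :: "'u game" and f g h
    assume G: "A \<in> games" "B \<in> games" "C \<in> games" "D \<in> games"
      and f: "f \<in> strategies A B" "g \<in> strategies B C" "h \<in> strategies C D"
    show "invertible two_cells id_cell vcomp_cell ((h \<odot>\<^sub>s g) \<odot>\<^sub>s f) (h \<odot>\<^sub>s g \<odot>\<^sub>s f) (assoc_cell f g h)"
      by (rule assoc_cellD(1)[OF I[OF G(1-3) f(1,2)] I[OF G(2-4) f(2,3)]])
  next
    fix A B :: "'u game" and f assume G: "A \<in> games" "B \<in> games" "f \<in> strategies A B"
    show "invertible two_cells id_cell vcomp_cell (f \<odot>\<^sub>s copycat A) f (runit_cell f)"
      using runit_cell(1)[OF S(3,4)[OF G]] S(1)[OF G] by simp
    show "invertible two_cells id_cell vcomp_cell (copycat B \<odot>\<^sub>s f) f (lunit_cell f)"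
      using lunit_cell(1)[OF S(3,4)[OF G]] S(2)[OF G] by simp
  next
    fix A B C D :: "'u game" and f f' g g' h h' \<phi> \<psi> \<chi>
    assume G: "A \<in> games" "B \<in> games" "C \<in> games" "D \<in> games"
      and f: "f \<in> strategies A B" "f' \<in> strategies A B" and g: "g \<in> strategies B C" "g' \<in> strategies B C"
      and h: "h \<in> strategies C D" "h' \<in> strategies C D"
      and c: "\<phi> \<in> two_cells f f'" "\<psi> \<in> two_cells g g'" "\<chi> \<in> two_cells h h'"
    show "vcomp_cell (assoc_cell f' g' h') (hcomp_cell (hcomp_cell \<chi> \<psi>) \<phi>)
        = vcomp_cell (hcomp_cell \<chi> (hcomp_cell \<psi> \<phi>)) (assoc_cell f g h)"
      by (rule assoc_cell_natural[OF I[OF G(1-3) f(1) g(1)] I[OF G(2-4) g(1) h(1)]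
            I[OF G(1-3) f(2) g(2)] I[OF G(2-4) g(2) h(2)] c])
  next
    fix A B :: "'u game" and f f' \<phi>
    assume G: "A \<in> games" "B \<in> games" and f: "f \<in> strategies A B" "f' \<in> strategies A B" and c: "\<phi> \<in> two_cells f f'"
    show "vcomp_cell (runit_cell f') (hcomp_cell \<phi> (id_cell (copycat A))) = vcomp_cell \<phi> (runit_cell f)"
      using runit_cell_natural[OF S(3,4)[OF G f(1)] S(3,4)[OF G f(2)] c] S(1)[OF G f(1)] by simp
    show "vcomp_cell (lunit_cell f') (hcomp_cell (id_cell (copycat B)) \<phi>) = vcomp_cell \<phi> (lunit_cell f)"
      using lunit_cell_natural[OF S(3,4)[OF G f(1)] S(3,4)[OF G f(2)] c] S(2)[OF G f(1)] by simp
  next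
    fix A B C D E :: "'u game" and f g h k
    assume G: "A \<in> games" "B \<in> games" "C \<in> games" "D \<in> games" "E \<in> games"
      and f: "f \<in> strategies A B" "g \<in> strategies B C" "h \<in> strategies C D" "k \<in> strategies D E"
    show "vcomp_cell (assoc_cell (g \<odot>\<^sub>s f) h k) (assoc_cell f g (k \<odot>\<^sub>s h))
        = vcomp_cell (hcomp_cell (id_cell k) (assoc_cell f g h))
            (vcomp_cell (assoc_cell f (h \<odot>\<^sub>s g) k) (hcomp_cell (assoc_cell g h k) (id_cell f)))"
      by (rule assoc_cell_pentagon[OF I[OF G(1-3) f(1,2)] I[OF G(2-4) f(2,3)] I[OF G(3-5) f(3,4)]])
  next
    fix A B C :: "'u game" and f g
    assume G: "A \<in> games" "B \<in> games" "C \<in> games" and f: "f \<in> strategies A B" "g \<in> strategies B C"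
    show "vcomp_cell (hcomp_cell (id_cell g) (lunit_cell f)) (assoc_cell f (copycat B) g)
        = hcomp_cell (runit_cell g) (id_cell f)"
      using unit_triangle[OF I[OF G f] S(4)[OF G(1,2) f(1)] S(4)[OF G(2,3) f(2)]] S(2)[OF G(1,2) f(1)] by simp
  qed
qed

end
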